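(* The Lyapunov exponent of a modular embedding is a weak commensurability invariant: if $(p_1,\rho_1)$ and $(p_2,\rho_2)$ are two cofinite modular embeddings that are weakly commensurable, then $\lambda(p_1,\rho_1)=\lambda(p_2,\rho_2)$.
   Context: Let $G=\mathrm{PSL}_2(\mathbb{R})$, acting on the upper half-plane $\mathbb{H}$. A modular embedding (of rank $2$ and weight $1$) is a pair $(p,\rho)$, where $\rho:\Gamma\to G$ is a group homomorphism from a lattice $\Gamma\leqslant G$ and $p:\mathbb{H}\to\mathbb{H}$ is a $\rho$-equivariant holomorphic map, i.e. $p(\gamma z)=\rho(\gamma)p(z)$ for all $\gamma\in\Gamma$, $z\in\mathbb{H}$. Write $\mathrm{dom}(\rho)=\Gamma$ and $\mathrm{im}(\rho)=\rho(\Gamma)$. The modular embedding is cofinite if $\mathrm{im}(\rho)$ acts discretely and cofinitely (with finite-area quotient) on $\mathbb{H}$; then $p$ descends to a holomorphic map $\bar p:\mathbb{H}/\mathrm{dom}(\rho)\to\mathbb{H}/\mathrm{im}(\rho)$. The Lyapunov exponent of a cofinite modular embedding is defined as $$\lambda(p,\rho)=\frac{\deg(\bar p)\,\mathrm{vol}(\mathbb{H}/\mathrm{im}(\rho))}{\mathrm{vol}(\mathbb{H}/\mathrm{dom}(\rho))},$$ where $\mathrm{vol}$ is hyperbolic area. For $g\in G$ let $c_g(\tilde g)=g\tilde g g^{-1}$ be conjugation by $g$. Two modular embeddings $(p_1,\rho_1)$, $(p_2,\rho_2)$ with domains $\Gamma_1,\Gamma_2$ are weakly commensurable if there exist $(g,h)\in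 G\times G$ and a group $\Gamma'$ that is a subgroup of finite index in both $\Gamma_1$ and $h\Gamma_2h^{-1}$ such that $\rho_1=c_g\circ\rho_2\circ c_{h^{-1}}$ on $\Gamma'$. *)

theory Defs
  imports "HOL-Analysis.Analysis" "HOL-Algebra.Group_Action"
begin

section \<open>The group PSL(2,R)\<close>

definition SL2R :: "(real^2^2) monoid" where
  "SL2R = \<lparr>carrier = {A. det A = 1}, monoid.mult = (\<lambda>A B. A ** B), one = mat 1\<rparr>"

definition pm1 :: "(real^2^2) set" where
  "pm1 = {mat 1, - mat 1}"

type_synonym psl2r = "(real^2^2) set"

definition PSL2R :: "psl2r monoid" where
  "PSL2R = SL2R Mod pm1"

text \<open>The quotient topology, with respect to the projection sending a matrix to its coset
  \<open>{A, -A}\<close>.\<close>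

definition PSL2R_topology :: "psl2r topology" where
  "PSL2R_topology = topology (\<lambda>U. U \<subseteq> carrier PSL2R \<and>
     openin (top_of_set (carrier SL2R)) {A \<in> carrier SL2R. pm1 #>\<^bsub>SL2R\<^esub> A \<in> U})"

abbreviation conj_PSL2R :: "psl2r \<Rightarrow> psl2r \<Rightarrow> psl2r" where
  "conj_PSL2R g x \<equiv> g \<otimes>\<^bsub>PSL2R\<^esub> x \<otimes>\<^bsub>PSL2R\<^esub> inv\<^bsub>PSL2R\<^esub> g"


section \<open>The action on the upper half-plane\<close>

definition upper_half_plane :: "complex set" (\<open>\<HH>\<close>) where
  "\<HH> = {z. Im z > 0}"

definition mat_act :: "real^2^2 \<Rightarrow> complex \<Rightarrow> complex" where
  "mat_act A = moebius (complex_of_real (A$1$1)) (complex_of_real (A$1$2))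
                       (complex_of_real (A$2$1)) (complex_of_real (A$2$2))"

text \<open>The two representatives of an element of \<open>PSL(2,R)\<close> act in the same way, so the
  argument of \<^const>\<open>the_elem\<close> is a singleton.  The restriction to the half-plane makes this an
  action in the sense of the locale \<^locale>\<open>group_action\<close>.\<close>

definition act :: "psl2r \<Rightarrow> complex \<Rightarrow> complex" where
  "act g = (\<lambda>z\<in>\<HH>. the_elem ((\<lambda>A. mat_act A z) ` g))"

abbreviation orbit_of :: "psl2r set \<Rightarrow> complex \<Rightarrow> complex set" where
  "orbit_of \<Gamma> z \<equiv> orbit (PSL2R\<lparr>carrier := \<Gamma>\<rparr>) act z"

abbreviation quotient_space :: "psl2r set \<Rightarrow> complex set set" where
  "quotient_space \<Gamma> \<equiv> orbits (PSL2R\<lparr>carrier := \<Gamma>\<rparr>) \<HH> act"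


section \<open>Hyperbolic area, lattices\<close>

definition hyp_area :: "complex measure" where
  "hyp_area = density lborel (\<lambda>z. ennreal (indicator \<HH> z / (Im z)\<^sup>2))"

definition fundamental_domain :: "psl2r set \<Rightarrow> complex set \<Rightarrow> bool" where
  "fundamental_domain \<Gamma> F \<longleftrightarrow>
     F \<in> sets borel \<and> F \<subseteq> \<HH> \<and> (\<Union>\<gamma>\<in>\<Gamma>. act \<gamma> ` F) = \<HH> \<and>
     (\<forall>\<gamma>\<in>\<Gamma>. \<gamma> \<noteq> \<one>\<^bsub>PSL2R\<^esub> \<longrightarrow> emeasure hyp_area (F \<inter> act \<gamma> ` F) = 0)"

text \<open>The area of \<open>\<HH>/\<Gamma>\<close>.  A discrete group has a fundamental domain, and all its fundamental
  domains have the same area.\<close>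

definition covolume :: "psl2r set \<Rightarrow> ennreal" where
  "covolume \<Gamma> = (THE v. \<exists>F. fundamental_domain \<Gamma> F \<and> emeasure hyp_area F = v)"

definition lattice_PSL2R :: "psl2r set \<Rightarrow> bool" where
  "lattice_PSL2R \<Gamma> \<longleftrightarrow>
     subgroup \<Gamma> PSL2R \<and>
     subtopology PSL2R_topology \<Gamma> = discrete_topology \<Gamma> \<and>
     covolume \<Gamma> < \<infinity>"

definition acts_discretely :: "psl2r set \<Rightarrow> bool" where
  "acts_discretely \<Gamma> \<longleftrightarrow>
     (\<forall>K. compact K \<and> K \<subseteq> \<HH> \<longrightarrow> finite {\<gamma>\<in>\<Gamma>. act \<gamma> ` K \<inter> K \<noteq> {}})"


section \<open>Modular embeddings and their Lyapunov exponent\<close>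

text \<open>The domain \<open>\<Gamma>\<close> of \<open>\<rho>\<close> is an explicit parameter; values of \<open>\<rho>\<close> outside \<open>\<Gamma>\<close> and
  of \<open>p\<close> outside the half-plane play no role.\<close>

definition modular_embedding ::
  "psl2r set \<Rightarrow> (complex \<Rightarrow> complex) \<Rightarrow> (psl2r \<Rightarrow> psl2r) \<Rightarrow> bool" where
  "modular_embedding \<Gamma> p \<rho> \<longleftrightarrow>
     lattice_PSL2R \<Gamma> \<and>
     \<rho> \<in> hom (PSL2R\<lparr>carrier := \<Gamma>\<rparr>) PSL2R \<and>
     p ` \<HH> \<subseteq> \<HH> \<and> p holomorphic_on \<HH> \<and>
     (\<forall>\<gamma>\<in>\<Gamma>. \<forall>z\<in>\<HH>. p (act \<gamma> z) = act (\<rho> \<gamma>) (p z))"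

definition cofinite_modular_embedding ::
  "psl2r set \<Rightarrow> (complex \<Rightarrow> complex) \<Rightarrow> (psl2r \<Rightarrow> psl2r) \<Rightarrow> bool" where
  "cofinite_modular_embedding \<Gamma> p \<rho> \<longleftrightarrow>
     modular_embedding \<Gamma> p \<rho> \<and> acts_discretely (\<rho> ` \<Gamma>) \<and> covolume (\<rho> ` \<Gamma>) < \<infinity>"

text \<open>The map \<open>\<HH>/\<Gamma> \<rightarrow> \<HH>/\<Delta>\<close> induced by \<open>p\<close>.  It is well defined when \<open>p\<close> is
  equivariant for a homomorphism from \<open>\<Gamma>\<close> to \<open>\<Delta>\<close>.\<close>

definition descended_map ::
  "psl2r set \<Rightarrow> (complex \<Rightarrow> complex) \<Rightarrow> complex set \<Rightarrow> complex set" where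
  "descended_map \<Delta> p X = the_elem ((\<lambda>z. orbit_of \<Delta> (p z)) ` X)"

text \<open>The degree of a map \<open>\<HH>/\<Gamma> \<rightarrow> \<HH>/\<Delta>\<close> is the number of preimages of a generic point.
  Genericity is needed because ramified points have fewer preimages, and because the map of open
  surfaces need not be proper: it may send a puncture of \<open>\<HH>/\<Gamma>\<close> to an interior point, which then
  loses a preimage.  Generic means outside a set of area zero.  Finitely many orbits form a set of
  area zero, so if all but finitely many points have exactly \<open>d\<close> preimages, the degree is \<open>d\<close>.\<close>

definition quotient_degree ::
  "psl2r set \<Rightarrow> psl2r set \<Rightarrow> (complex set \<Rightarrow> complex set) \<Rightarrow> nat" where
  "quotient_degree \<Gamma> \<Delta> f = (THE d. AE w in hyp_area.
     finite {X \<in> quotient_space \<Gamma>. f X = orbit_of \<Delta> w} \<and>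
     card {X \<in> quotient_space \<Gamma>. f X = orbit_of \<Delta> w} = d)"

definition lyapunov_exponent ::
  "psl2r set \<Rightarrow> (complex \<Rightarrow> complex) \<Rightarrow> (psl2r \<Rightarrow> psl2r) \<Rightarrow> real" where
  "lyapunov_exponent \<Gamma> p \<rho> =
     real (quotient_degree \<Gamma> (\<rho> ` \<Gamma>) (descended_map (\<rho> ` \<Gamma>) p)) *
     enn2real (covolume (\<rho> ` \<Gamma>)) / enn2real (covolume \<Gamma>)"


section \<open>Weak commensurability\<close>

definition finite_index_subgroup :: "psl2r set \<Rightarrow> psl2r set \<Rightarrow> bool" where
  "finite_index_subgroup \<Gamma>' \<Gamma> \<longleftrightarrow>
     subgroup \<Gamma>' (PSL2R\<lparr>carrier := \<Gamma>\<rparr>) \<and> finite (rcosets\<^bsub>PSL2R\<lparr>carrier := \<Gamma>\<rparr>\<^esub> \<Gamma>')"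

definition weakly_commensurable ::
  "psl2r set \<Rightarrow> (psl2r \<Rightarrow> psl2r) \<Rightarrow> psl2r set \<Rightarrow> (psl2r \<Rightarrow> psl2r) \<Rightarrow> bool" where
  "weakly_commensurable \<Gamma>\<^sub>1 \<rho>\<^sub>1 \<Gamma>\<^sub>2 \<rho>\<^sub>2 \<longleftrightarrow>
     (\<exists>g\<in>carrier PSL2R. \<exists>h\<in>carrier PSL2R. \<exists>\<Gamma>'.
        finite_index_subgroup \<Gamma>' \<Gamma>\<^sub>1 \<and>
        finite_index_subgroup \<Gamma>' (conj_PSL2R h ` \<Gamma>\<^sub>2) \<and>
        (\<forall>\<gamma>\<in>\<Gamma>'. \<rho>\<^sub>1 \<gamma> = conj_PSL2R g (\<rho>\<^sub>2 (conj_PSL2R (inv\<^bsub>PSL2R\<^esub> h) \<gamma>))))"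


section \<open>Well-definedness of the group, its topology and its action\<close>

lemma group_SL2R: "group SL2R"
proof (rule groupI)
  fix A assume "A \<in> carrier SL2R"
  then have d: "det A = 1" by (simp add: SL2R_def)
  then have "invertible A" by (simp add: invertible_det_nz)
  then obtain B where B: "A ** B = mat 1" "B ** A = mat 1" by (auto simp: invertible_def)
  then have "det B = 1" using det_mul[of A B] d by (simp add: det_I)
  then show "\<exists>B\<in>carrier SL2R. B \<otimes>\<^bsub>SL2R\<^esub> A = \<one>\<^bsub>SL2R\<^esub>" using B by (auto simp: SL2R_def)
qed (auto simp: SL2R_def det_mul det_I matrix_mul_assoc)

lemma mat_minus_left: "(- A) ** B = - (A ** B :: real^2^2)"
  by (simp add: matrix_matrix_mult_def vec_eq_iff sum_negf)

lemma mat_minus_right: "A ** (- B) = - (A ** B :: real^2^2)"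
  by (simp add: matrix_matrix_mult_def vec_eq_iff sum_negf)

lemma det_minus_mat1: "det (- mat 1 :: real^2^2) = 1"
  by (simp add: det_2 mat_def)

lemma normal_pm1: "pm1 \<lhd> SL2R"
proof -
  interpret group SL2R by (rule group_SL2R)
  have sub: "subgroup pm1 SL2R"
  proof (rule subgroupI)
    fix a assume a: "a \<in> pm1"
    have "a \<otimes>\<^bsub>SL2R\<^esub> a = \<one>\<^bsub>SL2R\<^esub>" "a \<in> carrier SL2R"
      using a by (auto simp: pm1_def SL2R_def mat_minus_left mat_minus_right det_I det_minus_mat1)
    then have "inv\<^bsub>SL2R\<^esub> a = a" by (simp add: inv_equality)
    then show "inv\<^bsub>SL2R\<^esub> a \<in> pm1" using a by simp
  qed (auto simp: pm1_def SL2R_def mat_minus_left mat_minus_right det_I det_minus_mat1)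
  show ?thesis
  proof (rule normalI[OF sub], intro ballI)
    fix x
    show "pm1 #>\<^bsub>SL2R\<^esub> x = x <#\<^bsub>SL2R\<^esub> pm1"
      by (auto simp: r_coset_def l_coset_def pm1_def SL2R_def mat_minus_left mat_minus_right)
  qed
qed

lemma group_PSL2R: "group PSL2R"
  unfolding PSL2R_def by (rule normal.factorgroup_is_group[OF normal_pm1])

lemma pm1_coset: "pm1 #>\<^bsub>SL2R\<^esub> A = {A, - A}"
  by (auto simp: r_coset_def pm1_def SL2R_def mat_minus_left)

lemma carrier_PSL2R: "carrier PSL2R = (\<lambda>A. {A, - A}) ` {A. det A = 1}"
proof -
  have "carrier SL2R = {A. det A = 1}" by (simp add: SL2R_def)
  then show ?thesis by (auto simp: PSL2R_def FactGroup_def RCOSETS_def pm1_coset)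
qed

lemma mult_PSL2R:
  assumes "det A = 1" "det B = 1"
  shows "{A, - A} \<otimes>\<^bsub>PSL2R\<^esub> {B, - B} = {A ** B, - (A ** B)}"
proof -
  have "A \<in> carrier SL2R" "B \<in> carrier SL2R" using assms by (auto simp: SL2R_def)
  from normal.rcos_sum[OF normal_pm1 this] show ?thesis
    by (simp add: PSL2R_def FactGroup_def pm1_coset) (simp add: SL2R_def)
qed

lemma openin_PSL2R_topology:
  "openin PSL2R_topology U \<longleftrightarrow> U \<subseteq> carrier PSL2R \<and>
     openin (top_of_set (carrier SL2R)) {A \<in> carrier SL2R. pm1 #>\<^bsub>SL2R\<^esub> A \<in> U}"
proof -
  let ?q = "\<lambda>U. {A \<in> carrier SL2R. pm1 #>\<^bsub>SL2R\<^esub> A \<in> U}"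
  have 1: "?q (S \<inter> T) = ?q S \<inter> ?q T" for S T by auto
  have 2: "?q (\<Union>\<K>) = (\<Union>K\<in>\<K>. ?q K)" for \<K> by auto
  have "istopology (\<lambda>U. U \<subseteq> carrier PSL2R \<and> openin (top_of_set (carrier SL2R)) (?q U))"
    unfolding istopology_def 1 2
    by (intro conjI allI impI) (blast, blast, blast, rule openin_Union, blast)
  then show ?thesis by (simp add: PSL2R_topology_def topology_inverse')
qed

lemma mat_act_minus [simp]: "mat_act (- A) z = mat_act A z"
proof -
  have "(- a * z + - b) / (- c * z + - d) = (a * z + b) / (c * z + d)" for a b c d :: complex
    using minus_divide_divide[of "a * z + b" "c * z + d"] by simp
  then show ?thesis by (simp add: mat_act_def moebius_def)
qed

lemma act_coset: "z \<in> \<HH> \<Longrightarrow> act {A, - A} z = mat_act A z"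
  by (simp add: act_def)

lemma mat_act_denom_nonzero:
  assumes "det (A :: real^2^2) = 1" "z \<in> \<HH>"
  shows "complex_of_real (A$2$1) * z + complex_of_real (A$2$2) \<noteq> 0"
  using assms by (auto simp: complex_eq_iff det_2 upper_half_plane_def)

lemma Im_mat_act:
  assumes "det (A :: real^2^2) = 1" "z \<in> \<HH>"
  shows "Im (mat_act A z) = Im z / (cmod (complex_of_real (A$2$1) * z + complex_of_real (A$2$2)))\<^sup>2"
proof -
  have "A$1$1 * A$2$2 - A$1$2 * A$2$1 = 1" using assms(1) by (simp add: det_2)
  then have "(A$1$1 * Im z) * (A$2$1 * Re z + A$2$2) - (A$1$1 * Re z + A$1$2) * (A$2$1 * Im z) = Im z"
    by algebra
  then show ?thesis by (simp add: mat_act_def moebius_def Im_divide cmod_power2)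
qed

lemma mat_act_in_upper_half_plane:
  assumes "det (A :: real^2^2) = 1" "z \<in> \<HH>"
  shows "mat_act A z \<in> \<HH>"
  using assms mat_act_denom_nonzero[OF assms] Im_mat_act[OF assms]
  by (simp add: upper_half_plane_def)

lemma mat_act_mult:
  assumes "det (A :: real^2^2) = 1" "det B = 1" "z \<in> \<HH>"
  shows "mat_act (A ** B) z = mat_act A (mat_act B z)"
proof -
  have *: "(a * ((p * z + q) / (r * z + s)) + b) / (c * ((p * z + q) / (r * z + s)) + d)
       = ((a * p + b * r) * z + (a * q + b * s)) / ((c * p + d * r) * z + (c * q + d * s))"
    if "r * z + s \<noteq> 0" for a b c d p q r s :: complex
  proof -
    have "x * ((p * z + q) / (r * z + s)) + y
        = ((x * p + y * r) * z + (x * q + y * s)) / (r * z + s)" for x y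
      using that by (simp add: field_simps)
    then show ?thesis using that by simp
  qed
  show ?thesis
    using *[OF mat_act_denom_nonzero[OF assms(2,3)]]
    by (simp add: mat_act_def moebius_def matrix_matrix_mult_def sum_2)
qed

lemma group_action_PSL2R: "group_action PSL2R \<HH> act"
proof -
  interpret G: group PSL2R by (rule group_PSL2R)
  have closed: "act g z \<in> \<HH>" if "g \<in> carrier PSL2R" "z \<in> \<HH>" for g z
    using that by (auto simp: carrier_PSL2R act_coset mat_act_in_upper_half_plane)
  have mult: "act (g \<otimes>\<^bsub>PSL2R\<^esub> h) z = act g (act h z)"
    if "g \<in> carrier PSL2R" "h \<in> carrier PSL2R" "z \<in> \<HH>" for g h z
    using that
    by (auto simp: carrier_PSL2R mult_PSL2R act_coset mat_act_mult mat_act_in_upper_half_plane)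
  have one: "act \<one>\<^bsub>PSL2R\<^esub> z = z" if "z \<in> \<HH>" for z
  proof -
    have "\<one>\<^bsub>PSL2R\<^esub> = {mat 1, - mat 1}" by (simp add: PSL2R_def FactGroup_def pm1_def)
    then show ?thesis using act_coset[OF that, of "mat 1"]
      by (simp add: mat_act_def moebius_def mat_def)
  qed
  have bij: "act g \<in> Bij \<HH>" if g: "g \<in> carrier PSL2R" for g
  proof -
    have "bij_betw (act g) \<HH> \<HH>"
    proof (rule bij_betw_byWitness[where f' = "act (inv\<^bsub>PSL2R\<^esub> g)"])
      show "\<forall>z\<in>\<HH>. act (inv\<^bsub>PSL2R\<^esub> g) (act g z) = z"
        using g by (simp add: one flip: mult)
      show "\<forall>z\<in>\<HH>. act g (act (inv\<^bsub>PSL2R\<^esub> g) z) = z"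
        using g by (simp add: one flip: mult)
    qed (use g closed in auto)
    then show ?thesis by (simp add: Bij_def act_def)
  qed
  have "act \<in> hom PSL2R (BijGroup \<HH>)"
  proof (rule homI)
    fix g h assume gh: "g \<in> carrier PSL2R" "h \<in> carrier PSL2R"
    have "act (g \<otimes>\<^bsub>PSL2R\<^esub> h) = compose \<HH> (act g) (act h)"
    proof (rule extensionalityI[where A = "\<HH>"])
      show "act (g \<otimes>\<^bsub>PSL2R\<^esub> h) z = compose \<HH> (act g) (act h) z" if "z \<in> \<HH>" for z
        using gh that by (simp add: mult compose_def)
    qed (simp_all add: act_def)
    then show "act (g \<otimes>\<^bsub>PSL2R\<^esub> h) = act g \<otimes>\<^bsub>BijGroup \<HH>\<^esub> act h"
      using gh by (simp add: BijGroup_def bij)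
  qed (simp add: BijGroup_def bij)
  then show ?thesis
    by (simp add: group_action_def group_hom_def group_hom_axioms_def group_BijGroup group_PSL2R)
qed

end

theory Submission
  imports Defs "HOL-Complex_Analysis.Complex_Analysis" "HOL-Real_Asymp.Real_Asymp"
    "HOL-Probability.Sinc_Integral"
begin

text \<open>
  The degree in the definition of the Lyapunov exponent of \<open>(p, \<rho>)\<close> counts preimages of a generic
  orbit, which is awkward to compare between commensurable groups.  The proof replaces it by an
  average.  Let \<open>J\<^sub>p\<close> be the factor by which \<open>p\<close> multiplies hyperbolic area
  (\<open>hyp_jacobian\<close>).  It is invariant under \<open>\<Gamma> = dom \<rho>\<close>, and for every fundamental domain \<open>F\<close>
  of \<open>\<Gamma>\<close>

    \<open>\<lambda>(p, \<rho>) = (\<integral> J\<^sub>p over F) / area F\<close>   (\<open>lyapunov_exponent_eq\<close>).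

  Passing to a subgroup of finite index multiplies numerator and denominator by the index
  (\<open>finite_index_integral\<close>), and replacing \<open>p\<close> by \<open>g \<circ> p \<circ> h\<inverse>\<close> only transports both.  So two
  weakly commensurable embeddings have the same exponent as soon as \<open>p\<^sub>1\<close> and
  \<open>g \<circ> p\<^sub>2 \<circ> h\<inverse>\<close> are the same map.  Both are equivariant for the same homomorphism on the
  common lattice \<open>\<Gamma>'\<close>, and weak commensurability speaks of the homomorphisms only, so one has to
  know that a homomorphism determines its equivariant map.

  That is \<open>equivariant_map_unique\<close>.  For two equivariant maps \<open>p\<close>, \<open>q\<close> the function
  \<open>f = 2 ln cosh (d(p, q) / 2)\<close> is \<open>\<Gamma>\<close>-invariant, and with \<open>P\<close>, \<open>Q\<close> their composites with a map of the
  half-plane onto the unit disc it is the sum of \<open>\<bar>P\<^sup>n - Q\<^sup>n\<bar>\<^sup>2 / n\<close>, so its average over a hyperbolic disc is at least its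
  value at the centre.  The quotient has finite area, so the average and the value must agree
  somewhere.  Equality at one point forces \<open>P - Q\<close> and
  \<open>P\<^sup>2 - Q\<^sup>2\<close> to be constant, and if \<open>p\<close> is not constant this implies
  \<open>p = q\<close>.

  The formula for \<open>\<lambda>\<close> has two halves.  The area formula says that the number \<open>N\<close> of preimages,
  integrated over a fundamental domain of \<open>\<Delta> = im \<rho>\<close>, is the integral of \<open>J\<^sub>p\<close> over \<open>F\<close>
  (\<open>integral_N\<close>).  It remains to see that \<open>N\<close> is constant almost everywhere
  (\<open>N_AE_constant\<close>); the map on the quotients need not be proper, so this is not a matter of
  counting sheets.  Instead let \<open>K\<close> average functions against the kernel \<open>cosh (d / 2) ^ (- 4)\<close>.
  Averaging preserves the integral of an invariant function over the quotient, up to the mass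
  \<open>c\<close> of the kernel.  If moreover \<open>K N \<ge> c N\<close>, then \<open>K N = c N\<close> almost everywhere, the same
  equation passes to the indicator functions of the sets \<open>{N \<ge> m}\<close>, and since the kernel is
  positive everywhere these sets are null or conull.

  The inequality \<open>K N \<ge> c N\<close> is where holomorphy and finite area enter once more.  The area
  formula turns the integral of \<open>cosh (d(b, _) / 2) ^ (- 2 s) N\<close> into an integral over \<open>F\<close> of \<open>J\<^sub>p\<close>
  times a Poincare series, and since averages over small discs expand as
  \<open>value + Laplacian + ...\<close> and have the same integral over \<open>F\<close> as the function, these moments
  satisfy the recursion \<open>(s - 1) M\<^sub>s = s M\<^bsub>s+1\<^esub>\<close> (\<open>moment_recursion\<close>).  The kernels alone satisfy
  the same recursion.  As \<open>s\<close> grows the normalised kernels concentrate at \<open>b\<close>, where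
  \<open>N \<ge> N b\<close> because \<open>{N \<ge> m}\<close> is open; so the moment for \<open>s = 2\<close>, which is \<open>K N b\<close>, is at least
  \<open>c N b\<close> (\<open>weighted_count_ge_N\<close>).
\<close>

section \<open>Change of variables for injective holomorphic maps\<close>

text \<open>The change of variables theorem for non-linear maps is about \<open>real^'n\<close>;
  these two isometries carry it over to the complex plane.\<close>

definition vec_to_complex :: "real^2 \<Rightarrow> complex" where
  "vec_to_complex v = Complex (v$1) (v$2)"

definition complex_to_vec :: "complex \<Rightarrow> real^2" where
  "complex_to_vec z = vector [Re z, Im z]"

lemma vec_to_complex_inverse [simp]: "complex_to_vec (vec_to_complex v) = v"
  by (simp add: complex_to_vec_def vec_to_complex_def vec_eq_iff forall_2)

lemma complex_to_vec_inverse [simp]: "vec_to_complex (complex_to_vec z) = z"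
  by (simp add: complex_to_vec_def vec_to_complex_def)

lemma linear_vec_to_complex: "linear vec_to_complex"
  by (rule linearI) (auto simp: vec_to_complex_def complex_eq_iff)

lemma linear_complex_to_vec: "linear complex_to_vec"
  by (rule linearI) (auto simp: complex_to_vec_def vec_eq_iff forall_2)

lemma vec_to_complex_measurable [measurable]: "vec_to_complex \<in> borel_measurable borel"
  by (intro borel_measurable_continuous_onI linear_continuous_on linear_conv_bounded_linear[THEN iffD1]
      linear_vec_to_complex)

lemma lborel_complex: "lborel = distr lborel borel vec_to_complex"
proof (rule lborel_eqI)
  fix l u :: complex
  assume le: "\<And>b. b \<in> Basis \<Longrightarrow> l \<bullet> b \<le> u \<bullet> b"
  have "vec_to_complex -` box l u = box (complex_to_vec l) (complex_to_vec u)"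
    by (auto simp: box_def vec_to_complex_def complex_to_vec_def Basis_complex_def inner_complex_def
        Basis_vec_def inner_axis forall_2)
  moreover have "\<forall>b\<in>Basis. complex_to_vec l \<bullet> b \<le> complex_to_vec u \<bullet> b"
    using le[of 1] le[of \<i>]
    by (auto simp: complex_to_vec_def Basis_complex_def inner_complex_def
        Basis_vec_def inner_axis forall_2)
  moreover have "(\<Prod>b\<in>Basis. (complex_to_vec u - complex_to_vec l) \<bullet> b) = (\<Prod>b\<in>Basis. (u - l) \<bullet> b)"
  proof -
    have B: "(Basis :: (real^2) set) = {axis 1 1, axis 2 1}"
      by (auto simp: Basis_vec_def UNIV_2)
    have "axis 1 1 \<noteq> (axis 2 1 :: real^2)" by (auto simp: axis_eq_axis)
    then show ?thesis
      unfolding B by (simp add: complex_to_vec_def Basis_complex_def inner_complex_def inner_axis)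
  qed
  ultimately show "emeasure (distr lborel borel vec_to_complex) (box l u) = ennreal (\<Prod>b\<in>Basis. (u - l) \<bullet> b)"
    by (simp add: emeasure_distr emeasure_lborel_box_eq)
qed simp

lemma emeasure_vec_image:
  assumes "B \<in> sets borel"
  shows "complex_to_vec ` B \<in> sets borel" "emeasure lborel (complex_to_vec ` B) = emeasure lborel B"
proof -
  have *: "complex_to_vec ` B = vec_to_complex -` B"
    by (auto simp: image_iff) (metis vec_to_complex_inverse)
  have "vec_to_complex -` B \<inter> space borel \<in> sets borel"
    by (rule measurable_sets[OF vec_to_complex_measurable assms])
  then show "complex_to_vec ` B \<in> sets borel" by (simp add: *)
  show "emeasure lborel (complex_to_vec ` B) = emeasure lborel B"
    by (subst lborel_complex) (simp add: emeasure_distr assms *)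
qed

lemma open_holomorphic_image_borel:
  assumes "\<phi> holomorphic_on U" "open U" "inj_on \<phi> U" "B \<in> sets borel" "B \<subseteq> U"
  shows "\<phi> ` B \<in> sets borel"
proof -
  obtain g where g: "g holomorphic_on (\<phi> ` U)" "\<And>z. z \<in> U \<Longrightarrow> g (\<phi> z) = z"
    using holomorphic_has_inverse[OF assms(1,2,3)] by metis
  have o: "open (\<phi> ` U)" using open_mapping_thm3[OF assms(1,2,3)] .
  have "\<phi> ` B = g -` B \<inter> \<phi> ` U" using g(2) assms(5) by fastforce
  also have "\<dots> \<in> sets borel"
  proof -
    have "g \<in> borel_measurable (restrict_space borel (\<phi> ` U))"
      using g(1) by (intro borel_measurable_continuous_on_restrict holomorphic_on_imp_continuous_on)
    from measurable_sets[OF this assms(4)] show ?thesis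
      using o by (simp add: space_restrict_space sets_restrict_space_iff)
  qed
  finally show ?thesis .
qed

text \<open>The real Jacobian determinant of a holomorphic map is
  \<open>\<bar>\<phi>'\<bar>\<^sup>2\<close>. The theorem on \<open>real^2\<close> speaks of
  sets of finite measure, so infinite values need a separate argument.\<close>

lemma emeasure_holomorphic_image:
  assumes hol: "\<phi> holomorphic_on U" and U: "open U" and inj: "inj_on \<phi> U"
    and B: "B \<in> sets borel" "B \<subseteq> U"
  shows "emeasure lborel (\<phi> ` B) = (\<integral>\<^sup>+z. indicator B z * ennreal ((cmod (deriv \<phi> z))\<^sup>2) \<partial>lborel)"
proof -
  define f where "f = complex_to_vec \<circ> \<phi> \<circ> vec_to_complex"
  define f' where "f' v = complex_to_vec \<circ> ((*) (deriv \<phi> (vec_to_complex v))) \<circ> vec_to_complex" for v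
  define S where "S = complex_to_vec ` B"
  have img: "f ` S = complex_to_vec ` \<phi> ` B" by (auto simp: f_def S_def image_image)
  have bor: "S \<in> sets borel" "\<phi> ` B \<in> sets borel" "f ` S \<in> sets borel"
    using emeasure_vec_image(1)[OF B(1)] open_holomorphic_image_borel[OF hol U inj B]
      emeasure_vec_image(1)[OF open_holomorphic_image_borel[OF hol U inj B]] unfolding img by (auto simp: S_def)
  have der: "(f has_derivative f' x) (at x within S)" if "x \<in> S" for x
  proof -
    have "vec_to_complex x \<in> U" using that B by (auto simp: S_def)
    then have 1: "(\<phi> has_derivative ((*) (deriv \<phi> (vec_to_complex x)))) (at (vec_to_complex x))"
      using hol U holomorphic_derivI has_field_derivative_imp_has_derivative by blast
    have 2: "(vec_to_complex has_derivative vec_to_complex) (at x)"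
      by (rule linear_imp_has_derivative[OF linear_vec_to_complex])
    have 3: "(complex_to_vec has_derivative complex_to_vec) (at (\<phi> (vec_to_complex x)))"
      by (rule linear_imp_has_derivative[OF linear_complex_to_vec])
    have "(f has_derivative f' x) (at x)"
      unfolding f_def f'_def comp_assoc
      by (intro diff_chain_at[OF diff_chain_at[OF 2 1], unfolded comp_assoc]) (use 3 in simp)
    then show ?thesis by (rule has_derivative_at_withinI)
  qed
  have injS: "inj_on f S"
  proof (rule inj_onI)
    fix x y assume a: "x \<in> S" "y \<in> S" "f x = f y"
    then have "\<phi> (vec_to_complex x) = \<phi> (vec_to_complex y)"
      by (metis comp_apply complex_to_vec_inverse f_def)
    moreover have "vec_to_complex x \<in> U" "vec_to_complex y \<in> U" using a B by (auto simp: S_def)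
    ultimately have "vec_to_complex x = vec_to_complex y" using inj by (simp add: inj_on_def)
    then show "x = y" by (metis vec_to_complex_inverse)
  qed
  have det: "\<bar>det (matrix (f' x))\<bar> = (cmod (deriv \<phi> (vec_to_complex x)))\<^sup>2" for x
  proof -
    define d where "d = deriv \<phi> (vec_to_complex x)"
    have "det (matrix (f' x)) = (Re d)\<^sup>2 + (Im d)\<^sup>2"
      by (simp add: det_2 matrix_def f'_def d_def vec_to_complex_def complex_to_vec_def axis_def
        power2_eq_square)
    then show ?thesis by (simp add: d_def cmod_power2)
  qed
  have Sleb: "S \<in> sets lebesgue" using bor by auto
  have key: "f ` S \<in> lmeasurable \<and> measure lebesgue (f ` S) = m \<longleftrightarrow>
     ((\<lambda>x. (cmod (deriv \<phi> (vec_to_complex x)))\<^sup>2) has_integral m) S" for m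
    using has_measure_differentiable_image[OF Sleb der injS, of m] by (simp add: det)
  have dm: "(\<lambda>z. indicator B z * (cmod (deriv \<phi> z))\<^sup>2) \<in> borel_measurable borel"
  proof -
    have "continuous_on U (\<lambda>z. (cmod (deriv \<phi> z))\<^sup>2)"
      by (intro continuous_intros holomorphic_on_imp_continuous_on holomorphic_deriv[OF hol U])
    then have "(\<lambda>z. indicator U z *\<^sub>R (cmod (deriv \<phi> z))\<^sup>2) \<in> borel_measurable borel"
      using U by (intro borel_measurable_continuous_on_indicator) auto
    then have "(\<lambda>z. indicator B z * (indicator U z *\<^sub>R (cmod (deriv \<phi> z))\<^sup>2)) \<in> borel_measurable borel"
      using B by measurable
    moreover have "(\<lambda>z. indicator B z * (indicator U z *\<^sub>R (cmod (deriv \<phi> z))\<^sup>2)) = (\<lambda>z. indicator B z * (cmod (deriv \<phi> z))\<^sup>2)"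
      using B(2) by (auto simp: indicator_def fun_eq_iff)
    ultimately show ?thesis by simp
  qed
  define I where "I = (\<integral>\<^sup>+z. indicator B z * ennreal ((cmod (deriv \<phi> z))\<^sup>2) \<partial>lborel)"
  define h where "h x = indicator S x * (cmod (deriv \<phi> (vec_to_complex x)))\<^sup>2" for x
  have hB: "h x = indicator B (vec_to_complex x) * (cmod (deriv \<phi> (vec_to_complex x)))\<^sup>2" for x
    by (auto simp: h_def S_def indicator_def image_iff) (metis vec_to_complex_inverse)
  have hm: "h \<in> borel_measurable borel"
    unfolding hB using measurable_compose[OF vec_to_complex_measurable dm] by simp
  have I: "I = (\<integral>\<^sup>+x. ennreal (h x) \<partial>lborel)"
  proof -
    have "I = (\<integral>\<^sup>+z. ennreal (indicator B z * (cmod (deriv \<phi> z))\<^sup>2) \<partial>lborel)"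
      unfolding I_def by (intro nn_integral_cong) (auto simp: indicator_def)
    also have "\<dots> = (\<integral>\<^sup>+x. ennreal (indicator B (vec_to_complex x) * (cmod (deriv \<phi> (vec_to_complex x)))\<^sup>2) \<partial>lborel)"
      using dm by (subst lborel_complex) (simp add: nn_integral_distr)
    finally show ?thesis by (simp add: hB)
  qed
  have em: "emeasure lborel (\<phi> ` B) = emeasure lborel (f ` S)"
    using emeasure_vec_image[OF bor(2)] by (simp add: img)
  have hint: "(h has_integral m) UNIV \<longleftrightarrow> f ` S \<in> lmeasurable \<and> measure lebesgue (f ` S) = m" for m
  proof -
    have h_if: "h = (\<lambda>x. if x \<in> S then (cmod (deriv \<phi> (vec_to_complex x)))\<^sup>2 else 0)"
      by (auto simp: h_def)
    show ?thesis unfolding h_if has_integral_restrict_UNIV key ..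
  qed
  have nonneg: "0 \<le> h x" for x by (simp add: h_def)
  show ?thesis
  proof (cases "emeasure lborel (f ` S) < \<infinity>")
    case True
    then have "f ` S \<in> lmeasurable" using bor by (simp add: fmeasurable_def)
    then have "(h has_integral measure lebesgue (f ` S)) UNIV" using hint by blast
    then have "I = measure lebesgue (f ` S)"
      using nn_integral_has_integral_lebesgue[where f = h and \<Omega> = UNIV] nonneg by (simp add: I)
    then show ?thesis using True bor em by (simp add: I_def emeasure_eq_ennreal_measure less_top)
  next
    case False
    have "I = \<infinity>"
    proof (rule ccontr)
      assume "I \<noteq> \<infinity>"
      then obtain m where m: "I = ennreal m" "0 \<le> m" by (cases I) auto
      have "(h has_integral m) UNIV"
        by (rule nn_integral_has_integral) (use m hm nonneg I in auto)
      then have "f ` S \<in> lmeasurable" using hint by blast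
      then show False using False bor by (simp add: fmeasurable_def)
    qed
    then show ?thesis using False em by (simp add: I_def flip: less_top)
  qed
qed

lemma nn_integral_holomorphic_image:
  assumes hol: "\<phi> holomorphic_on U" and U: "open U" and inj: "inj_on \<phi> U"
    and f [measurable]: "f \<in> borel_measurable borel"
  shows "(\<integral>\<^sup>+w. indicator (\<phi> ` U) w * f w \<partial>lborel) =
         (\<integral>\<^sup>+z. indicator U z * (ennreal ((cmod (deriv \<phi> z))\<^sup>2) * f (\<phi> z)) \<partial>lborel)"
proof -
  \<comment> \<open>Cutting off outside the open set \<open>U\<close> makes
    \<open>\<phi>\<close> and \<open>\<phi>'\<close> measurable on the whole plane.\<close>
  define \<psi> where "\<psi> z = indicator U z *\<^sub>R \<phi> z" for z
  define k where "k z = indicator U z *\<^sub>R (cmod (deriv \<phi> z))\<^sup>2" for z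
  have [measurable]: "\<psi> \<in> borel_measurable borel" unfolding \<psi>_def
    using U hol by (intro borel_measurable_continuous_on_indicator holomorphic_on_imp_continuous_on) auto
  have [measurable]: "k \<in> borel_measurable borel" unfolding k_def
    using U by (intro borel_measurable_continuous_on_indicator continuous_intros
        holomorphic_on_imp_continuous_on holomorphic_deriv[OF hol U]) auto
  have [measurable]: "U \<in> sets borel" using U by auto
  have [measurable]: "\<phi> ` U \<in> sets borel" using open_mapping_thm3[OF hol U inj] by auto
  have eq: "density lborel (indicator (\<phi> ` U)) = distr (density lborel (\<lambda>z. ennreal (k z))) borel \<psi>"
  proof (rule measure_eqI)
    fix A assume "A \<in> sets (density lborel (indicator (\<phi> ` U)))"
    then have A [measurable]: "A \<in> sets borel" by simp
    define B where "B = \<psi> -` A \<inter> U"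
    have B: "B \<in> sets borel" "B \<subseteq> U"
      using measurable_sets[OF \<open>\<psi> \<in> borel_measurable borel\<close> A] by (auto simp: B_def)
    have im: "\<phi> ` B = \<phi> ` U \<inter> A" by (auto simp: B_def \<psi>_def)
    have "emeasure (density lborel (indicator (\<phi> ` U))) A = emeasure lborel (\<phi> ` B)"
    proof -
      have "emeasure (density lborel (indicator (\<phi> ` U))) A
          = (\<integral>\<^sup>+z. indicator (\<phi> ` U) z * indicator A z \<partial>lborel)"
        by (rule emeasure_density) auto
      also have "\<dots> = (\<integral>\<^sup>+z. indicator (\<phi> ` U \<inter> A) z \<partial>lborel)"
        by (intro nn_integral_cong) (auto simp: indicator_def)
      also have "\<dots> = emeasure lborel (\<phi> ` B)" unfolding im by (rule nn_integral_indicator) auto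
      finally show ?thesis .
    qed
    also have "\<dots> = (\<integral>\<^sup>+z. indicator B z * ennreal ((cmod (deriv \<phi> z))\<^sup>2) \<partial>lborel)"
      by (rule emeasure_holomorphic_image[OF hol U inj B])
    also have "\<dots> = (\<integral>\<^sup>+z. ennreal (k z) * indicator (\<psi> -` A) z \<partial>lborel)"
      by (intro nn_integral_cong) (auto simp: B_def k_def indicator_def)
    also have "\<dots> = emeasure (distr (density lborel (\<lambda>z. ennreal (k z))) borel \<psi>) A"
      using measurable_sets[OF \<open>\<psi> \<in> borel_measurable borel\<close> A] by (simp add: emeasure_distr emeasure_density)
    finally show "emeasure (density lborel (indicator (\<phi> ` U))) A
       = emeasure (distr (density lborel (\<lambda>z. ennreal (k z))) borel \<psi>) A" .
  qed simp
  have "(\<integral>\<^sup>+w. indicator (\<phi> ` U) w * f w \<partial>lborel) = (\<integral>\<^sup>+w. f w \<partial>density lborel (indicator (\<phi> ` U)))"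
    by (simp add: nn_integral_density)
  also have "\<dots> = (\<integral>\<^sup>+z. ennreal (k z) * f (\<psi> z) \<partial>lborel)"
    unfolding eq by (simp add: nn_integral_distr nn_integral_density)
  also have "\<dots> = (\<integral>\<^sup>+z. indicator U z * (ennreal ((cmod (deriv \<phi> z))\<^sup>2) * f (\<phi> z)) \<partial>lborel)"
    by (intro nn_integral_cong) (auto simp: k_def \<psi>_def indicator_def)
  finally show ?thesis .
qed

section \<open>The action on the upper half-plane\<close>

lemma open_upper_half_plane: "open \<HH>"
  unfolding upper_half_plane_def by (rule open_halfspace_Im_gt)

lemma upper_half_plane_iff: "z \<in> \<HH> \<longleftrightarrow> Im z > 0"
  by (simp add: upper_half_plane_def)

lemma convex_upper_half_plane: "convex \<HH>"
  unfolding upper_half_plane_def by (rule convex_halfspace_Im_gt)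

lemma upper_half_plane_borel [measurable]: "\<HH> \<in> sets borel"
  using open_upper_half_plane by auto

lemma act_closed: "g \<in> carrier PSL2R \<Longrightarrow> z \<in> \<HH> \<Longrightarrow> act g z \<in> \<HH>"
  using group_action.element_image[OF group_action_PSL2R] by blast

lemma act_mult:
  "g \<in> carrier PSL2R \<Longrightarrow> h \<in> carrier PSL2R \<Longrightarrow> z \<in> \<HH> \<Longrightarrow> act (g \<otimes>\<^bsub>PSL2R\<^esub> h) z = act g (act h z)"
  using group_action.composition_rule[OF group_action_PSL2R] by blast

lemma act_one: "z \<in> \<HH> \<Longrightarrow> act \<one>\<^bsub>PSL2R\<^esub> z = z"
  using group_action.id_eq_one[OF group_action_PSL2R] by (metis restrict_apply')

lemma act_inv_act: "g \<in> carrier PSL2R \<Longrightarrow> z \<in> \<HH> \<Longrightarrow> act (inv\<^bsub>PSL2R\<^esub> g) (act g z) = z"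
  using group_action.orbit_sym_aux[OF group_action_PSL2R] by blast

lemma act_act_inv: "g \<in> carrier PSL2R \<Longrightarrow> z \<in> \<HH> \<Longrightarrow> act g (act (inv\<^bsub>PSL2R\<^esub> g) z) = z"
  using act_inv_act[of "inv\<^bsub>PSL2R\<^esub> g" z] group_PSL2R
  by (simp add: group.inv_closed group.inv_inv)

lemma act_image: "g \<in> carrier PSL2R \<Longrightarrow> act g ` \<HH> = \<HH>"
  using group_action.surj_prop[OF group_action_PSL2R] by blast

lemma inj_on_act: "g \<in> carrier PSL2R \<Longrightarrow> inj_on (act g) \<HH>"
  by (metis act_inv_act inj_onI)

lemma PSL2R_E:
  assumes "g \<in> carrier PSL2R"
  obtains A where "det A = 1" "g = {A, - A}"
  using assms by (auto simp: carrier_PSL2R)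

lemma PSL2R_matrix:
  assumes "g \<in> carrier PSL2R"
  obtains a b c d :: real where "a * d - b * c = 1"
    "\<And>z. z \<in> \<HH> \<Longrightarrow> act g z = (of_real a * z + of_real b) / (of_real c * z + of_real d)"
    "\<And>z. z \<in> \<HH> \<Longrightarrow> of_real c * z + of_real d \<noteq> (0::complex)"
proof -
  from assms obtain A where A: "det A = 1" "g = {A, - A}" by (rule PSL2R_E)
  show ?thesis
  proof (rule that[of "A$1$1" "A$2$2" "A$1$2" "A$2$1"])
    show "A$1$1 * A$2$2 - A$1$2 * A$2$1 = 1" using A(1) by (simp add: det_2)
  qed (use A mat_act_denom_nonzero[OF A(1)] in \<open>simp_all add: act_coset mat_act_def moebius_def\<close>)
qed

text \<open>The automorphy factor \<open>j z = c z + d\<close> controls the derivative and both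
  kinds of differences. The last two formulas make cross-ratio expressions such as
  \<open>sech2\<close> invariant.\<close>

lemma act_deriv_formulas:
  assumes g: "g \<in> carrier PSL2R"
  obtains j :: "complex \<Rightarrow> complex" where
    "\<And>z. z \<in> \<HH> \<Longrightarrow> j z \<noteq> 0"
    "\<And>z. z \<in> \<HH> \<Longrightarrow> (act g has_field_derivative 1 / (j z)\<^sup>2) (at z)"
    "\<And>z w. z \<in> \<HH> \<Longrightarrow> w \<in> \<HH> \<Longrightarrow> act g z - act g w = (z - w) / (j z * j w)"
    "\<And>z w. z \<in> \<HH> \<Longrightarrow> w \<in> \<HH> \<Longrightarrow> act g z - cnj (act g w) = (z - cnj w) / (j z * cnj (j w))"
proof -
  from g obtain a b c d :: real where det: "a * d - b * c = 1"
    and act: "\<And>z. z \<in> \<HH> \<Longrightarrow> act g z = (of_real a * z + of_real b) / (of_real c * z + of_real d)"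
    and nz: "\<And>z. z \<in> \<HH> \<Longrightarrow> of_real c * z + of_real d \<noteq> (0::complex)"
    by (rule PSL2R_matrix) blast
  have det': "of_real a * of_real d - of_real b * of_real c = (1 :: complex)"
    using det by (metis of_real_1 of_real_diff of_real_mult)
  have alg: "(A * z + B) / (C * z + D) - (A * w + B) / (C * w + D) = (z - w) / ((C * z + D) * (C * w + D))"
    if "C * z + D \<noteq> 0" "C * w + D \<noteq> 0" "A * D - B * C = 1" for A B C D z w :: complex
  proof -
    have "(A * z + B) * (C * w + D) - (A * w + B) * (C * z + D) = z - w"
      using that(3) by algebra
    then show ?thesis using that by (simp add: diff_frac_eq mult.commute)
  qed
  show ?thesis
  proof (rule that[of "\<lambda>z. of_real c * z + of_real d"])
    fix z assume z: "z \<in> \<HH>"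
    show "of_real c * z + of_real d \<noteq> (0::complex)" using nz z by blast
    have "((\<lambda>z. (of_real a * z + of_real b) / (of_real c * z + of_real d)) has_field_derivative
       (of_real a * (of_real c * z + of_real d) - (of_real a * z + of_real b) * of_real c) /
       ((of_real c * z + of_real d) * (of_real c * z + of_real d))) (at z)"
      using nz[OF z] by (auto intro!: derivative_eq_intros)
    moreover have "of_real a * (of_real c * z + of_real d) - (of_real a * z + of_real b) * of_real c = (1::complex)"
      using det' by algebra
    ultimately have "((\<lambda>z. (of_real a * z + of_real b) / (of_real c * z + of_real d)) has_field_derivative
       1 / (of_real c * z + of_real d)\<^sup>2) (at z)" by (simp add: power2_eq_square)
    then show "(act g has_field_derivative 1 / (of_real c * z + of_real d)\<^sup>2) (at z)"
      using has_field_derivative_transform_within_open[OF _ open_upper_half_plane z, of _ _ "act g"] act by auto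
  next
    fix z w assume z: "z \<in> \<HH>" and w: "w \<in> \<HH>"
    show "act g z - act g w = (z - w) / ((of_real c * z + of_real d) * (of_real c * w + of_real d))"
      unfolding act[OF z] act[OF w] by (rule alg) (use nz z w det' in auto)
    have "of_real c * cnj w + of_real d \<noteq> (0::complex)"
      using nz[OF w] by (metis complex_cnj_add complex_cnj_complex_of_real complex_cnj_mult complex_cnj_zero_iff)
    then show "act g z - cnj (act g w) = (z - cnj w) / ((of_real c * z + of_real d) * cnj (of_real c * w + of_real d))"
      unfolding act[OF z] act[OF w] using alg[of "of_real c" z "of_real d" "cnj w" "of_real a" "of_real b"] nz[OF z] det'
      by simp
  qed
qed

lemma act_holomorphic: "g \<in> carrier PSL2R \<Longrightarrow> act g holomorphic_on \<HH>"
  by (metis act_deriv_formulas holomorphic_on_open open_upper_half_plane)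

lemma act_continuous: "g \<in> carrier PSL2R \<Longrightarrow> continuous_on \<HH> (act g)"
  by (simp add: act_holomorphic holomorphic_on_imp_continuous_on)

lemma Im_act:
  assumes g: "g \<in> carrier PSL2R" and z: "z \<in> \<HH>"
  shows "Im (act g z) = Im z * cmod (deriv (act g) z)" "deriv (act g) z \<noteq> 0"
proof -
  obtain j where j: "j z \<noteq> 0" "(act g has_field_derivative 1 / (j z)\<^sup>2) (at z)"
    "act g z - cnj (act g z) = (z - cnj z) / (j z * cnj (j z))"
    using act_deriv_formulas[OF g] z by metis
  have d: "deriv (act g) z = 1 / (j z)\<^sup>2" using j(2) by (rule DERIV_imp_deriv)
  then show "deriv (act g) z \<noteq> 0" using j by simp
  have "cmod (act g z - cnj (act g z)) = cmod (z - cnj z) / (cmod (j z))\<^sup>2"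
    by (simp add: j(3) norm_divide norm_mult power2_eq_square)
  moreover have "cmod (u - cnj u) = 2 * Im u" if "u \<in> \<HH>" for u
    using that by (simp add: complex_diff_cnj norm_mult upper_half_plane_iff)
  ultimately have "Im (act g z) = Im z / (cmod (j z))\<^sup>2"
    using z act_closed[OF g z] by simp
  then show "Im (act g z) = Im z * cmod (deriv (act g) z)" by (simp add: d norm_divide norm_power)
qed

section \<open>A point-pair invariant\<close>

text \<open>With \<open>d\<close> the hyperbolic distance this is \<open>1 / cosh\<^sup>2 (d /
  2)\<close>. It replaces the distance throughout: it is rational in the coordinates and their
  conjugates, and its powers serve as integral kernels.\<close>

definition sech2 :: "complex \<Rightarrow> complex \<Rightarrow> real" where
  "sech2 z w = 4 * Im z * Im w / (cmod (z - cnj w))\<^sup>2"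

lemma cnj_diff_nonzero: "z \<in> \<HH> \<Longrightarrow> w \<in> \<HH> \<Longrightarrow> z - cnj w \<noteq> 0"
  by (auto simp: complex_eq_iff upper_half_plane_iff)

lemma cmod_diff_cnj: "(cmod (z - cnj w))\<^sup>2 = (cmod (z - w))\<^sup>2 + 4 * Im z * Im w"
  unfolding cmod_power2 by (simp add: power2_eq_square algebra_simps)

lemma sech2_commute: "sech2 z w = sech2 w z"
proof -
  have "cmod (z - cnj w) = cmod (w - cnj z)"
    by (metis complex_cnj_cnj complex_cnj_diff complex_mod_cnj norm_minus_commute)
  then show ?thesis by (simp add: sech2_def mult_ac)
qed

lemma sech2_pos: "z \<in> \<HH> \<Longrightarrow> w \<in> \<HH> \<Longrightarrow> 0 < sech2 z w"
  using cnj_diff_nonzero[of z w] by (simp add: sech2_def upper_half_plane_iff)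

lemma one_minus_sech2:
  "z \<in> \<HH> \<Longrightarrow> w \<in> \<HH> \<Longrightarrow> 1 - sech2 z w = (cmod ((z - w) / (z - cnj w)))\<^sup>2"
proof -
  assume "z \<in> \<HH>" "w \<in> \<HH>"
  then have "(cmod (z - cnj w))\<^sup>2 \<noteq> 0" using cnj_diff_nonzero by simp
  then have "1 - sech2 z w = ((cmod (z - cnj w))\<^sup>2 - 4 * Im z * Im w) / (cmod (z - cnj w))\<^sup>2"
    by (simp add: sech2_def diff_divide_distrib)
  then show ?thesis by (simp add: norm_divide power_divide cmod_diff_cnj[of z w])
qed

lemma sech2_le_1: "z \<in> \<HH> \<Longrightarrow> w \<in> \<HH> \<Longrightarrow> sech2 z w \<le> 1"
  using one_minus_sech2[of z w] by (smt (verit) zero_le_power2)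

lemma sech2_refl: "z \<in> \<HH> \<Longrightarrow> sech2 z z = 1"
  using one_minus_sech2[of z z] by simp

lemma sech2_eq_1_iff: "z \<in> \<HH> \<Longrightarrow> w \<in> \<HH> \<Longrightarrow> sech2 z w = 1 \<longleftrightarrow> z = w"
  using one_minus_sech2[of z w] cnj_diff_nonzero[of z w] by (auto simp: sech2_refl)

lemma sech2_act:
  assumes g: "g \<in> carrier PSL2R" and z: "z \<in> \<HH>" "w \<in> \<HH>"
  shows "sech2 (act g z) (act g w) = sech2 z w"
proof -
  obtain j where j: "j z \<noteq> 0" "j w \<noteq> 0" "act g z - act g w = (z - w) / (j z * j w)"
    "act g z - cnj (act g w) = (z - cnj w) / (j z * cnj (j w))"
    using act_deriv_formulas[OF g] z by metis
  have "1 - sech2 (act g z) (act g w) = 1 - sech2 z w"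
    using j z act_closed[OF g] by (simp add: one_minus_sech2 norm_divide norm_mult)
  then show ?thesis by simp
qed

lemma sech2_act_left:
  assumes g: "g \<in> carrier PSL2R" and z: "z \<in> \<HH>" "w \<in> \<HH>"
  shows "sech2 (act g z) w = sech2 z (act (inv\<^bsub>PSL2R\<^esub> g) w)"
  using sech2_act[OF g z(1), of "act (inv\<^bsub>PSL2R\<^esub> g) w"] z g
  by (simp add: act_act_inv act_closed group.inv_closed[OF group_PSL2R])

lemma continuous_on_sech2:
  assumes "continuous_on S f" "continuous_on S g" "f ` S \<subseteq> \<HH>" "g ` S \<subseteq> \<HH>"
  shows "continuous_on S (\<lambda>x. sech2 (f x) (g x))"
  unfolding sech2_def using cnj_diff_nonzero assms(3,4)
  by (intro continuous_intros assms(1,2)) (auto simp: image_subset_iff)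

lemma borel_measurable_sech2 [measurable (raw)]:
  assumes [measurable]: "f \<in> borel_measurable M" "g \<in> borel_measurable M"
  shows "(\<lambda>x. sech2 (f x) (g x)) \<in> borel_measurable M"
proof -
  have [measurable]: "cnj \<in> borel_measurable borel"
    by (intro borel_measurable_continuous_onI continuous_intros)
  show ?thesis unfolding sech2_def by measurable
qed

text \<open>In terms of the distance this is \<open>cosh (d(z, w) / 2) \<le> 2 cosh (d(z, u) /
  2) cosh (d(u, w) / 2)\<close>, a weak form of the triangle inequality. It comes from Ptolemy's
  identity for the four points \<open>z\<close>, \<open>u\<close>, \<open>cnj u\<close>,
  \<open>cnj w\<close>.\<close>

lemma sech2_quasi_triangle:
  assumes "z \<in> \<HH>" "u \<in> \<HH>" "w \<in> \<HH>"
  shows "sech2 z u * sech2 u w \<le> 4 * sech2 z w"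
proof -
  have le: "cmod (x - y) \<le> cmod (x - cnj y)" if "x \<in> \<HH>" "y \<in> \<HH>" for x y
  proof -
    have "0 \<le> 4 * Im x * Im y" using that by (simp add: upper_half_plane_iff)
    then have "(cmod (x - y))\<^sup>2 \<le> (cmod (x - cnj y))\<^sup>2" by (simp add: cmod_diff_cnj)
    then show ?thesis by (rule power2_le_imp_le) simp
  qed
  have "(z - cnj w) * (u - cnj u) = (z - u) * (cnj w - cnj u) + (z - cnj u) * (u - cnj w)"
    by (simp add: algebra_simps)
  then have "cmod (z - cnj w) * cmod (u - cnj u) \<le>
      cmod (z - u) * cmod (cnj w - cnj u) + cmod (z - cnj u) * cmod (u - cnj w)"
    using norm_triangle_ineq[of "(z - u) * (cnj w - cnj u)" "(z - cnj u) * (u - cnj w)"]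
    unfolding norm_mult[symmetric] by (simp only:)
  moreover have "cmod (z - u) * cmod (cnj w - cnj u) \<le> cmod (z - cnj u) * cmod (u - cnj w)"
  proof (rule mult_mono)
    show "cmod (cnj w - cnj u) \<le> cmod (u - cnj w)"
      using le[of u w] assms by (metis complex_cnj_diff complex_mod_cnj norm_minus_commute)
  qed (use le assms in auto)
  moreover have "cmod (u - cnj u) = 2 * Im u"
    using assms by (simp add: complex_diff_cnj norm_mult upper_half_plane_iff)
  ultimately have "cmod (z - cnj w) * Im u \<le> cmod (z - cnj u) * cmod (u - cnj w)" by simp
  then have sq: "(cmod (z - cnj w))\<^sup>2 * (Im u)\<^sup>2 \<le> (cmod (z - cnj u))\<^sup>2 * (cmod (u - cnj w))\<^sup>2"
  proof -
    assume "cmod (z - cnj w) * Im u \<le> cmod (z - cnj u) * cmod (u - cnj w)"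
    then have "(cmod (z - cnj w) * Im u)\<^sup>2 \<le> (cmod (z - cnj u) * cmod (u - cnj w))\<^sup>2"
      using assms(2) by (intro power_mono) (auto simp: upper_half_plane_iff)
    then show ?thesis by (simp only: power_mult_distrib)
  qed
  define A B C where "A = (cmod (z - cnj w))\<^sup>2" "B = (cmod (z - cnj u))\<^sup>2" "C = (cmod (u - cnj w))\<^sup>2"
  have pos: "A > 0" "B > 0" "C > 0" "Im z > 0" "Im u > 0" "Im w > 0"
    using cnj_diff_nonzero assms by (auto simp: A_B_C_def upper_half_plane_iff)
  have "A * (Im u)\<^sup>2 \<le> B * C" using sq by (simp add: A_B_C_def)
  then have "16 * Im z * Im w * (A * (Im u)\<^sup>2) \<le> 16 * Im z * Im w * (B * C)"
    using pos by (intro mult_left_mono) auto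
  then have "(4 * Im z * Im u) / B * ((4 * Im u * Im w) / C) \<le> 4 * ((4 * Im z * Im w) / A)"
  proof -
    assume le: "16 * Im z * Im w * (A * (Im u)\<^sup>2) \<le> 16 * Im z * Im w * (B * C)"
    have "(4 * Im z * Im u) / B * ((4 * Im u * Im w) / C) = 16 * Im z * Im w * (A * (Im u)\<^sup>2) / (A * (B * C))"
      using pos by (simp add: power2_eq_square)
    also have "\<dots> \<le> 16 * Im z * Im w * (B * C) / (A * (B * C))"
      using pos by (intro divide_right_mono le) auto
    also have "\<dots> = 4 * ((4 * Im z * Im w) / A)" using pos by simp
    finally show ?thesis .
  qed
  then show ?thesis by (simp add: sech2_def A_B_C_def)
qed

section \<open>Cayley transforms and the Schwarz-Pick lemma\<close>

text \<open>The conformal map onto the unit disc that sends \<open>b\<close> to the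
  origin.\<close>

definition cay :: "complex \<Rightarrow> complex \<Rightarrow> complex" where
  "cay b z = (z - b) / (z - cnj b)"

definition cay_inv :: "complex \<Rightarrow> complex \<Rightarrow> complex" where
  "cay_inv b \<zeta> = (b - cnj b * \<zeta>) / (1 - \<zeta>)"

lemma cmod_cay: "z \<in> \<HH> \<Longrightarrow> b \<in> \<HH> \<Longrightarrow> (cmod (cay b z))\<^sup>2 = 1 - sech2 z b"
  by (simp add: one_minus_sech2 cay_def)

lemma cmod_cay_less_1: "z \<in> \<HH> \<Longrightarrow> b \<in> \<HH> \<Longrightarrow> cmod (cay b z) < 1"
  using cmod_cay[of z b] sech2_pos[of z b] by (smt (verit) one_le_power)

lemma cay_self: "cay b b = 0" by (simp add: cay_def)

lemma cay_holomorphic: "b \<in> \<HH> \<Longrightarrow> cay b holomorphic_on \<HH>"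
  unfolding cay_def using cnj_diff_nonzero by (intro holomorphic_intros) auto

lemma cay_inv_cay:
  assumes "z \<in> \<HH>" "b \<in> \<HH>" shows "cay_inv b (cay b z) = z"
proof -
  have nz: "z - cnj b \<noteq> 0" "b - cnj b \<noteq> 0" using assms cnj_diff_nonzero by auto
  have "b - cnj b * cay b z = (z * (b - cnj b)) / (z - cnj b)"
    using nz by (simp add: cay_def field_simps)
  moreover have "1 - cay b z = (b - cnj b) / (z - cnj b)"
    using nz by (simp add: cay_def field_simps)
  ultimately show ?thesis using nz by (simp add: cay_inv_def)
qed

lemma cay_inv_in:
  assumes "b \<in> \<HH>" "cmod \<zeta> < 1" shows "cay_inv b \<zeta> \<in> \<HH>"
proof -
  have "1 - \<zeta> \<noteq> 0" using assms by auto
  have "Im (cay_inv b \<zeta>) = Im ((b - cnj b * \<zeta>) * cnj (1 - \<zeta>)) / (cmod (1 - \<zeta>))\<^sup>2"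
    unfolding cay_inv_def by (subst complex_div_cnj) (simp del: complex_cnj_diff)
  also have "Im ((b - cnj b * \<zeta>) * cnj (1 - \<zeta>)) = Im b * (1 - (cmod \<zeta>)\<^sup>2)"
    unfolding cmod_power2 by (simp add: power2_eq_square algebra_simps)
  finally show ?thesis using assms \<open>1 - \<zeta> \<noteq> 0\<close>
    by (simp add: upper_half_plane_iff power_less_one_iff abs_square_less_1)
qed

lemma cay_inv_0: "cay_inv b 0 = b" by (simp add: cay_inv_def)

lemma cay_inv_holomorphic: "cay_inv b holomorphic_on ball 0 1"
  unfolding cay_inv_def by (intro holomorphic_intros) auto

text \<open>Moving \<open>w\<close> and \<open>p w\<close> to the origin of the disc reduces
  this to the Schwarz lemma.\<close>

lemma schwarz_pick:
  assumes p: "p holomorphic_on \<HH>" "p ` \<HH> \<subseteq> \<HH>" and z: "z \<in> \<HH>" and w: "w \<in> \<HH>"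
  shows "sech2 z w \<le> sech2 (p z) (p w)"
proof -
  define F where "F = cay (p w) \<circ> p \<circ> cay_inv w"
  have pin: "p x \<in> \<HH>" if "x \<in> \<HH>" for x using p that by auto
  have hol: "F holomorphic_on ball 0 1" unfolding F_def
  proof (intro holomorphic_on_compose_gen[where t = \<HH>])
    show "cay_inv w holomorphic_on ball 0 1" by (rule cay_inv_holomorphic)
    show "cay_inv w ` ball 0 1 \<subseteq> \<HH>" using cay_inv_in[OF w] by auto
  qed (use p cay_holomorphic[OF pin[OF w]] in auto)
  have 0: "F 0 = 0" by (simp add: F_def cay_inv_0 cay_self)
  have lt: "cmod (F \<zeta>) < 1" if "cmod \<zeta> < 1" for \<zeta>
    using cmod_cay_less_1[OF pin[OF cay_inv_in[OF w that]] pin[OF w]] by (simp add: F_def)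
  have "cmod (F (cay w z)) \<le> cmod (cay w z)"
    by (rule Schwarz_Lemma(1)[OF hol 0 lt]) (auto intro: cmod_cay_less_1 z w)
  then have "cmod (cay (p w) (p z)) \<le> cmod (cay w z)" by (simp add: F_def cay_inv_cay z w)
  then have "(cmod (cay (p w) (p z)))\<^sup>2 \<le> (cmod (cay w z))\<^sup>2" by (intro power_mono) auto
  then show ?thesis using cmod_cay pin z w by simp
qed

section \<open>The hyperbolic Jacobian of a holomorphic map\<close>

text \<open>The pullback of the density \<open>1 / y\<^sup>2\<close> of hyperbolic area under
  \<open>p\<close>, relative to that density.\<close>

definition hyp_jacobian :: "(complex \<Rightarrow> complex) \<Rightarrow> complex \<Rightarrow> real" where
  "hyp_jacobian p z = (cmod (deriv p z) * Im z / Im (p z))\<^sup>2"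

lemma hyp_jacobian_nonneg [simp]: "0 \<le> hyp_jacobian p z"
  by (simp add: hyp_jacobian_def)

text \<open>The action preserves area, so composing with it on either side does not change the
  Jacobian.\<close>

lemma hyp_jacobian_covariant:
  assumes p: "p holomorphic_on \<HH>" and q: "q holomorphic_on \<HH>" "q ` \<HH> \<subseteq> \<HH>"
    and g: "g \<in> carrier PSL2R" and h: "h \<in> carrier PSL2R"
    and eq: "\<And>z. z \<in> \<HH> \<Longrightarrow> p (act h z) = act g (q z)" and z: "z \<in> \<HH>"
  shows "hyp_jacobian p (act h z) = hyp_jacobian q z"
proof -
  have qz: "q z \<in> \<HH>" using q z by auto
  have fd: "f field_differentiable (at x)" if "f holomorphic_on \<HH>" "x \<in> \<HH>" for f x
    using that holomorphic_on_imp_differentiable_at open_upper_half_plane by blast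
  have "deriv (p \<circ> act h) z = deriv (act g \<circ> q) z"
  proof (rule deriv_cong_ev)
    show "\<forall>\<^sub>F x in nhds z. (p \<circ> act h) x = (act g \<circ> q) x"
      using eventually_nhds_in_open[OF open_upper_half_plane z] by eventually_elim (simp add: eq)
  qed simp
  then have "deriv p (act h z) * deriv (act h) z = deriv (act g) (q z) * deriv q z"
    using deriv_chain[of "act h" z p] deriv_chain[of q z "act g"] fd p q act_holomorphic[OF g]
      act_holomorphic[OF h] act_closed[OF h z] z qz by simp
  then have 1: "cmod (deriv p (act h z)) * cmod (deriv (act h) z) = cmod (deriv (act g) (q z)) * cmod (deriv q z)"
    by (metis norm_mult)
  have "cmod (deriv p (act h z)) * Im (act h z) / Im (p (act h z))
     = (cmod (deriv p (act h z)) * cmod (deriv (act h) z)) * Im z / (Im (q z) * cmod (deriv (act g) (q z)))"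
    using Im_act(1)[OF h z] Im_act(1)[OF g qz] by (simp add: eq[OF z])
  also have "\<dots> = cmod (deriv q z) * Im z / Im (q z)"
    unfolding 1 using Im_act(2)[OF g qz] by simp
  finally show ?thesis by (simp add: hyp_jacobian_def)
qed

text \<open>The Jacobian is the square of the factor by which \<open>p\<close> multiplies
  infinitesimal distances, and \<open>1 - sech2 w z = tanh\<^sup>2 (d(w, z) / 2)\<close> is the
  squared distance up to a constant factor and terms of higher order.\<close>

lemma hyp_jacobian_tendsto:
  assumes p: "p holomorphic_on \<HH>" "p ` \<HH> \<subseteq> \<HH>" and z: "z \<in> \<HH>"
  shows "((\<lambda>w. (1 - sech2 (p w) (p z)) / (1 - sech2 w z)) \<longlongrightarrow> hyp_jacobian p z) (at z)"
proof -
  have pin: "p x \<in> \<HH>" if "x \<in> \<HH>" for x using p that by auto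
  have der: "(p has_field_derivative deriv p z) (at z)"
    using p z open_upper_half_plane holomorphic_derivI by blast
  have cp: "(p \<longlongrightarrow> p z) (at z)" using der DERIV_isCont isCont_def by blast
  have 1: "((\<lambda>w. (p w - p z) / (w - z)) \<longlongrightarrow> deriv p z) (at z)"
    using der by (simp add: has_field_derivative_iff)
  have nz: "p z - cnj (p z) \<noteq> 0" "z - cnj z \<noteq> 0" using cnj_diff_nonzero pin z by auto
  have "((\<lambda>w. (cmod ((p w - p z) / (w - z)) * (cmod (w - cnj z) / cmod (p w - cnj (p z))))\<^sup>2) \<longlongrightarrow>
      (cmod (deriv p z) * (cmod (z - cnj z) / cmod (p z - cnj (p z))))\<^sup>2) (at z)"
    using nz by (intro tendsto_intros 1 cp) auto
  moreover have "cmod (u - cnj u) = 2 * Im u" if "u \<in> \<HH>" for u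
    using that by (simp add: complex_diff_cnj norm_mult upper_half_plane_iff)
  ultimately have "((\<lambda>w. (cmod ((p w - p z) / (w - z)) * (cmod (w - cnj z) / cmod (p w - cnj (p z))))\<^sup>2) \<longlongrightarrow>
      hyp_jacobian p z) (at z)" using z pin[OF z] by (simp add: hyp_jacobian_def)
  moreover have "\<forall>\<^sub>F w in at z. (cmod ((p w - p z) / (w - z)) * (cmod (w - cnj z) / cmod (p w - cnj (p z))))\<^sup>2
      = (1 - sech2 (p w) (p z)) / (1 - sech2 w z)"
    using eventually_at_in_open'[OF open_upper_half_plane z]
    by eventually_elim (simp add: one_minus_sech2 pin z norm_divide power_divide power_mult_distrib)
  ultimately show ?thesis by (rule Lim_transform_eventually)
qed

lemma hyp_jacobian_le_1:
  assumes p: "p holomorphic_on \<HH>" "p ` \<HH> \<subseteq> \<HH>" and z: "z \<in> \<HH>"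
  shows "hyp_jacobian p z \<le> 1"
proof (rule tendsto_upperbound[OF hyp_jacobian_tendsto[OF assms]])
  show "\<forall>\<^sub>F w in at z. (1 - sech2 (p w) (p z)) / (1 - sech2 w z) \<le> 1"
    using eventually_at_in_open'[OF open_upper_half_plane z]
  proof eventually_elim
    case (elim w)
    then show ?case using schwarz_pick[OF p elim z] sech2_le_1[OF elim z]
      by (cases "sech2 w z = 1") (auto simp: divide_le_eq_1)
  qed
qed simp

lemma hyp_jacobian_id: "z \<in> \<HH> \<Longrightarrow> hyp_jacobian (\<lambda>z. z) z = 1"
  by (simp add: hyp_jacobian_def upper_half_plane_iff)

section \<open>Invariance of the hyperbolic area\<close>

lemma sets_hyp_area [simp, measurable_cong]: "sets hyp_area = sets borel"
  by (simp add: hyp_area_def)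

lemma space_hyp_area [simp]: "space hyp_area = UNIV"
  by (simp add: hyp_area_def)

lemma nn_integral_hyp_area:
  assumes [measurable]: "f \<in> borel_measurable borel"
  shows "(\<integral>\<^sup>+z. f z \<partial>hyp_area) = (\<integral>\<^sup>+z. indicator \<HH> z * (ennreal (1 / (Im z)\<^sup>2) * f z) \<partial>lborel)"
proof -
  have "(\<integral>\<^sup>+z. f z \<partial>hyp_area) = (\<integral>\<^sup>+z. ennreal (indicator \<HH> z / (Im z)\<^sup>2) * f z \<partial>lborel)"
    unfolding hyp_area_def by (subst nn_integral_density) auto
  also have "\<dots> = (\<integral>\<^sup>+z. indicator \<HH> z * (ennreal (1 / (Im z)\<^sup>2) * f z) \<partial>lborel)"
    by (intro nn_integral_cong) (auto simp: indicator_def)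
  finally show ?thesis .
qed

lemma AE_hyp_area_iff:
  assumes "Measurable.pred borel P"
  shows "(AE z in hyp_area. P z) \<longleftrightarrow> (AE z in lborel. z \<in> \<HH> \<longrightarrow> P z)"
proof -
  have "(AE z in hyp_area. P z) \<longleftrightarrow> (AE z in lborel. 0 < ennreal (indicator \<HH> z / (Im z)\<^sup>2) \<longrightarrow> P z)"
    unfolding hyp_area_def by (rule AE_density) measurable
  also have "\<dots> \<longleftrightarrow> (AE z in lborel. z \<in> \<HH> \<longrightarrow> P z)"
    by (intro AE_cong) (auto simp: indicator_def upper_half_plane_iff)
  finally show ?thesis .
qed

lemma AE_upper_half_plane: "AE z in hyp_area. z \<in> \<HH>"
  by (subst AE_hyp_area_iff) auto

lemma nn_integral_hyp_cong:
  assumes "\<And>z. z \<in> \<HH> \<Longrightarrow> f z = g z"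
  shows "(\<integral>\<^sup>+z. f z \<partial>hyp_area) = (\<integral>\<^sup>+z. g z \<partial>hyp_area)"
  by (rule nn_integral_cong_AE) (use AE_upper_half_plane assms in auto)

lemma measurable_act [measurable]:
  assumes "g \<in> carrier PSL2R" shows "act g \<in> borel_measurable borel"
proof -
  have "(\<lambda>z. if z \<in> \<HH> then act g z else undefined) \<in> borel_measurable borel"
    using act_continuous[OF assms] upper_half_plane_borel
    by (intro measurable_If_restrict_space_iff[THEN iffD2] conjI borel_measurable_continuous_on_restrict) auto
  moreover have "(\<lambda>z. if z \<in> \<HH> then act g z else undefined) = act g"
    by (auto simp: act_def)
  ultimately show ?thesis by simp
qed

text \<open>Under \<open>act g\<close> Lebesgue measure is multiplied by
  \<open>\<bar>g'\<bar>\<^sup>2\<close> and \<open>(Im z)\<^sup>2\<close> by the same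
  factor.\<close>

lemma nn_integral_act:
  assumes g: "g \<in> carrier PSL2R" and f [measurable]: "f \<in> borel_measurable borel"
  shows "(\<integral>\<^sup>+z. f (act g z) \<partial>hyp_area) = (\<integral>\<^sup>+z. f z \<partial>hyp_area)"
proof -
  have [measurable]: "act g \<in> borel_measurable borel" using g by measurable
  have "(\<integral>\<^sup>+z. f z \<partial>hyp_area) = (\<integral>\<^sup>+z. indicator (act g ` \<HH>) z * (ennreal (1 / (Im z)\<^sup>2) * f z) \<partial>lborel)"
    by (simp add: nn_integral_hyp_area act_image[OF g])
  also have "\<dots> = (\<integral>\<^sup>+z. indicator \<HH> z * (ennreal ((cmod (deriv (act g) z))\<^sup>2) *
       (ennreal (1 / (Im (act g z))\<^sup>2) * f (act g z))) \<partial>lborel)"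
    by (rule nn_integral_holomorphic_image) (use act_holomorphic[OF g] inj_on_act[OF g] open_upper_half_plane in auto)
  also have "\<dots> = (\<integral>\<^sup>+z. indicator \<HH> z * (ennreal (1 / (Im z)\<^sup>2) * f (act g z)) \<partial>lborel)"
  proof (intro nn_integral_cong)
    fix z
    show "indicator \<HH> z * (ennreal ((cmod (deriv (act g) z))\<^sup>2) * (ennreal (1 / (Im (act g z))\<^sup>2) * f (act g z)))
        = indicator \<HH> z * (ennreal (1 / (Im z)\<^sup>2) * f (act g z))"
    proof (cases "z \<in> \<HH>")
      case True
      have "(cmod (deriv (act g) z))\<^sup>2 * (1 / (Im (act g z))\<^sup>2) = 1 / (Im z)\<^sup>2"
        using Im_act[OF g True] True by (simp add: upper_half_plane_iff power_mult_distrib field_simps)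
      then have "ennreal ((cmod (deriv (act g) z))\<^sup>2) * ennreal (1 / (Im (act g z))\<^sup>2) = ennreal (1 / (Im z)\<^sup>2)"
        by (simp flip: ennreal_mult)
      then show ?thesis by (simp add: mult.assoc[symmetric])
    qed simp
  qed
  also have "\<dots> = (\<integral>\<^sup>+z. f (act g z) \<partial>hyp_area)"
    by (simp add: nn_integral_hyp_area)
  finally show ?thesis by simp
qed

section \<open>Discontinuous groups\<close>

text \<open>A fixed point of \<open>(a z + b) / (c z + d)\<close> is a root of a real quadratic
  polynomial, and at most one root of a nonzero one lies in the upper half-plane.\<close>

lemma fixes_two_points_imp_one:
  assumes g: "g \<in> carrier PSL2R" and z: "z \<in> \<HH>" "w \<in> \<HH>" "z \<noteq> w"
    and fixed: "act g z = z" "act g w = w"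
  shows "g = \<one>\<^bsub>PSL2R\<^esub>"
proof -
  from g obtain A where A: "det A = 1" "g = {A, - A}" by (rule PSL2R_E)
  define a b c d where "a = A$1$1" "b = A$1$2" "c = A$2$1" "d = A$2$2"
  have det: "a * d - b * c = 1" using A(1) by (simp add: det_2 a_b_c_d_def)
  have root: "2 * c * Re u = a - d \<and> - b = c * ((Re u)\<^sup>2 + (Im u)\<^sup>2)" if "u \<in> \<HH>" "act g u = u" for u
  proof -
    have nz: "of_real c * u + of_real d \<noteq> (0::complex)"
      using mat_act_denom_nonzero[OF A(1) that(1)] by (simp add: a_b_c_d_def)
    have "(of_real a * u + of_real b) / (of_real c * u + of_real d) = u"
      using that A act_coset[OF that(1), of A] by (simp add: mat_act_def moebius_def a_b_c_d_def)
    then have eq: "of_real a * u + of_real b = u * (of_real c * u + of_real d)"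
      using nz by (simp add: divide_eq_eq)
    have I: "a * Im u = Re u * (c * Im u) + Im u * (c * Re u + d)"
      using arg_cong[OF eq, of Im] by (simp add: algebra_simps)
    have R: "a * Re u + b = Re u * (c * Re u + d) - Im u * (c * Im u)"
      using arg_cong[OF eq, of Re] by (simp add: algebra_simps)
    have "Im u * (2 * c * Re u) = Im u * (a - d)" using I by (simp add: algebra_simps)
    then have 1: "2 * c * Re u = a - d" using that(1) by (simp add: upper_half_plane_iff)
    have "Re u * (2 * c * Re u) = Re u * (a - d)" using 1 by simp
    then have "- b = c * ((Re u)\<^sup>2 + (Im u)\<^sup>2)" using R by (simp add: power2_eq_square algebra_simps)
    then show ?thesis using 1 by simp
  qed
  have c: "c = 0"
  proof (rule ccontr)
    assume c: "c \<noteq> 0"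
    have "2 * c * Re z = 2 * c * Re w" using root z fixed by metis
    then have Re: "Re z = Re w" using c by simp
    have "c * ((Re z)\<^sup>2 + (Im z)\<^sup>2) = c * ((Re w)\<^sup>2 + (Im w)\<^sup>2)" using root z fixed by metis
    then have "(Im z)\<^sup>2 = (Im w)\<^sup>2" using c Re by simp
    then have "Im z = Im w" using z by (simp add: upper_half_plane_iff)
    then show False using Re z by (simp add: complex_eq_iff)
  qed
  have ad: "a = d" "b = 0" using root[OF z(1) fixed(1)] c by auto
  then have "a * a = 1" using det c by simp
  then have "a = 1 \<or> a = -1" by algebra
  then have "A = mat 1 \<or> A = - mat 1" using ad c
    by (auto simp: a_b_c_d_def vec_eq_iff forall_2 mat_def)
  then have "g = {mat 1, - mat 1}" using A(2) by auto
  then show ?thesis by (simp add: PSL2R_def FactGroup_def pm1_def)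
qed

locale discontinuous_group =
  fixes \<Gamma> :: "psl2r set"
  assumes subgroup: "subgroup \<Gamma> PSL2R" and discontinuous: "acts_discretely \<Gamma>"
begin

lemma mem_carrier: "\<gamma> \<in> \<Gamma> \<Longrightarrow> \<gamma> \<in> carrier PSL2R"
  using subgroup.mem_carrier[OF subgroup] .

lemma mult_mem: "\<gamma> \<in> \<Gamma> \<Longrightarrow> \<delta> \<in> \<Gamma> \<Longrightarrow> \<gamma> \<otimes>\<^bsub>PSL2R\<^esub> \<delta> \<in> \<Gamma>"
  using subgroup.m_closed[OF subgroup] .

lemma inv_mem: "\<gamma> \<in> \<Gamma> \<Longrightarrow> inv\<^bsub>PSL2R\<^esub> \<gamma> \<in> \<Gamma>"
  using subgroup.m_inv_closed[OF subgroup] .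

lemma one_mem: "\<one>\<^bsub>PSL2R\<^esub> \<in> \<Gamma>"
  using subgroup.one_closed[OF subgroup] .

lemma bij_betw_inv: "bij_betw (\<lambda>\<gamma>. inv\<^bsub>PSL2R\<^esub> \<gamma>) \<Gamma> \<Gamma>"
  by (rule bij_betw_byWitness[where f' = "\<lambda>\<gamma>. inv\<^bsub>PSL2R\<^esub> \<gamma>"])
    (auto simp: inv_mem mem_carrier group.inv_inv[OF group_PSL2R])

lemma bij_betw_mult_right: "\<delta> \<in> \<Gamma> \<Longrightarrow> bij_betw (\<lambda>\<gamma>. \<gamma> \<otimes>\<^bsub>PSL2R\<^esub> \<delta>) \<Gamma> \<Gamma>"
  by (rule bij_betw_byWitness[where f' = "\<lambda>\<gamma>. \<gamma> \<otimes>\<^bsub>PSL2R\<^esub> inv\<^bsub>PSL2R\<^esub> \<delta>"])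
    (auto simp: inv_mem mem_carrier mult_mem group.inv_solve_right' group_PSL2R
      group.is_monoid monoid.m_assoc group.r_inv group.l_inv monoid.r_one)

text \<open>Exhaust the half-plane by countably many compact sets. Each element moves
  \<open>\<i>\<close> within one of them, and for each of them finitely many elements
  do.\<close>

lemma countable: "countable \<Gamma>"
proof -
  define K where "K n = {z. cmod z \<le> real n \<and> 1 / (real n + 1) \<le> Im z}" for n :: nat
  have KH: "K n \<subseteq> \<HH>" for n
  proof
    fix z assume "z \<in> K n"
    then have "1 / (real n + 1) \<le> Im z" by (simp add: K_def)
    moreover have "0 < 1 / (real n + 1)" by simp
    ultimately show "z \<in> \<HH>" unfolding upper_half_plane_iff by linarith
  qed
  have "compact (K n)" for n
  proof -
    have "K n = cball 0 (real n) \<inter> {z. 1 / (real n + 1) \<le> Im z}" by (auto simp: K_def)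
    then show ?thesis
      by (simp add: closed_halfspace_Im_ge compact_Int_closed)
  qed
  then have "finite {\<gamma>\<in>\<Gamma>. act \<gamma> ` K n \<inter> K n \<noteq> {}}" for n
    using discontinuous KH unfolding acts_discretely_def by blast
  moreover have "\<Gamma> \<subseteq> (\<Union>n. {\<gamma>\<in>\<Gamma>. act \<gamma> ` K n \<inter> K n \<noteq> {}})"
  proof
    fix \<gamma> assume \<gamma>: "\<gamma> \<in> \<Gamma>"
    define z where "z = act \<gamma> \<i>"
    have i: "\<i> \<in> \<HH>" by (simp add: upper_half_plane_iff)
    have z: "Im z > 0" using act_closed[OF mem_carrier[OF \<gamma>] i] by (simp add: z_def upper_half_plane_iff)
    obtain n :: nat where n: "max (max 1 (cmod z)) (1 / Im z) \<le> real n"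
      using real_arch_simple by blast
    have "1 / (real n + 1) \<le> Im z"
    proof -
      have "1 \<le> real n * Im z" using n z by (simp add: divide_le_eq)
      then have "1 \<le> Im z * (real n + 1)" using z by (simp add: algebra_simps)
      then show ?thesis by (simp add: divide_le_eq)
    qed
    then have "z \<in> K n" "\<i> \<in> K n" using n by (auto simp: K_def divide_le_eq)
    then have "\<gamma> \<in> {\<gamma>\<in>\<Gamma>. act \<gamma> ` K n \<inter> K n \<noteq> {}}" using \<gamma> by (auto simp: z_def)
    then show "\<gamma> \<in> (\<Union>n. {\<gamma>\<in>\<Gamma>. act \<gamma> ` K n \<inter> K n \<noteq> {}})" by blast
  qed
  ultimately show ?thesis
    by (meson countable_UN countable_finite countable_subset uncountable_infinite countableI_type)
qed

text \<open>Only finitely many elements move a compact neighbourhood of \<open>z\<close> and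
  \<open>w\<close> to meet itself; each of those with \<open>\<gamma> z \<noteq> w\<close> is
  dealt with by continuity.\<close>

lemma separating_neighbourhoods:
  assumes z: "z \<in> \<HH>" and w: "w \<in> \<HH>"
  obtains U V where "open U" "open V" "z \<in> U" "w \<in> V" "U \<subseteq> \<HH>" "V \<subseteq> \<HH>"
    "\<And>\<gamma>. \<gamma> \<in> \<Gamma> \<Longrightarrow> act \<gamma> z \<noteq> w \<Longrightarrow> act \<gamma> ` U \<inter> V = {}"
proof -
  obtain r1 where r1: "r1 > 0" "cball z r1 \<subseteq> \<HH>" using open_contains_cball open_upper_half_plane z by metis
  obtain r2 where r2: "r2 > 0" "cball w r2 \<subseteq> \<HH>" using open_contains_cball open_upper_half_plane w by metis
  define K where "K = cball z r1 \<union> cball w r2"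
  have "compact K" "K \<subseteq> \<HH>" using r1 r2 by (auto simp: K_def)
  then have fin: "finite {\<gamma>\<in>\<Gamma>. act \<gamma> ` K \<inter> K \<noteq> {}}" using discontinuous unfolding acts_discretely_def by blast
  define S where "S = {\<gamma>\<in>\<Gamma>. act \<gamma> ` K \<inter> K \<noteq> {} \<and> act \<gamma> z \<noteq> w}"
  have finS: "finite S" by (rule finite_subset[OF _ fin]) (auto simp: S_def)
  have "\<forall>\<^sub>F x in nhds z \<times>\<^sub>F nhds w. act \<gamma> (fst x) \<noteq> snd x" if "\<gamma> \<in> S" for \<gamma>
  proof -
    have "isCont (act \<gamma>) z"
      using that z act_continuous[OF mem_carrier] continuous_on_eq_continuous_at open_upper_half_plane
      by (auto simp: S_def)
    then have t: "(act \<gamma> \<longlongrightarrow> act \<gamma> z) (nhds z)"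
      by (simp add: continuous_at tendsto_nhds_iff isCont_def)
    have "((\<lambda>x. act \<gamma> (fst x) - snd x) \<longlongrightarrow> act \<gamma> z - w) (nhds z \<times>\<^sub>F nhds w)"
      by (intro tendsto_diff filterlim_compose[OF t] filterlim_fst filterlim_snd)
    then have "\<forall>\<^sub>F x in nhds z \<times>\<^sub>F nhds w. act \<gamma> (fst x) - snd x \<noteq> 0"
      by (rule tendsto_imp_eventually_ne) (use that in \<open>auto simp: S_def\<close>)
    then show ?thesis by eventually_elim auto
  qed
  then have "\<forall>\<^sub>F x in nhds z \<times>\<^sub>F nhds w. \<forall>\<gamma>\<in>S. act \<gamma> (fst x) \<noteq> snd x"
    using finS by (simp add: eventually_ball_finite_distrib)
  then obtain P Q where PQ: "\<forall>\<^sub>F x in nhds z. P x" "\<forall>\<^sub>F y in nhds w. Q y"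
    "\<And>x y. P x \<Longrightarrow> Q y \<Longrightarrow> \<forall>\<gamma>\<in>S. act \<gamma> x \<noteq> y"
    unfolding eventually_prod_filter by auto
  obtain U where U: "open U" "z \<in> U" "\<And>x. x \<in> U \<Longrightarrow> P x" using PQ(1) unfolding eventually_nhds by blast
  obtain V where V: "open V" "w \<in> V" "\<And>x. x \<in> V \<Longrightarrow> Q x" using PQ(2) unfolding eventually_nhds by blast
  show ?thesis
  proof (rule that[of "U \<inter> ball z r1" "V \<inter> ball w r2"])
    show "U \<inter> ball z r1 \<subseteq> \<HH>" "V \<inter> ball w r2 \<subseteq> \<HH>" using r1 r2 by auto
    fix \<gamma> assume \<gamma>: "\<gamma> \<in> \<Gamma>" "act \<gamma> z \<noteq> w"
    show "act \<gamma> ` (U \<inter> ball z r1) \<inter> (V \<inter> ball w r2) = {}"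
    proof (cases "\<gamma> \<in> S")
      case True
      then show ?thesis using PQ(3) U V by blast
    next
      case False
      then have "act \<gamma> ` K \<inter> K = {}" using \<gamma> by (auto simp: S_def)
      moreover have "ball z r1 \<subseteq> K" "ball w r2 \<subseteq> K" by (auto simp: K_def)
      ultimately show ?thesis by blast
    qed
  qed (use U V r1 r2 in auto)
qed

definition fixed_points :: "complex set" where
  "fixed_points = {z\<in>\<HH>. \<exists>\<gamma>\<in>\<Gamma>. \<gamma> \<noteq> \<one>\<^bsub>PSL2R\<^esub> \<and> act \<gamma> z = z}"

lemma countable_fixed_points: "countable fixed_points"
proof -
  have eq: "fixed_points = (\<Union>\<gamma>\<in>\<Gamma> - {\<one>\<^bsub>PSL2R\<^esub>}. {z\<in>\<HH>. act \<gamma> z = z})"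
    by (auto simp: fixed_points_def)
  have "countable {z\<in>\<HH>. act \<gamma> z = z}" if "\<gamma> \<in> \<Gamma> - {\<one>\<^bsub>PSL2R\<^esub>}" for \<gamma>
  proof (cases "\<exists>z\<in>\<HH>. act \<gamma> z = z")
    case True
    then obtain z where z: "z \<in> \<HH>" "act \<gamma> z = z" by blast
    have "{z\<in>\<HH>. act \<gamma> z = z} \<subseteq> {z}"
      using fixes_two_points_imp_one[OF mem_carrier] that z by blast
    then show ?thesis by (meson countable_empty countable_insert countable_subset)
  next
    case False
    then have "{z\<in>\<HH>. act \<gamma> z = z} = {}" by auto
    then show ?thesis by (metis countable_empty)
  qed
  then show ?thesis unfolding eq using countable by (intro countable_UN) auto
qed

text \<open>Stabilisers of points of one orbit are conjugate.\<close>

lemma fixed_points_act: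
  assumes "\<gamma> \<in> \<Gamma>" "z \<in> \<HH>" "act \<gamma> z \<in> fixed_points" shows "z \<in> fixed_points"
proof -
  obtain \<delta> where \<delta>: "\<delta> \<in> \<Gamma>" "\<delta> \<noteq> \<one>\<^bsub>PSL2R\<^esub>" "act \<delta> (act \<gamma> z) = act \<gamma> z"
    using assms(3) by (auto simp: fixed_points_def)
  interpret group PSL2R by (rule group_PSL2R)
  note c = mem_carrier[OF \<delta>(1)] mem_carrier[OF assms(1)]
  define \<epsilon> where "\<epsilon> = inv\<^bsub>PSL2R\<^esub> \<gamma> \<otimes>\<^bsub>PSL2R\<^esub> (\<delta> \<otimes>\<^bsub>PSL2R\<^esub> \<gamma>)"
  have "\<epsilon> \<in> \<Gamma>" using assms \<delta> by (simp add: \<epsilon>_def mult_mem inv_mem)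
  moreover have "act \<epsilon> z = z"
    using c assms \<delta> by (simp add: \<epsilon>_def act_mult act_closed act_inv_act)
  moreover have "\<epsilon> \<noteq> \<one>\<^bsub>PSL2R\<^esub>"
  proof
    assume "\<epsilon> = \<one>\<^bsub>PSL2R\<^esub>"
    then have "\<delta> \<otimes>\<^bsub>PSL2R\<^esub> \<gamma> = \<gamma>" using c by (metis \<epsilon>_def inv_solve_left' m_closed r_one one_closed)
    then show False using \<delta>(2) c by (metis l_one one_closed right_cancel)
  qed
  ultimately show ?thesis using assms(2) by (auto simp: fixed_points_def)
qed

text \<open>Around each point that is not fixed there is an open set disjoint from its
  translates. Countably many of these cover the complement of the fixed points; taking from each
  the points whose orbits miss the earlier ones selects one point from every orbit without fixed
  points. The fixed points are added as they are: they have area zero, but the translates of a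
  fundamental domain have to cover the half-plane.\<close>

lemma strict_fundamental_set:
  obtains F where "F \<in> sets borel" "F \<subseteq> \<HH>" "fixed_points \<subseteq> F"
    "\<And>z. z \<in> \<HH> - fixed_points \<Longrightarrow> \<exists>!\<gamma>. \<gamma> \<in> \<Gamma> \<and> act \<gamma> z \<in> F"
proof -
  interpret G: group PSL2R by (rule group_PSL2R)
  define \<U> where "\<U> = {U. open U \<and> U \<subseteq> \<HH> \<and> (\<forall>\<gamma>\<in>\<Gamma>. \<gamma> \<noteq> \<one>\<^bsub>PSL2R\<^esub> \<longrightarrow> act \<gamma> ` U \<inter> U = {})}"
  have cover: "\<HH> - fixed_points \<subseteq> \<Union>\<U>"
  proof
    fix z assume z: "z \<in> \<HH> - fixed_points"
    then obtain U V where UV: "open U" "open V" "z \<in> U" "z \<in> V" "U \<subseteq> \<HH>" "V \<subseteq> \<HH>"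
      "\<And>\<gamma>. \<gamma> \<in> \<Gamma> \<Longrightarrow> act \<gamma> z \<noteq> z \<Longrightarrow> act \<gamma> ` U \<inter> V = {}"
      using separating_neighbourhoods[of z z] by auto
    have "U \<inter> V \<in> \<U>" using UV z unfolding \<U>_def fixed_points_def by blast
    then show "z \<in> \<Union>\<U>" using UV by blast
  qed
  have "open V" if "V \<in> \<U>" for V using that by (simp add: \<U>_def)
  then obtain \<V> where \<V>: "\<V> \<subseteq> \<U>" "countable \<V>" "\<Union>\<V> = \<Union>\<U>"
    by (rule Lindelof)
  define U where "U = from_nat_into (insert {} \<V>)"
  have rangeU: "range U = insert {} \<V>" using \<V>(2) by (simp add: U_def range_from_nat_into)
  have U\<U>: "U n \<in> \<U>" for n
  proof -
    have "U n \<in> insert {} \<V>" using rangeU by (metis rangeI)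
    moreover have "{} \<in> \<U>" by (simp add: \<U>_def)
    ultimately show ?thesis using \<V>(1) by (metis insertE subsetD)
  qed
  have coverU: "\<exists>n. z \<in> U n" if "z \<in> \<HH> - fixed_points" for z
    using cover that \<V>(3) rangeU by (metis UnionE insertCI rangeE subsetD)
  define T where "T n = {z\<in>\<HH>. \<exists>\<gamma>\<in>\<Gamma>. act \<gamma> z \<in> U n}" for n
  have T_act: "act \<gamma> z \<in> T n \<longleftrightarrow> z \<in> T n" if "\<gamma> \<in> \<Gamma>" "z \<in> \<HH>" for \<gamma> z n
  proof
    assume "act \<gamma> z \<in> T n"
    then obtain \<delta> where "\<delta> \<in> \<Gamma>" "act \<delta> (act \<gamma> z) \<in> U n" by (auto simp: T_def)
    then have "\<delta> \<otimes>\<^bsub>PSL2R\<^esub> \<gamma> \<in> \<Gamma>" "act (\<delta> \<otimes>\<^bsub>PSL2R\<^esub> \<gamma>) z \<in> U n"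
      using that by (simp_all add: act_mult mem_carrier mult_mem)
    then show "z \<in> T n" using that unfolding T_def by blast
  next
    assume "z \<in> T n"
    then obtain \<delta> where "\<delta> \<in> \<Gamma>" "act \<delta> z \<in> U n" by (auto simp: T_def)
    then have "\<delta> \<otimes>\<^bsub>PSL2R\<^esub> inv\<^bsub>PSL2R\<^esub> \<gamma> \<in> \<Gamma>" "act (\<delta> \<otimes>\<^bsub>PSL2R\<^esub> inv\<^bsub>PSL2R\<^esub> \<gamma>) (act \<gamma> z) \<in> U n"
      using that by (simp_all add: act_closed mem_carrier act_mult mult_mem inv_mem act_inv_act)
    then show "act \<gamma> z \<in> T n" using that act_closed[OF mem_carrier] unfolding T_def by blast
  qed
  have Tm: "T n \<in> sets borel" for n
  proof -
    have eq: "T n = (\<Union>\<gamma>\<in>\<Gamma>. act \<gamma> -` U n \<inter> \<HH>)" by (auto simp: T_def)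
    have "act \<gamma> -` U n \<inter> \<HH> \<in> sets borel" if "\<gamma> \<in> \<Gamma>" for \<gamma>
    proof -
      have "open (U n)" using U\<U>[of n] by (simp add: \<U>_def)
      then have "open (act \<gamma> -` U n \<inter> \<HH>)"
        using act_continuous[OF mem_carrier[OF that]] continuous_on_open_vimage[OF open_upper_half_plane] by blast
      then show ?thesis by auto
    qed
    then show ?thesis unfolding eq using countable by (intro sets.countable_UN') auto
  qed
  define P where "P n = U n - fixed_points - (\<Union>m<n. T m)" for n
  define F where "F = fixed_points \<union> (\<Union>n. P n)"
  show ?thesis
  proof (rule that[of F])
    have fpm: "fixed_points \<in> sets borel" using countable_fixed_points by (rule sets.countable[rotated]) auto
    have "U n \<in> sets borel" for n using U\<U>[of n] by (auto simp: \<U>_def)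
    then show "F \<in> sets borel" unfolding F_def P_def using fpm Tm by (auto intro!: sets.Un sets.Diff sets.countable_UN)
    show "F \<subseteq> \<HH>" using U\<U> by (auto simp: F_def P_def \<U>_def fixed_points_def)
    show "fixed_points \<subseteq> F" by (auto simp: F_def)
    fix z assume z: "z \<in> \<HH> - fixed_points"
    have nofix: "act \<gamma> z \<notin> fixed_points" if "\<gamma> \<in> \<Gamma>" for \<gamma>
      using fixed_points_act that z by blast
    have "\<exists>n. z \<in> T n"
    proof -
      obtain n where "z \<in> U n" using coverU z by blast
      then have "z \<in> T n" using z one_mem act_one by (auto simp: T_def intro!: bexI[of _ "\<one>\<^bsub>PSL2R\<^esub>"])
      then show ?thesis ..
    qed
    define n where "n = (LEAST n. z \<in> T n)"
    have n: "z \<in> T n" "\<And>m. m < n \<Longrightarrow> z \<notin> T m"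
      using LeastI_ex[OF \<open>\<exists>n. z \<in> T n\<close>] not_less_Least unfolding n_def by blast+
    have P_iff: "act \<gamma> z \<in> P m \<longleftrightarrow> m = n \<and> act \<gamma> z \<in> U n" if \<gamma>: "\<gamma> \<in> \<Gamma>" for \<gamma> m
    proof
      assume a: "act \<gamma> z \<in> P m"
      then have "z \<in> T m" using z \<gamma> by (auto simp: P_def T_def)
      then have "\<not> m < n" using n by blast
      moreover have "\<not> n < m" using a n(1) T_act[OF \<gamma>] z by (auto simp: P_def)
      ultimately have "m = n" by simp
      then show "m = n \<and> act \<gamma> z \<in> U n" using a by (auto simp: P_def)
    next
      assume "m = n \<and> act \<gamma> z \<in> U n"
      then show "act \<gamma> z \<in> P m" using nofix[OF \<gamma>] T_act[OF \<gamma>] z n(2) by (auto simp: P_def)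
    qed
    have F_iff: "act \<gamma> z \<in> F \<longleftrightarrow> act \<gamma> z \<in> U n" if "\<gamma> \<in> \<Gamma>" for \<gamma>
      using P_iff[OF that] nofix[OF that] by (auto simp: F_def)
    show "\<exists>!\<gamma>. \<gamma> \<in> \<Gamma> \<and> act \<gamma> z \<in> F"
    proof (rule ex_ex1I)
      show "\<exists>\<gamma>. \<gamma> \<in> \<Gamma> \<and> act \<gamma> z \<in> F" using n(1) F_iff by (auto simp: T_def)
    next
      fix \<gamma> \<delta> assume a: "\<gamma> \<in> \<Gamma> \<and> act \<gamma> z \<in> F" "\<delta> \<in> \<Gamma> \<and> act \<delta> z \<in> F"
      define \<epsilon> where "\<epsilon> = \<delta> \<otimes>\<^bsub>PSL2R\<^esub> inv\<^bsub>PSL2R\<^esub> \<gamma>"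
      have e: "\<epsilon> \<in> \<Gamma>" using a by (simp add: \<epsilon>_def mult_mem inv_mem)
      have "act \<epsilon> (act \<gamma> z) = act \<delta> z"
        using a z by (simp add: \<epsilon>_def act_mult mem_carrier act_closed act_inv_act)
      then have "act \<epsilon> ` U n \<inter> U n \<noteq> {}" using a F_iff by (metis disjoint_iff imageI)
      then have "\<epsilon> = \<one>\<^bsub>PSL2R\<^esub>" using U\<U>[of n] e by (auto simp: \<U>_def)
      then show "\<gamma> = \<delta>" using a mem_carrier
        by (metis G.inv_closed G.inv_equality G.inv_inv \<epsilon>_def)
    qed
  qed
qed

end

section \<open>Fundamental domains and unfolding\<close>

lemma sum_indicator_unique:
  assumes "\<exists>!x. x \<in> A \<and> f x \<in> B"
  shows "(\<integral>\<^sup>+x. indicator B (f x) \<partial>count_space A) = (1 :: ennreal)"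
proof -
  obtain a where a: "a \<in> A" "f a \<in> B" and uniq: "\<And>x. x \<in> A \<Longrightarrow> f x \<in> B \<Longrightarrow> x = a"
    using assms by (elim ex1E) metis
  have "(\<integral>\<^sup>+x. indicator B (f x) \<partial>count_space A) = (\<integral>\<^sup>+x. indicator {a} x \<partial>count_space A :: ennreal)"
  proof (rule nn_integral_cong)
    fix x assume "x \<in> space (count_space A)"
    then show "indicator B (f x) = (indicator {a} x :: ennreal)" using a uniq[of x] by (cases "f x \<in> B") (auto simp: indicator_def)
  qed
  also have "\<dots> = 1" by (subst nn_integral_indicator) (simp_all add: a)
  finally show ?thesis .
qed

lemma hyp_area_countable_null:
  assumes "countable A" shows "A \<in> null_sets hyp_area"
proof -
  have A: "A \<in> sets borel" using assms by (rule sets.countable[rotated]) auto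
  have "A \<in> null_sets lborel" using countable_imp_null_set_lborel[OF assms] .
  then have "AE z in lborel. z \<notin> A" by (simp add: AE_not_in)
  then have "AE z in hyp_area. z \<notin> A" using A by (subst AE_hyp_area_iff) auto
  then show ?thesis using A by (simp add: AE_iff_null_sets)
qed

context discontinuous_group
begin

lemma fundamental_domain_borel: "fundamental_domain \<Gamma> F \<Longrightarrow> F \<in> sets borel"
  by (simp add: fundamental_domain_def)

lemma strict_fundamental_domain:
  assumes F: "F \<in> sets borel" "F \<subseteq> \<HH>" "fixed_points \<subseteq> F"
    and ex1: "\<And>z. z \<in> \<HH> - fixed_points \<Longrightarrow> \<exists>!\<gamma>. \<gamma> \<in> \<Gamma> \<and> act \<gamma> z \<in> F"
  shows "fundamental_domain \<Gamma> F"
  unfolding fundamental_domain_def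
proof (intro conjI F ballI impI)
  interpret G: group PSL2R by (rule group_PSL2R)
  show "(\<Union>\<gamma>\<in>\<Gamma>. act \<gamma> ` F) = \<HH>"
  proof (intro equalityI subsetI)
    fix z assume "z \<in> (\<Union>\<gamma>\<in>\<Gamma>. act \<gamma> ` F)"
    then show "z \<in> \<HH>" using F(2) act_closed[OF mem_carrier] by auto
  next
    fix z assume z: "z \<in> \<HH>"
    show "z \<in> (\<Union>\<gamma>\<in>\<Gamma>. act \<gamma> ` F)"
    proof (cases "z \<in> fixed_points")
      case True
      then have "act \<one>\<^bsub>PSL2R\<^esub> z = z" "z \<in> F" using F z act_one by auto
      then show ?thesis using one_mem by (metis UN_I imageI)
    next
      case False
      then obtain \<gamma> where \<gamma>: "\<gamma> \<in> \<Gamma>" "act \<gamma> z \<in> F" using ex1 z by blast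
      then have "z = act (inv\<^bsub>PSL2R\<^esub> \<gamma>) (act \<gamma> z)" using act_inv_act mem_carrier z by simp
      then show ?thesis using \<gamma> inv_mem by blast
    qed
  qed
  fix \<gamma> assume \<gamma>: "\<gamma> \<in> \<Gamma>" "\<gamma> \<noteq> \<one>\<^bsub>PSL2R\<^esub>"
  have "F \<inter> act \<gamma> ` F \<subseteq> fixed_points"
  proof
    fix z assume z: "z \<in> F \<inter> act \<gamma> ` F"
    then obtain w where w: "w \<in> F" "z = act \<gamma> w" by blast
    have wH: "w \<in> \<HH>" using w F by auto
    show "z \<in> fixed_points"
    proof (rule ccontr)
      assume "z \<notin> fixed_points"
      then have "z \<in> \<HH> - fixed_points" using z F(2) by auto
      then have "\<exists>!\<gamma>. \<gamma> \<in> \<Gamma> \<and> act \<gamma> z \<in> F" by (rule ex1)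
      moreover have "act \<one>\<^bsub>PSL2R\<^esub> z \<in> F" using z F act_one by auto
      moreover have "act (inv\<^bsub>PSL2R\<^esub> \<gamma>) z \<in> F" using w wH \<gamma> act_inv_act mem_carrier by simp
      ultimately have "inv\<^bsub>PSL2R\<^esub> \<gamma> = \<one>\<^bsub>PSL2R\<^esub>"
        using one_mem inv_mem[OF \<gamma>(1)] by (elim ex1E) metis
      then have "\<gamma> = inv\<^bsub>PSL2R\<^esub> \<one>\<^bsub>PSL2R\<^esub>" using G.inv_inv[OF mem_carrier[OF \<gamma>(1)]] by simp
      then show False using \<gamma> by simp
    qed
  qed
  then have "F \<inter> act \<gamma> ` F \<in> null_sets hyp_area"
    by (intro hyp_area_countable_null countable_subset[OF _ countable_fixed_points])
  then show "emeasure hyp_area (F \<inter> act \<gamma> ` F) = 0" by auto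
qed

lemma AE_act:
  assumes \<gamma>: "\<gamma> \<in> \<Gamma>" and P: "AE z in hyp_area. P z" and m: "Measurable.pred borel P"
  shows "AE z in hyp_area. P (act \<gamma> z)"
proof -
  note [measurable] = m measurable_act[OF mem_carrier[OF \<gamma>]]
  have "(\<integral>\<^sup>+z. indicator {z. \<not> P z} (act \<gamma> z) \<partial>hyp_area) = (\<integral>\<^sup>+z. indicator {z. \<not> P z} z \<partial>hyp_area)"
    by (rule nn_integral_act[OF mem_carrier[OF \<gamma>]]) measurable
  also have "\<dots> = 0" using P by (subst nn_integral_0_iff_AE) auto
  finally have "AE z in hyp_area. indicator {z. \<not> P z} (act \<gamma> z) = (0::ennreal)"
    by (subst (asm) nn_integral_0_iff_AE) measurable
  then show ?thesis by eventually_elim (auto simp: indicator_def split: if_splits)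
qed

lemma act_image_borel:
  assumes "\<gamma> \<in> \<Gamma>" "F \<in> sets borel" "F \<subseteq> \<HH>"
  shows "act \<gamma> ` F \<in> sets borel"
  by (rule open_holomorphic_image_borel[OF act_holomorphic[OF mem_carrier[OF assms(1)]]
        open_upper_half_plane inj_on_act[OF mem_carrier[OF assms(1)]] assms(2,3)])

text \<open>If two translates of \<open>z\<close> lie in \<open>F\<close>, then a translate of
  \<open>z\<close> lies in an overlap \<open>F \<inter> act \<gamma> ` F\<close>; there are
  countably many of these, and each has area zero.\<close>

lemma fundamental_domain_AE_unique:
  assumes F: "fundamental_domain \<Gamma> F"
  shows "AE z in hyp_area. z \<in> \<HH> \<and> (\<exists>!\<gamma>. \<gamma> \<in> \<Gamma> \<and> act \<gamma> z \<in> F)"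
proof -
  interpret G: group PSL2R by (rule group_PSL2R)
  have Fb: "F \<in> sets borel" "F \<subseteq> \<HH>" and cov: "(\<Union>\<gamma>\<in>\<Gamma>. act \<gamma> ` F) = \<HH>"
    and null: "\<And>\<gamma>. \<gamma> \<in> \<Gamma> \<Longrightarrow> \<gamma> \<noteq> \<one>\<^bsub>PSL2R\<^esub> \<Longrightarrow> emeasure hyp_area (F \<inter> act \<gamma> ` F) = 0"
    using F by (auto simp: fundamental_domain_def)
  have "AE z in hyp_area. act \<delta> z \<notin> F \<inter> act \<gamma> ` F" if "\<gamma> \<in> \<Gamma>" "\<gamma> \<noteq> \<one>\<^bsub>PSL2R\<^esub>" "\<delta> \<in> \<Gamma>" for \<gamma> \<delta>
  proof (rule AE_act[OF that(3)])
    have [measurable]: "F \<inter> act \<gamma> ` F \<in> sets borel" using act_image_borel that Fb by blast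
    then have "F \<inter> act \<gamma> ` F \<in> null_sets hyp_area" using null that by (simp add: null_sets_def)
    then show "AE z in hyp_area. z \<notin> F \<inter> act \<gamma> ` F" by (rule AE_not_in)
    show "Measurable.pred borel (\<lambda>z. z \<notin> F \<inter> act \<gamma> ` F)" by measurable
  qed
  then have "AE z in hyp_area. \<forall>\<gamma>\<in>\<Gamma>. \<forall>\<delta>\<in>\<Gamma>. \<gamma> \<noteq> \<one>\<^bsub>PSL2R\<^esub> \<longrightarrow> act \<delta> z \<notin> F \<inter> act \<gamma> ` F"
    using countable by (simp add: AE_ball_countable)
  then show ?thesis using AE_upper_half_plane
  proof eventually_elim
    case (elim z)
    have "\<exists>\<gamma>. \<gamma> \<in> \<Gamma> \<and> act \<gamma> z \<in> F"
    proof -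
      obtain \<gamma> w where "\<gamma> \<in> \<Gamma>" "w \<in> F" "z = act \<gamma> w" using cov elim(2) by blast
      then have "act (inv\<^bsub>PSL2R\<^esub> \<gamma>) z \<in> F" using act_inv_act mem_carrier Fb by auto
      then show ?thesis using inv_mem \<open>\<gamma> \<in> \<Gamma>\<close> by blast
    qed
    moreover have "\<gamma> = \<delta>" if a: "\<gamma> \<in> \<Gamma> \<and> act \<gamma> z \<in> F" "\<delta> \<in> \<Gamma> \<and> act \<delta> z \<in> F" for \<gamma> \<delta>
    proof -
      define \<epsilon> where "\<epsilon> = \<delta> \<otimes>\<^bsub>PSL2R\<^esub> inv\<^bsub>PSL2R\<^esub> \<gamma>"
      have e: "\<epsilon> \<in> \<Gamma>" using a by (simp add: \<epsilon>_def mult_mem inv_mem)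
      have "act \<epsilon> (act \<gamma> z) = act \<delta> z"
        using a elim by (simp add: \<epsilon>_def act_mult mem_carrier act_closed act_inv_act)
      then have "act \<delta> z \<in> F \<inter> act \<epsilon> ` F" using a by (metis IntI imageI)
      then have "\<epsilon> = \<one>\<^bsub>PSL2R\<^esub>" using elim e a by blast
      then show "\<gamma> = \<delta>" using a mem_carrier
        by (metis G.inv_closed G.inv_equality G.inv_inv \<epsilon>_def)
    qed
    ultimately show ?case using elim(2) by blast
  qed
qed

lemma AE_sum_indicator:
  assumes F: "fundamental_domain \<Gamma> F"
  shows "AE z in hyp_area. z \<in> \<HH> \<and> (\<integral>\<^sup>+\<gamma>. indicator F (act \<gamma> z) \<partial>count_space \<Gamma>) = 1"
  using fundamental_domain_AE_unique[OF F]
proof eventually_elim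
  case (elim z)
  show ?case by (rule conjI[OF conjunct1[OF elim] sum_indicator_unique[OF conjunct2[OF elim]]])
qed

lemma measurable_count_integral:
  assumes "\<And>\<gamma>. \<gamma> \<in> \<Gamma> \<Longrightarrow> f \<gamma> \<in> borel_measurable M"
  shows "(\<lambda>z. \<integral>\<^sup>+\<gamma>. f \<gamma> z \<partial>count_space \<Gamma>) \<in> borel_measurable M"
proof -
  interpret sigma_finite_measure "count_space \<Gamma>"
    by (rule sigma_finite_measure_count_space_countable[OF countable])
  have "(\<lambda>(\<gamma>, z). f \<gamma> z) \<in> borel_measurable (count_space \<Gamma> \<Otimes>\<^sub>M M)"
    by (rule measurable_pair_measure_countable1[OF countable]) (use assms in simp)
  from measurable_compose[OF measurable_pair_swap' this]
  have "(\<lambda>(z, \<gamma>). f \<gamma> z) \<in> borel_measurable (M \<Otimes>\<^sub>M count_space \<Gamma>)" by (simp add: case_prod_beta')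
  from borel_measurable_nn_integral_fst[OF this] show ?thesis by simp
qed

lemma sum_over_inverses:
  "(\<integral>\<^sup>+\<gamma>. f (inv\<^bsub>PSL2R\<^esub> \<gamma>) \<partial>count_space \<Gamma>) = (\<integral>\<^sup>+\<gamma>. f \<gamma> \<partial>count_space \<Gamma>)"
  by (rule nn_integral_bij_count_space[OF bij_betw_inv])

lemma sum_over_translates:
  "\<delta> \<in> \<Gamma> \<Longrightarrow> (\<integral>\<^sup>+\<gamma>. f (\<gamma> \<otimes>\<^bsub>PSL2R\<^esub> \<delta>) \<partial>count_space \<Gamma>) = (\<integral>\<^sup>+\<gamma>. f \<gamma> \<partial>count_space \<Gamma>)"
  by (rule nn_integral_bij_count_space[OF bij_betw_mult_right])

text \<open>The translates of \<open>F\<close> tile the half-plane up to a null set, so an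
  integral over the half-plane is the integral over \<open>F\<close> of the sum over the
  orbit.\<close>

lemma unfolding_integral:
  assumes F: "fundamental_domain \<Gamma> F" and g [measurable]: "g \<in> borel_measurable borel"
  shows "(\<integral>\<^sup>+z. g z \<partial>hyp_area) =
    (\<integral>\<^sup>+z. indicator F z * (\<integral>\<^sup>+\<gamma>. g (act \<gamma> z) \<partial>count_space \<Gamma>) \<partial>hyp_area)"
proof -
  have [measurable]: "F \<in> sets borel" using F by (rule fundamental_domain_borel)
  note [measurable] = measurable_act[OF mem_carrier]
  have "(\<integral>\<^sup>+z. indicator F z * (\<integral>\<^sup>+\<gamma>. g (act \<gamma> z) \<partial>count_space \<Gamma>) \<partial>hyp_area)
      = (\<integral>\<^sup>+z. (\<integral>\<^sup>+\<gamma>. indicator F z * g (act \<gamma> z) \<partial>count_space \<Gamma>) \<partial>hyp_area)"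
    by (intro nn_integral_cong) (simp add: nn_integral_cmult)
  also have "\<dots> = (\<integral>\<^sup>+\<gamma>. (\<integral>\<^sup>+z. indicator F z * g (act \<gamma> z) \<partial>hyp_area) \<partial>count_space \<Gamma>)"
    by (rule nn_integral_count_space_nn_integral[OF countable]) measurable
  also have "\<dots> = (\<integral>\<^sup>+\<gamma>. (\<integral>\<^sup>+z. indicator F (act (inv\<^bsub>PSL2R\<^esub> \<gamma>) z) * g z \<partial>hyp_area) \<partial>count_space \<Gamma>)"
  proof (rule nn_integral_cong)
    fix \<gamma> assume "\<gamma> \<in> space (count_space \<Gamma>)"
    then have \<gamma>: "\<gamma> \<in> \<Gamma>" by simp
    note [measurable] = measurable_act[OF mem_carrier[OF inv_mem[OF \<gamma>]]]
    have "(\<integral>\<^sup>+z. indicator F z * g (act \<gamma> z) \<partial>hyp_area)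
        = (\<integral>\<^sup>+z. indicator F (act (inv\<^bsub>PSL2R\<^esub> \<gamma>) (act \<gamma> z)) * g (act \<gamma> z) \<partial>hyp_area)"
      by (intro nn_integral_hyp_cong) (simp add: act_inv_act mem_carrier \<gamma>)
    also have "\<dots> = (\<integral>\<^sup>+z. indicator F (act (inv\<^bsub>PSL2R\<^esub> \<gamma>) z) * g z \<partial>hyp_area)"
      by (rule nn_integral_act[OF mem_carrier[OF \<gamma>]]) measurable
    finally show "(\<integral>\<^sup>+z. indicator F z * g (act \<gamma> z) \<partial>hyp_area)
        = (\<integral>\<^sup>+z. indicator F (act (inv\<^bsub>PSL2R\<^esub> \<gamma>) z) * g z \<partial>hyp_area)" .
  qed
  also have "\<dots> = (\<integral>\<^sup>+\<gamma>. (\<integral>\<^sup>+z. indicator F (act \<gamma> z) * g z \<partial>hyp_area) \<partial>count_space \<Gamma>)"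
    by (rule sum_over_inverses)
  also have "\<dots> = (\<integral>\<^sup>+z. (\<integral>\<^sup>+\<gamma>. indicator F (act \<gamma> z) * g z \<partial>count_space \<Gamma>) \<partial>hyp_area)"
    by (rule nn_integral_count_space_nn_integral[OF countable, symmetric]) measurable
  also have "\<dots> = (\<integral>\<^sup>+z. g z \<partial>hyp_area)"
    by (rule nn_integral_cong_AE, use AE_sum_indicator[OF F] in eventually_elim)
      (simp add: nn_integral_multc)
  finally show ?thesis by simp
qed

definition invariant :: "(complex \<Rightarrow> 'b) \<Rightarrow> bool" where
  "invariant f \<longleftrightarrow> (\<forall>\<gamma>\<in>\<Gamma>. \<forall>z\<in>\<HH>. f (act \<gamma> z) = f z)"

lemma invariantD: "invariant f \<Longrightarrow> \<gamma> \<in> \<Gamma> \<Longrightarrow> z \<in> \<HH> \<Longrightarrow> f (act \<gamma> z) = f z"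
  by (simp add: invariant_def)

text \<open>Unfolding the function \<open>f\<close> times the indicator function of
  \<open>F'\<close> over \<open>F\<close> gives back \<open>f\<close>, because almost every
  orbit meets \<open>F'\<close> exactly once.\<close>

lemma integral_fundamental_domain_unique:
  assumes F: "fundamental_domain \<Gamma> F" and F': "fundamental_domain \<Gamma> F'"
    and f [measurable]: "f \<in> borel_measurable borel" and inv: "invariant f"
  shows "(\<integral>\<^sup>+z. indicator F' z * f z \<partial>hyp_area) = (\<integral>\<^sup>+z. indicator F z * f z \<partial>hyp_area)"
proof -
  have [measurable]: "F \<in> sets borel" "F' \<in> sets borel"
    using F F' fundamental_domain_borel by blast+
  have "(\<integral>\<^sup>+z. indicator F' z * f z \<partial>hyp_area)
     = (\<integral>\<^sup>+z. indicator F z * (\<integral>\<^sup>+\<gamma>. indicator F' (act \<gamma> z) * f (act \<gamma> z) \<partial>count_space \<Gamma>) \<partial>hyp_area)"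
    by (rule unfolding_integral[OF F]) measurable
  also have "\<dots> = (\<integral>\<^sup>+z. indicator F z * f z \<partial>hyp_area)"
  proof (rule nn_integral_cong_AE, use AE_sum_indicator[OF F'] in eventually_elim)
    case (elim z)
    have "(\<integral>\<^sup>+\<gamma>. indicator F' (act \<gamma> z) * f (act \<gamma> z) \<partial>count_space \<Gamma>)
        = (\<integral>\<^sup>+\<gamma>. indicator F' (act \<gamma> z) * f z \<partial>count_space \<Gamma>)"
      using elim inv by (intro nn_integral_cong) (auto simp: invariantD)
    also have "\<dots> = f z" using elim by (simp add: nn_integral_multc)
    finally show ?case by simp
  qed
  finally show ?thesis .
qed

lemma covolume_eq:
  assumes F: "fundamental_domain \<Gamma> F"
  shows "covolume \<Gamma> = emeasure hyp_area F"
  unfolding covolume_def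
proof (rule the_equality)
  fix v assume "\<exists>F. fundamental_domain \<Gamma> F \<and> emeasure hyp_area F = v"
  then obtain F' where F': "fundamental_domain \<Gamma> F'" "emeasure hyp_area F' = v" by blast
  have "invariant (\<lambda>_. 1 :: ennreal)" by (simp add: invariant_def)
  from integral_fundamental_domain_unique[OF F F'(1) _ this]
  show "v = emeasure hyp_area F" using F F' by (simp add: fundamental_domain_borel)
qed (use F in blast)

text \<open>Countably many translates of a null subset of \<open>F\<close> still have area
  zero.\<close>

lemma AE_invariant:
  assumes F: "fundamental_domain \<Gamma> F" and [measurable]: "Measurable.pred borel P"
    and inv: "invariant P" and ae: "AE z in hyp_area. z \<in> F \<longrightarrow> P z"
  shows "AE z in hyp_area. P z"
proof -
  have [measurable]: "F \<in> sets borel" using F by (rule fundamental_domain_borel)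
  have "(\<integral>\<^sup>+z. indicator {z. \<not> P z} z \<partial>hyp_area) =
    (\<integral>\<^sup>+z. indicator F z * (\<integral>\<^sup>+\<gamma>. indicator {z. \<not> P z} (act \<gamma> z) \<partial>count_space \<Gamma>) \<partial>hyp_area)"
    by (rule unfolding_integral[OF F]) measurable
  also have "\<dots> = (\<integral>\<^sup>+z. 0 \<partial>hyp_area)"
  proof (rule nn_integral_cong_AE, use ae AE_upper_half_plane in eventually_elim)
    case (elim z)
    have "indicator {z. \<not> P z} (act \<gamma> z) = (0::ennreal)" if "\<gamma> \<in> \<Gamma>" "z \<in> F" for \<gamma>
      using elim that invariantD[OF inv that(1)] by auto
    then show ?case by (cases "z \<in> F") (simp_all cong: nn_integral_cong_simp)
  qed
  finally have "(\<integral>\<^sup>+z. indicator {z. \<not> P z} z \<partial>hyp_area) = 0" by simp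
  then have "AE z in hyp_area. indicator {z. \<not> P z} z = (0::ennreal)"
    by (subst (asm) nn_integral_0_iff_AE) auto
  then show ?thesis by eventually_elim (auto simp: indicator_def split: if_splits)
qed

end

section \<open>Subgroups of finite index\<close>

text \<open>A fundamental domain of the subgroup is tiled, up to moving pieces around, by one
  copy of \<open>F\<close> for each coset. Both the area and the integral of the Jacobian are
  instances, with the same factor \<open>n\<close>. In the proof \<open>f\<close> is cut into
  one piece for each coset \<open>C\<close>, each of which unfolds over \<open>F'\<close> to the
  integral of \<open>f\<close> over a translate of \<open>F\<close>.\<close>

lemma finite_index_integral:
  assumes D: "discontinuous_group \<Gamma>" and sub: "finite_index_subgroup \<Gamma>' \<Gamma>"
  shows "discontinuous_group \<Gamma>'"
    "\<exists>n::nat. n > 0 \<and> (\<forall>F F' f. fundamental_domain \<Gamma> F \<longrightarrow> fundamental_domain \<Gamma>' F' \<longrightarrow>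
      f \<in> borel_measurable borel \<longrightarrow> discontinuous_group.invariant \<Gamma> f \<longrightarrow>
      (\<integral>\<^sup>+z. indicator F' z * f z \<partial>hyp_area) = of_nat n * (\<integral>\<^sup>+z. indicator F z * f z \<partial>hyp_area))"
proof -
  interpret D: discontinuous_group \<Gamma> by (rule D)
  interpret G: group PSL2R by (rule group_PSL2R)
  define R where "R = rcosets\<^bsub>PSL2R\<lparr>carrier := \<Gamma>\<rparr>\<^esub> \<Gamma>'"
  have sg: "subgroup \<Gamma>' (PSL2R\<lparr>carrier := \<Gamma>\<rparr>)" and finR: "finite R"
    using sub by (auto simp: finite_index_subgroup_def R_def)
  have grp: "group (PSL2R\<lparr>carrier := \<Gamma>\<rparr>)" by (rule G.subgroup_imp_group[OF D.subgroup])
  have sub\<Gamma>: "\<Gamma>' \<subseteq> \<Gamma>" using subgroup.subset[OF sg] by simp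
  have sgG: "subgroup \<Gamma>' PSL2R" by (rule G.incl_subgroup[OF D.subgroup sg])
  show D': "discontinuous_group \<Gamma>'"
  proof (rule discontinuous_group.intro)
    show "subgroup \<Gamma>' PSL2R" by (rule sgG)
    show "acts_discretely \<Gamma>'" unfolding acts_discretely_def
    proof (intro allI impI)
      fix K assume "compact K \<and> K \<subseteq> \<HH>"
      then have "finite {\<gamma>\<in>\<Gamma>. act \<gamma> ` K \<inter> K \<noteq> {}}" using D.discontinuous unfolding acts_discretely_def by blast
      then show "finite {\<gamma>\<in>\<Gamma>'. act \<gamma> ` K \<inter> K \<noteq> {}}"
        by (rule finite_subset[rotated]) (use sub\<Gamma> in auto)
    qed
  qed
  interpret D': discontinuous_group \<Gamma>' by (rule D')
  have Rne: "R \<noteq> {}" using group.rcosets_part_G[OF grp sg] D.one_mem by (auto simp: R_def)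
  have rep: "\<exists>c\<in>\<Gamma>. C = (\<lambda>\<gamma>. \<gamma> \<otimes>\<^bsub>PSL2R\<^esub> c) ` \<Gamma>'" if "C \<in> R" for C
    using that by (auto simp: R_def RCOSETS_def r_coset_def)
  have part: "\<Union>R = \<Gamma>" using group.rcosets_part_G[OF grp sg] by (simp add: R_def)
  have disj: "disjoint R" unfolding R_def disjoint_def
    using group.rcos_disjoint[OF grp sg] by (auto simp: pairwise_def disjnt_def)
  have split_sum: "(\<integral>\<^sup>+\<gamma>. k \<gamma> \<partial>count_space \<Gamma>) = (\<Sum>C\<in>R. \<integral>\<^sup>+\<gamma>. k \<gamma> \<partial>count_space C)" for k :: "psl2r \<Rightarrow> ennreal"
  proof -
    have "k \<gamma> * indicator \<Gamma> \<gamma> = (\<Sum>C\<in>R. k \<gamma> * indicator C \<gamma>)" for \<gamma>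
    proof (cases "\<gamma> \<in> \<Gamma>")
      case True
      then obtain C where C: "C \<in> R" "\<gamma> \<in> C" using part by blast
      have "(\<Sum>C'\<in>R. k \<gamma> * indicator C' \<gamma>) = (\<Sum>C'\<in>R. if C' = C then k \<gamma> else 0)"
        using C disj by (intro sum.cong) (auto simp: disjoint_def indicator_def)
      then show ?thesis using True C finR by simp
    next
      case False
      then have "\<And>C. C \<in> R \<Longrightarrow> \<gamma> \<notin> C" using part by blast
      then show ?thesis using False by simp
    qed
    then show ?thesis by (simp add: nn_integral_count_space_indicator nn_integral_sum)
  qed
  have main: "(\<integral>\<^sup>+z. indicator F' z * f z \<partial>hyp_area) = of_nat (card R) * (\<integral>\<^sup>+z. indicator F z * f z \<partial>hyp_area)"
    if F: "fundamental_domain \<Gamma> F" and F': "fundamental_domain \<Gamma>' F'"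
      and f [measurable]: "f \<in> borel_measurable borel" and inv: "D.invariant f" for F F' f
  proof -
    have [measurable]: "F \<in> sets borel" "F' \<in> sets borel"
      using F F' by (auto simp: fundamental_domain_def)
    obtain c where c: "\<And>C. C \<in> R \<Longrightarrow> c C \<in> \<Gamma>" "\<And>C. C \<in> R \<Longrightarrow> C = (\<lambda>\<gamma>. \<gamma> \<otimes>\<^bsub>PSL2R\<^esub> c C) ` \<Gamma>'"
      using rep by metis
    define ci where "ci C = inv\<^bsub>PSL2R\<^esub> (c C)" for C
    have ci: "ci C \<in> \<Gamma>" if "C \<in> R" for C using c(1)[OF that] D.inv_mem by (simp add: ci_def)
    note [measurable] = measurable_act[OF D.mem_carrier] measurable_act[OF D'.mem_carrier]
    define G where "G C z = f z * indicator F (act (ci C) z)" for C z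
    have Gm [measurable]: "G C \<in> borel_measurable borel" if "C \<in> R" for C
      unfolding G_def using measurable_act[OF D.mem_carrier[OF ci[OF that]]] by measurable
    have coset: "(\<integral>\<^sup>+\<gamma>. indicator F (act (inv\<^bsub>PSL2R\<^esub> \<gamma>) z) \<partial>count_space C)
       = (\<integral>\<^sup>+\<gamma>. indicator F (act (ci C) (act \<gamma> z)) \<partial>count_space \<Gamma>')" (is "?l = ?r")
      if C: "C \<in> R" and z: "z \<in> \<HH>" for C z
    proof -
      have "bij_betw (\<lambda>\<gamma>. \<gamma> \<otimes>\<^bsub>PSL2R\<^esub> c C) \<Gamma>' C"
      proof (rule bij_betw_imageI)
        show "inj_on (\<lambda>\<gamma>. \<gamma> \<otimes>\<^bsub>PSL2R\<^esub> c C) \<Gamma>'"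
          using c(1)[OF C] D'.mem_carrier D.mem_carrier by (auto simp: inj_on_def)
      qed (use c(2)[OF C] in simp)
      then have "?l = (\<integral>\<^sup>+\<gamma>. indicator F (act (inv\<^bsub>PSL2R\<^esub> (\<gamma> \<otimes>\<^bsub>PSL2R\<^esub> c C)) z) \<partial>count_space \<Gamma>')"
        by (rule nn_integral_bij_count_space[symmetric])
      also have "\<dots> = (\<integral>\<^sup>+\<gamma>. indicator F (act (ci C) (act (inv\<^bsub>PSL2R\<^esub> \<gamma>) z)) \<partial>count_space \<Gamma>')"
        using c(1)[OF C] D'.mem_carrier D.mem_carrier z
        by (intro nn_integral_cong) (auto simp: G.inv_mult_group act_mult ci_def)
      also have "\<dots> = ?r" by (rule D'.sum_over_inverses)
      finally show ?thesis .
    qed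
    have "(\<integral>\<^sup>+z. indicator F' z * f z \<partial>hyp_area)
       = (\<integral>\<^sup>+z. indicator F' z * (\<Sum>C\<in>R. \<integral>\<^sup>+\<gamma>. G C (act \<gamma> z) \<partial>count_space \<Gamma>') \<partial>hyp_area)"
    proof (rule nn_integral_cong_AE, use D.AE_sum_indicator[OF F] in eventually_elim)
      case (elim z)
      have "1 = (\<integral>\<^sup>+\<gamma>. indicator F (act (inv\<^bsub>PSL2R\<^esub> \<gamma>) z) \<partial>count_space \<Gamma>)"
        using elim D.sum_over_inverses[of "\<lambda>\<gamma>. indicator F (act \<gamma> z)"] by simp
      also have "\<dots> = (\<Sum>C\<in>R. \<integral>\<^sup>+\<gamma>. indicator F (act (ci C) (act \<gamma> z)) \<partial>count_space \<Gamma>')"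
        unfolding split_sum by (rule sum.cong) (use coset elim in auto)
      finally have "f z = f z * (\<Sum>C\<in>R. \<integral>\<^sup>+\<gamma>. indicator F (act (ci C) (act \<gamma> z)) \<partial>count_space \<Gamma>')" by simp
      also have "\<dots> = (\<Sum>C\<in>R. \<integral>\<^sup>+\<gamma>. G C (act \<gamma> z) \<partial>count_space \<Gamma>')"
        unfolding sum_distrib_left
      proof (rule sum.cong[OF refl])
        fix C
        have "f z * (\<integral>\<^sup>+\<gamma>. indicator F (act (ci C) (act \<gamma> z)) \<partial>count_space \<Gamma>')
            = (\<integral>\<^sup>+\<gamma>. f z * indicator F (act (ci C) (act \<gamma> z)) \<partial>count_space \<Gamma>')"
          by (rule nn_integral_cmult[symmetric]) simp
        also have "\<dots> = (\<integral>\<^sup>+\<gamma>. G C (act \<gamma> z) \<partial>count_space \<Gamma>')"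
          using elim sub\<Gamma> by (intro nn_integral_cong) (auto simp: G_def D.invariantD[OF inv])
        finally show "f z * (\<integral>\<^sup>+\<gamma>. indicator F (act (ci C) (act \<gamma> z)) \<partial>count_space \<Gamma>')
            = (\<integral>\<^sup>+\<gamma>. G C (act \<gamma> z) \<partial>count_space \<Gamma>')" .
      qed
      finally show ?case by simp
    qed
    also have "\<dots> = (\<Sum>C\<in>R. \<integral>\<^sup>+z. indicator F' z * (\<integral>\<^sup>+\<gamma>. G C (act \<gamma> z) \<partial>count_space \<Gamma>') \<partial>hyp_area)"
    proof -
      have "(\<lambda>z. indicator F' z * (\<integral>\<^sup>+\<gamma>. G C (act \<gamma> z) \<partial>count_space \<Gamma>')) \<in> borel_measurable hyp_area" if C: "C \<in> R" for C
      proof -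
        note [measurable] = Gm[OF C]
        have "(\<lambda>z. \<integral>\<^sup>+\<gamma>. G C (act \<gamma> z) \<partial>count_space \<Gamma>') \<in> borel_measurable hyp_area"
          by (rule D'.measurable_count_integral) measurable
        then show ?thesis by measurable
      qed
      then show ?thesis unfolding sum_distrib_left by (rule nn_integral_sum)
    qed
    also have "\<dots> = (\<Sum>C\<in>R. \<integral>\<^sup>+z. G C z \<partial>hyp_area)"
      by (intro sum.cong refl D'.unfolding_integral[OF F', symmetric] Gm)
    also have "\<dots> = (\<Sum>C\<in>R. \<integral>\<^sup>+z. indicator F z * f z \<partial>hyp_area)"
    proof (intro sum.cong refl)
      fix C assume C: "C \<in> R"
      note cc = D.mem_carrier[OF ci[OF C]]
      have "(\<integral>\<^sup>+z. G C z \<partial>hyp_area) = (\<integral>\<^sup>+z. indicator F (act (ci C) z) * f (act (ci C) z) \<partial>hyp_area)"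
        by (intro nn_integral_hyp_cong) (simp add: G_def D.invariantD[OF inv ci[OF C]] mult.commute)
      also have "\<dots> = (\<integral>\<^sup>+z. indicator F z * f z \<partial>hyp_area)"
        by (rule nn_integral_act[OF cc]) measurable
      finally show "(\<integral>\<^sup>+z. G C z \<partial>hyp_area) = (\<integral>\<^sup>+z. indicator F z * f z \<partial>hyp_area)" .
    qed
    finally show ?thesis by simp
  qed
  show "\<exists>n::nat. n > 0 \<and> (\<forall>F F' f. fundamental_domain \<Gamma> F \<longrightarrow> fundamental_domain \<Gamma>' F' \<longrightarrow>
      f \<in> borel_measurable borel \<longrightarrow> D.invariant f \<longrightarrow>
      (\<integral>\<^sup>+z. indicator F' z * f z \<partial>hyp_area) = of_nat n * (\<integral>\<^sup>+z. indicator F z * f z \<partial>hyp_area))"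
    using main Rne finR by (intro exI[of _ "card R"]) (auto simp: card_gt_0_iff)
qed

section \<open>Conjugate groups\<close>

lemma emeasure_act_image:
  assumes h: "h \<in> carrier PSL2R" and B: "B \<in> sets borel" "B \<subseteq> \<HH>"
  shows "act h ` B \<in> sets borel" "emeasure hyp_area (act h ` B) = emeasure hyp_area B"
proof -
  show m: "act h ` B \<in> sets borel"
    by (rule open_holomorphic_image_borel[OF act_holomorphic[OF h] open_upper_half_plane inj_on_act[OF h] B])
  have "emeasure hyp_area (act h ` B) = (\<integral>\<^sup>+z. indicator (act h ` B) z \<partial>hyp_area)" using m by simp
  also have "\<dots> = (\<integral>\<^sup>+z. indicator (act h ` B) (act h z) \<partial>hyp_area)"
    using m by (intro nn_integral_act[OF h, symmetric]) auto
  also have "\<dots> = (\<integral>\<^sup>+z. indicator B z \<partial>hyp_area)"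
  proof (rule nn_integral_hyp_cong)
    fix z assume "z \<in> \<HH>"
    then have "act h z \<in> act h ` B \<longleftrightarrow> z \<in> B"
      using inj_on_image_mem_iff[OF inj_on_act[OF h] _ B(2)] by blast
    then show "indicator (act h ` B) (act h z) = (indicator B z :: ennreal)" by (simp add: indicator_def)
  qed
  finally show "emeasure hyp_area (act h ` B) = emeasure hyp_area B" using B by simp
qed

lemma act_conj:
  assumes "h \<in> carrier PSL2R" "\<gamma> \<in> carrier PSL2R" "z \<in> \<HH>"
  shows "act (conj_PSL2R h \<gamma>) (act h z) = act h (act \<gamma> z)"
  using assms group_PSL2R
  by (simp add: act_mult act_closed act_inv_act group.inv_closed group.is_monoid monoid.m_closed)

lemma conj_fundamental_domain:
  assumes h: "h \<in> carrier PSL2R" and sub: "\<Gamma> \<subseteq> carrier PSL2R" and F: "fundamental_domain \<Gamma> F"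
  shows "fundamental_domain (conj_PSL2R h ` \<Gamma>) (act h ` F)"
proof -
  interpret G: group PSL2R by (rule group_PSL2R)
  have Fb: "F \<in> sets borel" "F \<subseteq> \<HH>" and cov: "(\<Union>\<gamma>\<in>\<Gamma>. act \<gamma> ` F) = \<HH>"
    and null: "\<And>\<gamma>. \<gamma> \<in> \<Gamma> \<Longrightarrow> \<gamma> \<noteq> \<one>\<^bsub>PSL2R\<^esub> \<Longrightarrow> emeasure hyp_area (F \<inter> act \<gamma> ` F) = 0"
    using F by (auto simp: fundamental_domain_def)
  have im: "act (conj_PSL2R h \<gamma>) ` act h ` F = act h ` act \<gamma> ` F" if "\<gamma> \<in> \<Gamma>" for \<gamma>
  proof -
    have "act (conj_PSL2R h \<gamma>) (act h x) = act h (act \<gamma> x)" if "x \<in> F" for x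
      using act_conj[OF h, of \<gamma> x] sub Fb \<open>\<gamma> \<in> \<Gamma>\<close> that by blast
    then show ?thesis by (simp add: image_image)
  qed
  show ?thesis unfolding fundamental_domain_def
  proof (intro conjI ballI impI)
    show "act h ` F \<in> sets borel" by (rule emeasure_act_image(1)[OF h Fb])
    show "act h ` F \<subseteq> \<HH>" using act_image[OF h] Fb by auto
    have "(\<Union>\<gamma>\<in>conj_PSL2R h ` \<Gamma>. act \<gamma> ` act h ` F) = act h ` (\<Union>\<gamma>\<in>\<Gamma>. act \<gamma> ` F)"
      using im by (simp add: image_UN)
    then show "(\<Union>\<gamma>\<in>conj_PSL2R h ` \<Gamma>. act \<gamma> ` act h ` F) = \<HH>" by (simp add: cov act_image[OF h])
    fix \<gamma>' assume "\<gamma>' \<in> conj_PSL2R h ` \<Gamma>" "\<gamma>' \<noteq> \<one>\<^bsub>PSL2R\<^esub>"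
    then obtain \<gamma> where \<gamma>: "\<gamma> \<in> \<Gamma>" "\<gamma>' = conj_PSL2R h \<gamma>" "\<gamma> \<noteq> \<one>\<^bsub>PSL2R\<^esub>"
      using h by fastforce
    have \<gamma>F: "act \<gamma> ` F \<subseteq> \<HH>" using cov \<gamma> by blast
    have \<gamma>c: "\<gamma> \<in> carrier PSL2R" using sub \<gamma> by blast
    have "act h ` F \<inter> act \<gamma>' ` act h ` F = act h ` (F \<inter> act \<gamma> ` F)"
      unfolding \<gamma>(2) im[OF \<gamma>(1)] using inj_on_image_Int[OF inj_on_act[OF h] Fb(2) \<gamma>F] by simp
    moreover have "F \<inter> act \<gamma> ` F \<in> sets borel" using Fb emeasure_act_image(1)[OF \<gamma>c Fb] by auto
    ultimately show "emeasure hyp_area (act h ` F \<inter> act \<gamma>' ` act h ` F) = 0"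
      using emeasure_act_image(2)[OF h, of "F \<inter> act \<gamma> ` F"] null[OF \<gamma>(1,3)] Fb by auto
  qed
qed

lemma conj_discontinuous_group:
  assumes h: "h \<in> carrier PSL2R" and D: "discontinuous_group \<Gamma>"
  shows "discontinuous_group (conj_PSL2R h ` \<Gamma>)"
proof (rule discontinuous_group.intro)
  interpret D: discontinuous_group \<Gamma> by (rule D)
  interpret G: group PSL2R by (rule group_PSL2R)
  note c = D.mem_carrier h
  have hom: "conj_PSL2R h \<in> hom PSL2R PSL2R"
    by (rule homI) (use h in \<open>simp_all add: G.m_assoc G.inv_solve_left\<close>)
  have gh: "group_hom PSL2R PSL2R (conj_PSL2R h)"
    using hom by (simp add: group_hom_def group_hom_axioms_def G.is_group)
  show "subgroup (conj_PSL2R h ` \<Gamma>) PSL2R"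
    by (rule group_hom.subgroup_img_is_subgroup[OF gh D.subgroup])
  show "acts_discretely (conj_PSL2R h ` \<Gamma>)" unfolding acts_discretely_def
  proof (intro allI impI)
    fix K assume K: "compact K \<and> K \<subseteq> \<HH>"
    define L where "L = act (inv\<^bsub>PSL2R\<^esub> h) ` K"
    have "continuous_on K (act (inv\<^bsub>PSL2R\<^esub> h))" using act_continuous[of "inv\<^bsub>PSL2R\<^esub> h"] h K continuous_on_subset by auto
    then have "compact L" using K by (auto simp: L_def compact_continuous_image)
    moreover have "L \<subseteq> \<HH>" using K h act_closed by (auto simp: L_def)
    ultimately have "finite {\<gamma>\<in>\<Gamma>. act \<gamma> ` L \<inter> L \<noteq> {}}" using D.discontinuous unfolding acts_discretely_def by blast
    moreover have "{\<gamma>'\<in>conj_PSL2R h ` \<Gamma>. act \<gamma>' ` K \<inter> K \<noteq> {}} \<subseteq> conj_PSL2R h ` {\<gamma>\<in>\<Gamma>. act \<gamma> ` L \<inter> L \<noteq> {}}"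
    proof
      fix \<gamma>' assume "\<gamma>' \<in> {\<gamma>'\<in>conj_PSL2R h ` \<Gamma>. act \<gamma>' ` K \<inter> K \<noteq> {}}"
      then obtain \<gamma> z where \<gamma>: "\<gamma> \<in> \<Gamma>" "\<gamma>' = conj_PSL2R h \<gamma>" "z \<in> K" "act \<gamma>' z \<in> K" by blast
      have zH: "z \<in> \<HH>" using \<gamma> K by blast
      define w where "w = act (inv\<^bsub>PSL2R\<^esub> h) z"
      have wH: "w \<in> \<HH>" using zH h act_closed by (simp add: w_def)
      have "z = act h w" using act_act_inv[OF h zH] by (simp add: w_def)
      then have "act \<gamma>' z = act h (act \<gamma> w)" using act_conj[OF h c(1)[OF \<gamma>(1)] wH] \<gamma>(2) by simp
      then have "act (inv\<^bsub>PSL2R\<^esub> h) (act \<gamma>' z) = act \<gamma> w"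
        using act_inv_act[OF h act_closed[OF c(1)[OF \<gamma>(1)] wH]] by simp
      then have "act \<gamma> w \<in> L" "w \<in> L" using \<gamma> by (auto simp: L_def w_def intro: rev_image_eqI)
      then show "\<gamma>' \<in> conj_PSL2R h ` {\<gamma>\<in>\<Gamma>. act \<gamma> ` L \<inter> L \<noteq> {}}" using \<gamma> by blast
    qed
    ultimately show "finite {\<gamma>'\<in>conj_PSL2R h ` \<Gamma>. act \<gamma>' ` K \<inter> K \<noteq> {}}"
      by (meson finite_imageI finite_subset)
  qed
qed

section \<open>The area of the half-plane\<close>

text \<open>The strip \<open>1 < Im z < 2\<close> already has infinite area.\<close>

lemma emeasure_hyp_area_UNIV: "emeasure hyp_area UNIV = \<infinity>"
proof -
  have "ennreal (real n / 4) \<le> emeasure hyp_area UNIV" for n :: nat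
  proof -
    define B where "B = box (Complex 0 1) (Complex (real n) 2)"
    have [measurable]: "B \<in> sets borel" by (simp add: B_def)
    have B: "z \<in> B \<Longrightarrow> 0 < Im z \<and> Im z < 2" for z by (auto simp: B_def box_def Basis_complex_def)
    have "emeasure lborel B = ennreal (real n)"
      unfolding B_def by (subst emeasure_lborel_box) (auto simp: Basis_complex_def)
    then have "ennreal (real n / 4) = ennreal (1/4) * emeasure lborel B"
      by (simp flip: ennreal_mult)
    also have "\<dots> = (\<integral>\<^sup>+z. ennreal (1/4) * indicator B z \<partial>lborel)" by (simp add: nn_integral_cmult)
    also have "\<dots> \<le> (\<integral>\<^sup>+z. indicator \<HH> z * (ennreal (1 / (Im z)\<^sup>2) * 1) \<partial>lborel)"
    proof (rule nn_integral_mono)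
      fix z
      show "ennreal (1/4) * indicator B z \<le> indicator \<HH> z * (ennreal (1 / (Im z)\<^sup>2) * 1)"
      proof (cases "z \<in> B")
        case True
        then have i: "0 < Im z" "Im z < 2" using B by auto
        then have "(Im z)\<^sup>2 \<le> 2\<^sup>2" by (intro power_mono) auto
        then have "1/4 \<le> 1 / (Im z)\<^sup>2" using i by (simp add: field_simps)
        then show ?thesis using i True by (simp add: upper_half_plane_iff ennreal_leI)
      qed simp
    qed
    also have "\<dots> = emeasure hyp_area UNIV" using nn_integral_hyp_area[of "\<lambda>_. 1"] by simp
    finally show ?thesis .
  qed
  note le = this
  show ?thesis
  proof (rule ccontr)
    assume "emeasure hyp_area UNIV \<noteq> \<infinity>"
    then obtain r where r: "emeasure hyp_area UNIV = ennreal r" "0 \<le> r" by (cases "emeasure hyp_area UNIV") auto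
    obtain n :: nat where n: "4 * r < real n" using reals_Archimedean2 by blast
    have "ennreal (real n / 4) \<le> ennreal r" using le[of n] r by simp
    then show False using n r by simp
  qed
qed

text \<open>Finitely many sets of finite area do not cover the half-plane.\<close>

lemma (in discontinuous_group) finite_covolume_imp_infinite:
  assumes F: "fundamental_domain \<Gamma> F" and fin: "emeasure hyp_area F < \<infinity>"
  shows "infinite \<Gamma>"
proof
  assume "finite \<Gamma>"
  have [measurable]: "F \<in> sets borel" using F by (rule fundamental_domain_borel)
  have "emeasure hyp_area UNIV = (\<integral>\<^sup>+z. 1 \<partial>hyp_area)" by simp
  also have "\<dots> = (\<integral>\<^sup>+z. indicator F z * (\<integral>\<^sup>+\<gamma>. 1 \<partial>count_space \<Gamma>) \<partial>hyp_area)"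
    by (rule unfolding_integral[OF F]) simp
  also have "\<dots> = emeasure hyp_area F * of_nat (card \<Gamma>)"
    using \<open>finite \<Gamma>\<close> by (simp add: nn_integral_multc emeasure_count_space_finite)
  also have "\<dots> < \<infinity>" using fin by (simp add: ennreal_mult_less_top of_nat_less_top)
  finally show False using emeasure_hyp_area_UNIV by simp
qed

section \<open>Lattices act discretely\<close>

text \<open>The inverse of a matrix of determinant one, as a polynomial in its entries; this
  makes its continuity evident.\<close>

definition adjugate2 :: "real^2^2 \<Rightarrow> real^2^2" where
  "adjugate2 B = (\<chi> i j. if i = 1 then (if j = 1 then B$2$2 else - B$1$2) else (if j = 1 then - B$2$1 else B$1$1))"

lemma det_adjugate2: "det (adjugate2 B) = det B"
  by (simp add: det_2 adjugate2_def)

lemma mult_adjugate2: "det B = 1 \<Longrightarrow> B ** adjugate2 B = mat 1" "det B = 1 \<Longrightarrow> adjugate2 B ** B = mat 1"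
  by (simp_all add: det_2 adjugate2_def matrix_matrix_mult_def vec_eq_iff forall_2 sum_2 mat_def algebra_simps)

lemma continuous_on_mult_adjugate2:
  "continuous_on UNIV (\<lambda>p::(real^2^2)\<times>(real^2^2). fst p ** adjugate2 (snd p))"
proof -
  have mul: "continuous_on UNIV (\<lambda>p::(real^2^2)\<times>(real^2^2). fst p ** snd p)"
    unfolding matrix_matrix_mult_def sum_2 by (intro continuous_intros)
  have adj: "continuous_on UNIV adjugate2"
    unfolding adjugate2_def
  proof (intro continuous_on_vec_lambda)
    fix i j :: 2
    show "continuous_on UNIV (\<lambda>B::real^2^2. if i = 1 then if j = 1 then B$2$2 else - B$1$2 else if j = 1 then - B$2$1 else B$1$1)"
      by (cases "i = 1"; cases "j = 1"; simp; intro continuous_intros)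
  qed
  have "continuous_on UNIV (\<lambda>p::(real^2^2)\<times>(real^2^2). (fst p, adjugate2 (snd p)))"
    by (intro continuous_on_Pair continuous_on_fst continuous_on_id continuous_on_compose2[OF adj]
        continuous_on_snd) auto
  from continuous_on_compose2[OF mul this] show ?thesis by simp
qed

lemma mult_inv_PSL2R:
  assumes "det A = 1" "det B = 1"
  shows "{A, - A} \<otimes>\<^bsub>PSL2R\<^esub> inv\<^bsub>PSL2R\<^esub> {B, - B} = {A ** adjugate2 B, - (A ** adjugate2 B)}"
proof -
  interpret G: group PSL2R by (rule group_PSL2R)
  have one: "\<one>\<^bsub>PSL2R\<^esub> = {mat 1, - mat 1}" by (simp add: PSL2R_def FactGroup_def pm1_def)
  have "{adjugate2 B, - adjugate2 B} \<otimes>\<^bsub>PSL2R\<^esub> {B, - B} = \<one>\<^bsub>PSL2R\<^esub>"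
    using assms mult_adjugate2 by (simp add: mult_PSL2R det_adjugate2 one)
  moreover have "{adjugate2 B, - adjugate2 B} \<in> carrier PSL2R" "{B, - B} \<in> carrier PSL2R"
    using assms by (auto simp: carrier_PSL2R det_adjugate2)
  ultimately have "inv\<^bsub>PSL2R\<^esub> {B, - B} = {adjugate2 B, - adjugate2 B}"
    by (intro G.inv_equality)
  then show ?thesis using assms by (simp add: mult_PSL2R det_adjugate2)
qed

lemma mult_inv_eq_one:
  assumes "a \<in> carrier PSL2R" "b \<in> carrier PSL2R" "a \<otimes>\<^bsub>PSL2R\<^esub> inv\<^bsub>PSL2R\<^esub> b = \<one>\<^bsub>PSL2R\<^esub>"
  shows "a = b"
proof -
  interpret G: group PSL2R by (rule group_PSL2R)
  have "a = (a \<otimes>\<^bsub>PSL2R\<^esub> inv\<^bsub>PSL2R\<^esub> b) \<otimes>\<^bsub>PSL2R\<^esub> b" using assms(1,2) by (simp add: G.m_assoc)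
  then show ?thesis using assms by simp
qed

text \<open>The topology is that of the quotient of the matrix group by its centre; what is
  needed from it is a neighbourhood of the identity matrix that contains no other matrix of the
  group.\<close>

lemma discrete_subgroup_isolated_one:
  assumes sub: "subgroup \<Gamma> PSL2R" and disc: "subtopology PSL2R_topology \<Gamma> = discrete_topology \<Gamma>"
  obtains \<epsilon> where "\<epsilon> > 0"
    "\<And>A. det A = 1 \<Longrightarrow> {A, - A} \<in> \<Gamma> \<Longrightarrow> dist A (mat 1) < \<epsilon> \<Longrightarrow> {A, - A} = \<one>\<^bsub>PSL2R\<^esub>"
proof -
  have one: "\<one>\<^bsub>PSL2R\<^esub> = {mat 1, - mat 1}" by (simp add: PSL2R_def FactGroup_def pm1_def)
  have "openin (subtopology PSL2R_topology \<Gamma>) {\<one>\<^bsub>PSL2R\<^esub>}"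
    using subgroup.one_closed[OF sub] by (simp add: disc)
  then obtain U where U: "openin PSL2R_topology U" "{\<one>\<^bsub>PSL2R\<^esub>} = U \<inter> \<Gamma>"
    by (auto simp: openin_subtopology)
  then have "openin (top_of_set (carrier SL2R)) {A \<in> carrier SL2R. pm1 #>\<^bsub>SL2R\<^esub> A \<in> U}"
    by (simp add: openin_PSL2R_topology)
  then obtain T where T: "open T" "{A \<in> carrier SL2R. pm1 #>\<^bsub>SL2R\<^esub> A \<in> U} = carrier SL2R \<inter> T"
    by (auto simp: openin_open)
  have TU: "A \<in> T \<longleftrightarrow> {A, - A} \<in> U" if "det A = 1" for A
    using T(2) that by (auto simp: SL2R_def pm1_coset[unfolded SL2R_def] set_eq_iff)
  have "mat 1 \<in> T" using U(2) TU[of "mat 1"] one by (auto simp: det_I)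
  then obtain \<epsilon> where \<epsilon>: "\<epsilon> > 0" "ball (mat 1) \<epsilon> \<subseteq> T" using T(1) open_contains_ball by blast
  show ?thesis
  proof (rule that[OF \<epsilon>(1)])
    fix A assume A: "det A = 1" "{A, - A} \<in> \<Gamma>" "dist A (mat 1) < \<epsilon>"
    then have "A \<in> T" using \<epsilon> by (auto simp: dist_commute)
    then have "{A, - A} \<in> U \<inter> \<Gamma>" using TU[OF A(1)] A(2) by (intro IntI) simp_all
    then have "{A, - A} \<in> {\<one>\<^bsub>PSL2R\<^esub>}" by (simp only: U(2))
    then show "{A, - A} = \<one>\<^bsub>PSL2R\<^esub>" by (rule singletonD)
  qed
qed

lemma bounded_entries:
  fixes S :: "(real^2^2) set"
  assumes "\<And>A i j. A \<in> S \<Longrightarrow> \<bar>A$i$j\<bar> \<le> C"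
  shows "bounded S"
proof (rule boundedI)
  fix A assume A: "A \<in> S"
  have "norm A \<le> (\<Sum>i\<in>UNIV. norm (A$i))" unfolding norm_vec_def by (rule L2_set_le_sum) simp
  also have "\<dots> \<le> (\<Sum>i\<in>(UNIV::2 set). (\<Sum>j\<in>(UNIV::2 set). C))"
  proof (rule sum_mono)
    fix i
    have "norm (A$i) \<le> (\<Sum>j\<in>UNIV. \<bar>A$i$j\<bar>)" by (rule norm_le_l1_cart)
    also have "\<dots> \<le> (\<Sum>j\<in>(UNIV::2 set). C)" by (rule sum_mono) (use assms A in auto)
    finally show "norm (A$i) \<le> (\<Sum>j\<in>(UNIV::2 set). C)" .
  qed
  finally show "norm A \<le> (\<Sum>i\<in>(UNIV::2 set). (\<Sum>j\<in>(UNIV::2 set). C))" .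
qed

text \<open>If \<open>z\<close> and \<open>w = A z\<close> lie in \<open>K\<close>, then
  \<open>\<bar>c z + d\<bar>\<^sup>2 = Im z / Im w\<close> is bounded, hence so is \<open>a z +
  b = w (c z + d)\<close>. As \<open>Im z\<close> is bounded below, this bounds the
  entries.\<close>

lemma bounded_matrices_meeting_compact:
  assumes K: "compact K" "K \<subseteq> \<HH>"
  shows "bounded {A::real^2^2. det A = 1 \<and> mat_act A ` K \<inter> K \<noteq> {}}"
proof (cases "K = {}")
  case False
  obtain R where R: "\<And>z. z \<in> K \<Longrightarrow> cmod z \<le> R" using compact_imp_bounded[OF K(1)] by (auto simp: bounded_iff)
  obtain z0 where z0: "z0 \<in> K" "\<And>z. z \<in> K \<Longrightarrow> Im z0 \<le> Im z"
    using continuous_attains_inf[OF K(1) False continuous_on_Im[OF continuous_on_id]] by auto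
  define e where "e = Im z0"
  have e: "e > 0" using z0 K by (auto simp: e_def upper_half_plane_iff)
  have R0: "R \<ge> 0" using R[OF z0(1)] norm_ge_zero order_trans by blast
  define J where "J = sqrt (R / e)"
  have J0: "J \<ge> 0" using e R0 by (simp add: J_def)
  \<comment> \<open>The sum of the bounds for the four entries derived below.\<close>
  define Cb where "Cb = J / e + (J + J / e * R) + R * J / e + (R * J + R * J / e * R)"
  show ?thesis
  proof (rule bounded_entries[of _ Cb])
    fix A i j assume "A \<in> {A::real^2^2. det A = 1 \<and> mat_act A ` K \<inter> K \<noteq> {}}"
    then obtain z where A: "det A = 1" and z: "z \<in> K" "mat_act A z \<in> K" by auto
    define w where "w = mat_act A z"
    have zH: "z \<in> \<HH>" "w \<in> \<HH>" using z K by (auto simp: w_def)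
    define q where "q = complex_of_real (A$2$1) * z + complex_of_real (A$2$2)"
    have q0: "q \<noteq> 0" using mat_act_denom_nonzero[OF A zH(1)] by (simp add: q_def)
    have "(cmod q)\<^sup>2 = Im z / Im w"
      using Im_mat_act[OF A zH(1)] zH q0 by (simp add: w_def q_def[symmetric] upper_half_plane_iff)
    also have "\<dots> \<le> R / e"
    proof (rule frac_le)
      show "Im z \<le> R" using R[OF z(1)] abs_Im_le_cmod[of z] by linarith
      show "e \<le> Im w" using z0(2) z by (simp add: e_def w_def)
    qed (use R0 e in auto)
    finally have q: "cmod q \<le> J" unfolding J_def by (rule real_le_rsqrt)
    have lin: "\<bar>x\<bar> \<le> C / e \<and> \<bar>y\<bar> \<le> C + C / e * R" if "cmod (complex_of_real x * z + complex_of_real y) \<le> C" for x y C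
    proof -
      have C0: "C \<ge> 0" using that norm_ge_zero order_trans by blast
      have "\<bar>x\<bar> * Im z \<le> C"
        using abs_Im_le_cmod[of "complex_of_real x * z + complex_of_real y"] that zH
        by (simp add: abs_mult upper_half_plane_iff)
      moreover have "\<bar>x\<bar> * e \<le> \<bar>x\<bar> * Im z" using z0(2)[OF z(1)] by (intro mult_left_mono) (auto simp: e_def)
      ultimately have "\<bar>x\<bar> * e \<le> C" by linarith
      then have x: "\<bar>x\<bar> \<le> C / e" using e by (simp add: pos_le_divide_eq)
      have "cmod (complex_of_real y) \<le> cmod (complex_of_real x * z + complex_of_real y) + cmod (complex_of_real x * z)"
        by (metis add_diff_cancel_left' norm_triangle_ineq4)
      then have "\<bar>y\<bar> \<le> C + \<bar>x\<bar> * cmod z" using that by (simp add: norm_mult)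
      also have "\<dots> \<le> C + C / e * R"
        using x R[OF z(1)] C0 e by (intro add_left_mono mult_mono) auto
      finally show ?thesis using x by blast
    qed
    have "w = (complex_of_real (A$1$1) * z + complex_of_real (A$1$2)) / q"
      by (simp add: w_def q_def mat_act_def moebius_def)
    then have "complex_of_real (A$1$1) * z + complex_of_real (A$1$2) = w * q" using q0 by simp
    then have "cmod (complex_of_real (A$1$1) * z + complex_of_real (A$1$2)) \<le> R * J"
      using q R[OF z(2)] R0 by (simp add: norm_mult w_def mult_mono)
    from lin[OF this] lin[OF q[unfolded q_def]]
    have "\<bar>A$1$1\<bar> \<le> R * J / e" "\<bar>A$1$2\<bar> \<le> R * J + R * J / e * R" "\<bar>A$2$1\<bar> \<le> J / e" "\<bar>A$2$2\<bar> \<le> J + J / e * R"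
      by auto
    moreover have "0 \<le> J / e" "0 \<le> J + J / e * R" "0 \<le> R * J / e" "0 \<le> R * J + R * J / e * R"
      using J0 e R0 by auto
    ultimately have "\<forall>i j. \<bar>A$i$j\<bar> \<le> Cb" unfolding forall_2 Cb_def by linarith
    then show "\<bar>A$i$j\<bar> \<le> Cb" by blast
  qed
qed simp

text \<open>Infinitely many elements moving a compact set to meet itself would give infinitely
  many matrices in a bounded set. Two distinct ones near a limit point have a quotient near the
  identity, against discreteness.\<close>

lemma lattice_discontinuous:
  assumes "lattice_PSL2R \<Gamma>"
  shows "discontinuous_group \<Gamma>"
proof (rule discontinuous_group.intro)
  show sub: "subgroup \<Gamma> PSL2R" using assms by (simp add: lattice_PSL2R_def)
  have disc: "subtopology PSL2R_topology \<Gamma> = discrete_topology \<Gamma>" using assms by (simp add: lattice_PSL2R_def)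
  obtain \<epsilon> where \<epsilon>: "\<epsilon> > 0"
    "\<And>A. det A = 1 \<Longrightarrow> {A, - A} \<in> \<Gamma> \<Longrightarrow> dist A (mat 1) < \<epsilon> \<Longrightarrow> {A, - A} = \<one>\<^bsub>PSL2R\<^esub>"
    using discrete_subgroup_isolated_one[OF sub disc] by blast
  interpret G: group PSL2R by (rule group_PSL2R)
  show "acts_discretely \<Gamma>" unfolding acts_discretely_def
  proof (intro allI impI, rule ccontr)
    fix K assume K: "compact K \<and> K \<subseteq> \<HH>"
    define S where "S = {\<gamma> \<in> \<Gamma>. act \<gamma> ` K \<inter> K \<noteq> {}}"
    assume "infinite {\<gamma> \<in> \<Gamma>. act \<gamma> ` K \<inter> K \<noteq> {}}"
    then have infS: "infinite S" by (simp add: S_def)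
    define M where "M = {A. det A = 1 \<and> {A, - A} \<in> S}"
    have "S \<subseteq> (\<lambda>A. {A, - A}) ` M"
    proof
      fix \<gamma> assume \<gamma>: "\<gamma> \<in> S"
      then have "\<gamma> \<in> carrier PSL2R" using subgroup.mem_carrier[OF sub] by (auto simp: S_def)
      then obtain A where "det A = 1" "\<gamma> = {A, - A}" by (rule PSL2R_E)
      then show "\<gamma> \<in> (\<lambda>A. {A, - A}) ` M" using \<gamma> by (auto simp: M_def)
    qed
    then have infM: "infinite M" using infS finite_subset by blast
    have "M \<subseteq> {A. det A = 1 \<and> mat_act A ` K \<inter> K \<noteq> {}}"
    proof
      fix A assume A: "A \<in> M"
      then obtain z where "z \<in> K" "act {A, - A} z \<in> K" by (auto simp: M_def S_def)
      then have "z \<in> K" "mat_act A z \<in> K" using K act_coset[of z A] by auto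
      then show "A \<in> {A. det A = 1 \<and> mat_act A ` K \<inter> K \<noteq> {}}" using A by (auto simp: M_def)
    qed
    then have "bounded M" using bounded_matrices_meeting_compact K bounded_subset by blast
    then obtain x where x: "x islimpt M" using bounded_infinite_imp_islimpt[OF subset_refl _ infM] by blast
    have detcont: "continuous_on UNIV (det :: real^2^2 \<Rightarrow> real)"
      unfolding det_2 by (intro continuous_intros)
    have "closed {A :: real^2^2. det A = 1}" by (intro closed_Collect_eq detcont continuous_intros)
    then have "x \<in> {A. det A = 1}" by (rule closed_limpt[THEN iffD1, rule_format])
      (rule islimpt_subset[OF x], auto simp: M_def)
    then have dx: "x ** adjugate2 x = mat 1" using mult_adjugate2 by simp
    obtain \<delta> where \<delta>: "\<delta> > 0" "\<And>p. dist p (x, x) < \<delta> \<Longrightarrow> dist (fst p ** adjugate2 (snd p)) (mat 1) < \<epsilon>"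
      using continuous_on_mult_adjugate2 \<epsilon>(1) dx unfolding continuous_on_iff by (metis UNIV_I fst_conv snd_conv)
    have inf: "infinite (M \<inter> ball x (\<delta> / 2))" using x \<delta>(1) by (simp add: islimpt_eq_infinite_ball)
    then obtain A where A: "A \<in> M \<inter> ball x (\<delta> / 2)" using infinite_imp_nonempty by blast
    \<comment> \<open>\<open>A\<close> and \<open>- A\<close> are the same group element, so
      \<open>B\<close> has to avoid both.\<close>
    have "infinite (M \<inter> ball x (\<delta> / 2) - {A, - A})" using inf by simp
    then have "M \<inter> ball x (\<delta> / 2) - {A, - A} \<noteq> {}" by (rule infinite_imp_nonempty)
    then obtain B where B: "B \<in> M \<inter> ball x (\<delta> / 2)" "B \<notin> {A, - A}" by blast
    have det: "det A = 1" "det B = 1" and \<Gamma>: "{A, - A} \<in> \<Gamma>" "{B, - B} \<in> \<Gamma>" using A B by (auto simp: M_def S_def)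
    have "dist (A, B) (x, x) \<le> dist A x + dist B x"
      by (simp add: dist_Pair_Pair sqrt_sum_squares_le_sum)
    also have "\<dots> < \<delta>" using A B by (simp add: dist_commute)
    finally have "dist (A ** adjugate2 B) (mat 1) < \<epsilon>" using \<delta>(2)[of "(A, B)"] by simp
    moreover have "{A, - A} \<otimes>\<^bsub>PSL2R\<^esub> inv\<^bsub>PSL2R\<^esub> {B, - B} \<in> \<Gamma>"
      using \<Gamma> sub by (simp add: subgroup.m_closed subgroup.m_inv_closed)
    ultimately have "{A, - A} \<otimes>\<^bsub>PSL2R\<^esub> inv\<^bsub>PSL2R\<^esub> {B, - B} = \<one>\<^bsub>PSL2R\<^esub>"
      using \<epsilon>(2)[of "A ** adjugate2 B"] mult_inv_PSL2R[OF det] det by (simp add: det_mul det_adjugate2)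
    then have "{A, - A} = {B, - B}"
      using mult_inv_eq_one \<Gamma> subgroup.mem_carrier[OF sub] by blast
    then have "B \<in> {A, - A}" by (metis insertI1)
    then show False using B(2) by simp
  qed
qed

section \<open>Transitivity and rotations\<close>

lemma i_in [simp]: "\<i> \<in> \<HH>" by (simp add: upper_half_plane_iff)

definition mat2 :: "real \<Rightarrow> real \<Rightarrow> real \<Rightarrow> real \<Rightarrow> real^2^2" where
  "mat2 a b c d = vector [vector [a, b], vector [c, d]]"

lemma mat2_PSL2R:
  assumes "a * d - b * c = 1"
  shows "{mat2 a b c d, - mat2 a b c d} \<in> carrier PSL2R"
    "z \<in> \<HH> \<Longrightarrow> act {mat2 a b c d, - mat2 a b c d} z = (of_real a * z + of_real b) / (of_real c * z + of_real d)"
proof -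
  have "det (mat2 a b c d) = 1" using assms by (simp add: det_2 mat2_def)
  then show "{mat2 a b c d, - mat2 a b c d} \<in> carrier PSL2R" by (auto simp: carrier_PSL2R)
  show "z \<in> \<HH> \<Longrightarrow> act {mat2 a b c d, - mat2 a b c d} z = (of_real a * z + of_real b) / (of_real c * z + of_real d)"
    by (simp add: act_coset mat_act_def moebius_def mat2_def)
qed

lemma act_transitive:
  assumes "z \<in> \<HH>"
  obtains g where "g \<in> carrier PSL2R" "act g \<i> = z"
proof -
  define y where "y = Im z"
  define r where "r = sqrt y"
  have y: "y > 0" and r: "r > 0" "r * r = y" using assms by (auto simp: y_def r_def upper_half_plane_iff)
  have det: "r * (1 / r) - (Re z / r) * 0 = 1" using r by simp
  have "act {mat2 r (Re z / r) 0 (1 / r), - mat2 r (Re z / r) 0 (1 / r)} \<i>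
      = (of_real r * \<i> + of_real (Re z / r)) / (of_real 0 * \<i> + of_real (1 / r))"
    by (rule mat2_PSL2R(2)[OF det]) simp
  also have "\<dots> = of_real (r * r) * \<i> + of_real (Re z)" using r(1) by (simp add: field_simps)
  also have "\<dots> = z" unfolding r(2) by (simp add: complex_eq_iff y_def)
  finally show ?thesis using that mat2_PSL2R(1)[OF det] by blast
qed

text \<open>The rotation by \<open>\<theta>\<close> in the matrix group rotates the disc about
  the image \<open>0\<close> of \<open>\<i>\<close> by \<open>2 \<theta>\<close>.\<close>

lemma act_rotation:
  obtains g where "g \<in> carrier PSL2R" "\<And>w. w \<in> \<HH> \<Longrightarrow> cay \<i> (act g w) = cis (2 * \<theta>) * cay \<i> w"
proof -
  have det: "cos \<theta> * cos \<theta> - sin \<theta> * (- sin \<theta>) = 1" by (simp flip: power2_eq_square)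
  define g where "g = {mat2 (cos \<theta>) (sin \<theta>) (- sin \<theta>) (cos \<theta>), - mat2 (cos \<theta>) (sin \<theta>) (- sin \<theta>) (cos \<theta>)}"
  have g: "g \<in> carrier PSL2R" unfolding g_def by (rule mat2_PSL2R(1)[OF det])
  show ?thesis
  proof (rule that[OF g])
    fix w assume w: "w \<in> \<HH>"
    define q where "q = of_real (- sin \<theta>) * w + of_real (cos \<theta>)"
    have a: "act g w = (of_real (cos \<theta>) * w + of_real (sin \<theta>)) / q"
      unfolding g_def q_def by (rule mat2_PSL2R(2)[OF det w])
    have q: "q \<noteq> 0"
    proof
      assume q0: "q = 0"
      then have "Im q = 0" by simp
      then have "sin \<theta> = 0" using w by (simp add: q_def upper_half_plane_iff)
      then show False using q0 det by (simp add: q_def)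
    qed
    have ci: "of_real (cos \<theta>) + \<i> * of_real (sin \<theta>) = cis \<theta>" "of_real (cos \<theta>) - \<i> * of_real (sin \<theta>) = cis (- \<theta>)"
      by (auto simp: complex_eq_iff)
    have 1: "act g w - \<i> = cis \<theta> * (w - \<i>) / q"
    proof -
      have "act g w - \<i> = (of_real (cos \<theta>) * w + of_real (sin \<theta>) - \<i> * q) / q" using q by (simp add: a diff_divide_distrib)
      also have "of_real (cos \<theta>) * w + of_real (sin \<theta>) - \<i> * q = cis \<theta> * (w - \<i>)"
        unfolding q_def ci[symmetric] by (simp add: algebra_simps)
      finally show ?thesis .
    qed
    have 2: "act g w - cnj \<i> = cis (- \<theta>) * (w - cnj \<i>) / q"
    proof -
      have "act g w - cnj \<i> = (of_real (cos \<theta>) * w + of_real (sin \<theta>) + \<i> * q) / q" using q by (simp add: a add_divide_distrib)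
      also have "of_real (cos \<theta>) * w + of_real (sin \<theta>) + \<i> * q = cis (- \<theta>) * (w - cnj \<i>)"
        unfolding q_def ci(2)[symmetric] by (simp add: algebra_simps)
      finally show ?thesis .
    qed
    have "w - cnj \<i> \<noteq> 0" using cnj_diff_nonzero[OF w i_in] .
    then have "cay \<i> (act g w) = (cis \<theta> / cis (- \<theta>)) * cay \<i> w"
      unfolding cay_def 1 2 using q by simp
    also have "cis \<theta> / cis (- \<theta>) = cis (2 * \<theta>)" by (simp add: cis_divide)
    finally show "cay \<i> (act g w) = cis (2 * \<theta>) * cay \<i> w" .
  qed
qed

section \<open>Averaging against a point-pair invariant\<close>

lemma sigma_finite_hyp_area: "sigma_finite_measure hyp_area"
  unfolding hyp_area_def
  by (subst sigma_finite_measure.sigma_finite_iff_density_finite[OF sigma_finite_lborel]) auto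

lemma pair_sigma_finite_hyp_area: "pair_sigma_finite hyp_area hyp_area"
  by (simp add: pair_sigma_finite_def sigma_finite_hyp_area)

definition kernel_mass :: "(real \<Rightarrow> ennreal) \<Rightarrow> ennreal" where
  "kernel_mass \<phi> = (\<integral>\<^sup>+w. \<phi> (sech2 \<i> w) \<partial>hyp_area)"

text \<open>The action is transitive and preserves both area and \<open>sech2\<close>, so the
  mass does not depend on the point.\<close>

lemma kernel_mass:
  assumes z: "z \<in> \<HH>" and [measurable]: "\<phi> \<in> borel_measurable borel"
  shows "(\<integral>\<^sup>+w. \<phi> (sech2 z w) \<partial>hyp_area) = kernel_mass \<phi>"
proof -
  obtain g where g: "g \<in> carrier PSL2R" "act g \<i> = z" using act_transitive[OF z] .
  have "(\<integral>\<^sup>+w. \<phi> (sech2 z w) \<partial>hyp_area) = (\<integral>\<^sup>+w. \<phi> (sech2 z (act g w)) \<partial>hyp_area)"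
    by (rule nn_integral_act[OF g(1), symmetric]) measurable
  also have "\<dots> = kernel_mass \<phi>"
    unfolding kernel_mass_def by (rule nn_integral_hyp_cong) (use g sech2_act[OF g(1) i_in] in auto)
  finally show ?thesis .
qed

text \<open>Averaging against a kernel that depends on the distance only is symmetric and
  commutes with the group, so on the quotient it multiplies the total integral by the mass of
  the kernel. Concretely, unfold the inner integral over \<open>F\<close>, exchange the
  integrals by the symmetry of the kernel, and fold back.\<close>

lemma (in discontinuous_group) integral_kernel:
  assumes F: "fundamental_domain \<Gamma> F" and \<phi> [measurable]: "\<phi> \<in> borel_measurable borel"
    and f [measurable]: "f \<in> borel_measurable borel" and inv: "invariant f"
  shows "(\<integral>\<^sup>+z. indicator F z * (\<integral>\<^sup>+w. \<phi> (sech2 z w) * f w \<partial>hyp_area) \<partial>hyp_area)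
      = kernel_mass \<phi> * (\<integral>\<^sup>+w. indicator F w * f w \<partial>hyp_area)"
proof -
  interpret pair_sigma_finite hyp_area hyp_area by (rule pair_sigma_finite_hyp_area)
  have [measurable]: "F \<in> sets borel" using F by (rule fundamental_domain_borel)
  note [measurable] = measurable_act[OF mem_carrier]
  define S where "S z w = (\<integral>\<^sup>+\<gamma>. \<phi> (sech2 z (act \<gamma> w)) \<partial>count_space \<Gamma>)" for z w
  have Sm [measurable]: "(\<lambda>p. S (fst p) (snd p)) \<in> borel_measurable (borel \<Otimes>\<^sub>M borel)"
    unfolding S_def by (rule measurable_count_integral) measurable
  have "(\<integral>\<^sup>+z. indicator F z * (\<integral>\<^sup>+w. \<phi> (sech2 z w) * f w \<partial>hyp_area) \<partial>hyp_area)
     = (\<integral>\<^sup>+z. (\<integral>\<^sup>+w. indicator F z * (indicator F w * (f w * S z w)) \<partial>hyp_area) \<partial>hyp_area)"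
  proof (rule nn_integral_hyp_cong)
    fix z assume z: "z \<in> \<HH>"
    have "(\<integral>\<^sup>+w. \<phi> (sech2 z w) * f w \<partial>hyp_area)
       = (\<integral>\<^sup>+w. indicator F w * (\<integral>\<^sup>+\<gamma>. \<phi> (sech2 z (act \<gamma> w)) * f (act \<gamma> w) \<partial>count_space \<Gamma>) \<partial>hyp_area)"
      by (rule unfolding_integral[OF F]) measurable
    also have "\<dots> = (\<integral>\<^sup>+w. indicator F w * (f w * S z w) \<partial>hyp_area)"
    proof (rule nn_integral_hyp_cong)
      fix w assume w: "w \<in> \<HH>"
      have "(\<integral>\<^sup>+\<gamma>. \<phi> (sech2 z (act \<gamma> w)) * f (act \<gamma> w) \<partial>count_space \<Gamma>)
          = (\<integral>\<^sup>+\<gamma>. \<phi> (sech2 z (act \<gamma> w)) * f w \<partial>count_space \<Gamma>)"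
        by (rule nn_integral_cong) (simp add: invariantD[OF inv] w)
      also have "\<dots> = f w * S z w" unfolding S_def by (subst nn_integral_multc) (auto simp: mult.commute)
      finally show "indicator F w * (\<integral>\<^sup>+\<gamma>. \<phi> (sech2 z (act \<gamma> w)) * f (act \<gamma> w) \<partial>count_space \<Gamma>)
         = indicator F w * (f w * S z w)" by simp
    qed
    finally show "indicator F z * (\<integral>\<^sup>+w. \<phi> (sech2 z w) * f w \<partial>hyp_area) =
       (\<integral>\<^sup>+w. indicator F z * (indicator F w * (f w * S z w)) \<partial>hyp_area)"
      by (simp add: indicator_def)
  qed
  also have "\<dots> = (\<integral>\<^sup>+w. (\<integral>\<^sup>+z. indicator F z * (indicator F w * (f w * S z w)) \<partial>hyp_area) \<partial>hyp_area)"
    by (rule Fubini'[symmetric]) measurable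
  also have "\<dots> = (\<integral>\<^sup>+w. indicator F w * f w * kernel_mass \<phi> \<partial>hyp_area)"
  proof (rule nn_integral_hyp_cong)
    fix w assume w: "w \<in> \<HH>"
    have [measurable]: "(\<lambda>z. S z w) \<in> borel_measurable borel"
      unfolding S_def by (rule measurable_count_integral) measurable
    have "(\<integral>\<^sup>+z. indicator F z * (indicator F w * (f w * S z w)) \<partial>hyp_area)
        = (\<integral>\<^sup>+z. indicator F w * f w * (indicator F z * S z w) \<partial>hyp_area)"
      by (rule nn_integral_cong) (simp add: mult_ac)
    also have "\<dots> = indicator F w * f w * (\<integral>\<^sup>+z. indicator F z * S z w \<partial>hyp_area)"
      by (rule nn_integral_cmult) measurable
    also have "(\<integral>\<^sup>+z. indicator F z * S z w \<partial>hyp_area)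
        = (\<integral>\<^sup>+z. indicator F z * (\<integral>\<^sup>+\<gamma>. \<phi> (sech2 w (act \<gamma> z)) \<partial>count_space \<Gamma>) \<partial>hyp_area)"
    proof (rule nn_integral_hyp_cong)
      fix z assume z: "z \<in> \<HH>"
      have "S z w = (\<integral>\<^sup>+\<gamma>. \<phi> (sech2 w (act (inv\<^bsub>PSL2R\<^esub> \<gamma>) z)) \<partial>count_space \<Gamma>)"
        unfolding S_def
      proof (rule nn_integral_cong)
        fix \<gamma> assume "\<gamma> \<in> space (count_space \<Gamma>)"
        then have "sech2 (act \<gamma> w) z = sech2 w (act (inv\<^bsub>PSL2R\<^esub> \<gamma>) z)"
          using sech2_act_left[OF mem_carrier w z] by simp
        then show "\<phi> (sech2 z (act \<gamma> w)) = \<phi> (sech2 w (act (inv\<^bsub>PSL2R\<^esub> \<gamma>) z))"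
          by (simp add: sech2_commute[of z])
      qed
      also have "\<dots> = (\<integral>\<^sup>+\<gamma>. \<phi> (sech2 w (act \<gamma> z)) \<partial>count_space \<Gamma>)" by (rule sum_over_inverses)
      finally show "indicator F z * S z w = indicator F z * (\<integral>\<^sup>+\<gamma>. \<phi> (sech2 w (act \<gamma> z)) \<partial>count_space \<Gamma>)" by simp
    qed
    also have "\<dots> = (\<integral>\<^sup>+z. \<phi> (sech2 w z) \<partial>hyp_area)"
      by (rule unfolding_integral[OF F, symmetric]) measurable
    also have "\<dots> = kernel_mass \<phi>" by (rule kernel_mass[OF w \<phi>])
    finally show "(\<integral>\<^sup>+z. indicator F z * (indicator F w * (f w * S z w)) \<partial>hyp_area) = indicator F w * f w * kernel_mass \<phi>" .
  qed
  also have "\<dots> = kernel_mass \<phi> * (\<integral>\<^sup>+w. indicator F w * f w \<partial>hyp_area)"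
    by (subst nn_integral_multc) (auto simp: mult.commute)
  finally show ?thesis .
qed

section \<open>Hyperbolic discs and the mean value property\<close>

text \<open>A hyperbolic disc about \<open>z\<close>, with the radius measured by
  \<open>sech2\<close>: it is empty for \<open>t \<ge> 1\<close> and shrinks to its centre as
  \<open>t\<close> tends to \<open>1\<close> from below.\<close>

definition hdisc :: "real \<Rightarrow> complex \<Rightarrow> complex set" where
  "hdisc t z = {w\<in>\<HH>. t < sech2 z w}"

lemma hdisc_subset: "hdisc t z \<subseteq> \<HH>" by (auto simp: hdisc_def)

lemma centre_in_hdisc: "z \<in> \<HH> \<Longrightarrow> t < 1 \<Longrightarrow> z \<in> hdisc t z"
  by (simp add: hdisc_def sech2_refl)

lemma open_hdisc: assumes "z \<in> \<HH>" shows "open (hdisc t z)"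
proof -
  have "continuous_on \<HH> (sech2 z)" using continuous_on_sech2[of \<HH> "\<lambda>_. z" "\<lambda>w. w"] assms
    by (auto intro: continuous_intros)
  then have "open (sech2 z -` {t<..} \<inter> \<HH>)"
    using continuous_on_open_vimage[OF open_upper_half_plane] by (metis open_greaterThan)
  moreover have "hdisc t z = sech2 z -` {t<..} \<inter> \<HH>" by (auto simp: hdisc_def)
  ultimately show ?thesis by simp
qed

lemma hdisc_borel [measurable]: "hdisc t z \<in> sets borel"
  unfolding hdisc_def by measurable

lemma act_hdisc_iff:
  assumes "g \<in> carrier PSL2R" "z \<in> \<HH>" "w \<in> \<HH>"
  shows "act g w \<in> hdisc t (act g z) \<longleftrightarrow> w \<in> hdisc t z"
  using assms by (simp add: hdisc_def act_closed sech2_act)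

lemma hdisc_subset_compact:
  assumes z: "z \<in> \<HH>" and t: "0 < t"
  obtains K where "compact K" "hdisc t z \<subseteq> K" "K \<subseteq> \<HH>"
proof -
  define y where "y = Im z"
  have y: "y > 0" using z by (simp add: y_def upper_half_plane_iff)
  define m M where "m = t * y / 4" and "M = 4 * y / t"
  have m: "m > 0" using t y by (simp add: m_def)
  define K where "K = cball (cnj z) (sqrt (4 * y * M / t)) \<inter> {w. m \<le> Im w}"
  show ?thesis
  proof (rule that[of K])
    show "compact K" unfolding K_def by (intro compact_Int_closed compact_cball closed_halfspace_Im_ge)
    show "K \<subseteq> \<HH>" using m by (auto simp: K_def upper_half_plane_iff)
    show "hdisc t z \<subseteq> K"
    proof
      fix w assume "w \<in> hdisc t z"
      then have w: "w \<in> \<HH>" "t < sech2 w z" by (auto simp: hdisc_def sech2_commute)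
      define v where "v = Im w"
      have v: "v > 0" using w by (simp add: v_def upper_half_plane_iff)
      define N where "N = (cmod (w - cnj z))\<^sup>2"
      have N0: "N > 0" using cnj_diff_nonzero[OF w(1) z] by (simp add: N_def)
      \<comment> \<open>The squared distance of \<open>w\<close> and \<open>cnj z\<close> is at
        least \<open>(v + y)\<^sup>2\<close>, so neither of the imaginary parts
        \<open>v\<close>, \<open>y\<close> can be much larger than the other.\<close>
      have tN: "t * N < 4 * v * y" using w(2) N0 by (simp add: sech2_def v_def y_def N_def pos_less_divide_eq)
      have "N \<ge> (v + y)\<^sup>2" unfolding N_def cmod_power2 by (simp add: v_def y_def)
      then have N2: "N \<ge> v\<^sup>2" "N \<ge> y\<^sup>2" using v y by (auto simp: power2_sum intro: order_trans[rotated])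
      have "t * v\<^sup>2 \<le> t * N" "t * y\<^sup>2 \<le> t * N" using N2 t by (auto intro: mult_left_mono)
      then have "v * (t * v) < v * (4 * y)" "y * (t * y) < y * (4 * v)"
        using tN by (auto simp: power2_eq_square algebra_simps)
      then have vt: "t * v < 4 * y" "t * y < 4 * v" using v y by (auto simp: mult_less_cancel_left_pos)
      have vM: "v \<le> M" "m \<le> v" using vt t by (auto simp: M_def m_def pos_le_divide_eq mult.commute)
      have "t * N \<le> 4 * y * M"
      proof -
        have "4 * v * y \<le> 4 * y * M" using vM y by simp
        then show ?thesis using tN by linarith
      qed
      then have "N \<le> 4 * y * M / t" using t by (simp add: pos_le_divide_eq mult.commute)
      then have "cmod (w - cnj z) \<le> sqrt (4 * y * M / t)" unfolding N_def by (rule real_le_rsqrt)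
      then show "w \<in> K" using vM by (simp add: K_def v_def dist_norm norm_minus_commute)
    qed
  qed
qed

lemma emeasure_compact_finite:
  assumes K: "compact K" "K \<subseteq> \<HH>" shows "emeasure hyp_area K < \<infinity>"
proof (cases "K = {}")
  case False
  obtain z0 where z0: "z0 \<in> K" "\<And>z. z \<in> K \<Longrightarrow> Im z0 \<le> Im z"
    using continuous_attains_inf[OF K(1) False continuous_on_Im[OF continuous_on_id]] by auto
  have e: "Im z0 > 0" using z0 K by (auto simp: upper_half_plane_iff)
  have [measurable]: "K \<in> sets borel" using K(1) by (rule borel_compact)
  have "emeasure hyp_area K = (\<integral>\<^sup>+z. indicator \<HH> z * (ennreal (1 / (Im z)\<^sup>2) * indicator K z) \<partial>lborel)"
    using nn_integral_hyp_area[of "indicator K"] by simp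
  also have "\<dots> \<le> (\<integral>\<^sup>+z. ennreal (1 / (Im z0)\<^sup>2) * indicator K z \<partial>lborel)"
    using z0 e by (intro nn_integral_mono) (auto simp: indicator_def upper_half_plane_iff intro!: ennreal_leI divide_left_mono power_mono)
  also have "\<dots> = ennreal (1 / (Im z0)\<^sup>2) * emeasure lborel K" by (simp add: nn_integral_cmult)
  also have "\<dots> < \<infinity>" using emeasure_bounded_finite[OF compact_imp_bounded[OF K(1)]] by (simp add: ennreal_mult_less_top)
  finally show ?thesis .
qed simp

lemma emeasure_open_pos:
  assumes U: "open U" "U \<noteq> {}" "U \<subseteq> \<HH>" shows "emeasure hyp_area U > 0"
proof -
  have [measurable]: "U \<in> sets borel" using U by auto
  have "\<not> (AE z in lborel. z \<notin> U)"
  proof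
    assume "AE z in lborel. z \<notin> U"
    then have "emeasure lborel U = 0" by (subst (asm) AE_iff_measurable[OF _ refl]) auto
    then have "U \<in> null_sets lebesgue" by (intro null_sets_completionI null_setsI) auto
    then show False using open_not_negligible[OF U(1,2)] by (simp add: negligible_iff_null_sets)
  qed
  then have "\<not> (AE z in hyp_area. z \<notin> U)" 
  proof (subst AE_hyp_area_iff)
    assume "\<not> (AE z in lborel. z \<notin> U)"
    then show "\<not> (AE z in lborel. z \<in> \<HH> \<longrightarrow> z \<notin> U)"
      by (rule contrapos_nn) (erule eventually_mono, use U in auto)
  qed measurable
  then have "emeasure hyp_area U \<noteq> 0"
    by (subst (asm) AE_iff_measurable[OF _ refl]) auto
  then show ?thesis by (simp add: zero_less_iff_neq_zero)
qed

definition disc_area :: "real \<Rightarrow> real" where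
  "disc_area t = measure hyp_area (hdisc t \<i>)"

lemma emeasure_hdisc:
  assumes z: "z \<in> \<HH>" and t: "0 < t" "t < 1"
  shows "emeasure hyp_area (hdisc t z) = ennreal (disc_area t)" "disc_area t > 0"
proof -
  have eq: "emeasure hyp_area (hdisc t z) = kernel_mass (indicator {t<..})" if "z \<in> \<HH>" for z
  proof -
    have "emeasure hyp_area (hdisc t z) = (\<integral>\<^sup>+w. indicator (hdisc t z) w \<partial>hyp_area)" by simp
    also have "\<dots> = (\<integral>\<^sup>+w. indicator {t<..} (sech2 z w) \<partial>hyp_area)"
      by (rule nn_integral_hyp_cong) (simp add: hdisc_def indicator_def)
    also have "\<dots> = kernel_mass (indicator {t<..})" by (rule kernel_mass[OF that]) simp
    finally show ?thesis .
  qed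
  obtain K where K: "compact K" "hdisc t \<i> \<subseteq> K" "K \<subseteq> \<HH>" using hdisc_subset_compact[OF i_in t(1)] .
  have "emeasure hyp_area (hdisc t \<i>) \<le> emeasure hyp_area K" using K borel_compact[OF K(1)] by (intro emeasure_mono) auto
  also have "\<dots> < \<infinity>" by (rule emeasure_compact_finite[OF K(1,3)])
  finally have fin: "emeasure hyp_area (hdisc t \<i>) = ennreal (disc_area t)"
    unfolding disc_area_def by (intro emeasure_eq_ennreal_measure) auto
  then show "emeasure hyp_area (hdisc t z) = ennreal (disc_area t)" using eq[OF z] eq[OF i_in] by simp
  have "emeasure hyp_area (hdisc t \<i>) > 0"
    by (rule emeasure_open_pos) (use open_hdisc centre_in_hdisc[OF i_in t(2)] hdisc_subset in auto)
  then show "disc_area t > 0" using fin by simp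
qed

lemma borel_measurable_on_hdisc:
  fixes f :: "complex \<Rightarrow> 'b::{banach, second_countable_topology}"
  assumes "continuous_on \<HH> f"
  shows "(\<lambda>w. indicator (hdisc t z) w *\<^sub>R f w) \<in> borel_measurable borel"
  by (intro borel_measurable_continuous_on_indicator hdisc_borel continuous_on_subset[OF assms hdisc_subset])

lemma set_integrable_hdisc:
  fixes f :: "complex \<Rightarrow> 'b::{banach, second_countable_topology}"
  assumes f: "continuous_on \<HH> f" and z: "z \<in> \<HH>" and t: "0 < t" "t < 1"
  shows "set_integrable hyp_area (hdisc t z) f"
proof -
  obtain K where K: "compact K" "hdisc t z \<subseteq> K" "K \<subseteq> \<HH>" using hdisc_subset_compact[OF z t(1)] .
  have "compact (f ` K)" using f K continuous_on_subset by (intro compact_continuous_image) auto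
  then obtain C where C: "\<And>x. x \<in> K \<Longrightarrow> norm (f x) \<le> C" using compact_imp_bounded bounded_iff by (metis imageI)
  have "(\<lambda>w. indicator (hdisc t z) w *\<^sub>R f w) \<in> borel_measurable borel"
    using f by (rule borel_measurable_on_hdisc)
  then show ?thesis unfolding set_integrable_def
    using emeasure_hdisc(1)[OF z t] K C
    by (intro integrableI_bounded_set[where A = "hdisc t z" and B = C]) auto
qed

text \<open>Cauchy's formula, for the circle through \<open>\<zeta>\<close> about the
  origin.\<close>

lemma mean_over_circle:
  assumes g: "g holomorphic_on ball 0 1" and \<zeta>: "cmod \<zeta> < 1"
  shows "((\<lambda>s. g (cis (2 * pi * s) * \<zeta>)) has_integral g 0) {0..1}"
proof -
  define G where "G u = g (u * \<zeta>)" for u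
  have "G holomorphic_on cball 0 1"
  proof -
    have "(\<lambda>u. u * \<zeta>) ` cball 0 1 \<subseteq> ball 0 1"
    proof
      fix x assume "x \<in> (\<lambda>u. u * \<zeta>) ` cball 0 1"
      then obtain u where u: "cmod u \<le> 1" "x = u * \<zeta>" by auto
      have "cmod u * cmod \<zeta> \<le> 1 * cmod \<zeta>" using u by (intro mult_right_mono) auto
      then show "x \<in> ball 0 1" using u \<zeta> by (simp add: norm_mult)
    qed
    then have "(g \<circ> (\<lambda>u. u * \<zeta>)) holomorphic_on cball 0 1"
      by (intro holomorphic_on_compose_gen[OF _ g] holomorphic_intros)
    then show ?thesis by (simp add: G_def[abs_def] comp_def)
  qed
  from Cauchy_integral_circlepath_simple[OF this, of 0]
  have "((\<lambda>u. G u / u) has_contour_integral 2 * of_real pi * \<i> * G 0) (circlepath 0 1)" by simp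
  then have "((\<lambda>x. G (circlepath 0 1 x) / circlepath 0 1 x * vector_derivative (circlepath 0 1) (at x within {0..1}))
     has_integral 2 * of_real pi * \<i> * G 0) {0..1}"
    by (simp add: has_contour_integral_def)
  then have "((\<lambda>x. (2 * of_real pi * \<i>) * g (cis (2 * pi * x) * \<zeta>)) has_integral (2 * of_real pi * \<i>) * G 0) {0..1}"
  proof (rule has_integral_eq[rotated])
    fix x :: real assume x: "x \<in> {0..1}"
    have c: "circlepath 0 1 x = cis (2 * pi * x)" by (simp add: circlepath cis_conv_exp mult_ac)
    show "G (circlepath 0 1 x) / circlepath 0 1 x * vector_derivative (circlepath 0 1) (at x within {0..1})
        = (2 * of_real pi * \<i>) * g (cis (2 * pi * x) * \<zeta>)"
      using x unfolding vector_derivative_circlepath01[OF x[simplified, THEN conjunct1] x[simplified, THEN conjunct2]] c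
      by (simp add: G_def cis_conv_exp mult_ac)
  qed
  from has_integral_mult_right[OF this, of "1 / (2 * of_real pi * \<i>)"]
  show ?thesis by (simp add: G_def)
qed

lemma distr_act: "g \<in> carrier PSL2R \<Longrightarrow> distr hyp_area borel (act g) = hyp_area"
proof (rule measure_eqI)
  fix A assume g: "g \<in> carrier PSL2R" and "A \<in> sets (distr hyp_area borel (act g))"
  then have [measurable]: "A \<in> sets borel" by simp
  note [measurable] = measurable_act[OF g]
  have "emeasure (distr hyp_area borel (act g)) A = (\<integral>\<^sup>+z. indicator A z \<partial>distr hyp_area borel (act g))" by simp
  also have "\<dots> = (\<integral>\<^sup>+z. indicator A (act g z) \<partial>hyp_area)" by (rule nn_integral_distr) auto
  also have "\<dots> = (\<integral>\<^sup>+z. indicator A z \<partial>hyp_area)" by (rule nn_integral_act[OF g]) simp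
  finally show "emeasure (distr hyp_area borel (act g)) A = emeasure hyp_area A" by simp
qed simp

lemma set_integral_act:
  fixes f :: "complex \<Rightarrow> 'b::{banach, second_countable_topology}"
  assumes g: "g \<in> carrier PSL2R" and z: "z \<in> \<HH>" and f: "continuous_on \<HH> f"
  shows "(LINT w:hdisc t (act g z)|hyp_area. f w) = (LINT w:hdisc t z|hyp_area. f (act g w))"
proof -
  have m: "(\<lambda>w. indicator (hdisc t (act g z)) w *\<^sub>R f w) \<in> borel_measurable borel"
    using f by (rule borel_measurable_on_hdisc)
  have "(LINT w:hdisc t (act g z)|hyp_area. f w)
      = (LINT w|distr hyp_area borel (act g). indicator (hdisc t (act g z)) w *\<^sub>R f w)"
    by (simp add: set_lebesgue_integral_def distr_act[OF g])
  also have "\<dots> = (LINT w|hyp_area. indicator (hdisc t (act g z)) (act g w) *\<^sub>R f (act g w))"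
    by (rule integral_distr) (use measurable_act[OF g] m in auto)
  also have "\<dots> = (LINT w:hdisc t z|hyp_area. f (act g w))"
    unfolding set_lebesgue_integral_def
  proof (rule integral_cong_AE)
    note [measurable] = measurable_act[OF g]
    have "(\<lambda>w. indicator (hdisc t (act g z)) (act g w) *\<^sub>R f (act g w)) \<in> borel_measurable borel"
      using measurable_compose[OF measurable_act[OF g] m] by simp
    then show "(\<lambda>w. indicator (hdisc t (act g z)) (act g w) *\<^sub>R f (act g w)) \<in> borel_measurable hyp_area" by simp
    have "continuous_on \<HH> (\<lambda>w. f (act g w))"
      by (rule continuous_on_compose2[OF f act_continuous[OF g]]) (use act_closed[OF g] in auto)
    then have "(\<lambda>w. indicator (hdisc t z) w *\<^sub>R f (act g w)) \<in> borel_measurable borel"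
      by (rule borel_measurable_on_hdisc)
    then show "(\<lambda>w. indicator (hdisc t z) w *\<^sub>R f (act g w)) \<in> borel_measurable hyp_area" by simp
    show "AE w in hyp_area. indicator (hdisc t (act g z)) (act g w) *\<^sub>R f (act g w)
        = indicator (hdisc t z) w *\<^sub>R f (act g w)"
      using AE_upper_half_plane by eventually_elim (simp add: indicator_def act_hdisc_iff[OF g z])
  qed
  finally show ?thesis .
qed

text \<open>Averaging a holomorphic function over all rotations about \<open>\<i>\<close> gives
  its value at \<open>\<i>\<close>, by Cauchy's formula in the disc. A disc about
  \<open>\<i>\<close> and its area are invariant under rotations, so this does not change the
  integral.\<close>

lemma mean_value_at_i:
  assumes h: "h holomorphic_on \<HH>" and t: "0 < t" "t < 1"
  shows "(LINT w:hdisc t \<i>|hyp_area. h w) = disc_area t *\<^sub>R h \<i>"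
proof -
  define B where "B = hdisc t \<i>"
  define I where "I = (LINT w:B|hyp_area. h w)"
  have hc: "continuous_on \<HH> h" using h by (rule holomorphic_on_imp_continuous_on)
  define g where "g = h \<circ> cay_inv \<i>"
  have g: "g holomorphic_on ball 0 1" unfolding g_def
    by (rule holomorphic_on_compose_gen[OF cay_inv_holomorphic h]) (use cay_inv_in[OF i_in] in auto)
  have gc: "continuous_on (ball 0 1) g" using g by (rule holomorphic_on_imp_continuous_on)
  define R where "R s w = g (cis (2 * pi * s) * cay \<i> w)" for s :: real and w
  have cin: "cis a * cay \<i> w \<in> ball 0 1" if "w \<in> \<HH>" for a w
    using cmod_cay_less_1[OF that i_in] by (simp add: norm_mult)
  have cinB: "cis a * cay \<i> w \<in> ball 0 1" if "w \<in> B" for a w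
    using cin that hdisc_subset unfolding B_def by blast
  have Rc: "continuous_on ({0..1} \<times> B) (\<lambda>p. R (fst p) (snd p))"
    unfolding R_def
  proof (rule continuous_on_compose2[OF gc])
    have "continuous_on B (cay \<i>)"
      using cay_holomorphic[OF i_in] hdisc_subset continuous_on_subset holomorphic_on_imp_continuous_on by (metis B_def)
    then have "continuous_on ({0..1} \<times> B) (\<lambda>p. cay \<i> (snd p))"
      by (rule continuous_on_compose2) (auto intro: continuous_intros)
    then show "continuous_on ({0..1} \<times> B) (\<lambda>x. cis (2 * pi * fst x) * cay \<i> (snd x))"
      unfolding cis_conv_exp by (intro continuous_intros)
  qed (use cinB in auto)
  have rot: "(LINT w:B|hyp_area. R s w) = I" for s
  proof -
    obtain k where k: "k \<in> carrier PSL2R" "\<And>w. w \<in> \<HH> \<Longrightarrow> cay \<i> (act k w) = cis (2 * (pi * s)) * cay \<i> w"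
      using act_rotation by blast
    have fix_i: "act k \<i> = \<i>"
    proof -
      have "cay_inv \<i> (cay \<i> (act k \<i>)) = cay_inv \<i> 0" using k(2)[OF i_in] by (simp add: cay_self)
      then show ?thesis by (simp add: cay_inv_cay act_closed[OF k(1)] cay_inv_0)
    qed
    have "R s w = h (act k w)" if "w \<in> \<HH>" for w
    proof -
      have "R s w = h (cay_inv \<i> (cay \<i> (act k w)))" using k(2)[OF that] by (simp add: R_def g_def mult_ac)
      then show ?thesis by (simp add: cay_inv_cay act_closed[OF k(1) that])
    qed
    then have "(LINT w:B|hyp_area. R s w) = (LINT w:B|hyp_area. h (act k w))"
      using hdisc_subset unfolding set_lebesgue_integral_def B_def
      by (intro Bochner_Integration.integral_cong) (auto simp: indicator_def)
    also have "\<dots> = I" unfolding I_def B_def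
      using set_integral_act[OF k(1) i_in hc, of t] by (simp add: fix_i)
    finally show ?thesis .
  qed
  define H where "H s w = indicator {0..1} s *\<^sub>R (indicator B w *\<^sub>R R s w)" for s w
  have circ: "(LINT s|lborel. H s w) = indicator B w *\<^sub>R h \<i>" for w
  proof (cases "w \<in> B")
    case True
    then have w: "w \<in> \<HH>" using hdisc_subset by (auto simp: B_def)
    have "continuous_on {0..1::real} (\<lambda>s. (s, w))" by (intro continuous_intros)
    from continuous_on_compose2[OF Rc this] True have "continuous_on {0..1} (\<lambda>s. R s w)" by auto
    then have "set_integrable lborel {0..1} (\<lambda>s. R s w)" by (rule borel_integrable_atLeastAtMost')
    then have "(LINT s:{0..1}|lborel. R s w) = integral {0..1} (\<lambda>s. R s w)"
      by (rule set_borel_integral_eq_integral)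
    moreover have "((\<lambda>s. R s w) has_integral g 0) {0..1}"
      unfolding R_def by (rule mean_over_circle[OF g]) (rule cmod_cay_less_1[OF w i_in])
    ultimately have "(LINT s:{0..1}|lborel. R s w) = g 0" by (simp add: integral_unique)
    then show ?thesis using True by (simp add: H_def set_lebesgue_integral_def g_def cay_inv_0)
  qed (simp add: H_def)
  interpret P: pair_sigma_finite lborel hyp_area
    by (simp add: pair_sigma_finite_def sigma_finite_hyp_area sigma_finite_lborel)
  have int: "integrable (lborel \<Otimes>\<^sub>M hyp_area) (\<lambda>(s, w). H s w)"
  proof -
    obtain K where K: "compact K" "B \<subseteq> K" "K \<subseteq> \<HH>" using hdisc_subset_compact[OF i_in t(1)] by (auto simp: B_def)
    obtain C where C: "\<And>s w. s \<in> {0..1} \<Longrightarrow> w \<in> B \<Longrightarrow> norm (R s w) \<le> C"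
    proof -
      have "cball 0 (sqrt (1 - t)) \<subseteq> (ball 0 1 :: complex set)"
        using t by (simp add: cball_subset_ball_iff)
      then have "compact (g ` cball 0 (sqrt (1 - t)))"
        by (intro compact_continuous_image continuous_on_subset[OF gc]) auto
      then obtain C where C: "\<And>x. x \<in> cball 0 (sqrt (1 - t)) \<Longrightarrow> norm (g x) \<le> C"
        using compact_imp_bounded bounded_iff by (metis imageI)
      have "norm (R s w) \<le> C" if "w \<in> B" for s w
      proof -
        have "(cmod (cay \<i> w))\<^sup>2 \<le> 1 - t" using that by (simp add: cmod_cay B_def hdisc_def sech2_commute)
        then have "cmod (cay \<i> w) \<le> sqrt (1 - t)" by (rule real_le_rsqrt)
        then show ?thesis unfolding R_def by (intro C) (simp add: norm_mult)
      qed
      then show ?thesis using that by blast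
    qed
    have "(\<lambda>p. indicator ({0..1::real} \<times> B) p *\<^sub>R R (fst p) (snd p)) \<in> borel_measurable borel"
      using Rc by (intro borel_measurable_continuous_on_indicator) (auto simp: B_def intro!: borel_Times)
    moreover have "(\<lambda>p. indicator ({0..1} \<times> B) p *\<^sub>R R (fst p) (snd p)) = (\<lambda>(s, w). H s w)"
      by (auto simp: H_def indicator_def)
    ultimately have m: "(\<lambda>(s, w). H s w) \<in> borel_measurable (lborel \<Otimes>\<^sub>M hyp_area)"
      by (simp add: borel_prod[symmetric] cong: measurable_cong_sets)
    have "{0..1::real} \<times> B \<in> sets (lborel \<Otimes>\<^sub>M hyp_area)"
      by (rule pair_measureI) (simp_all add: B_def hdisc_borel)
    moreover have "emeasure (lborel \<Otimes>\<^sub>M hyp_area) ({0..1::real} \<times> B) < \<infinity>"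
      by (subst P.M2.emeasure_pair_measure_Times) (auto simp: B_def emeasure_hdisc[OF i_in t])
    ultimately show ?thesis using m
    proof (rule_tac integrableI_bounded_set[where A = "{0..1} \<times> B" and B = C])
      show "AE x in lborel \<Otimes>\<^sub>M hyp_area. x \<in> {0..1} \<times> B \<longrightarrow> norm (case x of (s, w) \<Rightarrow> H s w) \<le> C"
        by (rule AE_I2) (clarsimp simp: H_def C)
      show "AE x in lborel \<Otimes>\<^sub>M hyp_area. x \<notin> {0..1} \<times> B \<longrightarrow> (case x of (s, w) \<Rightarrow> H s w) = 0"
        by (rule AE_I2) (auto simp: H_def indicator_def split: if_splits)
    qed
  qed
  have "(LINT w|hyp_area. (LINT s|lborel. H s w)) = (LINT s|lborel. (LINT w|hyp_area. H s w))"
    by (rule P.Fubini_integral[OF int])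
  also have "(\<lambda>s. LINT w|hyp_area. H s w) = (\<lambda>s. indicator {0..1} s *\<^sub>R I)"
    using rot by (simp add: H_def set_lebesgue_integral_def del: scaleR_scaleR)
  also have "(LINT s|lborel. indicator {0..1::real} s *\<^sub>R I) = I"
    by (subst integral_scaleR_left) auto
  finally have "I = (LINT w|hyp_area. indicator B w *\<^sub>R h \<i>)" by (simp add: circ)
  also have "\<dots> = disc_area t *\<^sub>R h \<i>" using emeasure_hdisc[OF i_in t]
    by (simp add: B_def disc_area_def)
  finally show ?thesis by (simp add: I_def B_def)
qed

lemma mean_value:
  assumes h: "h holomorphic_on \<HH>" and z: "z \<in> \<HH>" and t: "0 < t" "t < 1"
  shows "(LINT w:hdisc t z|hyp_area. h w) = disc_area t *\<^sub>R h z"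
proof -
  obtain g where g: "g \<in> carrier PSL2R" "act g \<i> = z" using act_transitive[OF z] .
  have "(h \<circ> act g) holomorphic_on \<HH>"
    by (rule holomorphic_on_compose_gen[OF act_holomorphic[OF g(1)] h]) (use act_closed[OF g(1)] in auto)
  from mean_value_at_i[OF this t] show ?thesis
    using set_integral_act[OF g(1) i_in holomorphic_on_imp_continuous_on[OF h], of t] g(2) by simp
qed

section \<open>Averages over hyperbolic discs\<close>

definition havg :: "real \<Rightarrow> (complex \<Rightarrow> real) \<Rightarrow> complex \<Rightarrow> real" where
  "havg t f z = (LINT w:hdisc t z|hyp_area. f w) / disc_area t"

locale hdisc_radius =
  fixes t :: real
  assumes t: "0 < t" "t < 1"
begin

lemma disc_area_pos: "disc_area t > 0"
  using emeasure_hdisc(2)[OF i_in t] .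

lemma havg_const: "z \<in> \<HH> \<Longrightarrow> havg t (\<lambda>_. c) z = c"
  using emeasure_hdisc[OF _ t, of z] disc_area_pos
  by (simp add: havg_def set_lebesgue_integral_def measure_def)

lemma havg_add:
  assumes "z \<in> \<HH>" "continuous_on \<HH> f" "continuous_on \<HH> g"
  shows "havg t (\<lambda>w. f w + g w) z = havg t f z + havg t g z"
  using set_integral_add(2)[OF set_integrable_hdisc[OF assms(2,1) t] set_integrable_hdisc[OF assms(3,1) t]]
  by (simp add: havg_def add_divide_distrib)

lemma havg_cmult: "havg t (\<lambda>w. c * f w) z = c * havg t f z"
  by (simp add: havg_def)

lemma havg_sum:
  assumes "z \<in> \<HH>" "\<And>i. i \<in> I \<Longrightarrow> continuous_on \<HH> (f i)"
  shows "havg t (\<lambda>w. \<Sum>i\<in>I. f i w) z = (\<Sum>i\<in>I. havg t (f i) z)"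
  using assms(2)
proof (induction I rule: infinite_finite_induct)
  case (insert i I)
  then show ?case
    using havg_add[OF assms(1), of "f i" "\<lambda>w. \<Sum>i\<in>I. f i w"] by (simp add: continuous_on_sum)
qed (use havg_const[OF assms(1), of 0] in simp_all)

lemma havg_mono:
  assumes "z \<in> \<HH>" "continuous_on \<HH> f" "continuous_on \<HH> g" "\<And>w. w \<in> hdisc t z \<Longrightarrow> f w \<le> g w"
  shows "havg t f z \<le> havg t g z"
  unfolding havg_def
  by (intro divide_right_mono set_integral_mono set_integrable_hdisc assms t) (use disc_area_pos in auto)

lemma havg_cong:
  assumes "\<And>w. w \<in> hdisc t z \<Longrightarrow> f w = g w"
  shows "havg t f z = havg t g z"
proof -
  have "(\<lambda>w. indicator (hdisc t z) w *\<^sub>R f w) = (\<lambda>w. indicator (hdisc t z) w *\<^sub>R g w)"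
    using assms by (auto simp: indicator_def)
  then show ?thesis by (simp add: havg_def set_lebesgue_integral_def)
qed

lemma havg_Re_holomorphic:
  assumes h: "h holomorphic_on \<HH>" and z: "z \<in> \<HH>"
  shows "havg t (\<lambda>w. Re (h w)) z = Re (h z)"
proof -
  have "set_integrable hyp_area (hdisc t z) h"
    by (rule set_integrable_hdisc[OF holomorphic_on_imp_continuous_on[OF h] z t])
  then have "(LINT w:hdisc t z|hyp_area. Re (h w)) = Re (LINT w:hdisc t z|hyp_area. h w)"
    by (simp add: set_lebesgue_integral_def set_integrable_def flip: integral_Re)
  then show ?thesis using mean_value[OF h z t] disc_area_pos by (simp add: havg_def)
qed

text \<open>Expand \<open>\<bar>h z + (h w - h z)\<bar>\<^sup>2\<close>: the mixed term is the
  real part of a holomorphic function vanishing at \<open>z\<close>.\<close>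

lemma havg_norm_square:
  assumes h: "h holomorphic_on \<HH>" and z: "z \<in> \<HH>"
  shows "havg t (\<lambda>w. (cmod (h w))\<^sup>2) z = (cmod (h z))\<^sup>2 + havg t (\<lambda>w. (cmod (h w - h z))\<^sup>2) z"
proof -
  have hc: "continuous_on \<HH> h" by (rule holomorphic_on_imp_continuous_on[OF h])
  define k where "k w = 2 * cnj (h z) * (h w - h z)" for w
  have k: "k holomorphic_on \<HH>" unfolding k_def by (intro holomorphic_intros h)
  have "(\<lambda>w. (cmod (h w))\<^sup>2) = (\<lambda>w. ((cmod (h z))\<^sup>2 + (cmod (h w - h z))\<^sup>2) + Re (k w))"
    by (rule ext, unfold k_def cmod_power2) (simp add: power2_eq_square algebra_simps)
  then have "havg t (\<lambda>w. (cmod (h w))\<^sup>2) z = havg t (\<lambda>w. ((cmod (h z))\<^sup>2 + (cmod (h w - h z))\<^sup>2) + Re (k w)) z"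
    by simp
  also have "\<dots> = havg t (\<lambda>w. (cmod (h z))\<^sup>2 + (cmod (h w - h z))\<^sup>2) z + havg t (\<lambda>w. Re (k w)) z"
    by (rule havg_add[OF z]) (intro continuous_intros hc holomorphic_on_imp_continuous_on[OF k])+
  also have "havg t (\<lambda>w. (cmod (h z))\<^sup>2 + (cmod (h w - h z))\<^sup>2) z = (cmod (h z))\<^sup>2 + havg t (\<lambda>w. (cmod (h w - h z))\<^sup>2) z"
    using havg_add[OF z, of "\<lambda>_. (cmod (h z))\<^sup>2" "\<lambda>w. (cmod (h w - h z))\<^sup>2"]
    by (simp add: havg_const[OF z] continuous_intros hc)
  also have "havg t (\<lambda>w. Re (k w)) z = 0" using havg_Re_holomorphic[OF k z] by (simp add: k_def)
  finally show ?thesis by simp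
qed

lemma havg_nonneg:
  assumes "\<And>w. w \<in> hdisc t z \<Longrightarrow> 0 \<le> f w" shows "0 \<le> havg t f z"
  unfolding havg_def set_lebesgue_integral_def using disc_area_pos
  by (intro divide_nonneg_pos Bochner_Integration.integral_nonneg) (use assms in \<open>auto simp: indicator_def\<close>)

lemma havg_eq_0_imp:
  assumes f: "continuous_on \<HH> f" and z: "z \<in> \<HH>" and nonneg: "\<And>w. w \<in> \<HH> \<Longrightarrow> 0 \<le> f w"
    and eq: "havg t f z = 0" and w: "w \<in> hdisc t z"
  shows "f w = 0"
proof (rule ccontr)
  assume "f w \<noteq> 0"
  define U where "U = {w \<in> hdisc t z. f w \<noteq> 0}"
  have "U = f -` (- {0}) \<inter> hdisc t z" by (auto simp: U_def)
  moreover have "open (f -` (- {0}) \<inter> hdisc t z)"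
    using continuous_on_subset[OF f hdisc_subset] continuous_on_open_vimage[OF open_hdisc[OF z]]
    by (metis open_Compl closed_singleton)
  ultimately have "open U" by simp
  moreover have "w \<in> U" using \<open>f w \<noteq> 0\<close> w by (simp add: U_def)
  moreover have "U \<subseteq> \<HH>" using hdisc_subset by (auto simp: U_def)
  ultimately have pos: "emeasure hyp_area U > 0" by (intro emeasure_open_pos) auto
  have int: "set_integrable hyp_area (hdisc t z) f" by (rule set_integrable_hdisc[OF f z t])
  have "(LINT w|hyp_area. indicator (hdisc t z) w *\<^sub>R f w) = 0"
    using eq disc_area_pos by (simp add: havg_def set_lebesgue_integral_def)
  then have "AE w in hyp_area. indicator (hdisc t z) w *\<^sub>R f w = 0"
  proof (subst (asm) integral_nonneg_eq_0_iff_AE[OF int[unfolded set_integrable_def]])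
    show "AE w in hyp_area. 0 \<le> indicator (hdisc t z) w *\<^sub>R f w"
      using nonneg hdisc_subset by (intro AE_I2) (auto simp: indicator_def)
  qed
  then have "AE w in hyp_area. w \<notin> U" by eventually_elim (auto simp: U_def)
  then have "emeasure hyp_area U = 0"
    using \<open>open U\<close> by (subst (asm) AE_iff_measurable[OF _ refl]) auto
  then show False using pos by simp
qed

definition disc_kernel :: "real \<Rightarrow> ennreal" where
  "disc_kernel x = indicator {t<..} x * ennreal (1 / disc_area t)"

lemma disc_kernel_measurable [measurable]: "disc_kernel \<in> borel_measurable borel"
  unfolding disc_kernel_def by measurable

text \<open>Disc averages of nonnegative functions, written with a kernel so that
  \<open>integral_kernel\<close> applies.\<close>

lemma havg_eq_kernel_integral:
  assumes z: "z \<in> \<HH>" and f: "continuous_on \<HH> f" and nonneg: "\<And>w. w \<in> \<HH> \<Longrightarrow> 0 \<le> f w"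
  shows "(\<integral>\<^sup>+w. disc_kernel (sech2 z w) * ennreal (indicator \<HH> w *\<^sub>R f w) \<partial>hyp_area) = ennreal (havg t f z)"
proof -
  have int: "integrable hyp_area (\<lambda>w. indicator (hdisc t z) w *\<^sub>R f w)"
    using set_integrable_hdisc[OF f z t] by (simp add: set_integrable_def)
  have "(\<integral>\<^sup>+w. disc_kernel (sech2 z w) * ennreal (indicator \<HH> w *\<^sub>R f w) \<partial>hyp_area)
     = (\<integral>\<^sup>+w. ennreal (1 / disc_area t) * ennreal (indicator (hdisc t z) w *\<^sub>R f w) \<partial>hyp_area)"
    by (rule nn_integral_hyp_cong) (simp add: disc_kernel_def hdisc_def indicator_def)
  also have "\<dots> = ennreal (1 / disc_area t) * (\<integral>\<^sup>+w. ennreal (indicator (hdisc t z) w *\<^sub>R f w) \<partial>hyp_area)"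
    using int by (intro nn_integral_cmult) auto
  also have "(\<integral>\<^sup>+w. ennreal (indicator (hdisc t z) w *\<^sub>R f w) \<partial>hyp_area)
      = ennreal (LINT w|hyp_area. indicator (hdisc t z) w *\<^sub>R f w)"
    using nonneg hdisc_subset by (intro nn_integral_eq_integral[OF int] AE_I2) (auto simp: indicator_def)
  finally show ?thesis using disc_area_pos
    by (simp add: havg_def set_lebesgue_integral_def divide_inverse mult.commute flip: ennreal_mult')
qed

lemma havg_measurable:
  assumes f: "continuous_on \<HH> f" and nonneg: "\<And>w. w \<in> \<HH> \<Longrightarrow> 0 \<le> f w"
  shows "(\<lambda>z. indicator \<HH> z *\<^sub>R havg t f z) \<in> borel_measurable borel"
proof -
  interpret sigma_finite_measure hyp_area by (rule sigma_finite_hyp_area)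
  have "(\<lambda>w. indicator \<HH> w *\<^sub>R f w) \<in> borel_measurable borel"
    using f by (intro borel_measurable_continuous_on_indicator) auto
  then have m: "(\<lambda>w. ennreal (indicator \<HH> w *\<^sub>R f w)) \<in> borel_measurable borel" by measurable
  have "(\<lambda>p. disc_kernel (sech2 (fst p) (snd p)) * ennreal (indicator \<HH> (snd p) *\<^sub>R f (snd p)))
      \<in> borel_measurable (borel \<Otimes>\<^sub>M hyp_area)"
    using measurable_compose[OF measurable_snd m] by measurable
  from borel_measurable_nn_integral_fst[OF this]
  have "(\<lambda>z. indicator \<HH> z * enn2real (\<integral>\<^sup>+w. disc_kernel (sech2 z w) * ennreal (indicator \<HH> w *\<^sub>R f w) \<partial>hyp_area)) \<in> borel_measurable borel"
    by simp
  moreover have "indicator \<HH> z * enn2real (\<integral>\<^sup>+w. disc_kernel (sech2 z w) * ennreal (indicator \<HH> w *\<^sub>R f w) \<partial>hyp_area)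
      = indicator \<HH> z *\<^sub>R havg t f z" for z
  proof (cases "z \<in> \<HH>")
    case True
    have "0 \<le> havg t f z" by (rule havg_nonneg) (use nonneg hdisc_subset in auto)
    then show ?thesis using havg_eq_kernel_integral[OF True f nonneg] True by simp
  qed simp
  ultimately show ?thesis by (simp only:)
qed

lemma kernel_mass_disc_kernel: "kernel_mass disc_kernel = 1"
proof -
  have "kernel_mass disc_kernel = (\<integral>\<^sup>+w. disc_kernel (sech2 \<i> w) * ennreal (indicator \<HH> w *\<^sub>R 1) \<partial>hyp_area)"
    unfolding kernel_mass_def by (rule nn_integral_hyp_cong) simp
  also have "\<dots> = ennreal (havg t (\<lambda>_. 1) \<i>)" by (rule havg_eq_kernel_integral) auto
  finally show ?thesis by (simp add: havg_const)
qed

end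

lemma borel_measurable_on_upper_half_plane:
  fixes f :: "complex \<Rightarrow> 'b::{banach, second_countable_topology}"
  assumes "continuous_on \<HH> f"
  shows "(\<lambda>w. indicator \<HH> w *\<^sub>R f w) \<in> borel_measurable borel"
  using assms by (intro borel_measurable_continuous_on_indicator) auto

context discontinuous_group
begin

lemma integral_havg:
  assumes "hdisc_radius t" and F: "fundamental_domain \<Gamma> F"
    and f: "continuous_on \<HH> f" and nonneg: "\<And>w. w \<in> \<HH> \<Longrightarrow> 0 \<le> f w" and inv: "invariant f"
  shows "(\<integral>\<^sup>+z. indicator F z * ennreal (havg t f z) \<partial>hyp_area) = (\<integral>\<^sup>+z. indicator F z * ennreal (f z) \<partial>hyp_area)"
proof -
  interpret hdisc_radius t by fact
  define f' where "f' w = ennreal (indicator \<HH> w *\<^sub>R f w)" for w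
  have [measurable]: "f' \<in> borel_measurable borel"
    unfolding f'_def using borel_measurable_on_upper_half_plane[OF f] by measurable
  have inv': "invariant f'" using inv act_closed[OF mem_carrier] by (simp add: invariant_def f'_def)
  have "(\<integral>\<^sup>+z. indicator F z * ennreal (havg t f z) \<partial>hyp_area)
     = (\<integral>\<^sup>+z. indicator F z * (\<integral>\<^sup>+w. disc_kernel (sech2 z w) * f' w \<partial>hyp_area) \<partial>hyp_area)"
    by (rule nn_integral_hyp_cong) (simp only: f'_def havg_eq_kernel_integral[OF _ f nonneg])
  also have "\<dots> = kernel_mass disc_kernel * (\<integral>\<^sup>+w. indicator F w * f' w \<partial>hyp_area)"
    by (rule integral_kernel[OF F _ _ inv']) measurable
  also have "\<dots> = (\<integral>\<^sup>+w. indicator F w * f' w \<partial>hyp_area)" by (simp add: kernel_mass_disc_kernel)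
  also have "\<dots> = (\<integral>\<^sup>+z. indicator F z * ennreal (f z) \<partial>hyp_area)"
    by (rule nn_integral_hyp_cong) (simp add: f'_def)
  finally show ?thesis .
qed

text \<open>Otherwise the half-plane would have area zero.\<close>

lemma fundamental_domain_pos:
  assumes F: "fundamental_domain \<Gamma> F" shows "emeasure hyp_area F > 0"
proof (rule ccontr)
  assume "\<not> emeasure hyp_area F > 0"
  then have 0: "emeasure hyp_area F = 0" by simp
  have [measurable]: "F \<in> sets borel" using F by (rule fundamental_domain_borel)
  then have ae: "AE z in hyp_area. z \<notin> F" using 0 by (intro AE_not_in) (simp add: null_sets_def)
  have "emeasure hyp_area UNIV = (\<integral>\<^sup>+z. 1 \<partial>hyp_area)" by simp
  also have "\<dots> = (\<integral>\<^sup>+z. indicator F z * (\<integral>\<^sup>+\<gamma>. 1 \<partial>count_space \<Gamma>) \<partial>hyp_area)"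
    by (rule unfolding_integral[OF F]) simp
  also have "\<dots> = (\<integral>\<^sup>+z. 0 \<partial>hyp_area)"
    by (rule nn_integral_cong_AE) (use ae in eventually_elim, simp)
  finally show False using emeasure_hyp_area_UNIV by simp
qed

text \<open>If \<open>f\<close> were integrable over \<open>F\<close>, its average would have
  the same integral as \<open>f\<close> itself, hence equal \<open>f\<close> almost everywhere
  in \<open>F\<close>. In general \<open>f\<close> is truncated at height \<open>n + C\<close>.
  Where \<open>f < n\<close> this does not affect the disc averages, since \<open>f\<close>
  oscillates by at most \<open>C\<close> on a disc; elsewhere the average of the truncation is
  too small by at most \<open>C\<close>, and the area of the part of \<open>F\<close> where
  \<open>f \<ge> n\<close> tends to zero.\<close>

lemma subharmonic_somewhere_harmonic:
  assumes rad: "hdisc_radius t" and F: "fundamental_domain \<Gamma> F" and fin: "emeasure hyp_area F < \<infinity>"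
    and f: "continuous_on \<HH> f" and nonneg: "\<And>w. w \<in> \<HH> \<Longrightarrow> 0 \<le> f w" and inv: "invariant f"
    and osc: "\<And>z w. z \<in> \<HH> \<Longrightarrow> w \<in> hdisc t z \<Longrightarrow> f w \<le> f z + C"
    and sub: "\<And>z. z \<in> \<HH> \<Longrightarrow> f z \<le> havg t f z"
  shows "\<exists>z\<in>\<HH>. havg t f z = f z"
proof -
  interpret hdisc_radius t by (rule rad)
  have [measurable]: "F \<in> sets borel" using F by (rule fundamental_domain_borel)
  have FH: "F \<subseteq> \<HH>" using F by (simp add: fundamental_domain_def)
  have C0: "C \<ge> 0" using osc[OF i_in centre_in_hdisc[OF i_in]] t by (simp add: hdisc_radius_def)
  have osc': "f z \<le> f w + C" if "z \<in> \<HH>" "w \<in> hdisc t z" for z w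
    using that osc[of w z] hdisc_subset by (auto simp: hdisc_def sech2_commute)
  define D where "D z = indicator \<HH> z *\<^sub>R (havg t f z - f z)" for z
  have Dm [measurable]: "D \<in> borel_measurable borel" unfolding D_def scaleR_diff_right
    by (intro borel_measurable_diff havg_measurable borel_measurable_on_upper_half_plane f nonneg)
  have D0: "D z \<ge> 0" for z using sub by (simp add: D_def indicator_def)
  define f0 where "f0 z = indicator \<HH> z *\<^sub>R f z" for z
  have f0m [measurable]: "f0 \<in> borel_measurable borel" unfolding f0_def by (rule borel_measurable_on_upper_half_plane[OF f])
  have main: "(\<integral>\<^sup>+z. indicator F z * ennreal (indicator {z. f0 z < real n} z * D z) \<partial>hyp_area)
       \<le> ennreal C * emeasure hyp_area (F \<inter> {z. real n \<le> f0 z})" for n :: nat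
  proof -
    define T where "T = real n + C"
    define g where "g z = min (f z) T" for z
    have g: "continuous_on \<HH> g" unfolding g_def by (intro continuous_intros f)
    have g0: "0 \<le> g z" if "z \<in> \<HH>" for z using nonneg[OF that] C0 by (simp add: g_def T_def)
    have ginv: "invariant g" using inv by (simp add: invariant_def g_def)
    define I where "I = (\<integral>\<^sup>+z. indicator F z * ennreal (g z) \<partial>hyp_area)"
    have "I \<le> (\<integral>\<^sup>+z. ennreal T * indicator F z \<partial>hyp_area)" unfolding I_def
      by (intro nn_integral_mono) (auto simp: indicator_def g_def intro!: ennreal_leI)
    also have "\<dots> = ennreal T * emeasure hyp_area F" by (simp add: nn_integral_cmult)
    also have "\<dots> < \<infinity>" using fin by (simp add: ennreal_mult_less_top)
    finally have Ifin: "I \<noteq> \<infinity>" by simp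
    have pw: "g z + indicator {z. f0 z < real n} z * D z \<le> havg t g z + C * indicator {z. real n \<le> f0 z} z"
      if z: "z \<in> \<HH>" for z
    proof (cases "f z < real n")
      case True
      have "g w = f w" if "w \<in> hdisc t z" for w
        using osc[OF z that] True by (simp add: g_def T_def)
      then have "havg t g z = havg t f z" by (rule havg_cong)
      moreover have "g z = f z" using True C0 by (simp add: g_def T_def)
      ultimately show ?thesis using z True by (simp add: D_def f0_def)
    next
      case False
      have "g z - C \<le> g w" if "w \<in> hdisc t z" for w
        using osc'[OF z that] C0 by (auto simp: g_def min_def)
      then have "havg t (\<lambda>_. g z - C) z \<le> havg t g z" by (intro havg_mono z g) auto
      then show ?thesis using z False by (simp add: havg_const f0_def)
    qed
    have gm: "(\<lambda>z. ennreal (indicator \<HH> z *\<^sub>R g z)) \<in> borel_measurable borel"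
      using borel_measurable_on_upper_half_plane[OF g] by measurable
    have I_eq: "I = (\<integral>\<^sup>+z. indicator F z * ennreal (indicator \<HH> z *\<^sub>R g z) \<partial>hyp_area)"
      unfolding I_def by (rule nn_integral_hyp_cong) simp
    have "I + (\<integral>\<^sup>+z. indicator F z * ennreal (indicator {z. f0 z < real n} z * D z) \<partial>hyp_area)
        = (\<integral>\<^sup>+z. indicator F z * ennreal (indicator \<HH> z *\<^sub>R g z) + indicator F z * ennreal (indicator {z. f0 z < real n} z * D z) \<partial>hyp_area)"
      unfolding I_eq by (rule nn_integral_add[symmetric]) (use gm in measurable)
    also have "\<dots> \<le> (\<integral>\<^sup>+z. indicator F z * ennreal (havg t g z) + ennreal C * indicator (F \<inter> {z. real n \<le> f0 z}) z \<partial>hyp_area)"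
    proof (rule nn_integral_mono)
      fix z
      show "indicator F z * ennreal (indicator \<HH> z *\<^sub>R g z) + indicator F z * ennreal (indicator {z. f0 z < real n} z * D z)
         \<le> indicator F z * ennreal (havg t g z) + ennreal C * indicator (F \<inter> {z. real n \<le> f0 z}) z"
      proof (cases "z \<in> F")
        case True
        then have z: "z \<in> \<HH>" using FH by auto
        have a0: "0 \<le> havg t g z" by (rule havg_nonneg) (use g0 hdisc_subset in auto)
        have "ennreal (g z) + ennreal (indicator {z. f0 z < real n} z * D z) = ennreal (g z + indicator {z. f0 z < real n} z * D z)"
          using g0[OF z] D0 by (intro ennreal_plus[symmetric]) auto
        also have "\<dots> \<le> ennreal (havg t g z + C * indicator {z. real n \<le> f0 z} z)" by (intro ennreal_leI pw z)
        also have "\<dots> = ennreal (havg t g z) + ennreal C * indicator {z. real n \<le> f0 z} z"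
          using a0 C0 by (simp add: ennreal_plus indicator_def)
        finally show ?thesis using True z by (simp add: indicator_def)
      qed simp
    qed
    also have "\<dots> = I + ennreal C * emeasure hyp_area (F \<inter> {z. real n \<le> f0 z})"
    proof -
      have "(\<lambda>z. indicator F z * ennreal (havg t g z)) \<in> borel_measurable hyp_area"
      proof -
        have "(\<lambda>z. indicator F z * ennreal (indicator \<HH> z *\<^sub>R havg t g z)) \<in> borel_measurable hyp_area"
          using havg_measurable[OF g g0] by measurable
        moreover have "(\<lambda>z. indicator F z * ennreal (indicator \<HH> z *\<^sub>R havg t g z)) = (\<lambda>z. indicator F z * ennreal (havg t g z))"
          using FH by (auto simp: indicator_def fun_eq_iff)
        ultimately show ?thesis by simp
      qed
      then have "(\<integral>\<^sup>+z. indicator F z * ennreal (havg t g z) + ennreal C * indicator (F \<inter> {z. real n \<le> f0 z}) z \<partial>hyp_area)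
         = (\<integral>\<^sup>+z. indicator F z * ennreal (havg t g z) \<partial>hyp_area) + (\<integral>\<^sup>+z. ennreal C * indicator (F \<inter> {z. real n \<le> f0 z}) z \<partial>hyp_area)"
      proof (rule nn_integral_add)
        have "{z. real n \<le> f0 z} \<in> sets borel" by measurable
        then have [measurable]: "F \<inter> {z. real n \<le> f0 z} \<in> sets borel" by auto
        show "(\<lambda>z. ennreal C * indicator (F \<inter> {z. real n \<le> f0 z}) z) \<in> borel_measurable hyp_area" by measurable
      qed
      also have "(\<integral>\<^sup>+z. indicator F z * ennreal (havg t g z) \<partial>hyp_area) = I"
        unfolding I_def by (rule integral_havg[OF rad F g g0 ginv])
      finally show ?thesis by (simp add: nn_integral_cmult)
    qed
    finally show ?thesis using Ifin by simp
  qed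
  have lim0: "(\<lambda>n. ennreal C * emeasure hyp_area (F \<inter> {z. real n \<le> f0 z})) \<longlonglongrightarrow> 0"
  proof -
    have "(\<lambda>n. emeasure hyp_area (F \<inter> {z. real n \<le> f0 z})) \<longlonglongrightarrow> emeasure hyp_area (\<Inter>n. F \<inter> {z. real n \<le> f0 z})"
    proof (rule Lim_emeasure_decseq)
      show "decseq (\<lambda>n. F \<inter> {z. real n \<le> f0 z})" by (auto simp: decseq_def)
      show "emeasure hyp_area (F \<inter> {z. real n \<le> f0 z}) \<noteq> \<infinity>" for n
        using fin emeasure_mono[of "F \<inter> {z. real n \<le> f0 z}" F hyp_area] by (auto simp: top_unique)
    qed auto
    moreover have "(\<Inter>n. F \<inter> {z. real n \<le> f0 z}) = {}"
    proof -
      have "\<exists>n. \<not> real n \<le> f0 z" for z using reals_Archimedean2[of "f0 z"] by (auto simp: not_le)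
      then show ?thesis by blast
    qed
    ultimately have "(\<lambda>n. emeasure hyp_area (F \<inter> {z. real n \<le> f0 z})) \<longlonglongrightarrow> 0" by simp
    from tendsto_mult_ennreal[OF tendsto_const this, of "ennreal C"] show ?thesis by simp
  qed
  have "(\<integral>\<^sup>+z. indicator F z * ennreal (indicator {z. f0 z < real m} z * D z) \<partial>hyp_area) = 0" for m :: nat
  proof -
    have "(\<integral>\<^sup>+z. indicator F z * ennreal (indicator {z. f0 z < real m} z * D z) \<partial>hyp_area)
       \<le> ennreal C * emeasure hyp_area (F \<inter> {z. real n \<le> f0 z})" if "m \<le> n" for n
    proof -
      have "(\<integral>\<^sup>+z. indicator F z * ennreal (indicator {z. f0 z < real m} z * D z) \<partial>hyp_area)
         \<le> (\<integral>\<^sup>+z. indicator F z * ennreal (indicator {z. f0 z < real n} z * D z) \<partial>hyp_area)"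
        using that D0 by (intro nn_integral_mono mult_left_mono ennreal_leI) (auto simp: indicator_def)
      then show ?thesis using main[of n] by (rule order_trans)
    qed
    then have "(\<integral>\<^sup>+z. indicator F z * ennreal (indicator {z. f0 z < real m} z * D z) \<partial>hyp_area) \<le> 0"
      by (intro LIMSEQ_le_const[OF lim0]) blast
    then show ?thesis by simp
  qed
  then have "AE z in hyp_area. indicator F z * ennreal (indicator {z. f0 z < real m} z * D z) = 0" for m :: nat
    by (subst (asm) nn_integral_0_iff_AE) auto
  then have ae: "AE z in hyp_area. \<forall>m::nat. indicator F z * ennreal (indicator {z. f0 z < real m} z * D z) = 0"
    by (subst AE_all_countable) blast
  have "\<not> (AE z in hyp_area. z \<notin> F)"
    using fundamental_domain_pos[OF F] by (simp add: AE_iff_null_sets[symmetric] null_sets_def)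
  then obtain z where z: "z \<in> F" "\<And>m::nat. indicator F z * ennreal (indicator {z. f0 z < real m} z * D z) = 0"
  proof -
    assume *: "\<not> (AE z in hyp_area. z \<notin> F)"
    have "\<exists>z. z \<in> F \<and> (\<forall>m::nat. indicator F z * ennreal (indicator {z. f0 z < real m} z * D z) = 0)"
    proof (rule ccontr)
      assume "\<not> ?thesis"
      then have "AE z in hyp_area. z \<notin> F" using ae by (auto elim!: eventually_mono)
      then show False using * by simp
    qed
    then show ?thesis using that by blast
  qed
  obtain m :: nat where "f0 z < real m" using reals_Archimedean2 by blast
  then have "D z = 0" using z(2)[of m] z(1) D0[of z] by (simp add: ennreal_eq_0_iff)
  then show ?thesis using z(1) FH by (intro bexI[of _ z]) (auto simp: D_def)
qed

end

section \<open>Uniqueness of the equivariant map\<close>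

lemma ln_one_minus_series:
  fixes x :: complex
  assumes "cmod x < 1"
  shows "(\<lambda>n. Re (x ^ n) / real n) sums (- ln (cmod (1 - x)))"
proof -
  have "(\<lambda>n. (-1) ^ Suc n / of_nat n * (- x) ^ n) sums Ln (1 + (- x))"
    by (rule Ln_series) (use assms in simp)
  moreover have "(\<lambda>n. (-1) ^ Suc n / of_nat n * (- x) ^ n) = (\<lambda>n. - (x ^ n / of_nat n))"
  proof
    fix n
    have "(-1) ^ n * (- x) ^ n = x ^ n" by (simp flip: power_mult_distrib)
    then show "(-1) ^ Suc n / of_nat n * (- x) ^ n = - (x ^ n / of_nat n)"
      by (metis mult_minus1 power_Suc minus_divide_left mult_minus_left times_divide_eq_left)
  qed
  ultimately have "(\<lambda>n. - (x ^ n / of_nat n)) sums Ln (1 - x)" by simp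
  then have "(\<lambda>n. x ^ n / of_nat n) sums (- Ln (1 - x))" using sums_minus by fastforce
  then have "(\<lambda>n. Re (x ^ n / of_nat n)) sums Re (- Ln (1 - x))" by (rule sums_Re)
  moreover have "1 - x \<noteq> 0" using assms by auto
  ultimately show ?thesis by simp
qed

lemma sech2_cay:
  assumes p: "p \<in> \<HH>" and q: "q \<in> \<HH>"
  shows "sech2 p q = (1 - (cmod (cay \<i> p))\<^sup>2) * (1 - (cmod (cay \<i> q))\<^sup>2) / (cmod (1 - cay \<i> p * cnj (cay \<i> q)))\<^sup>2"
proof -
  have nz: "p + \<i> \<noteq> 0" "q + \<i> \<noteq> 0" using cnj_diff_nonzero[OF p i_in] cnj_diff_nonzero[OF q i_in] by simp_all
  have nzc: "cnj q - \<i> \<noteq> 0" using nz(2) by (metis complex_cnj_add complex_cnj_i complex_cnj_zero_iff diff_conv_add_uminus)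
  have one: "1 - (cmod (cay \<i> u))\<^sup>2 = 4 * Im u / (cmod (u + \<i>))\<^sup>2" if "u \<in> \<HH>" for u
    using cmod_cay[OF that i_in] by (simp add: sech2_def)
  have "1 - cay \<i> p * cnj (cay \<i> q) = ((p + \<i>) * (cnj q - \<i>) - (p - \<i>) * (cnj q + \<i>)) / ((p + \<i>) * (cnj q - \<i>))"
  proof -
    have "1 - (a / b) * (c / d) = (b * d - a * c) / (b * d)" if "b \<noteq> 0" "d \<noteq> 0" for a b c d :: complex
      using that by (simp add: diff_divide_distrib)
    from this[OF nz(1) nzc, of "p - \<i>" "cnj q + \<i>"] show ?thesis by (simp add: cay_def)
  qed
  also have "(p + \<i>) * (cnj q - \<i>) - (p - \<i>) * (cnj q + \<i>) = - 2 * \<i> * (p - cnj q)"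
    by (simp add: algebra_simps)
  finally have "cmod (1 - cay \<i> p * cnj (cay \<i> q)) = 2 * cmod (p - cnj q) / (cmod (p + \<i>) * cmod (cnj q - \<i>))"
    by (simp add: norm_divide norm_mult)
  moreover have "cmod (cnj q - \<i>) = cmod (q + \<i>)"
    by (metis complex_cnj_add complex_cnj_i complex_mod_cnj diff_conv_add_uminus)
  ultimately have d: "(cmod (1 - cay \<i> p * cnj (cay \<i> q)))\<^sup>2 = 4 * (cmod (p - cnj q))\<^sup>2 / ((cmod (p + \<i>))\<^sup>2 * (cmod (q + \<i>))\<^sup>2)"
    by (simp add: power_divide power_mult_distrib)
  have "cmod (p + \<i>) \<noteq> 0" "cmod (q + \<i>) \<noteq> 0" using nz by auto
  then show ?thesis unfolding one[OF p] one[OF q] d by (simp add: sech2_def)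
qed

text \<open>Take logarithms in \<open>sech2_cay\<close> and expand each factor: with
  \<open>P\<close>, \<open>Q\<close> the images of \<open>p\<close>, \<open>q\<close> in the
  disc, the \<open>n\<close>-th terms combine to \<open>\<bar>P\<^sup>n\<bar>\<^sup>2 +
  \<bar>Q\<^sup>n\<bar>\<^sup>2 - 2 Re (P\<^sup>n cnj Q\<^sup>n)\<close>. The term for \<open>n
  = 0\<close> is a division by zero and hence zero.\<close>

lemma ln_sech2_series:
  assumes p: "p \<in> \<HH>" and q: "q \<in> \<HH>"
  shows "(\<lambda>n. (cmod (cay \<i> p ^ n - cay \<i> q ^ n))\<^sup>2 / real n) sums (- ln (sech2 p q))"
proof -
  define P Q where "P = cay \<i> p" and "Q = cay \<i> q"
  have PQ: "cmod P < 1" "cmod Q < 1" using cmod_cay_less_1 p q by (auto simp: P_def Q_def)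
  have sq: "(cmod x)\<^sup>2 < 1" if "cmod x < 1" for x using that by (simp add: abs_square_less_1)
  have a: "cmod (of_real ((cmod P)\<^sup>2)) < 1" "cmod (of_real ((cmod Q)\<^sup>2)) < 1" using sq PQ by (simp_all add: norm_power)
  have b: "cmod (P * cnj Q) < 1"
  proof -
    have "cmod P * cmod Q \<le> cmod P * 1" using PQ by (intro mult_left_mono) auto
    then show ?thesis using PQ by (simp add: norm_mult)
  qed
  have "(\<lambda>n. Re (of_real ((cmod P)\<^sup>2) ^ n) / real n + Re (of_real ((cmod Q)\<^sup>2) ^ n) / real n - 2 * (Re ((P * cnj Q) ^ n) / real n))
     sums (- ln (cmod (1 - of_real ((cmod P)\<^sup>2))) + - ln (cmod (1 - of_real ((cmod Q)\<^sup>2))) - 2 * (- ln (cmod (1 - P * cnj Q))))"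
    by (intro sums_diff sums_add sums_mult ln_one_minus_series a b)
  moreover have "Re (of_real ((cmod P)\<^sup>2) ^ n) / real n + Re (of_real ((cmod Q)\<^sup>2) ^ n) / real n - 2 * (Re ((P * cnj Q) ^ n) / real n)
     = (cmod (P ^ n - Q ^ n))\<^sup>2 / real n" for n
  proof -
    have gen: "(cmod (x - y))\<^sup>2 = (cmod x)\<^sup>2 + (cmod y)\<^sup>2 - 2 * Re (x * cnj y)" for x y
      unfolding cmod_power2 by (simp add: power2_eq_square algebra_simps)
    have "(cmod (P ^ n - Q ^ n))\<^sup>2 = ((cmod P)\<^sup>2) ^ n + ((cmod Q)\<^sup>2) ^ n - 2 * Re ((P * cnj Q) ^ n)"
      unfolding gen by (simp add: norm_power power_mult_distrib flip: power_mult) (simp add: mult.commute)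
    moreover have "Re (of_real x ^ n) = x ^ n" for x by (metis Re_complex_of_real of_real_power)
    ultimately show ?thesis by (simp add: add_divide_distrib diff_divide_distrib)
  qed
  moreover have "- ln (cmod (1 - of_real ((cmod P)\<^sup>2))) + - ln (cmod (1 - of_real ((cmod Q)\<^sup>2))) - 2 * (- ln (cmod (1 - P * cnj Q)))
     = - ln (sech2 p q)"
  proof -
    have pos: "0 < 1 - (cmod P)\<^sup>2" "0 < 1 - (cmod Q)\<^sup>2" "0 < (cmod (1 - P * cnj Q))\<^sup>2" using sq PQ b by auto
    have "cmod (1 - of_real x) = 1 - x" if "x < 1" for x :: real
      using that by (metis abs_of_pos diff_gt_0_iff_gt norm_of_real of_real_1 of_real_diff)
    moreover have "2 * ln (cmod (1 - P * cnj Q)) = ln ((cmod (1 - P * cnj Q))\<^sup>2)"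
      using pos(3) by (subst ln_realpow) auto
    moreover have "ln (sech2 p q) = ln (1 - (cmod P)\<^sup>2) + ln (1 - (cmod Q)\<^sup>2) - ln ((cmod (1 - P * cnj Q))\<^sup>2)"
      unfolding sech2_cay[OF p q] P_def[symmetric] Q_def[symmetric] using pos
      by (simp add: ln_div ln_mult_pos)
    ultimately show ?thesis using pos by (simp del: of_real_power)
  qed
  ultimately show ?thesis by (simp add: P_def Q_def)
qed

text \<open>Each term of the series is the squared norm of a holomorphic function and has the
  gain of \<open>havg_norm_square\<close>. The gains for \<open>n = 1\<close> and \<open>n =
  2\<close> suffice to determine the maps.\<close>

lemma (in hdisc_radius) havg_ln_sech2_gain:
  assumes p: "p holomorphic_on \<HH>" "p ` \<HH> \<subseteq> \<HH>" and q: "q holomorphic_on \<HH>" "q ` \<HH> \<subseteq> \<HH>" and z: "z \<in> \<HH>"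
  defines "h \<equiv> \<lambda>n w. cay \<i> (p w) ^ n - cay \<i> (q w) ^ n"
  shows "- ln (sech2 (p z) (q z)) + havg t (\<lambda>w. (cmod (h 1 w - h 1 z))\<^sup>2) z + havg t (\<lambda>w. (cmod (h 2 w - h 2 z))\<^sup>2) z / 2
    \<le> havg t (\<lambda>w. - ln (sech2 (p w) (q w))) z"
proof -
  have pin: "p w \<in> \<HH>" "q w \<in> \<HH>" if "w \<in> \<HH>" for w using that p q by auto
  have hol: "h n holomorphic_on \<HH>" for n
  proof -
    have "(cay \<i> \<circ> p) holomorphic_on \<HH>" "(cay \<i> \<circ> q) holomorphic_on \<HH>"
      by (rule holomorphic_on_compose_gen[OF _ cay_holomorphic[OF i_in]]; use p q in auto)+
    then show ?thesis unfolding h_def by (auto simp: comp_def intro!: holomorphic_intros)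
  qed
  have hc: "continuous_on \<HH> (h n)" for n by (rule holomorphic_on_imp_continuous_on[OF hol])
  define D where "D n = havg t (\<lambda>w. (cmod (h n w - h n z))\<^sup>2) z" for n
  have D0: "D n \<ge> 0" for n unfolding D_def by (rule havg_nonneg) simp
  have ser: "(\<lambda>n. (cmod (h n w))\<^sup>2 / real n) sums (- ln (sech2 (p w) (q w)))" if "w \<in> \<HH>" for w
    unfolding h_def by (rule ln_sech2_series) (use pin that in auto)
  have fc: "continuous_on \<HH> (\<lambda>w. - ln (sech2 (p w) (q w)))"
    using sech2_pos pin p q by (intro continuous_intros continuous_on_sech2 holomorphic_on_imp_continuous_on)
      (auto simp: less_imp_neq[symmetric])
  have "(\<Sum>n<N. (cmod (h n z))\<^sup>2 / real n) + D 1 + D 2 / 2 \<le> havg t (\<lambda>w. - ln (sech2 (p w) (q w))) z" if N: "3 \<le> N" for N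
  proof -
    have "(\<Sum>n<N. (cmod (h n z))\<^sup>2 / real n) + D 1 + D 2 / 2 \<le> (\<Sum>n<N. ((cmod (h n z))\<^sup>2 + D n) / real n)"
    proof -
      have "D 1 + D 2 / 2 = (\<Sum>n\<in>{1,2}. D n / real n)" by simp
      also have "\<dots> \<le> (\<Sum>n<N. D n / real n)" using N D0 by (intro sum_mono2) auto
      finally show ?thesis by (simp add: add_divide_distrib sum.distrib)
    qed
    also have "\<dots> = (\<Sum>n<N. havg t (\<lambda>w. (1 / real n) * (cmod (h n w))\<^sup>2) z)"
      unfolding havg_cmult havg_norm_square[OF hol z] D_def by simp
    also have "\<dots> = havg t (\<lambda>w. \<Sum>n<N. (1 / real n) * (cmod (h n w))\<^sup>2) z"
      by (rule havg_sum[OF z, symmetric]) (intro continuous_intros hc)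
    also have "\<dots> \<le> havg t (\<lambda>w. - ln (sech2 (p w) (q w))) z"
    proof (rule havg_mono[OF z _ fc])
      show "continuous_on \<HH> (\<lambda>w. \<Sum>n<N. (1 / real n) * (cmod (h n w))\<^sup>2)" by (intro continuous_intros hc)
      fix w assume "w \<in> hdisc t z"
      then have s: "(\<lambda>n. (cmod (h n w))\<^sup>2 / real n) sums (- ln (sech2 (p w) (q w)))" using ser hdisc_subset by blast
      have "(\<Sum>n<N. (cmod (h n w))\<^sup>2 / real n) \<le> (\<Sum>n. (cmod (h n w))\<^sup>2 / real n)"
        by (rule sum_le_suminf) (use s sums_summable in auto)
      then show "(\<Sum>n<N. (1 / real n) * (cmod (h n w))\<^sup>2) \<le> - ln (sech2 (p w) (q w))"
        using sums_unique[OF s] by simp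
    qed
    finally show ?thesis .
  qed
  moreover have "(\<lambda>N. (\<Sum>n<N. (cmod (h n z))\<^sup>2 / real n) + D 1 + D 2 / 2) \<longlonglongrightarrow> - ln (sech2 (p z) (q z)) + D 1 + D 2 / 2"
    using ser[OF z] unfolding sums_def by (intro tendsto_intros)
  ultimately have "- ln (sech2 (p z) (q z)) + D 1 + D 2 / 2 \<le> havg t (\<lambda>w. - ln (sech2 (p w) (q w))) z"
    by (intro LIMSEQ_le_const2) (auto intro: exI[of _ 3])
  then show ?thesis by (simp add: D_def)
qed

text \<open>The function \<open>f = - ln (sech2 (p _) (q _))\<close> is invariant and
  subharmonic. By the Schwarz-Pick lemma it has bounded oscillation on discs, so
  \<open>subharmonic_somewhere_harmonic\<close> gives a point with no gain, so that \<open>P - Q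
  = c\<close> and \<open>P\<^sup>2 - Q\<^sup>2\<close> are constant; if \<open>c\<close> were
  not zero, \<open>P + Q\<close> and hence \<open>P\<close> would be constant.\<close>

lemma (in discontinuous_group) equivariant_map_unique:
  assumes F: "fundamental_domain \<Gamma> F" and fin: "emeasure hyp_area F < \<infinity>"
    and p: "p holomorphic_on \<HH>" "p ` \<HH> \<subseteq> \<HH>" and q: "q holomorphic_on \<HH>" "q ` \<HH> \<subseteq> \<HH>"
    and \<rho>: "\<And>\<gamma>. \<gamma> \<in> \<Gamma> \<Longrightarrow> \<rho> \<gamma> \<in> carrier PSL2R"
    and peq: "\<And>\<gamma> z. \<gamma> \<in> \<Gamma> \<Longrightarrow> z \<in> \<HH> \<Longrightarrow> p (act \<gamma> z) = act (\<rho> \<gamma>) (p z)"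
    and qeq: "\<And>\<gamma> z. \<gamma> \<in> \<Gamma> \<Longrightarrow> z \<in> \<HH> \<Longrightarrow> q (act \<gamma> z) = act (\<rho> \<gamma>) (q z)"
    and nonconst: "\<not> p constant_on \<HH>" and z: "z \<in> \<HH>"
  shows "p z = q z"
proof -
  have rad: "hdisc_radius (1/2)" by (simp add: hdisc_radius_def)
  interpret hdisc_radius "1/2" by (rule rad)
  have pin: "p w \<in> \<HH>" "q w \<in> \<HH>" if "w \<in> \<HH>" for w using that p q by auto
  define f where "f w = - ln (sech2 (p w) (q w))" for w
  have f0: "0 \<le> f w" if "w \<in> \<HH>" for w
    using sech2_pos[of "p w" "q w"] sech2_le_1[of "p w" "q w"] pin[OF that] by (simp add: f_def)
  have fc: "continuous_on \<HH> f" unfolding f_def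
    using sech2_pos pin p q by (intro continuous_intros continuous_on_sech2 holomorphic_on_imp_continuous_on)
      (auto simp: less_imp_neq[symmetric])
  have finv: "invariant f"
    unfolding invariant_def f_def using peq qeq \<rho> pin by (simp add: sech2_act)
  define h where "h n w = cay \<i> (p w) ^ n - cay \<i> (q w) ^ n" for n :: nat and w
  have gain: "f z + havg (1/2) (\<lambda>w. (cmod (h 1 w - h 1 z))\<^sup>2) z + havg (1/2) (\<lambda>w. (cmod (h 2 w - h 2 z))\<^sup>2) z / 2
      \<le> havg (1/2) f z" if "z \<in> \<HH>" for z
    unfolding f_def[abs_def] h_def by (rule havg_ln_sech2_gain[OF p q that])
  have nn: "0 \<le> havg (1/2) (\<lambda>w. (cmod (h n w - h n z))\<^sup>2) z" for n z by (rule havg_nonneg) simp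
  \<comment> \<open>Passing from \<open>(p z, q z)\<close> to \<open>(p w, q w)\<close> in two
    steps, each step costs a factor \<open>4\<close> from \<open>sech2_quasi_triangle\<close>
    and a factor \<open>2\<close> from the size of the disc; the bound is \<open>8\<^sup>2 =
    64\<close>.\<close>
  have osc: "f w \<le> f z + ln 64" if zw: "z \<in> \<HH>" "w \<in> hdisc (1/2) z" for z w
  proof -
    have w: "w \<in> \<HH>" "1/2 < sech2 z w" using zw by (auto simp: hdisc_def)
    have pw: "1/2 \<le> sech2 (p w) (p z)" using schwarz_pick[OF p zw(1) w(1)] w(2) by (simp add: sech2_commute)
    have qw: "1/2 \<le> sech2 (q z) (q w)" using schwarz_pick[OF q zw(1) w(1)] w(2) by simp
    note pos = sech2_pos[OF pin(1)[OF zw(1)] pin(2)[OF zw(1)]] sech2_pos[OF pin(1)[OF w(1)] pin(2)[OF w(1)]]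
    have 1: "sech2 (p w) (p z) * sech2 (p z) (q w) \<le> 4 * sech2 (p w) (q w)"
      by (rule sech2_quasi_triangle) (use pin zw w in auto)
    have 2: "sech2 (p z) (q z) * sech2 (q z) (q w) \<le> 4 * sech2 (p z) (q w)"
      by (rule sech2_quasi_triangle) (use pin zw w in auto)
    have "sech2 (p z) (q z) * (1/2) \<le> sech2 (p z) (q z) * sech2 (q z) (q w)" using qw pos by (intro mult_left_mono) auto
    then have a: "sech2 (p z) (q z) \<le> 8 * sech2 (p z) (q w)" using 2 by simp
    have "(1/2) * sech2 (p z) (q w) \<le> sech2 (p w) (p z) * sech2 (p z) (q w)"
      using pw sech2_pos[OF pin(1)[OF zw(1)] pin(2)[OF w(1)]] by (intro mult_right_mono) auto
    then have "sech2 (p z) (q z) \<le> 64 * sech2 (p w) (q w)" using 1 a by simp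
    then have "ln (sech2 (p z) (q z)) \<le> ln (64 * sech2 (p w) (q w))" using pos by (subst ln_le_cancel_iff) auto
    then show ?thesis using pos by (simp add: f_def ln_mult_pos)
  qed
  have "\<exists>z\<in>\<HH>. havg (1/2) f z = f z"
  proof (rule subharmonic_somewhere_harmonic[OF rad F fin fc f0 finv osc])
    fix z assume "z \<in> \<HH>"
    then show "f z \<le> havg (1/2) f z" using gain[of z] nn[of 1 z] nn[of 2 z] by linarith
  qed
  then obtain z0 where z0: "z0 \<in> \<HH>" "havg (1/2) f z0 = f z0" by blast
  have hol: "(\<lambda>w. cay \<i> (p w)) holomorphic_on \<HH>" "(\<lambda>w. cay \<i> (q w)) holomorphic_on \<HH>"
    using holomorphic_on_compose_gen[OF p(1) cay_holomorphic[OF i_in] p(2)]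
      holomorphic_on_compose_gen[OF q(1) cay_holomorphic[OF i_in] q(2)] by (auto simp: comp_def)
  have hh: "h n holomorphic_on \<HH>" for n unfolding h_def by (intro holomorphic_intros hol)
  have const: "h n w = h n z0" if n: "n = 1 \<or> n = 2" and w: "w \<in> \<HH>" for n w
  proof -
    have "havg (1/2) (\<lambda>w. (cmod (h n w - h n z0))\<^sup>2) z0 = 0"
      using gain[OF z0(1)] nn[of 1 z0] nn[of 2 z0] z0(2) n by auto
    then have "(cmod (h n w - h n z0))\<^sup>2 = 0" if "w \<in> hdisc (1/2) z0" for w
      by (rule havg_eq_0_imp[rotated 3, OF _ that _ z0(1)])
        (auto intro!: continuous_intros holomorphic_on_imp_continuous_on[OF hh])
    then have eq: "h n w = h n z0" if "w \<in> hdisc (1/2) z0" for w using that by auto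
    show ?thesis
    proof (rule analytic_continuation_open[OF open_hdisc[OF z0(1), of "1/2"] open_upper_half_plane _
          convex_connected[OF convex_upper_half_plane] hdisc_subset hh holomorphic_on_const eq w])
      show "hdisc (1/2) z0 \<noteq> {}" using centre_in_hdisc[OF z0(1), of "1/2"] by auto
    qed
  qed
  define c where "c = h 1 z0"
  have c0: "c = 0"
  proof (rule ccontr)
    assume c: "c \<noteq> 0"
    have cp: "cay \<i> (p w) = (h 2 z0 / c + c) / 2" if w: "w \<in> \<HH>" for w
    proof -
      have 1: "cay \<i> (p w) - cay \<i> (q w) = c" using const[of 1, OF _ w] by (simp add: c_def h_def)
      have "(cay \<i> (p w))\<^sup>2 - (cay \<i> (q w))\<^sup>2 = h 2 z0" using const[of 2, OF _ w] by (simp add: h_def)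
      then have "(cay \<i> (p w) + cay \<i> (q w)) * c = h 2 z0" unfolding 1[symmetric] by (simp add: power2_eq_square algebra_simps)
      then have "cay \<i> (p w) + cay \<i> (q w) = h 2 z0 / c" using c by (simp add: field_simps)
      then have "cay \<i> (p w) + cay \<i> (p w) = h 2 z0 / c + c" using 1 by (simp add: algebra_simps)
      then show ?thesis by (simp add: mult_2[symmetric] mult.commute)
    qed
    have "p w = cay_inv \<i> ((h 2 z0 / c + c) / 2)" if "w \<in> \<HH>" for w
      using cay_inv_cay[OF pin(1)[OF that] i_in] unfolding cp[OF that] by (rule sym)
    then have "p constant_on \<HH>" unfolding constant_on_def by (intro exI ballI)
    then show False using nonconst by simp
  qed
  have "h 1 z = 0" using const[of 1, OF _ z] c0 by (simp add: c_def)
  then have eq: "cay \<i> (p z) = cay \<i> (q z)" by (simp add: h_def)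
  have "p z = cay_inv \<i> (cay \<i> (p z))" by (rule cay_inv_cay[OF pin(1)[OF z] i_in, symmetric])
  also have "\<dots> = q z" unfolding eq by (rule cay_inv_cay[OF pin(2)[OF z] i_in])
  finally show ?thesis .
qed

section \<open>Disc averages to second order\<close>

lemma hdisc_shrinks:
  assumes z: "z \<in> \<HH>" and U: "open U" "z \<in> U"
  obtains t0 where "t0 < 1" "\<And>t. t0 < t \<Longrightarrow> t < 1 \<Longrightarrow> hdisc t z \<subseteq> U"
proof -
  obtain r where r: "r > 0" "ball z r \<subseteq> U" using U open_contains_ball by blast
  obtain K where K: "compact K" "hdisc (1/2) z \<subseteq> K" "K \<subseteq> \<HH>" using hdisc_subset_compact[OF z, of "1/2"] by auto
  obtain M where M: "\<And>w. w \<in> K \<Longrightarrow> cmod w \<le> M" using compact_imp_bounded[OF K(1)] by (auto simp: bounded_iff)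
  define B where "B = (\<bar>M\<bar> + cmod z + 1)\<^sup>2"
  have B: "B > 0" unfolding B_def by (intro zero_less_power) (simp add: add_nonneg_pos)
  define t0 where "t0 = max (1/2) (1 - r\<^sup>2 / B)"
  show ?thesis
  proof (rule that[of t0])
    show "t0 < 1" using r B by (simp add: t0_def)
    fix t assume t: "t0 < t" "t < 1"
    show "hdisc t z \<subseteq> U"
    proof
      fix w assume w: "w \<in> hdisc t z"
      then have "w \<in> hdisc (1/2) z" using t by (auto simp: hdisc_def t0_def)
      then have "cmod w \<le> M" using K M by blast
      have wH: "w \<in> \<HH>" using w hdisc_subset by blast
      have "cmod (w - cnj z) \<le> \<bar>M\<bar> + cmod z + 1"
        using norm_triangle_ineq4[of w "cnj z"] \<open>cmod w \<le> M\<close> by simp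
      then have nB: "(cmod (w - cnj z))\<^sup>2 \<le> B" unfolding B_def by (intro power_mono) auto
      have pos: "0 < (cmod (w - cnj z))\<^sup>2" using cnj_diff_nonzero[OF wH z] by simp
      have "(cmod (w - z))\<^sup>2 = (1 - sech2 w z) * (cmod (w - cnj z))\<^sup>2"
        unfolding one_minus_sech2[OF wH z] using pos by (simp add: norm_divide power_divide)
      also have "\<dots> \<le> (1 - sech2 w z) * B"
        using nB sech2_le_1[OF wH z] by (intro mult_left_mono) auto
      also have "\<dots> < (r\<^sup>2 / B) * B"
        using w t B by (intro mult_strict_right_mono) (auto simp: hdisc_def t0_def sech2_commute)
      also have "\<dots> = r\<^sup>2" using B by simp
      finally have "cmod (w - z) < r" using r by (simp add: power2_less_imp_less)
      then show "w \<in> U" using r by (auto simp: dist_norm norm_minus_commute)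
    qed
  qed
qed

lemma eventually_at_left_interval:
  fixes a b :: real
  shows "a < b \<Longrightarrow> \<forall>\<^sub>F t in at_left b. a < t \<and> t < b"
  using eventually_at_left_real[of a b] by (simp add: greaterThanLessThan_iff)

text \<open>The mean of \<open>tanh\<^sup>2 (d / 2)\<close> over a disc, which measures how
  small the disc is; second-order effects are compared with it.\<close>

definition disc_variance :: "real \<Rightarrow> real" where
  "disc_variance t = havg t (\<lambda>w. 1 - sech2 \<i> w) \<i>"

lemma continuous_on_sech2_left: "z \<in> \<HH> \<Longrightarrow> continuous_on \<HH> (\<lambda>w. sech2 z w)"
  by (rule continuous_on_sech2) (auto intro: continuous_intros)

context hdisc_radius
begin

lemma disc_variance:
  assumes z: "z \<in> \<HH>" shows "havg t (\<lambda>w. 1 - sech2 z w) z = disc_variance t"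
proof -
  have nn: "0 \<le> 1 - sech2 z w" if "z \<in> \<HH>" "w \<in> \<HH>" for z w using sech2_le_1[OF that] by simp
  have eq: "ennreal (havg t (\<lambda>w. 1 - sech2 z w) z) = kernel_mass (\<lambda>x. disc_kernel x * ennreal (1 - x))" if z: "z \<in> \<HH>" for z
  proof -
    have "ennreal (havg t (\<lambda>w. 1 - sech2 z w) z)
       = (\<integral>\<^sup>+w. disc_kernel (sech2 z w) * ennreal (indicator \<HH> w *\<^sub>R (1 - sech2 z w)) \<partial>hyp_area)"
      by (rule havg_eq_kernel_integral[symmetric]) (use z nn continuous_on_sech2_left in \<open>auto intro!: continuous_intros\<close>)
    also have "\<dots> = (\<integral>\<^sup>+w. disc_kernel (sech2 z w) * ennreal (1 - sech2 z w) \<partial>hyp_area)"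
      by (rule nn_integral_hyp_cong) simp
    also have "\<dots> = kernel_mass (\<lambda>x. disc_kernel x * ennreal (1 - x))"
      by (rule kernel_mass[OF z, of "\<lambda>x. disc_kernel x * ennreal (1 - x)"]) measurable
    finally show ?thesis .
  qed
  have pos: "0 \<le> havg t (\<lambda>w. 1 - sech2 z w) z" if "z \<in> \<HH>" for z
    by (rule havg_nonneg) (use nn that hdisc_subset in blast)
  have "ennreal (havg t (\<lambda>w. 1 - sech2 z w) z) = ennreal (disc_variance t)"
    unfolding disc_variance_def eq[OF z] eq[OF i_in] ..
  then show ?thesis using pos[OF z] pos[OF i_in] by (simp add: disc_variance_def)
qed

lemma disc_variance_pos: "disc_variance t > 0"
proof -
  have c: "continuous_on \<HH> (\<lambda>w. 1 - sech2 \<i> w)" by (intro continuous_intros continuous_on_sech2_left i_in)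
  have nn: "0 \<le> 1 - sech2 \<i> w" if "w \<in> \<HH>" for w using sech2_le_1[OF i_in that] by simp
  have "0 \<le> disc_variance t" unfolding disc_variance_def by (rule havg_nonneg) (use nn hdisc_subset in blast)
  moreover have "disc_variance t \<noteq> 0"
  proof
    assume "disc_variance t = 0"
    then have "1 - sech2 \<i> w = 0" if "w \<in> hdisc t \<i>" for w
      using havg_eq_0_imp[OF c i_in nn _ that] by (simp add: disc_variance_def)
    then have "w = \<i>" if "w \<in> hdisc t \<i>" for w
      using that sech2_eq_1_iff[OF i_in, of w] hdisc_subset by auto
    then have "hdisc t \<i> = {\<i>}" using centre_in_hdisc[OF i_in t(2)] by auto
    then show False using open_hdisc[OF i_in, of t] not_open_singleton by metis
  qed
  ultimately show ?thesis by simp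
qed

end

text \<open>The function \<open>sech2 (p _) b ^ s\<close> relative to its value at
  \<open>z\<close> is \<open>1\<close>, plus the real part of a holomorphic function vanishing
  at \<open>z\<close>, plus a remainder divisible by \<open>q = tanh\<^sup>2 (d(p _, p z) /
  2)\<close>. Only the remainder survives averaging over discs about \<open>z\<close>. The
  expansion is exact: with a holomorphic \<open>g\<close> such that \<open>g z = 1\<close>,
  \<open>sech2 (p w) b = sech2 (p z) b \<bar>g w\<bar>\<^sup>2 (1 - q w)\<close>; put \<open>h =
  g\<^sup>s\<close> and write \<open>\<bar>h\<bar>\<^sup>2 = 1 + 2 Re (h - 1) + \<bar>h -
  1\<bar>\<^sup>2\<close>. The bound for the remainder is uniform in \<open>b\<close>,
  \<open>z\<close> and \<open>p\<close>, as needed for dominated convergence.\<close>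

lemma sech2_power_ratio:
  assumes p: "p holomorphic_on \<HH>" "p ` \<HH> \<subseteq> \<HH>" and z: "z \<in> \<HH>" and b: "b \<in> \<HH>"
  defines "q \<equiv> \<lambda>w. 1 - sech2 (p w) (p z)"
  obtains h S where "h holomorphic_on \<HH>" "h z = 1" "continuous_on \<HH> S"
    "S z = (real s)\<^sup>2 * (1 - sech2 (p z) b) - real s"
    "\<And>w. w \<in> \<HH> \<Longrightarrow> q w \<le> 1/4 \<Longrightarrow> \<bar>S w\<bar> \<le> 4 * (real s * 2 ^ s)\<^sup>2 + 4 ^ s * real s"
    "\<And>w. w \<in> \<HH> \<Longrightarrow> sech2 (p w) b ^ s = sech2 (p z) b ^ s * (1 + 2 * Re (h w - 1) + q w * S w)"
proof -
  have pin: "p w \<in> \<HH>" if "w \<in> \<HH>" for w using that p by auto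
  define c where "c = p z"
  have c: "c \<in> \<HH>" using pin z by (simp add: c_def)
  have nz: "c - cnj b \<noteq> 0" "c - cnj c \<noteq> 0" using cnj_diff_nonzero b c by auto
  have pnz: "p w - cnj b \<noteq> 0" "p w - cnj c \<noteq> 0" if "w \<in> \<HH>" for w using cnj_diff_nonzero pin[OF that] b c by auto
  define g where "g w = (c - cnj b) * (p w - cnj c) / ((p w - cnj b) * (c - cnj c))" for w
  define Q where "Q w = (p w - c) / (p w - cnj c)" for w
  define a where "a = (cnj c - cnj b) / (c - cnj b)"
  have ghol: "g holomorphic_on \<HH>" unfolding g_def by (intro holomorphic_intros p(1)) (use nz pnz in auto)
  have gz: "g z = 1" using nz by (simp add: g_def c_def[symmetric])
  have qQ: "q w = (cmod (Q w))\<^sup>2" if "w \<in> \<HH>" for w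
    unfolding q_def Q_def c_def[symmetric] by (rule one_minus_sech2[OF pin[OF that] c])
  have a2: "(cmod a)\<^sup>2 = 1 - sech2 c b"
  proof -
    have "cmod (cnj c - cnj b) = cmod (c - b)" by (metis complex_cnj_diff complex_mod_cnj)
    then show ?thesis unfolding one_minus_sech2[OF c b] a_def by (simp add: norm_divide)
  qed
  \<comment> \<open>So \<open>g - 1 = a Q g\<close> is divisible by \<open>Q\<close>, whose
    squared norm is \<open>q\<close>; and for \<open>q \<le> 1 / 4\<close> one has
    \<open>\<bar>a Q\<bar> \<le> 1 / 2\<close> and hence \<open>\<bar>g\<bar> \<le>
    2\<close>.\<close>
  have gaQ: "g w * (1 - a * Q w) = 1" if w: "w \<in> \<HH>" for w
  proof -
    have "1 - a * Q w = ((c - cnj b) * (p w - cnj c) - (cnj c - cnj b) * (p w - c)) / ((c - cnj b) * (p w - cnj c))"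
      using nz pnz[OF w] unfolding a_def Q_def times_divide_times_eq by (subst diff_divide_distrib) simp
    also have "(c - cnj b) * (p w - cnj c) - (cnj c - cnj b) * (p w - c) = (p w - cnj b) * (c - cnj c)"
      by (simp add: algebra_simps)
    finally show ?thesis using nz pnz[OF w] by (simp add: g_def)
  qed
  then have g1: "g w - 1 = a * Q w * g w" if "w \<in> \<HH>" for w using that by (simp add: algebra_simps)
  define G where "G w = (\<Sum>j<s. g w ^ j)" for w
  define h where "h w = g w ^ s" for w
  define S where "S w = (cmod a)\<^sup>2 * (cmod (g w * G w))\<^sup>2 - (cmod (h w))\<^sup>2 * (\<Sum>j<s. (1 - q w) ^ j)" for w
  have gc: "continuous_on \<HH> g" by (rule holomorphic_on_imp_continuous_on[OF ghol])
  have h1: "(cmod (h w - 1))\<^sup>2 = q w * ((cmod a)\<^sup>2 * (cmod (g w * G w))\<^sup>2)" if w: "w \<in> \<HH>" for w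
  proof -
    have "h w - 1 = (g w - 1) * G w" unfolding h_def G_def by (rule power_diff_1_eq)
    then show ?thesis by (simp add: g1[OF w] qQ[OF w] norm_mult power_mult_distrib)
  qed
  have q1: "(1 - q w) ^ s = 1 - q w * (\<Sum>j<s. (1 - q w) ^ j)" for w
    using power_diff_1_eq[of "1 - q w" s] by (simp add: algebra_simps)
  show ?thesis
  proof (rule that[of h S])
    show "h holomorphic_on \<HH>" unfolding h_def by (intro holomorphic_intros ghol)
    show "h z = 1" by (simp add: h_def gz)
    have qc: "continuous_on \<HH> q" unfolding q_def
      by (intro continuous_intros continuous_on_sech2 holomorphic_on_imp_continuous_on p) (use c c_def in auto)
    show "continuous_on \<HH> S" unfolding S_def G_def h_def by (intro continuous_intros gc qc)
    have "q z = 0" using sech2_refl[OF c] by (simp add: q_def c_def)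
    then show "S z = (real s)\<^sup>2 * (1 - sech2 (p z) b) - real s"
      by (simp add: S_def G_def h_def gz a2 c_def[symmetric] norm_power flip: power_mult)
    show "\<bar>S w\<bar> \<le> 4 * (real s * 2 ^ s)\<^sup>2 + 4 ^ s * real s" if w: "w \<in> \<HH>" and le: "q w \<le> 1/4" for w
    proof -
      have "(cmod a)\<^sup>2 \<le> 1\<^sup>2" using a2 sech2_pos[OF c b] by simp
      then have a1: "cmod a \<le> 1" by (rule power2_le_imp_le) simp
      have "(cmod (Q w))\<^sup>2 \<le> (1/2)\<^sup>2" using le qQ[OF w] by (simp add: power2_eq_square)
      then have Q: "cmod (Q w) \<le> 1/2" by (rule power2_le_imp_le) simp
      have "cmod a * cmod (Q w) \<le> 1 * (1/2)" using a1 Q by (intro mult_mono) auto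
      then have "1/2 \<le> cmod (1 - a * Q w)" using norm_triangle_ineq2[of 1 "a * Q w"] by (simp add: norm_mult)
      moreover have "cmod (g w) * cmod (1 - a * Q w) = 1" using gaQ[OF w] by (metis norm_mult norm_one)
      ultimately have "cmod (g w) * (1/2) \<le> 1"
        using mult_left_mono[OF _ norm_ge_zero, of "1/2" "cmod (1 - a * Q w)" "g w"] by simp
      then have g2: "cmod (g w) \<le> 2" by simp
      have "cmod (G w) \<le> (\<Sum>j<s. 2 ^ s)" unfolding G_def
      proof (rule sum_norm_le)
        fix j assume "j \<in> {..<s}"
        then have "cmod (g w ^ j) \<le> 2 ^ j" unfolding norm_power by (intro power_mono g2) simp
        also have "\<dots> \<le> 2 ^ s" using \<open>j \<in> {..<s}\<close> by (intro power_increasing) auto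
        finally show "cmod (g w ^ j) \<le> 2 ^ s" .
      qed
      then have "cmod (g w) * cmod (G w) \<le> 2 * (real s * 2 ^ s)" using g2 by (intro mult_mono) auto
      then have "(cmod (g w * G w))\<^sup>2 \<le> (2 * (real s * 2 ^ s))\<^sup>2" unfolding norm_mult by (intro power_mono) auto
      moreover have "(cmod a)\<^sup>2 \<le> 1" using a2 sech2_pos[OF c b] by simp
      ultimately have "(cmod a)\<^sup>2 * (cmod (g w * G w))\<^sup>2 \<le> 1 * (2 * (real s * 2 ^ s))\<^sup>2" by (intro mult_mono) auto
      then have 1: "(cmod a)\<^sup>2 * (cmod (g w * G w))\<^sup>2 \<le> 4 * (real s * 2 ^ s)\<^sup>2" by (simp add: power_mult_distrib)
      have q01: "0 \<le> 1 - q w" "1 - q w \<le> 1" using le qQ[OF w] by auto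
      have "(cmod (h w))\<^sup>2 \<le> (2 ^ s)\<^sup>2" unfolding h_def norm_power by (intro power_mono g2) auto
      moreover have "(\<Sum>j<s. (1 - q w) ^ j) \<le> (\<Sum>j<s. 1)" using q01 by (intro sum_mono power_le_one) auto
      ultimately have "(cmod (h w))\<^sup>2 * (\<Sum>j<s. (1 - q w) ^ j) \<le> (2 ^ s)\<^sup>2 * real s"
        using q01 by (intro mult_mono sum_nonneg) auto
      moreover have "(2 ^ s)\<^sup>2 = (4::real) ^ s" by (simp add: power2_eq_square flip: power_mult_distrib)
      ultimately have 2: "(cmod (h w))\<^sup>2 * (\<Sum>j<s. (1 - q w) ^ j) \<le> 4 ^ s * real s" by simp
      have "0 \<le> (cmod a)\<^sup>2 * (cmod (g w * G w))\<^sup>2" "0 \<le> (cmod (h w))\<^sup>2 * (\<Sum>j<s. (1 - q w) ^ j)"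
        using q01 by (auto intro!: mult_nonneg_nonneg sum_nonneg)
      then show ?thesis using 1 2 unfolding S_def by linarith
    qed
    show "sech2 (p w) b ^ s = sech2 (p z) b ^ s * (1 + 2 * Re (h w - 1) + q w * S w)" if w: "w \<in> \<HH>" for w
    proof -
      have base: "sech2 (p w) b = sech2 c b * ((cmod (g w))\<^sup>2 * (1 - q w))"
      proof -
        have ic: "cmod (c - cnj c) = 2 * Im c" using c by (simp add: complex_diff_cnj norm_mult upper_half_plane_iff)
        define A B C where "A = (cmod (c - cnj b))\<^sup>2" "B = (cmod (p w - cnj b))\<^sup>2" "C = (cmod (p w - cnj c))\<^sup>2"
        have nzs: "A \<noteq> 0" "B \<noteq> 0" "C \<noteq> 0" "Im c \<noteq> 0" using nz pnz[OF w] c by (auto simp: A_B_C_def upper_half_plane_iff)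
        have "(cmod (g w))\<^sup>2 = A * C / (B * (2 * Im c)\<^sup>2)"
          by (simp add: g_def norm_divide norm_mult power_divide power_mult_distrib ic A_B_C_def)
        moreover have "1 - q w = 4 * Im (p w) * Im c / C" by (simp add: q_def sech2_def c_def[symmetric] A_B_C_def)
        moreover have "sech2 c b = 4 * Im c * Im b / A" by (simp add: sech2_def A_B_C_def)
        moreover have "sech2 (p w) b = 4 * Im (p w) * Im b / B" by (simp add: sech2_def A_B_C_def)
        ultimately show ?thesis using nzs by (simp add: power2_eq_square)
      qed
      have "((cmod (g w))\<^sup>2 * (1 - q w)) ^ s = (cmod (h w))\<^sup>2 * (1 - q w) ^ s"
        by (simp add: h_def norm_power power_mult_distrib mult.commute flip: power_mult)
      also have "\<dots> = (cmod (h w))\<^sup>2 - q w * ((cmod (h w))\<^sup>2 * (\<Sum>j<s. (1 - q w) ^ j))"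
        unfolding q1 by (simp add: algebra_simps)
      finally have X: "((cmod (g w))\<^sup>2 * (1 - q w)) ^ s
         = (cmod (h w))\<^sup>2 - q w * ((cmod (h w))\<^sup>2 * (\<Sum>j<s. (1 - q w) ^ j))" .
      have "(cmod (h w))\<^sup>2 = 1 + 2 * Re (h w - 1) + (cmod (h w - 1))\<^sup>2"
        unfolding cmod_power2 by (simp add: power2_eq_square algebra_simps)
      then have "((cmod (g w))\<^sup>2 * (1 - q w)) ^ s = 1 + 2 * Re (h w - 1) + q w * S w"
        using X unfolding h1[OF w] S_def right_diff_distrib by linarith
      moreover have "sech2 (p w) b ^ s = sech2 c b ^ s * ((cmod (g w))\<^sup>2 * (1 - q w)) ^ s"
        unfolding base by (rule power_mult_distrib)
      ultimately show ?thesis by (simp only: c_def)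
    qed
  qed
qed

definition sech2_power_defect :: "(complex \<Rightarrow> complex) \<Rightarrow> complex \<Rightarrow> nat \<Rightarrow> real \<Rightarrow> complex \<Rightarrow> real" where
  "sech2_power_defect p b s t z = (havg t (\<lambda>w. sech2 (p w) b ^ s) z - sech2 (p z) b ^ s) / disc_variance t"

text \<open>By \<open>sech2_power_ratio\<close> the defect is the average of \<open>q S\<close>
  divided by that of \<open>\<sigma> = tanh\<^sup>2 (d(z, _) / 2)\<close>. Schwarz-Pick gives
  \<open>q \<le> \<sigma>\<close>, hence the bound; and \<open>q / \<sigma>\<close> tends to the
  Jacobian at \<open>z\<close>, hence the limit. The limit is, up to a factor, the Laplacian of
  \<open>sech2 (p _) b ^ s\<close>. For \<open>t \<ge> 3 / 4\<close> one has \<open>\<sigma>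
  \<le> 1 / 4\<close> on the disc, where the remainder is controlled.\<close>

lemma sech2_power_defect:
  assumes p: "p holomorphic_on \<HH>" "p ` \<HH> \<subseteq> \<HH>" and z: "z \<in> \<HH>" and b: "b \<in> \<HH>"
  shows "3/4 \<le> t \<Longrightarrow> t < 1 \<Longrightarrow>
      \<bar>sech2_power_defect p b s t z\<bar> \<le> (4 * (real s * 2 ^ s)\<^sup>2 + 4 ^ s * real s) * sech2 (p z) b ^ s"
    "((\<lambda>t. sech2_power_defect p b s t z) \<longlongrightarrow>
      hyp_jacobian p z * ((real s)\<^sup>2 * (1 - sech2 (p z) b) - real s) * sech2 (p z) b ^ s) (at_left 1)"
proof -
  have pin: "p w \<in> \<HH>" if "w \<in> \<HH>" for w using that p by auto
  define q where "q w = 1 - sech2 (p w) (p z)" for w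
  define \<sigma> where "\<sigma> w = 1 - sech2 z w" for w
  define C where "C = 4 * (real s * 2 ^ s)\<^sup>2 + 4 ^ s * real s"
  obtain h S where h: "h holomorphic_on \<HH>" "h z = 1" and S: "continuous_on \<HH> S"
    and Sz: "S z = (real s)\<^sup>2 * (1 - sech2 (p z) b) - real s"
    and Sb: "\<And>w. w \<in> \<HH> \<Longrightarrow> q w \<le> 1/4 \<Longrightarrow> \<bar>S w\<bar> \<le> C"
    and eq: "\<And>w. w \<in> \<HH> \<Longrightarrow> sech2 (p w) b ^ s = sech2 (p z) b ^ s * (1 + 2 * Re (h w - 1) + q w * S w)"
    using sech2_power_ratio[OF p z b, of s] unfolding q_def C_def by metis
  have qc: "continuous_on \<HH> q" unfolding q_def
    by (intro continuous_intros continuous_on_sech2 holomorphic_on_imp_continuous_on p) (use pin z in auto)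
  have \<sigma>c: "continuous_on \<HH> \<sigma>" unfolding \<sigma>_def by (intro continuous_intros continuous_on_sech2_left z)
  have q\<sigma>: "0 \<le> q w" "q w \<le> \<sigma> w" if "w \<in> \<HH>" for w
    using schwarz_pick[OF p z that] sech2_le_1[OF pin[OF that] pin[OF z]] by (auto simp: q_def \<sigma>_def sech2_commute)
  have pos: "0 < sech2 (p z) b ^ s" using sech2_pos[OF pin[OF z] b] by simp
  have C0: "C \<ge> 0" by (simp add: C_def)
  have defect: "sech2_power_defect p b s t z = sech2 (p z) b ^ s * (havg t (\<lambda>w. q w * S w) z / disc_variance t)"
    if t: "0 < t" "t < 1" for t
  proof -
    interpret hdisc_radius t by (simp add: hdisc_radius_def t)
    have hr: "(\<lambda>w. 2 * (h w - 1)) holomorphic_on \<HH>" by (intro holomorphic_intros h)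
    have "havg t (\<lambda>w. sech2 (p w) b ^ s) z = havg t (\<lambda>w. sech2 (p z) b ^ s * (1 + Re (2 * (h w - 1)) + q w * S w)) z"
      by (rule havg_cong) (use eq hdisc_subset in auto)
    also have "\<dots> = sech2 (p z) b ^ s * havg t (\<lambda>w. 1 + Re (2 * (h w - 1)) + q w * S w) z" by (rule havg_cmult)
    also have "havg t (\<lambda>w. 1 + Re (2 * (h w - 1)) + q w * S w) z
        = havg t (\<lambda>w. 1 + Re (2 * (h w - 1))) z + havg t (\<lambda>w. q w * S w) z"
      by (rule havg_add[OF z]) (intro continuous_intros qc S holomorphic_on_imp_continuous_on h)+
    also have "havg t (\<lambda>w. 1 + Re (2 * (h w - 1))) z = havg t (\<lambda>w. 1) z + havg t (\<lambda>w. Re (2 * (h w - 1))) z"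
      by (rule havg_add[OF z]) (intro continuous_intros holomorphic_on_imp_continuous_on h)+
    also have "havg t (\<lambda>w. Re (2 * (h w - 1))) z = 0" using havg_Re_holomorphic[OF hr z] h(2) by simp
    finally have "havg t (\<lambda>w. sech2 (p w) b ^ s) z = sech2 (p z) b ^ s * (1 + havg t (\<lambda>w. q w * S w) z)"
      by (simp add: havg_const[OF z])
    then show ?thesis by (simp add: sech2_power_defect_def algebra_simps)
  qed
  show "\<bar>sech2_power_defect p b s t z\<bar> \<le> (4 * (real s * 2 ^ s)\<^sup>2 + 4 ^ s * real s) * sech2 (p z) b ^ s"
    if tt: "3/4 \<le> t" "t < 1" for t
  proof -
    interpret hdisc_radius t using tt by (simp add: hdisc_radius_def)
    have bd: "\<bar>q w * S w\<bar> \<le> C * \<sigma> w" if w: "w \<in> hdisc t z" for w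
    proof -
      have wH: "w \<in> \<HH>" using w hdisc_subset by blast
      have "q w \<le> 1/4" using q\<sigma>(2)[OF wH] w tt by (simp add: \<sigma>_def hdisc_def)
      then have "q w * \<bar>S w\<bar> \<le> \<sigma> w * C" using q\<sigma>[OF wH] Sb[OF wH] by (intro mult_mono) auto
      then show ?thesis using q\<sigma>(1)[OF wH] by (simp add: abs_mult mult.commute)
    qed
    have "havg t (\<lambda>w. q w * S w) z \<le> havg t (\<lambda>w. C * \<sigma> w) z"
      by (intro havg_mono z continuous_intros qc S \<sigma>c) (use bd in \<open>auto simp: abs_le_iff\<close>)
    moreover have "havg t (\<lambda>w. (- C) * \<sigma> w) z \<le> havg t (\<lambda>w. q w * S w) z"
      by (intro havg_mono z continuous_intros qc S \<sigma>c) (use bd in \<open>force simp: abs_le_iff\<close>)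
    ultimately have "\<bar>havg t (\<lambda>w. q w * S w) z\<bar> \<le> C * disc_variance t"
      unfolding havg_cmult using disc_variance[OF z] by (simp add: \<sigma>_def abs_le_iff)
    then have "\<bar>havg t (\<lambda>w. q w * S w) z / disc_variance t\<bar> \<le> C"
      using disc_variance_pos by (simp add: abs_divide pos_divide_le_eq)
    then have "sech2 (p z) b ^ s * \<bar>havg t (\<lambda>w. q w * S w) z / disc_variance t\<bar> \<le> sech2 (p z) b ^ s * C"
      using pos by (intro mult_left_mono) auto
    then show ?thesis using defect tt pos by (simp add: abs_mult C_def mult.commute)
  qed
  have "((\<lambda>t. havg t (\<lambda>w. q w * S w) z / disc_variance t) \<longlongrightarrow> hyp_jacobian p z * S z) (at_left 1)"
  proof (rule tendstoI)
    fix e :: real assume e: "e > 0"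
    define L where "L = hyp_jacobian p z * S z"
    have "isCont S z" using S z open_upper_half_plane continuous_on_eq_continuous_at by blast
    then have "((\<lambda>w. (1 - sech2 (p w) (p z)) / (1 - sech2 w z) * S w) \<longlongrightarrow> L) (at z)"
      unfolding L_def by (intro tendsto_mult hyp_jacobian_tendsto p z) (simp add: isCont_def)
    then have "\<forall>\<^sub>F w in at z. dist ((1 - sech2 (p w) (p z)) / (1 - sech2 w z) * S w) L < e / 2"
      using e by (intro tendstoD) auto
    then obtain U where U: "open U" "z \<in> U"
      "\<And>w. w \<in> U \<Longrightarrow> w \<noteq> z \<Longrightarrow> dist ((1 - sech2 (p w) (p z)) / (1 - sech2 w z) * S w) L < e / 2"
      unfolding eventually_at_topological by blast
    have near: "\<bar>q w * S w - L * \<sigma> w\<bar> \<le> e / 2 * \<sigma> w" if w: "w \<in> U" "w \<in> \<HH>" for w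
    proof (cases "w = z")
      case True
      then have "\<sigma> w = 0" "q w = 0" using sech2_refl z pin by (auto simp: \<sigma>_def q_def)
      then show ?thesis by simp
    next
      case False
      have s0: "\<sigma> w > 0" using sech2_eq_1_iff[OF z w(2)] sech2_le_1[OF z w(2)] False by (auto simp: \<sigma>_def)
      have "\<bar>q w / \<sigma> w * S w - L\<bar> < e / 2"
        using U(3)[OF w(1) False] by (simp add: q_def \<sigma>_def dist_real_def sech2_commute[of w z])
      then have "\<bar>q w / \<sigma> w * S w - L\<bar> * \<sigma> w \<le> e / 2 * \<sigma> w" using s0 by (intro mult_right_mono) auto
      moreover have "\<bar>q w / \<sigma> w * S w - L\<bar> * \<sigma> w = \<bar>(q w / \<sigma> w * S w - L) * \<sigma> w\<bar>" using s0 by (simp add: abs_mult)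
      moreover have "(q w / \<sigma> w * S w - L) * \<sigma> w = q w * S w - L * \<sigma> w" using s0 by (simp add: algebra_simps)
      ultimately show ?thesis by simp
    qed
    obtain t0 where t0: "t0 < 1" "\<And>t. t0 < t \<Longrightarrow> t < 1 \<Longrightarrow> hdisc t z \<subseteq> U" using hdisc_shrinks[OF z U(1,2)] by blast
    have "\<forall>\<^sub>F t in at_left 1. max 0 t0 < t \<and> t < (1::real)"
      by (rule eventually_at_left_interval) (use t0(1) in simp)
    then show "\<forall>\<^sub>F t in at_left 1. dist (havg t (\<lambda>w. q w * S w) z / disc_variance t) (hyp_jacobian p z * S z) < e"
    proof eventually_elim
      case (elim t)
      interpret hdisc_radius t using elim by (simp add: hdisc_radius_def)
      have in_U: "w \<in> U" "w \<in> \<HH>" if "w \<in> hdisc t z" for w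
        using that t0(2)[of t] elim hdisc_subset by auto
      have var: "havg t \<sigma> z = disc_variance t" using disc_variance[OF z] by (simp add: \<sigma>_def[abs_def])
      have squeeze: "q w * S w \<le> (L + e / 2) * \<sigma> w" "(L - e / 2) * \<sigma> w \<le> q w * S w" if "w \<in> hdisc t z" for w
        using near[OF in_U[OF that]] unfolding distrib_right left_diff_distrib by linarith+
      have "havg t (\<lambda>w. q w * S w) z \<le> havg t (\<lambda>w. (L + e / 2) * \<sigma> w) z"
        by (intro havg_mono z continuous_intros qc S \<sigma>c) (use squeeze in auto)
      moreover have "havg t (\<lambda>w. (L - e / 2) * \<sigma> w) z \<le> havg t (\<lambda>w. q w * S w) z"
        by (intro havg_mono z continuous_intros qc S \<sigma>c) (use squeeze in auto)
      ultimately have "\<bar>havg t (\<lambda>w. q w * S w) z - L * disc_variance t\<bar> \<le> e / 2 * disc_variance t"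
        unfolding havg_cmult var by (simp only: distrib_right left_diff_distrib abs_le_iff) linarith
      then have "\<bar>(havg t (\<lambda>w. q w * S w) z - L * disc_variance t) / disc_variance t\<bar> \<le> e / 2"
        using disc_variance_pos by (simp add: abs_divide pos_divide_le_eq)
      then have "\<bar>havg t (\<lambda>w. q w * S w) z / disc_variance t - L\<bar> \<le> e / 2"
        using disc_variance_pos by (simp add: diff_divide_distrib)
      then show ?case using e by (simp add: dist_real_def L_def)
    qed
  qed
  then have "((\<lambda>t. sech2 (p z) b ^ s * (havg t (\<lambda>w. q w * S w) z / disc_variance t)) \<longlongrightarrow>
      sech2 (p z) b ^ s * (hyp_jacobian p z * S z)) (at_left 1)" by (intro tendsto_intros)
  moreover have "\<forall>\<^sub>F t in at_left 1. sech2 (p z) b ^ s * (havg t (\<lambda>w. q w * S w) z / disc_variance t) = sech2_power_defect p b s t z"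
  proof -
    have "\<forall>\<^sub>F t in at_left 1. 0 < t \<and> t < (1::real)" by (intro eventually_at_left_interval) simp
    then show ?thesis by eventually_elim (simp add: defect)
  qed
  ultimately have "((\<lambda>t. sech2_power_defect p b s t z) \<longlongrightarrow> sech2 (p z) b ^ s * (hyp_jacobian p z * S z)) (at_left 1)"
    by (rule Lim_transform_eventually)
  then show "((\<lambda>t. sech2_power_defect p b s t z) \<longlongrightarrow>
      hyp_jacobian p z * ((real s)\<^sup>2 * (1 - sech2 (p z) b) - real s) * sech2 (p z) b ^ s) (at_left 1)"
    by (simp add: Sz mult_ac)
qed

section \<open>Moments of a Poincare series\<close>

lemma (in discontinuous_group) bij_betw_mult_left:
  assumes "\<delta> \<in> \<Gamma>"
  shows "bij_betw (\<lambda>\<gamma>. \<delta> \<otimes>\<^bsub>PSL2R\<^esub> \<gamma>) \<Gamma> \<Gamma>"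
proof -
  interpret G: group PSL2R by (rule group_PSL2R)
  note c = mem_carrier[OF assms] mem_carrier[OF inv_mem[OF assms]]
  show ?thesis
    by (rule bij_betw_byWitness[where f' = "\<lambda>\<gamma>. inv\<^bsub>PSL2R\<^esub> \<delta> \<otimes>\<^bsub>PSL2R\<^esub> \<gamma>"])
      (use assms c mem_carrier in \<open>auto simp: mult_mem inv_mem G.m_assoc[symmetric]\<close>)
qed

lemma (in discontinuous_group) sum_over_left_translates:
  "\<delta> \<in> \<Gamma> \<Longrightarrow> (\<integral>\<^sup>+\<gamma>. f (\<delta> \<otimes>\<^bsub>PSL2R\<^esub> \<gamma>) \<partial>count_space \<Gamma>) = (\<integral>\<^sup>+\<gamma>. f \<gamma> \<partial>count_space \<Gamma>)"
  by (rule nn_integral_bij_count_space[OF bij_betw_mult_left])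

locale equivariant_map = source: discontinuous_group \<Gamma> + target: discontinuous_group \<Delta>
  for \<Gamma> \<Delta> :: "psl2r set" and p :: "complex \<Rightarrow> complex" and \<rho> :: "psl2r \<Rightarrow> psl2r" +
  assumes hol: "p holomorphic_on \<HH>" and maps: "p ` \<HH> \<subseteq> \<HH>"
    and \<rho>_mem: "\<gamma> \<in> \<Gamma> \<Longrightarrow> \<rho> \<gamma> \<in> \<Delta>"
    and equivariant: "\<gamma> \<in> \<Gamma> \<Longrightarrow> z \<in> \<HH> \<Longrightarrow> p (act \<gamma> z) = act (\<rho> \<gamma>) (p z)"
begin

lemma p_in: "z \<in> \<HH> \<Longrightarrow> p z \<in> \<HH>" using maps by auto

lemma p_continuous: "continuous_on \<HH> p" using hol by (rule holomorphic_on_imp_continuous_on)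

lemma continuous_sech2_power: "b \<in> \<HH> \<Longrightarrow> continuous_on \<HH> (\<lambda>w. sech2 (p w) b ^ s)"
  by (intro continuous_intros continuous_on_sech2 p_continuous maps) auto

lemma jacobian_continuous: "continuous_on \<HH> (hyp_jacobian p)"
  unfolding hyp_jacobian_def
  by (intro continuous_intros p_continuous holomorphic_on_imp_continuous_on holomorphic_deriv hol open_upper_half_plane)
    (use p_in in \<open>auto simp: upper_half_plane_iff less_imp_neq[symmetric]\<close>)

lemma jacobian_invariant: "source.invariant (hyp_jacobian p)"
  unfolding source.invariant_def
  using hyp_jacobian_covariant[OF hol hol maps target.mem_carrier[OF \<rho>_mem] source.mem_carrier equivariant] by blast

text \<open>The factor \<open>indicator \<HH> z\<close> makes this measurable for maps
  \<open>p\<close> that are arbitrary outside the half-plane.\<close>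

definition poincare_series :: "complex \<Rightarrow> nat \<Rightarrow> complex \<Rightarrow> ennreal" where
  "poincare_series b s z = (\<integral>\<^sup>+\<delta>. ennreal (indicator \<HH> z *\<^sub>R sech2 (p z) (act \<delta> b) ^ s) \<partial>count_space \<Delta>)"

lemma term_measurable:
  assumes "b \<in> \<HH>"
  shows "(\<lambda>z. indicator \<HH> z *\<^sub>R sech2 (p z) b ^ s) \<in> borel_measurable borel"
  by (rule borel_measurable_on_upper_half_plane[OF continuous_sech2_power[OF assms]])

lemma poincare_series_measurable:
  assumes "b \<in> \<HH>" shows "poincare_series b s \<in> borel_measurable borel"
  unfolding poincare_series_def
  by (rule target.measurable_count_integral) (use term_measurable act_closed[OF target.mem_carrier assms] in measurable)

lemma poincare_series_invariant:
  assumes b: "b \<in> \<HH>" shows "source.invariant (poincare_series b s)"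
  unfolding source.invariant_def
proof (intro ballI)
  fix \<gamma> z assume \<gamma>: "\<gamma> \<in> \<Gamma>" and z: "z \<in> \<HH>"
  interpret G: group PSL2R by (rule group_PSL2R)
  define \<epsilon> where "\<epsilon> = inv\<^bsub>PSL2R\<^esub> (\<rho> \<gamma>)"
  have \<epsilon>: "\<epsilon> \<in> \<Delta>" using \<rho>_mem[OF \<gamma>] target.inv_mem by (simp add: \<epsilon>_def)
  have "poincare_series b s (act \<gamma> z) = (\<integral>\<^sup>+\<delta>. ennreal (sech2 (p z) (act (\<epsilon> \<otimes>\<^bsub>PSL2R\<^esub> \<delta>) b) ^ s) \<partial>count_space \<Delta>)"
    unfolding poincare_series_def
  proof (rule nn_integral_cong)
    fix \<delta> assume "\<delta> \<in> space (count_space \<Delta>)"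
    then have \<delta>: "\<delta> \<in> carrier PSL2R" using target.mem_carrier by simp
    have "sech2 (p (act \<gamma> z)) (act \<delta> b) = sech2 (p z) (act \<epsilon> (act \<delta> b))"
      unfolding equivariant[OF \<gamma> z] \<epsilon>_def
      by (rule sech2_act_left[OF target.mem_carrier[OF \<rho>_mem[OF \<gamma>]] p_in[OF z] act_closed[OF \<delta> b]])
    also have "act \<epsilon> (act \<delta> b) = act (\<epsilon> \<otimes>\<^bsub>PSL2R\<^esub> \<delta>) b" by (rule act_mult[symmetric, OF target.mem_carrier[OF \<epsilon>] \<delta> b])
    finally show "ennreal (indicator \<HH> (act \<gamma> z) *\<^sub>R sech2 (p (act \<gamma> z)) (act \<delta> b) ^ s) =
       ennreal (sech2 (p z) (act (\<epsilon> \<otimes>\<^bsub>PSL2R\<^esub> \<delta>) b) ^ s)"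
      using act_closed[OF source.mem_carrier[OF \<gamma>] z] by simp
  qed
  also have "\<dots> = (\<integral>\<^sup>+\<delta>. ennreal (sech2 (p z) (act \<delta> b) ^ s) \<partial>count_space \<Delta>)"
    by (rule target.sum_over_left_translates[OF \<epsilon>])
  also have "\<dots> = poincare_series b s z" using z by (simp add: poincare_series_def)
  finally show "poincare_series b s (act \<gamma> z) = poincare_series b s z" .
qed

definition moment :: "complex set \<Rightarrow> complex \<Rightarrow> nat \<Rightarrow> ennreal" where
  "moment F b s = (\<integral>\<^sup>+z. indicator F z * (ennreal (hyp_jacobian p z) * poincare_series b s z) \<partial>hyp_area)"

text \<open>The series \<open>u = poincare_series b s\<close> is invariant and integrable over
  \<open>F\<close>, so its disc averages have the same integral over \<open>F\<close>. Divide
  the difference of average and function by \<open>disc_variance\<close> and let the discs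
  shrink. By \<open>sech2_power_defect\<close> the terms are dominated by a multiple of the
  terms of \<open>u\<close> and converge to \<open>J s ((s - 1) sech2\<^sup>s - s
  sech2\<^bsup>s+1\<^esup>)\<close>, with \<open>J\<close> the Jacobian; so the integral of the
  sum of these limits is zero.\<close>

lemma moment_recursion:
  assumes F: "fundamental_domain \<Gamma> F" and b: "b \<in> \<HH>" and s: "2 \<le> s"
    and fin: "(\<integral>\<^sup>+z. indicator F z * poincare_series b 2 z \<partial>hyp_area) < \<infinity>"
  shows "ennreal (real (s - 1)) * moment F b s = ennreal (real s) * moment F b (s + 1)" "moment F b s < \<infinity>"
proof -
  have [measurable]: "F \<in> sets borel" using F by (rule source.fundamental_domain_borel)
  have FH: "F \<subseteq> \<HH>" using F by (simp add: fundamental_domain_def)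
  \<comment> \<open>The integral over \<open>F\<close> and the sum over \<open>\<Delta>\<close>
    are treated as a single integral over a product, so that dominated convergence applies to
    both at once.\<close>
  define M1 where "M1 = density hyp_area (indicator F)"
  define M where "M = M1 \<Otimes>\<^sub>M count_space \<Delta>"
  interpret C: sigma_finite_measure "count_space \<Delta>"
    by (rule sigma_finite_measure_count_space_countable[OF target.countable])
  have sM1 [measurable_cong]: "sets M1 = sets borel" by (simp add: M1_def)
  have spM: "space M = UNIV \<times> \<Delta>" by (simp add: M_def M1_def space_pair_measure)
  have bd: "act \<delta> b \<in> \<HH>" if "\<delta> \<in> \<Delta>" for \<delta> by (rule act_closed[OF target.mem_carrier[OF that] b])
  have mM: "(\<lambda>x. f (snd x) (fst x)) \<in> borel_measurable M"
    if "\<forall>\<delta>\<in>\<Delta>. f \<delta> \<in> borel_measurable borel" for f :: "psl2r \<Rightarrow> complex \<Rightarrow> real"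
  proof -
    have "(\<lambda>(\<delta>, z). f \<delta> z) \<in> borel_measurable (count_space \<Delta> \<Otimes>\<^sub>M borel)"
      by (rule measurable_pair_measure_countable1[OF target.countable]) (use that in simp)
    from measurable_compose[OF measurable_pair_swap' this]
    have "(\<lambda>x. f (snd x) (fst x)) \<in> borel_measurable (borel \<Otimes>\<^sub>M count_space \<Delta>)" by (simp add: case_prod_beta')
    moreover have "sets M = sets (borel \<Otimes>\<^sub>M count_space \<Delta>)"
      unfolding M_def by (rule sets_pair_measure_cong) (simp_all add: sM1)
    ultimately show ?thesis by (simp cong: measurable_cong_sets)
  qed
  have int_M: "(\<integral>\<^sup>+x. ennreal (f (snd x) (fst x)) \<partial>M) = (\<integral>\<^sup>+z. indicator F z * (\<integral>\<^sup>+\<delta>. ennreal (f \<delta> z) \<partial>count_space \<Delta>) \<partial>hyp_area)"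
    if m: "\<forall>\<delta>\<in>\<Delta>. f \<delta> \<in> borel_measurable borel" for f :: "psl2r \<Rightarrow> complex \<Rightarrow> real"
  proof -
    have m': "(\<lambda>x. ennreal (f (snd x) (fst x))) \<in> borel_measurable M" using mM[OF m] by measurable
    have "(\<integral>\<^sup>+x. ennreal (f (snd x) (fst x)) \<partial>M) = (\<integral>\<^sup>+z. (\<integral>\<^sup>+\<delta>. ennreal (f \<delta> z) \<partial>count_space \<Delta>) \<partial>M1)"
      using C.nn_integral_fst[OF m'[unfolded M_def]] by (simp add: M_def)
    also have "\<dots> = (\<integral>\<^sup>+z. indicator F z * (\<integral>\<^sup>+\<delta>. ennreal (f \<delta> z) \<partial>count_space \<Delta>) \<partial>hyp_area)"
    proof -
      have "(\<lambda>z. \<integral>\<^sup>+\<delta>. ennreal (f \<delta> z) \<partial>count_space \<Delta>) \<in> borel_measurable hyp_area"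
      proof (rule target.measurable_count_integral)
        fix \<delta> assume "\<delta> \<in> \<Delta>"
        then have [measurable]: "f \<delta> \<in> borel_measurable borel" using m by blast
        show "(\<lambda>z. ennreal (f \<delta> z)) \<in> borel_measurable hyp_area" by measurable
      qed
      then show ?thesis unfolding M1_def by (subst nn_integral_density) auto
    qed
    finally show ?thesis .
  qed
  define U where "U \<delta> z = indicator \<HH> z *\<^sub>R sech2 (p z) (act \<delta> b) ^ s" for \<delta> z
  define V where "V t \<delta> z = indicator \<HH> z *\<^sub>R havg t (\<lambda>w. sech2 (p w) (act \<delta> b) ^ s) z" for t \<delta> z
  \<comment> \<open>The discs of radius \<open>1 - 1 / (n + 4)\<close> shrink to their centres,
    and the shift by \<open>4\<close> keeps them in the range \<open>t \<ge> 3 / 4\<close> of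
    the uniform bound.\<close>
  define W where "W n \<delta> z = indicator \<HH> z *\<^sub>R sech2_power_defect p (act \<delta> b) s (1 - 1 / (real n + 4)) z" for n :: nat and \<delta> z
  define J where "J \<delta> z = indicator \<HH> z *\<^sub>R (hyp_jacobian p z * ((real s)\<^sup>2 * (1 - sech2 (p z) (act \<delta> b)) - real s) * sech2 (p z) (act \<delta> b) ^ s)" for \<delta> z
  define A where "A r \<delta> z = indicator \<HH> z *\<^sub>R (hyp_jacobian p z * sech2 (p z) (act \<delta> b) ^ r)" for r :: nat and \<delta> z
  define C where "C = 4 * (real s * 2 ^ s)\<^sup>2 + 4 ^ s * real s"
  have nn: "0 \<le> sech2 (p w) (act \<delta> b) ^ r" if "\<delta> \<in> \<Delta>" "w \<in> \<HH>" for \<delta> w r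
    using sech2_pos[OF p_in[OF that(2)] bd[OF that(1)]] by simp
  have Um: "\<forall>\<delta>\<in>\<Delta>. U \<delta> \<in> borel_measurable borel" unfolding U_def using term_measurable bd by blast
  have Am: "\<forall>\<delta>\<in>\<Delta>. A r \<delta> \<in> borel_measurable borel" for r unfolding A_def
    by (intro ballI borel_measurable_on_upper_half_plane continuous_intros jacobian_continuous continuous_sech2_power bd)
  have Vm: "\<forall>\<delta>\<in>\<Delta>. V t \<delta> \<in> borel_measurable borel" if t: "0 < t" "t < 1" for t
  proof -
    interpret R: hdisc_radius t by (simp add: hdisc_radius_def t)
    show ?thesis unfolding V_def
      by (intro ballI R.havg_measurable continuous_sech2_power bd nn)
  qed
  have int_U: "(\<integral>\<^sup>+x. ennreal (U (snd x) (fst x)) \<partial>M) = (\<integral>\<^sup>+z. indicator F z * poincare_series b s z \<partial>hyp_area)"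
    unfolding int_M[OF Um] by (simp add: U_def poincare_series_def)
  have finU: "(\<integral>\<^sup>+z. indicator F z * poincare_series b s z \<partial>hyp_area) < \<infinity>"
  proof -
    have "poincare_series b s z \<le> poincare_series b 2 z" for z
      unfolding poincare_series_def
      using s sech2_le_1[OF p_in bd] sech2_pos[OF p_in bd]
      by (intro nn_integral_mono ennreal_leI) (auto simp: indicator_def less_imp_le intro!: power_decreasing)
    then have "(\<integral>\<^sup>+z. indicator F z * poincare_series b s z \<partial>hyp_area) \<le> (\<integral>\<^sup>+z. indicator F z * poincare_series b 2 z \<partial>hyp_area)"
      by (intro nn_integral_mono mult_left_mono) auto
    then show ?thesis using fin by simp
  qed
  have U0: "0 \<le> U \<delta> z" if "\<delta> \<in> \<Delta>" for \<delta> z using nn[OF that] by (simp add: U_def indicator_def)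
  have Uint: "integrable M (\<lambda>x. U (snd x) (fst x))"
    by (rule integrableI_nonneg[OF mM[OF Um]]) (use int_U finU U0 spM in \<open>auto intro!: AE_I2\<close>)
  have VU: "integrable M (\<lambda>x. V t (snd x) (fst x)) \<and> (LINT x|M. V t (snd x) (fst x)) = (LINT x|M. U (snd x) (fst x))"
    if t: "0 < t" "t < 1" for t
  proof -
    interpret R: hdisc_radius t by (simp add: hdisc_radius_def t)
    have V0: "0 \<le> V t \<delta> z" if "\<delta> \<in> \<Delta>" for \<delta> z
    proof -
      have "0 \<le> havg t (\<lambda>w. sech2 (p w) (act \<delta> b) ^ s) z"
        by (rule R.havg_nonneg) (rule nn[OF that subsetD[OF hdisc_subset]])
      then show ?thesis by (simp add: V_def)
    qed
    have "(\<integral>\<^sup>+x. ennreal (V t (snd x) (fst x)) \<partial>M)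
        = (\<integral>\<^sup>+z. indicator F z * (\<integral>\<^sup>+w. R.disc_kernel (sech2 z w) * poincare_series b s w \<partial>hyp_area) \<partial>hyp_area)"
      unfolding int_M[OF Vm[OF t]]
    proof (rule nn_integral_hyp_cong)
      fix z assume z: "z \<in> \<HH>"
      have "(\<integral>\<^sup>+\<delta>. ennreal (V t \<delta> z) \<partial>count_space \<Delta>)
         = (\<integral>\<^sup>+\<delta>. (\<integral>\<^sup>+w. R.disc_kernel (sech2 z w) * ennreal (U \<delta> w) \<partial>hyp_area) \<partial>count_space \<Delta>)"
      proof (rule nn_integral_cong)
        fix \<delta> assume "\<delta> \<in> space (count_space \<Delta>)"
        then have \<delta>: "\<delta> \<in> \<Delta>" by simp
        show "ennreal (V t \<delta> z) = (\<integral>\<^sup>+w. R.disc_kernel (sech2 z w) * ennreal (U \<delta> w) \<partial>hyp_area)"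
          unfolding U_def using R.havg_eq_kernel_integral[OF z continuous_sech2_power[OF bd[OF \<delta>]] nn[OF \<delta>]] z
          by (simp add: V_def)
      qed
      also have "\<dots> = (\<integral>\<^sup>+w. (\<integral>\<^sup>+\<delta>. R.disc_kernel (sech2 z w) * ennreal (U \<delta> w) \<partial>count_space \<Delta>) \<partial>hyp_area)"
      proof (rule nn_integral_count_space_nn_integral[OF target.countable, symmetric])
        fix \<delta> assume "\<delta> \<in> \<Delta>"
        note [measurable] = Um[rule_format, OF this]
        show "(\<lambda>w. R.disc_kernel (sech2 z w) * ennreal (U \<delta> w)) \<in> borel_measurable hyp_area" by measurable
      qed
      also have "\<dots> = (\<integral>\<^sup>+w. R.disc_kernel (sech2 z w) * poincare_series b s w \<partial>hyp_area)"
        by (simp add: nn_integral_cmult poincare_series_def U_def)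
      finally show "indicator F z * (\<integral>\<^sup>+\<delta>. ennreal (V t \<delta> z) \<partial>count_space \<Delta>)
         = indicator F z * (\<integral>\<^sup>+w. R.disc_kernel (sech2 z w) * poincare_series b s w \<partial>hyp_area)" by simp
    qed
    also have "\<dots> = kernel_mass R.disc_kernel * (\<integral>\<^sup>+z. indicator F z * poincare_series b s z \<partial>hyp_area)"
      by (rule source.integral_kernel[OF F R.disc_kernel_measurable poincare_series_measurable[OF b] poincare_series_invariant[OF b]])
    also have "\<dots> = (\<integral>\<^sup>+x. ennreal (U (snd x) (fst x)) \<partial>M)" by (simp add: R.kernel_mass_disc_kernel int_U)
    finally have eq: "(\<integral>\<^sup>+x. ennreal (V t (snd x) (fst x)) \<partial>M) = (\<integral>\<^sup>+x. ennreal (U (snd x) (fst x)) \<partial>M)" .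
    have V0': "AE x in M. 0 \<le> V t (snd x) (fst x)" and U0': "AE x in M. 0 \<le> U (snd x) (fst x)"
      using V0 U0 spM by (auto intro!: AE_I2)
    have Vint: "integrable M (\<lambda>x. V t (snd x) (fst x))"
      by (rule integrableI_nonneg[OF mM[OF Vm[OF t]] V0']) (use eq int_U finU in simp)
    then show ?thesis
      using nn_integral_eq_integral[OF Vint V0'] nn_integral_eq_integral[OF Uint U0'] eq
        integral_nonneg_AE[OF V0'] integral_nonneg_AE[OF U0'] by simp
  qed
  have W_eq: "W n \<delta> z = (V (1 - 1 / (real n + 4)) \<delta> z - U \<delta> z) / disc_variance (1 - 1 / (real n + 4))" for n \<delta> z
    by (simp add: W_def V_def U_def sech2_power_defect_def indicator_def)
  have tn: "3/4 \<le> 1 - 1 / (real n + 4)" "1 - 1 / (real n + 4) < 1" for n :: nat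
    by (auto simp: field_simps)
  have tn0: "0 < 1 - 1 / (real n + 4)" for n :: nat using tn(1)[of n] by linarith
  have W_0: "(LINT x|M. W n (snd x) (fst x)) = 0" for n
    unfolding W_eq using VU[OF tn0 tn(2)] Uint by simp
  have Wm: "(\<lambda>x. W n (snd x) (fst x)) \<in> borel_measurable M" for n
    unfolding W_eq using VU[OF tn0 tn(2), of n] Uint by (intro borel_measurable_divide borel_measurable_diff) auto
  have Jm: "(\<lambda>x. J (snd x) (fst x)) \<in> borel_measurable M"
  proof (rule mM, rule ballI)
    fix \<delta> assume \<delta>: "\<delta> \<in> \<Delta>"
    have "continuous_on \<HH> (\<lambda>z. sech2 (p z) (act \<delta> b))" using continuous_sech2_power[OF bd[OF \<delta>], of 1] by simp
    then show "J \<delta> \<in> borel_measurable borel" unfolding J_def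
      by (intro borel_measurable_on_upper_half_plane continuous_intros jacobian_continuous)
  qed
  have lim: "(\<lambda>n. W n \<delta> z) \<longlonglongrightarrow> J \<delta> z" if \<delta>: "\<delta> \<in> \<Delta>" for \<delta> z
  proof (cases "z \<in> \<HH>")
    case True
    have "filterlim (\<lambda>n::nat. 1 - 1 / (real n + 4)) (at_left 1) sequentially"
    proof -
      have "(\<lambda>n::nat. 1 - 1 / (real n + 4)) \<longlonglongrightarrow> 1" by real_asymp
      then show ?thesis using tn(2) by (auto simp: filterlim_at intro!: always_eventually)
    qed
    from filterlim_compose[OF sech2_power_defect(2)[OF hol maps True bd[OF \<delta>]] this]
    show ?thesis using True by (simp add: W_def J_def)
  qed (simp add: W_def J_def)
  have bound: "norm (W n \<delta> z) \<le> C * U \<delta> z" if \<delta>: "\<delta> \<in> \<Delta>" for n \<delta> z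
    using sech2_power_defect(1)[OF hol maps _ bd[OF \<delta>] tn, of z s n] by (simp add: W_def U_def C_def indicator_def)
  have dct: "integrable M (\<lambda>x. J (snd x) (fst x))" "(\<lambda>n. LINT x|M. W n (snd x) (fst x)) \<longlonglongrightarrow> (LINT x|M. J (snd x) (fst x))"
  proof -
    have w: "integrable M (\<lambda>x. C * U (snd x) (fst x))" using Uint by simp
    have l: "AE x in M. (\<lambda>n. W n (snd x) (fst x)) \<longlonglongrightarrow> J (snd x) (fst x)" using lim spM by (auto intro!: AE_I2)
    have bb: "AE x in M. norm (W n (snd x) (fst x)) \<le> C * U (snd x) (fst x)" for n
      using bound spM by (auto intro!: AE_I2)
    show "integrable M (\<lambda>x. J (snd x) (fst x))" by (rule integrable_dominated_convergence[OF Jm Wm w l bb])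
    show "(\<lambda>n. LINT x|M. W n (snd x) (fst x)) \<longlonglongrightarrow> (LINT x|M. J (snd x) (fst x))"
      by (rule integral_dominated_convergence[OF Jm Wm w l bb])
  qed
  then have J0: "(LINT x|M. J (snd x) (fst x)) = 0" by (simp add: W_0 LIMSEQ_const_iff)
  have A0: "0 \<le> A r \<delta> z" if "\<delta> \<in> \<Delta>" for r \<delta> z
    by (cases "z \<in> \<HH>") (simp_all add: A_def nn[OF that])
  have A0': "AE x in M. 0 \<le> A r (snd x) (fst x)" for r using A0 spM by (auto intro!: AE_I2)
  have Aint: "integrable M (\<lambda>x. A r (snd x) (fst x))" if "r \<in> {s, s + 1}" for r
  proof (rule Bochner_Integration.integrable_bound[OF Uint mM[OF Am]])
    have "A r \<delta> z \<le> U \<delta> z" if \<delta>: "\<delta> \<in> \<Delta>" for \<delta> z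
    proof (cases "z \<in> \<HH>")
      case True
      have "hyp_jacobian p z * sech2 (p z) (act \<delta> b) ^ r \<le> 1 * sech2 (p z) (act \<delta> b) ^ s"
        using \<open>r \<in> {s, s + 1}\<close> hyp_jacobian_le_1[OF hol maps True] sech2_le_1[OF p_in[OF True] bd[OF \<delta>]] sech2_pos[OF p_in[OF True] bd[OF \<delta>]]
        by (intro mult_mono power_decreasing) auto
      then show ?thesis using True by (simp add: A_def U_def)
    qed (simp add: A_def U_def)
    then show "AE x in M. norm (A r (snd x) (fst x)) \<le> norm (U (snd x) (fst x))"
      using A0 U0 spM by (auto intro!: AE_I2)
  qed
  have mom: "moment F b r = ennreal (LINT x|M. A r (snd x) (fst x))" if r: "r \<in> {s, s + 1}" for r
  proof -
    have "moment F b r = (\<integral>\<^sup>+x. ennreal (A r (snd x) (fst x)) \<partial>M)"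
      unfolding int_M[OF Am] moment_def
    proof (rule nn_integral_hyp_cong)
      fix z assume z: "z \<in> \<HH>"
      have "ennreal (hyp_jacobian p z) * poincare_series b r z = (\<integral>\<^sup>+\<delta>. ennreal (A r \<delta> z) \<partial>count_space \<Delta>)"
        unfolding poincare_series_def using z nn
        by (subst nn_integral_cmult[symmetric]) (auto intro!: nn_integral_cong simp: A_def ennreal_mult)
      then show "indicator F z * (ennreal (hyp_jacobian p z) * poincare_series b r z)
         = indicator F z * (\<integral>\<^sup>+\<delta>. ennreal (A r \<delta> z) \<partial>count_space \<Delta>)" by simp
    qed
    then show ?thesis using nn_integral_eq_integral[OF Aint[OF r] A0'] by simp
  qed
  have mom_s: "moment F b s = ennreal (LINT x|M. A s (snd x) (fst x))"
    "moment F b (s + 1) = ennreal (LINT x|M. A (s + 1) (snd x) (fst x))" by (rule mom; simp)+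
  have JA: "J \<delta> z = real s * (real (s - 1) * A s \<delta> z - real s * A (s + 1) \<delta> z)" for \<delta> z
    using s by (simp add: J_def A_def power2_eq_square of_nat_diff algebra_simps)
  have "(LINT x|M. J (snd x) (fst x)) = real s * (real (s - 1) * (LINT x|M. A s (snd x) (fst x)) - real s * (LINT x|M. A (s + 1) (snd x) (fst x)))"
    unfolding JA using Aint by simp
  then have "real (s - 1) * (LINT x|M. A s (snd x) (fst x)) = real s * (LINT x|M. A (s + 1) (snd x) (fst x))"
    using J0 s by simp
  then have "ennreal (real (s - 1) * (LINT x|M. A s (snd x) (fst x))) = ennreal (real s * (LINT x|M. A (s + 1) (snd x) (fst x)))"
    by (rule arg_cong)
  then show "ennreal (real (s - 1)) * moment F b s = ennreal (real s) * moment F b (s + 1)"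
    by (simp only: mom_s ennreal_mult'[OF of_nat_0_le_iff])
  show "moment F b s < \<infinity>" by (simp add: mom)
qed

end

section \<open>Fibres of the descended map\<close>

context discontinuous_group
begin

lemma orbit_of_eq: "orbit_of \<Gamma> z = (\<lambda>\<gamma>. act \<gamma> z) ` \<Gamma>"
  by (auto simp: orbit_def)

lemma self_in_orbit: "z \<in> \<HH> \<Longrightarrow> z \<in> orbit_of \<Gamma> z"
  unfolding orbit_of_eq using act_one one_mem by (metis imageI)

lemma orbit_act: 
  assumes \<gamma>: "\<gamma> \<in> \<Gamma>" and z: "z \<in> \<HH>" shows "orbit_of \<Gamma> (act \<gamma> z) = orbit_of \<Gamma> z"
proof (intro equalityI subsetI)
  fix w assume "w \<in> orbit_of \<Gamma> (act \<gamma> z)"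
  then obtain \<delta> where "\<delta> \<in> \<Gamma>" "w = act \<delta> (act \<gamma> z)" by (auto simp: orbit_of_eq)
  then have "w = act (\<delta> \<otimes>\<^bsub>PSL2R\<^esub> \<gamma>) z" "\<delta> \<otimes>\<^bsub>PSL2R\<^esub> \<gamma> \<in> \<Gamma>" using \<gamma> z by (simp_all add: act_mult mem_carrier mult_mem)
  then show "w \<in> orbit_of \<Gamma> z" unfolding orbit_of_eq by blast
next
  fix w assume "w \<in> orbit_of \<Gamma> z"
  then obtain \<delta> where \<delta>: "\<delta> \<in> \<Gamma>" "w = act \<delta> z" by (auto simp: orbit_of_eq)
  define \<epsilon> where "\<epsilon> = \<delta> \<otimes>\<^bsub>PSL2R\<^esub> inv\<^bsub>PSL2R\<^esub> \<gamma>"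
  have "w = act \<epsilon> (act \<gamma> z)" "\<epsilon> \<in> \<Gamma>"
    using \<delta> \<gamma> z by (simp_all add: \<epsilon>_def act_mult mem_carrier mult_mem inv_mem act_closed act_inv_act)
  then show "w \<in> orbit_of \<Gamma> (act \<gamma> z)" unfolding orbit_of_eq by blast
qed

lemma orbit_eq_iff:
  assumes "z \<in> \<HH>" "w \<in> \<HH>"
  shows "orbit_of \<Gamma> z = orbit_of \<Gamma> w \<longleftrightarrow> (\<exists>\<gamma>\<in>\<Gamma>. w = act \<gamma> z)"
proof
  assume "orbit_of \<Gamma> z = orbit_of \<Gamma> w"
  then have "w \<in> orbit_of \<Gamma> z" using self_in_orbit[OF assms(2)] by simp
  then show "\<exists>\<gamma>\<in>\<Gamma>. w = act \<gamma> z" by (auto simp: orbit_of_eq)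
qed (use orbit_act assms in auto)

lemma stabilizer_trivial:
  assumes z: "z \<in> \<HH>" "z \<notin> fixed_points" and \<gamma>: "\<gamma> \<in> \<Gamma>" "\<delta> \<in> \<Gamma>" "act \<gamma> z = act \<delta> z"
  shows "\<gamma> = \<delta>"
proof -
  have "act (inv\<^bsub>PSL2R\<^esub> \<delta> \<otimes>\<^bsub>PSL2R\<^esub> \<gamma>) z = z"
    using \<gamma> z by (simp add: act_mult mem_carrier inv_mem act_inv_act)
  then have "inv\<^bsub>PSL2R\<^esub> \<delta> \<otimes>\<^bsub>PSL2R\<^esub> \<gamma> = \<one>\<^bsub>PSL2R\<^esub>"
    using z \<gamma> mult_mem inv_mem by (auto simp: fixed_points_def)
  then have "inv\<^bsub>PSL2R\<^esub> \<gamma> = inv\<^bsub>PSL2R\<^esub> \<delta>"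
    using group.inv_equality[OF group_PSL2R] \<gamma> inv_mem mem_carrier by metis
  then show ?thesis using group.inv_inv[OF group_PSL2R] mem_carrier \<gamma> by metis
qed

text \<open>Intersect, for each point, the neighbourhoods that separate its orbit from each of
  the others.\<close>

lemma separate_inequivalent_points:
  assumes "finite Y" "Y \<subseteq> \<HH>" "\<And>y y'. y \<in> Y \<Longrightarrow> y' \<in> Y \<Longrightarrow> y \<noteq> y' \<Longrightarrow> orbit_of \<Gamma> y \<noteq> orbit_of \<Gamma> y'"
  obtains U where "\<And>y. y \<in> Y \<Longrightarrow> open (U y) \<and> y \<in> U y \<and> U y \<subseteq> \<HH>"
    "\<And>y y' \<gamma>. y \<in> Y \<Longrightarrow> y' \<in> Y \<Longrightarrow> y \<noteq> y' \<Longrightarrow> \<gamma> \<in> \<Gamma> \<Longrightarrow> act \<gamma> ` U y \<inter> U y' = {}"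
proof -
  have ex: "\<exists>p. open (fst p) \<and> open (snd p) \<and> y \<in> fst p \<and> y' \<in> snd p \<and> fst p \<subseteq> \<HH> \<and> snd p \<subseteq> \<HH> \<and>
      (\<forall>\<gamma>\<in>\<Gamma>. act \<gamma> y \<noteq> y' \<longrightarrow> act \<gamma> ` fst p \<inter> snd p = {})" if yy: "y \<in> Y" "y' \<in> Y" for y y'
  proof -
    have h: "y \<in> \<HH>" "y' \<in> \<HH>" using yy assms(2) by auto
    obtain A B where AB: "open A" "open B" "y \<in> A" "y' \<in> B" "A \<subseteq> \<HH>" "B \<subseteq> \<HH>"
      "\<And>\<gamma>. \<gamma> \<in> \<Gamma> \<Longrightarrow> act \<gamma> y \<noteq> y' \<Longrightarrow> act \<gamma> ` A \<inter> B = {}"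
      by (rule separating_neighbourhoods[OF h]) blast
    show ?thesis by (rule exI[of _ "(A, B)"]) (simp add: AB)
  qed
  define N where "N y y' = (SOME p. open (fst p) \<and> open (snd p) \<and> y \<in> fst p \<and> y' \<in> snd p \<and> fst p \<subseteq> \<HH> \<and> snd p \<subseteq> \<HH> \<and>
      (\<forall>\<gamma>\<in>\<Gamma>. act \<gamma> y \<noteq> y' \<longrightarrow> act \<gamma> ` fst p \<inter> snd p = {}))" for y y'
  have N: "open (fst (N y y')) \<and> open (snd (N y y')) \<and> y \<in> fst (N y y') \<and> y' \<in> snd (N y y') \<and> fst (N y y') \<subseteq> \<HH> \<and> snd (N y y') \<subseteq> \<HH> \<and>
      (\<forall>\<gamma>\<in>\<Gamma>. act \<gamma> y \<noteq> y' \<longrightarrow> act \<gamma> ` fst (N y y') \<inter> snd (N y y') = {})" if "y \<in> Y" "y' \<in> Y" for y y'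
    unfolding N_def by (rule someI_ex[OF ex[OF that]])
  define U where "U y = (\<Inter>y'\<in>Y. fst (N y y') \<inter> snd (N y' y))" for y
  show ?thesis
  proof (rule that[of U])
    fix y assume y: "y \<in> Y"
    show "open (U y) \<and> y \<in> U y \<and> U y \<subseteq> \<HH>"
    proof (intro conjI)
      show "open (U y)" unfolding U_def using N[OF y] N[OF _ y] assms(1) by (intro open_INT) auto
      show "y \<in> U y" unfolding U_def using N[OF y] N[OF _ y] by blast
      show "U y \<subseteq> \<HH>" unfolding U_def using N[OF y y] y by blast
    qed
  next
    fix y y' \<gamma> assume y: "y \<in> Y" "y' \<in> Y" "y \<noteq> y'" and \<gamma>: "\<gamma> \<in> \<Gamma>"
    have yH: "y \<in> \<HH>" using y assms(2) by auto
    have "act \<gamma> y \<noteq> y'"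
    proof
      assume "act \<gamma> y = y'"
      then have "orbit_of \<Gamma> y' = orbit_of \<Gamma> y" using orbit_act[OF \<gamma> yH] by simp
      then show False using assms(3) y by metis
    qed
    then have "act \<gamma> ` fst (N y y') \<inter> snd (N y y') = {}" using N[OF y(1,2)] \<gamma> by blast
    moreover have "U y \<subseteq> fst (N y y')" "U y' \<subseteq> snd (N y y')" using y by (auto simp: U_def)
    ultimately show "act \<gamma> ` U y \<inter> U y' = {}" by blast
  qed
qed

end

locale nonconstant_equivariant_map = equivariant_map +
  assumes nonconst: "\<not> p constant_on \<HH>"
begin

definition preimages :: "complex \<Rightarrow> complex set set" where
  "preimages w = {X \<in> quotient_space \<Gamma>. descended_map \<Delta> p X = orbit_of \<Delta> w}"

definition fibre_count :: "complex \<Rightarrow> ennreal" where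
  "fibre_count w = emeasure (count_space UNIV) (preimages w)"

lemma descended_map_orbit:
  assumes z: "z \<in> \<HH>" shows "descended_map \<Delta> p (orbit_of \<Gamma> z) = orbit_of \<Delta> (p z)"
proof -
  have "orbit_of \<Delta> (p (act \<gamma> z)) = orbit_of \<Delta> (p z)" if "\<gamma> \<in> \<Gamma>" for \<gamma>
    unfolding equivariant[OF that z] by (rule target.orbit_act[OF \<rho>_mem[OF that] p_in[OF z]])
  then have "(\<lambda>z. orbit_of \<Delta> (p z)) ` orbit_of \<Gamma> z = {orbit_of \<Delta> (p z)}"
    unfolding source.orbit_of_eq image_image using source.one_mem by auto
  then show ?thesis by (simp add: descended_map_def)
qed

lemma preimages_eq:
  assumes w: "w \<in> \<HH>"
  shows "preimages w = (\<lambda>z. orbit_of \<Gamma> z) ` {z \<in> \<HH>. \<exists>\<delta>\<in>\<Delta>. p z = act \<delta> w}"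
proof -
  have "descended_map \<Delta> p (orbit_of \<Gamma> z) = orbit_of \<Delta> w \<longleftrightarrow> (\<exists>\<delta>\<in>\<Delta>. p z = act \<delta> w)" if "z \<in> \<HH>" for z
    unfolding descended_map_orbit[OF that] using target.orbit_eq_iff[OF w p_in[OF that]] by metis
  then show ?thesis unfolding preimages_def orbits_def by blast
qed

lemma fibre_count_invariant: "target.invariant fibre_count"
  unfolding target.invariant_def fibre_count_def preimages_def
  using target.orbit_act by simp

text \<open>Nonconstant holomorphic maps are open: \<open>m\<close> inequivalent preimages have
  neighbourhoods that stay inequivalent and whose images are neighbourhoods of the given
  point.\<close>

lemma open_fibre_count_ge: "open {w \<in> \<HH>. of_nat m \<le> fibre_count w}"
proof (subst open_subopen, intro ballI)
  fix w0 assume "w0 \<in> {w \<in> \<HH>. of_nat m \<le> fibre_count w}"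
  then have w0: "w0 \<in> \<HH>" and m: "of_nat m \<le> fibre_count w0" by auto
  have "\<exists>T. T \<subseteq> preimages w0 \<and> finite T \<and> card T = m"
  proof (cases "finite (preimages w0)")
    case True
    then have "m \<le> card (preimages w0)" using m by (simp add: fibre_count_def)
    then show ?thesis by (metis obtain_subset_with_card_n)
  next
    case False
    then show ?thesis by (metis infinite_arbitrarily_large)
  qed
  then obtain T where T: "T \<subseteq> preimages w0" "finite T" "card T = m" by blast
  have "\<forall>X\<in>T. \<exists>z. z \<in> \<HH> \<and> X = orbit_of \<Gamma> z \<and> (\<exists>\<delta>\<in>\<Delta>. p z = act \<delta> w0)"
    using T(1) unfolding preimages_eq[OF w0] by blast
  then obtain r where r: "\<And>X. X \<in> T \<Longrightarrow> r X \<in> \<HH> \<and> X = orbit_of \<Gamma> (r X) \<and> (\<exists>\<delta>\<in>\<Delta>. p (r X) = act \<delta> w0)"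
    by metis
  define Y where "Y = r ` T"
  have inj: "inj_on r T"
  proof (rule inj_onI)
    fix X X' assume "X \<in> T" "X' \<in> T" and eq: "r X = r X'"
    then have "X = orbit_of \<Gamma> (r X)" "X' = orbit_of \<Gamma> (r X')" using r by blast+
    then show "X = X'" by (simp only: eq)
  qed
  have Y: "finite Y" "card Y = m" "Y \<subseteq> \<HH>" using T inj r by (auto simp: Y_def card_image)
  have ineq: "orbit_of \<Gamma> y \<noteq> orbit_of \<Gamma> y'" if yy: "y \<in> Y" "y' \<in> Y" "y \<noteq> y'" for y y'
  proof -
    obtain X X' where X: "X \<in> T" "y = r X" "X' \<in> T" "y' = r X'" using yy unfolding Y_def by blast
    then have "orbit_of \<Gamma> y = X" "orbit_of \<Gamma> y' = X'" using r by metis+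
    then show ?thesis using X yy(3) by auto
  qed
  have "\<forall>y\<in>Y. \<exists>\<delta>\<in>\<Delta>. p y = act \<delta> w0" using r by (auto simp: Y_def)
  then obtain d where d: "\<And>y. y \<in> Y \<Longrightarrow> d y \<in> \<Delta> \<and> p y = act (d y) w0" by metis
  obtain U where U: "\<And>y. y \<in> Y \<Longrightarrow> open (U y) \<and> y \<in> U y \<and> U y \<subseteq> \<HH>"
    "\<And>y y' \<gamma>. y \<in> Y \<Longrightarrow> y' \<in> Y \<Longrightarrow> y \<noteq> y' \<Longrightarrow> \<gamma> \<in> \<Gamma> \<Longrightarrow> act \<gamma> ` U y \<inter> U y' = {}"
    using source.separate_inequivalent_points[OF Y(1,3) ineq] by blast
  define W where "W = \<HH> \<inter> (\<Inter>y\<in>Y. act (d y) -` (p ` U y) \<inter> \<HH>)"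
  have "open W" unfolding W_def
  proof (rule open_Int[OF open_upper_half_plane open_INT[OF Y(1)]], rule ballI)
    fix y assume y: "y \<in> Y"
    have "open (p ` U y)"
      by (rule open_mapping_thm[OF hol open_upper_half_plane convex_connected[OF convex_upper_half_plane] _ _ nonconst])
        (use U(1)[OF y] in auto)
    then show "open (act (d y) -` (p ` U y) \<inter> \<HH>)"
      using act_continuous[OF target.mem_carrier] d[OF y] continuous_on_open_vimage[OF open_upper_half_plane] by blast
  qed
  moreover have "w0 \<in> W"
  proof -
    have "act (d y) w0 \<in> p ` U y" if "y \<in> Y" for y using d[OF that] U(1)[OF that] by (metis imageI)
    then show ?thesis unfolding W_def using w0 by auto
  qed
  moreover have "W \<subseteq> {w \<in> \<HH>. of_nat m \<le> fibre_count w}"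
  proof
    fix w assume w: "w \<in> W"
    then have wH: "w \<in> \<HH>" by (auto simp: W_def)
    have "\<forall>y\<in>Y. \<exists>x. x \<in> U y \<and> p x = act (d y) w"
    proof
      fix y assume "y \<in> Y"
      then have "act (d y) w \<in> p ` U y" using w unfolding W_def by blast
      then show "\<exists>x. x \<in> U y \<and> p x = act (d y) w" by auto
    qed
    then obtain x where x: "\<And>y. y \<in> Y \<Longrightarrow> x y \<in> U y \<and> p (x y) = act (d y) w" by metis
    have xH: "x y \<in> \<HH>" if "y \<in> Y" for y using x[OF that] U(1)[OF that] by auto
    have "inj_on (\<lambda>y. orbit_of \<Gamma> (x y)) Y"
    proof (rule inj_onI, rule ccontr)
      fix y y' assume y: "y \<in> Y" "y' \<in> Y" "orbit_of \<Gamma> (x y) = orbit_of \<Gamma> (x y')" "y \<noteq> y'"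
      then obtain \<gamma> where "\<gamma> \<in> \<Gamma>" "x y' = act \<gamma> (x y)" using source.orbit_eq_iff[OF xH xH] by blast
      then show False using U(2)[OF y(1,2,4)] x y by blast
    qed
    then have card: "card ((\<lambda>y. orbit_of \<Gamma> (x y)) ` Y) = m" using Y by (simp add: card_image)
    have sub: "(\<lambda>y. orbit_of \<Gamma> (x y)) ` Y \<subseteq> preimages w"
      unfolding preimages_eq[OF wH] using x xH d by blast
    have "of_nat m = emeasure (count_space UNIV) ((\<lambda>y. orbit_of \<Gamma> (x y)) ` Y)" using card Y by simp
    also have "\<dots> \<le> fibre_count w" unfolding fibre_count_def by (rule emeasure_mono[OF sub]) simp
    finally show "w \<in> {w \<in> \<HH>. of_nat m \<le> fibre_count w}" using wH by simp
  qed
  ultimately show "\<exists>T. open T \<and> w0 \<in> T \<and> T \<subseteq> {w \<in> \<HH>. of_nat m \<le> fibre_count w}" by blast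
qed

lemma fibre_count_cases:
  obtains n :: nat where "fibre_count w = of_nat n" | "fibre_count w = \<infinity>"
  by (cases "finite (preimages w)") (auto simp: fibre_count_def)

text \<open>The count as a function on the whole plane. Its values lie in the extended reals,
  since at this stage nothing prevents a point from having infinitely many preimages.\<close>

definition N :: "complex \<Rightarrow> ennreal" where
  "N w = indicator \<HH> w * fibre_count w"

lemma N_cases:
  obtains n :: nat where "N w = of_nat n" | "N w = \<infinity>"
proof (cases "w \<in> \<HH>")
  case True
  then have "N w = fibre_count w" by (simp add: N_def)
  then show thesis using that by (rule_tac fibre_count_cases[of w]) simp_all
next
  case False
  then show thesis using that(1)[of 0] by (simp add: N_def)
qed

lemma N_ge_measurable: "{w. of_nat m \<le> N w} \<in> sets borel"
proof -
  have "{w. of_nat m \<le> N w} = (if m = 0 then UNIV else {w \<in> \<HH>. of_nat m \<le> fibre_count w})"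
    by (auto simp: N_def indicator_def)
  then show ?thesis using open_fibre_count_ge[of m] by auto
qed

text \<open>The count is the sum over \<open>m \<ge> 1\<close> of the indicator functions of the
  sets where it is at least \<open>m\<close>.\<close>

lemma N_measurable [measurable]: "N \<in> borel_measurable borel"
proof -
  have Nw: "N w = (\<Sum>m. indicator {w. of_nat (Suc m) \<le> N w} w)" for w
  proof (rule N_cases[of w])
    fix n :: nat assume n: "N w = of_nat n"
    have "(\<Sum>m. indicator {w. of_nat (Suc m) \<le> N w} w) = (\<Sum>m. indicator {..<n} m :: ennreal)"
      unfolding n by (intro suminf_cong) (simp add: indicator_def n Suc_le_eq del: of_nat_Suc)
    also have "\<dots> = (\<Sum>m<n. indicator {..<n} m)" by (rule suminf_finite) auto
    finally show "N w = (\<Sum>m. indicator {w. of_nat (Suc m) \<le> N w} w)" using n by simp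
  next
    assume n: "N w = \<infinity>"
    have "(\<Sum>m. indicator {w. of_nat (Suc m) \<le> N w} w) = (\<Sum>m::nat. 1 :: ennreal)"
      by (intro suminf_cong) (simp add: n)
    also have "\<dots> = \<infinity>"
      using nn_integral_count_space_nat[of "\<lambda>_. 1"] by simp
    finally show "N w = (\<Sum>m. indicator {w. of_nat (Suc m) \<le> N w} w)" using n by simp
  qed
  have eq: "(\<lambda>w. \<Sum>m. indicator {w. of_nat (Suc m) \<le> N w} w) = N"
    by (rule ext) (rule Nw[symmetric])
  have "(\<lambda>w. \<Sum>m. indicator {w. of_nat (Suc m) \<le> N w} w :: ennreal) \<in> borel_measurable borel"
  proof -
    define A where "A m = {w. of_nat (Suc m) \<le> N w}" for m
    have [measurable]: "A m \<in> sets borel" for m unfolding A_def by (rule N_ge_measurable)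
    have "(\<lambda>w. \<Sum>m. indicator (A m) w :: ennreal) \<in> borel_measurable borel" by measurable
    then show ?thesis unfolding A_def .
  qed
  then show ?thesis unfolding eq .
qed

lemma N_invariant: "target.invariant N"
  unfolding target.invariant_def N_def
  using target.invariantD[OF fibre_count_invariant] act_closed[OF target.mem_carrier] by simp

section \<open>Area formula\<close>

definition critical_points :: "complex set" where "critical_points = {z \<in> \<HH>. deriv p z = 0}"

lemma fsigma_upper_half_plane: "fsigma \<HH>"
proof -
  have "\<HH> = (\<Union>n::nat. {z. 1 / (real n + 1) \<le> Im z})"
  proof (intro equalityI subsetI)
    fix z assume "z \<in> \<HH>"
    then obtain n :: nat where "1 / Im z < real n" "Im z > 0" using reals_Archimedean2 by (auto simp: upper_half_plane_iff)
    then have "1 / (real n + 1) \<le> Im z" by (simp add: field_simps)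
    then show "z \<in> (\<Union>n::nat. {z. 1 / (real n + 1) \<le> Im z})" by blast
  next
    fix z assume "z \<in> (\<Union>n::nat. {z. 1 / (real n + 1) \<le> Im z})"
    then obtain n :: nat where "1 / (real n + 1) \<le> Im z" by blast
    moreover have "0 < 1 / (real n + 1)" by simp
    ultimately show "z \<in> \<HH>" unfolding upper_half_plane_iff by linarith
  qed
  moreover have "fsigma (\<Union>n::nat. {z. 1 / (real n + 1) \<le> Im z})"
    by (rule fsigma.intros) (rule closed_halfspace_Im_ge)
  ultimately show ?thesis by simp
qed

lemma countable_critical_points: "countable critical_points"
proof -
  have d: "deriv p holomorphic_on \<HH>" by (rule holomorphic_deriv[OF hol open_upper_half_plane])
  have conn: "connected \<HH>" by (rule convex_connected[OF convex_upper_half_plane])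
  show ?thesis
  proof (cases "deriv p constant_on \<HH>")
    case True
    then obtain c where c: "\<And>z. z \<in> \<HH> \<Longrightarrow> deriv p z = c" by (auto simp: constant_on_def)
    have "c \<noteq> 0"
    proof
      assume "c = 0"
      then have "(p has_field_derivative 0) (at z)" if "z \<in> \<HH>" for z
        using holomorphic_derivI[OF hol open_upper_half_plane that] c[OF that] by simp
      then have "p constant_on \<HH>" by (rule has_field_derivative_0_imp_constant_on[OF _ conn open_upper_half_plane])
      then show False using nonconst by simp
    qed
    then show ?thesis by (simp add: critical_points_def c cong: conj_cong)
  next
    case False
    show ?thesis unfolding critical_points_def
      by (rule holomorphic_countable_zeros[OF d open_upper_half_plane conn _ False]) (rule fsigma_upper_half_plane)
  qed
qed

text \<open>A holomorphic map is injective near a point where its derivative does not vanish,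
  and countably many such neighbourhoods suffice.\<close>

lemma injectivity_pieces:
  obtains U where "\<And>n::nat. open (U n)" "\<And>n. U n \<subseteq> \<HH>" "\<And>n. inj_on p (U n)" "\<HH> - critical_points \<subseteq> (\<Union>n. U n)"
proof -
  define \<U> where "\<U> = {U. open U \<and> U \<subseteq> \<HH> \<and> inj_on p U}"
  have cover: "\<HH> - critical_points \<subseteq> \<Union>\<U>"
  proof
    fix z assume z: "z \<in> \<HH> - critical_points"
    then obtain r where "r > 0" "ball z r \<subseteq> \<HH>" "inj_on p (ball z r)"
      using has_complex_derivative_locally_injective[OF hol _ open_upper_half_plane, of z] by (auto simp: critical_points_def)
    then have "ball z r \<in> \<U>" "z \<in> ball z r" by (auto simp: \<U>_def)
    then show "z \<in> \<Union>\<U>" by blast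
  qed
  have "open V" if "V \<in> \<U>" for V using that by (simp add: \<U>_def)
  then obtain \<V> where \<V>: "\<V> \<subseteq> \<U>" "countable \<V>" "\<Union>\<V> = \<Union>\<U>" by (rule Lindelof)
  define U where "U = from_nat_into (insert {} \<V>)"
  have rangeU: "range U = insert {} \<V>" using \<V>(2) by (simp add: U_def range_from_nat_into)
  have "U n \<in> \<U>" for n
  proof -
    have "U n \<in> insert {} \<V>" using rangeU by (metis rangeI)
    moreover have "{} \<in> \<U>" by (simp add: \<U>_def)
    ultimately show ?thesis using \<V>(1) by (metis insertE subsetD)
  qed
  moreover have "\<HH> - critical_points \<subseteq> (\<Union>n. U n)" using cover \<V>(3) rangeU by auto
  ultimately show ?thesis by (intro that[of U]) (auto simp: \<U>_def)
qed

lemma nn_integral_injective_piece: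
  assumes U: "open U" "U \<subseteq> \<HH>" "inj_on p U" and B: "B \<in> sets borel" "B \<subseteq> U"
    and K [measurable]: "K \<in> borel_measurable borel"
  shows "p ` B \<in> sets borel"
    "(\<integral>\<^sup>+w. indicator (p ` B) w * K w \<partial>hyp_area) = (\<integral>\<^sup>+z. indicator B z * (ennreal (hyp_jacobian p z) * K (p z)) \<partial>hyp_area)"
proof -
  have holU: "p holomorphic_on U" using hol U(2) holomorphic_on_subset by blast
  show pB [measurable]: "p ` B \<in> sets borel" by (rule open_holomorphic_image_borel[OF holU U(1,3) B])
  have [measurable]: "B \<in> sets borel" by (rule B)
  have pbm: "(\<lambda>z. indicator \<HH> z *\<^sub>R p z) \<in> borel_measurable borel" by (rule borel_measurable_on_upper_half_plane[OF p_continuous])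
  have jm: "(\<lambda>z. indicator \<HH> z *\<^sub>R hyp_jacobian p z) \<in> borel_measurable borel"
    by (rule borel_measurable_on_upper_half_plane[OF jacobian_continuous])
  have pBK: "(\<lambda>w. indicator (p ` B) w * K w) \<in> borel_measurable borel" by measurable
  have "(\<integral>\<^sup>+w. indicator (p ` B) w * K w \<partial>hyp_area)
     = (\<integral>\<^sup>+w. indicator (p ` U) w * (ennreal (1 / (Im w)\<^sup>2) * (indicator (p ` B) w * K w)) \<partial>lborel)"
    unfolding nn_integral_hyp_area[OF pBK]
    using B(2) U(2) p_in by (intro nn_integral_cong) (auto simp: indicator_def)
  also have "\<dots> = (\<integral>\<^sup>+z. indicator U z * (ennreal ((cmod (deriv p z))\<^sup>2) * (ennreal (1 / (Im (p z))\<^sup>2) * (indicator (p ` B) (p z) * K (p z)))) \<partial>lborel)"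
    by (rule nn_integral_holomorphic_image[OF holU U(1,3)]) measurable
  also have "\<dots> = (\<integral>\<^sup>+z. indicator \<HH> z * (ennreal (1 / (Im z)\<^sup>2) * (indicator B z * (ennreal (indicator \<HH> z *\<^sub>R hyp_jacobian p z) * K (indicator \<HH> z *\<^sub>R p z)))) \<partial>lborel)"
  proof (rule nn_integral_cong)
    fix z
    show "indicator U z * (ennreal ((cmod (deriv p z))\<^sup>2) * (ennreal (1 / (Im (p z))\<^sup>2) * (indicator (p ` B) (p z) * K (p z))))
       = indicator \<HH> z * (ennreal (1 / (Im z)\<^sup>2) * (indicator B z * (ennreal (indicator \<HH> z *\<^sub>R hyp_jacobian p z) * K (indicator \<HH> z *\<^sub>R p z))))"
    proof (cases "z \<in> B")
      case True
      then have z: "z \<in> U" "z \<in> \<HH>" using B U by auto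
      have "(cmod (deriv p z))\<^sup>2 * (1 / (Im (p z))\<^sup>2) = 1 / (Im z)\<^sup>2 * hyp_jacobian p z"
        using z(2) p_in[OF z(2)] by (simp add: hyp_jacobian_def upper_half_plane_iff power_mult_distrib power_divide)
      then have "ennreal ((cmod (deriv p z))\<^sup>2) * ennreal (1 / (Im (p z))\<^sup>2) = ennreal (1 / (Im z)\<^sup>2) * ennreal (hyp_jacobian p z)"
        by (simp flip: ennreal_mult)
      then show ?thesis using True z by (simp add: mult.assoc[symmetric])
    next
      case False
      have "p z \<notin> p ` B" if "z \<in> U" using inj_on_image_mem_iff[OF U(3) that B(2)] False by simp
      then show ?thesis using False by (cases "z \<in> U") auto
    qed
  qed
  also have "\<dots> = (\<integral>\<^sup>+z. indicator B z * (ennreal (indicator \<HH> z *\<^sub>R hyp_jacobian p z) * K (indicator \<HH> z *\<^sub>R p z)) \<partial>hyp_area)"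
    by (rule nn_integral_hyp_area[symmetric]) (use pbm jm in measurable)
  also have "\<dots> = (\<integral>\<^sup>+z. indicator B z * (ennreal (hyp_jacobian p z) * K (p z)) \<partial>hyp_area)"
    by (rule nn_integral_hyp_cong) simp
  finally show "(\<integral>\<^sup>+w. indicator (p ` B) w * K w \<partial>hyp_area) = (\<integral>\<^sup>+z. indicator B z * (ennreal (hyp_jacobian p z) * K (p z)) \<partial>hyp_area)" .
qed

text \<open>Cut a strict fundamental set of \<open>\<Gamma>\<close>, without critical and fixed
  points, into countably many pieces \<open>B n\<close> on which \<open>p\<close> is injective.
  For a generic \<open>w\<close> the preimages of its orbit correspond to the pairs \<open>(n,
  \<delta>)\<close> with \<open>\<delta> w\<close> in \<open>p (B n)\<close>. Sum over the
  pairs, integrate, and change variables on each piece.\<close>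

lemma area_formula:
  assumes F: "fundamental_domain \<Gamma> F" and k [measurable]: "k \<in> borel_measurable borel"
  shows "(\<integral>\<^sup>+w. N w * k w \<partial>hyp_area) =
    (\<integral>\<^sup>+z. indicator F z * (ennreal (hyp_jacobian p z) * (\<integral>\<^sup>+\<delta>. k (act \<delta> (p z)) \<partial>count_space \<Delta>)) \<partial>hyp_area)"
proof -
  obtain F0 where F0: "F0 \<in> sets borel" "F0 \<subseteq> \<HH>" "source.fixed_points \<subseteq> F0"
    and ex1: "\<And>z. z \<in> \<HH> - source.fixed_points \<Longrightarrow> \<exists>!\<gamma>. \<gamma> \<in> \<Gamma> \<and> act \<gamma> z \<in> F0"
    by (rule source.strict_fundamental_set) blast
  have fd0: "fundamental_domain \<Gamma> F0" by (rule source.strict_fundamental_domain[OF F0 ex1])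
  obtain U where U: "\<And>n::nat. open (U n)" "\<And>n. U n \<subseteq> \<HH>" "\<And>n. inj_on p (U n)" "\<HH> - critical_points \<subseteq> (\<Union>n. U n)"
    by (rule injectivity_pieces) blast
  define bad where "bad = critical_points \<union> source.fixed_points"
  have bad: "countable bad" using countable_critical_points source.countable_fixed_points by (simp add: bad_def)
  define B where "B n = (F0 - bad) \<inter> (U n - (\<Union>m<n. U m))" for n
  have BU: "B n \<subseteq> U n" for n by (auto simp: B_def)
  have badb: "bad \<in> sets borel" using bad by (rule sets.countable[rotated]) auto
  have Ub: "U n \<in> sets borel" for n by (rule borel_open[OF U(1)])
  have Bb [measurable]: "B n \<in> sets borel" for n unfolding B_def
    by (intro sets.Int sets.Diff sets.finite_UN Ub F0(1) badb) auto
  have UB: "(\<Union>n. B n) = F0 - bad"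
  proof (intro equalityI subsetI)
    fix z assume z: "z \<in> F0 - bad"
    then have ex: "\<exists>n. z \<in> U n" using U(4) F0(2) by (auto simp: bad_def)
    define n where "n = (LEAST n. z \<in> U n)"
    have "z \<in> U n" unfolding n_def by (rule LeastI_ex[OF ex])
    moreover have "z \<notin> U m" if "m < n" for m using not_less_Least that unfolding n_def by blast
    ultimately have "z \<in> B n" using z unfolding B_def by blast
    then show "z \<in> (\<Union>n. B n)" by blast
  qed (auto simp: B_def)
  have disj: "n = m" if "z \<in> B n" "z \<in> B m" for n m z
  proof (rule ccontr)
    assume "n \<noteq> m"
    then consider "n < m" | "m < n" by linarith
    then show False
    proof cases
      case 1
      then show False using that by (simp add: B_def)
    next
      case 2
      then show False using that by (simp add: B_def)
    qed
  qed
  define K where "K w = (\<integral>\<^sup>+\<delta>. k (act \<delta> w) \<partial>count_space \<Delta>)" for w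
  note [measurable] = measurable_act[OF target.mem_carrier]
  have Km [measurable]: "K \<in> borel_measurable borel" unfolding K_def
    by (rule target.measurable_count_integral) measurable
  \<comment> \<open>Outside the countable set \<open>E\<close> the point has a trivial
    stabiliser, and no preimage of a point of its orbit is critical or fixed.\<close>
  define E where "E = target.fixed_points \<union> (\<Union>\<delta>\<in>\<Delta>. act \<delta> ` p ` bad)"
  have E: "countable E" unfolding E_def using bad target.countable target.countable_fixed_points by auto
  have count: "N w = (\<integral>\<^sup>+n. (\<integral>\<^sup>+\<delta>. indicator (p ` B n) (act \<delta> w) \<partial>count_space \<Delta>) \<partial>count_space UNIV)"
    if w: "w \<in> \<HH>" "w \<notin> E" for w
  proof -
    define P where "P = {(n, \<delta>). \<delta> \<in> \<Delta> \<and> act \<delta> w \<in> p ` B n}"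
    define g where "g x = orbit_of \<Gamma> (inv_into (B (fst x)) p (act (snd x) w))" for x
    have notbad: "z \<notin> bad" if "\<delta> \<in> \<Delta>" "p z = act \<delta> w" for z \<delta>
    proof
      assume "z \<in> bad"
      then have "act (inv\<^bsub>PSL2R\<^esub> \<delta>) (p z) \<in> E" using target.inv_mem[OF that(1)] by (auto simp: E_def)
      then show False using w act_inv_act[OF target.mem_carrier[OF that(1)] w(1)] that(2) by simp
    qed
    have inv: "inv_into (B n) p (act \<delta> w) \<in> B n" "p (inv_into (B n) p (act \<delta> w)) = act \<delta> w" if "(n, \<delta>) \<in> P" for n \<delta>
      using that by (auto simp: P_def inv_into_into f_inv_into_f)
    have BH: "z \<in> \<HH>" "z \<in> F0" "z \<notin> source.fixed_points" if "z \<in> B n" for z n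
      using that F0(2) by (auto simp: B_def bad_def)
    have "bij_betw g P (preimages w)"
    proof (rule bij_betw_imageI)
      show "inj_on g P"
      proof (rule inj_onI)
        fix x y assume x: "x \<in> P" and y: "y \<in> P" and eq: "g x = g y"
        obtain n \<delta> m \<epsilon> where xy: "x = (n, \<delta>)" "y = (m, \<epsilon>)" by (cases x, cases y) auto
        define a b where "a = inv_into (B n) p (act \<delta> w)" and "b = inv_into (B m) p (act \<epsilon> w)"
        have a: "a \<in> B n" "p a = act \<delta> w" and b: "b \<in> B m" "p b = act \<epsilon> w"
          using inv x y by (auto simp: a_def b_def xy)
        obtain \<gamma> where \<gamma>: "\<gamma> \<in> \<Gamma>" "b = act \<gamma> a"
          using eq source.orbit_eq_iff[OF BH(1)[OF a(1)] BH(1)[OF b(1)]] by (auto simp: g_def xy a_def b_def)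
        have "\<exists>!\<gamma>. \<gamma> \<in> \<Gamma> \<and> act \<gamma> a \<in> F0" by (rule ex1) (use BH[OF a(1)] in auto)
        moreover have "\<gamma> \<in> \<Gamma> \<and> act \<gamma> a \<in> F0" using \<gamma> BH(2)[OF b(1)] by simp
        moreover have "\<one>\<^bsub>PSL2R\<^esub> \<in> \<Gamma> \<and> act \<one>\<^bsub>PSL2R\<^esub> a \<in> F0"
          using source.one_mem act_one[OF BH(1)[OF a(1)]] BH(2)[OF a(1)] by simp
        ultimately have "\<gamma> = \<one>\<^bsub>PSL2R\<^esub>" by (elim ex1E) metis
        then have ab: "a = b" using \<gamma>(2) act_one[OF BH(1)[OF a(1)]] by simp
        then have nm: "n = m" using disj a b by simp
        have "act \<delta> w = act \<epsilon> w" using a b ab by simp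
        then have "\<delta> = \<epsilon>" using target.stabilizer_trivial[OF w(1)] w(2) x y by (auto simp: E_def P_def xy)
        then show "x = y" using nm xy by simp
      qed
      show "g ` P = preimages w"
      proof (intro equalityI subsetI)
        fix X assume "X \<in> g ` P"
        then obtain n \<delta> where x: "(n, \<delta>) \<in> P" "X = orbit_of \<Gamma> (inv_into (B n) p (act \<delta> w))" by (auto simp: g_def)
        then show "X \<in> preimages w" unfolding preimages_eq[OF w(1)]
          using inv[OF x(1)] BH(1) by (auto simp: P_def)
      next
        fix X assume "X \<in> preimages w"
        then obtain z \<delta> where z: "z \<in> \<HH>" "X = orbit_of \<Gamma> z" "\<delta> \<in> \<Delta>" "p z = act \<delta> w"
          unfolding preimages_eq[OF w(1)] by blast
        have "z \<notin> source.fixed_points" using notbad[OF z(3,4)] by (simp add: bad_def)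
        then obtain \<gamma> where \<gamma>: "\<gamma> \<in> \<Gamma>" "act \<gamma> z \<in> F0" using ex1[of z] z(1) by blast
        define \<epsilon> where "\<epsilon> = \<rho> \<gamma> \<otimes>\<^bsub>PSL2R\<^esub> \<delta>"
        have \<epsilon>: "\<epsilon> \<in> \<Delta>" "p (act \<gamma> z) = act \<epsilon> w"
          using z \<gamma> w \<rho>_mem by (simp_all add: \<epsilon>_def target.mult_mem equivariant act_mult target.mem_carrier)
        have "act \<gamma> z \<notin> bad" by (rule notbad[OF \<epsilon>])
        then obtain n where n: "act \<gamma> z \<in> B n" using UB \<gamma>(2) by blast
        then have nP: "(n, \<epsilon>) \<in> P" using \<epsilon> by (auto simp: P_def intro: image_eqI[OF sym])
        have "inv_into (B n) p (act \<epsilon> w) = act \<gamma> z"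
          using inv_into_f_f[OF inj_on_subset[OF U(3) BU] n] \<epsilon>(2) by simp
        then have "g (n, \<epsilon>) = X" using source.orbit_act[OF \<gamma>(1) z(1)] z(2) by (simp add: g_def)
        then show "X \<in> g ` P" using nP by blast
      qed
    qed
    then have "N w = emeasure (count_space UNIV) P"
      using w(1) by (simp add: N_def fibre_count_def emeasure_count_space bij_betw_finite bij_betw_same_card)
    also have "\<dots> = (\<integral>\<^sup>+x. indicator P x \<partial>count_space UNIV)" by simp
    also have "\<dots> = (\<integral>\<^sup>+n. (\<integral>\<^sup>+\<delta>. indicator P (n, \<delta>) \<partial>count_space UNIV) \<partial>count_space UNIV)"
      by (rule nn_integral_fst_count_space[symmetric])
    also have "\<dots> = (\<integral>\<^sup>+n. (\<integral>\<^sup>+\<delta>. indicator (p ` B n) (act \<delta> w) \<partial>count_space \<Delta>) \<partial>count_space UNIV)"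
      by (intro nn_integral_cong, subst nn_integral_count_space_indicator) (auto intro!: nn_integral_cong simp: P_def indicator_def)
    finally show ?thesis .
  qed
  have pB [measurable]: "p ` B n \<in> sets borel" for n
    by (rule nn_integral_injective_piece(1)[OF U(1-3) Bb BU borel_measurable_const])
  have aeE: "AE w in hyp_area. w \<notin> E" using hyp_area_countable_null[OF E] by (rule AE_not_in)
  have "(\<integral>\<^sup>+w. N w * k w \<partial>hyp_area)
     = (\<integral>\<^sup>+w. (\<integral>\<^sup>+n. (\<integral>\<^sup>+\<delta>. indicator (p ` B n) (act \<delta> w) * k w \<partial>count_space \<Delta>) \<partial>count_space UNIV) \<partial>hyp_area)"
    by (rule nn_integral_cong_AE, use aeE AE_upper_half_plane in eventually_elim) (simp add: count nn_integral_multc)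
  also have "\<dots> = (\<integral>\<^sup>+n. (\<integral>\<^sup>+w. (\<integral>\<^sup>+\<delta>. indicator (p ` B n) (act \<delta> w) * k w \<partial>count_space \<Delta>) \<partial>hyp_area) \<partial>count_space UNIV)"
    by (rule nn_integral_count_space_nn_integral) (simp, rule target.measurable_count_integral, measurable)
  also have "\<dots> = (\<integral>\<^sup>+n. (\<integral>\<^sup>+\<delta>. (\<integral>\<^sup>+w. indicator (p ` B n) (act \<delta> w) * k w \<partial>hyp_area) \<partial>count_space \<Delta>) \<partial>count_space UNIV)"
    by (rule nn_integral_cong, rule nn_integral_count_space_nn_integral[OF target.countable]) measurable
  also have "\<dots> = (\<integral>\<^sup>+n. (\<integral>\<^sup>+\<delta>. (\<integral>\<^sup>+w. indicator (p ` B n) w * k (act (inv\<^bsub>PSL2R\<^esub> \<delta>) w) \<partial>hyp_area) \<partial>count_space \<Delta>) \<partial>count_space UNIV)"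
  proof (rule nn_integral_cong, rule nn_integral_cong)
    fix n \<delta> assume "\<delta> \<in> space (count_space \<Delta>)"
    then have \<delta>: "\<delta> \<in> \<Delta>" by simp
    note [measurable] = measurable_act[OF target.mem_carrier[OF target.inv_mem[OF \<delta>]]]
    have "(\<integral>\<^sup>+w. indicator (p ` B n) (act \<delta> w) * k w \<partial>hyp_area)
        = (\<integral>\<^sup>+w. indicator (p ` B n) (act \<delta> w) * k (act (inv\<^bsub>PSL2R\<^esub> \<delta>) (act \<delta> w)) \<partial>hyp_area)"
      by (rule nn_integral_hyp_cong) (simp add: act_inv_act target.mem_carrier \<delta>)
    also have "\<dots> = (\<integral>\<^sup>+w. indicator (p ` B n) w * k (act (inv\<^bsub>PSL2R\<^esub> \<delta>) w) \<partial>hyp_area)"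
      by (rule nn_integral_act[OF target.mem_carrier[OF \<delta>]]) measurable
    finally show "(\<integral>\<^sup>+w. indicator (p ` B n) (act \<delta> w) * k w \<partial>hyp_area)
       = (\<integral>\<^sup>+w. indicator (p ` B n) w * k (act (inv\<^bsub>PSL2R\<^esub> \<delta>) w) \<partial>hyp_area)" .
  qed
  also have "\<dots> = (\<integral>\<^sup>+n. (\<integral>\<^sup>+\<delta>. (\<integral>\<^sup>+w. indicator (p ` B n) w * k (act \<delta> w) \<partial>hyp_area) \<partial>count_space \<Delta>) \<partial>count_space UNIV)"
    by (rule nn_integral_cong, rule target.sum_over_inverses)
  also have "\<dots> = (\<integral>\<^sup>+n. (\<integral>\<^sup>+w. (\<integral>\<^sup>+\<delta>. indicator (p ` B n) w * k (act \<delta> w) \<partial>count_space \<Delta>) \<partial>hyp_area) \<partial>count_space UNIV)"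
    by (rule nn_integral_cong, rule nn_integral_count_space_nn_integral[OF target.countable, symmetric]) measurable
  also have "\<dots> = (\<integral>\<^sup>+n. (\<integral>\<^sup>+w. indicator (p ` B n) w * K w \<partial>hyp_area) \<partial>count_space UNIV)"
    by (simp add: nn_integral_cmult K_def)
  also have "\<dots> = (\<integral>\<^sup>+n. (\<integral>\<^sup>+z. indicator (B n) z * (ennreal (hyp_jacobian p z) * K (p z)) \<partial>hyp_area) \<partial>count_space UNIV)"
    by (rule nn_integral_cong) (rule nn_integral_injective_piece(2)[OF U(1-3) Bb BU Km])
  also have "\<dots> = (\<integral>\<^sup>+n. (\<integral>\<^sup>+z. indicator (B n) z * (ennreal (indicator \<HH> z *\<^sub>R hyp_jacobian p z) * K (indicator \<HH> z *\<^sub>R p z)) \<partial>hyp_area) \<partial>count_space UNIV)"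
    by (rule nn_integral_cong, rule nn_integral_hyp_cong) simp
  also have "\<dots> = (\<integral>\<^sup>+z. (\<integral>\<^sup>+n. indicator (B n) z * (ennreal (indicator \<HH> z *\<^sub>R hyp_jacobian p z) * K (indicator \<HH> z *\<^sub>R p z)) \<partial>count_space UNIV) \<partial>hyp_area)"
  proof (rule nn_integral_count_space_nn_integral[symmetric])
    fix n
    note [measurable] = borel_measurable_on_upper_half_plane[OF p_continuous] borel_measurable_on_upper_half_plane[OF jacobian_continuous]
    show "(\<lambda>z. indicator (B n) z * (ennreal (indicator \<HH> z *\<^sub>R hyp_jacobian p z) * K (indicator \<HH> z *\<^sub>R p z))) \<in> borel_measurable hyp_area"
      by measurable
  qed simp
  also have "\<dots> = (\<integral>\<^sup>+z. indicator F0 z * (ennreal (hyp_jacobian p z) * K (p z)) \<partial>hyp_area)"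
  proof (rule nn_integral_cong_AE, use AE_not_in[OF hyp_area_countable_null[OF bad]] AE_upper_half_plane in eventually_elim)
    case (elim z)
    have "(\<integral>\<^sup>+n. indicator (B n) z \<partial>count_space UNIV) = (indicator F0 z :: ennreal)"
    proof (cases "z \<in> F0")
      case True
      then obtain n where n: "z \<in> B n" using UB elim by blast
      have "(\<integral>\<^sup>+m. indicator (B m) z \<partial>count_space UNIV) = (\<integral>\<^sup>+m. indicator {n} m \<partial>count_space UNIV :: ennreal)"
        using n disj by (intro nn_integral_cong) (auto simp: indicator_def)
      then show ?thesis using True by simp
    next
      case False
      then have "z \<notin> B n" for n using UB by blast
      then show ?thesis using False by simp
    qed
    then show ?case using elim by (simp add: nn_integral_multc)
  qed
  also have "\<dots> = (\<integral>\<^sup>+z. indicator F z * (ennreal (hyp_jacobian p z) * K (p z)) \<partial>hyp_area)"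
  proof -
    define f where "f z = ennreal (indicator \<HH> z *\<^sub>R hyp_jacobian p z) * K (indicator \<HH> z *\<^sub>R p z)" for z
    note [measurable] = borel_measurable_on_upper_half_plane[OF p_continuous] borel_measurable_on_upper_half_plane[OF jacobian_continuous]
    have fm: "f \<in> borel_measurable borel" unfolding f_def by measurable
    have Kinv: "K (act \<delta> w) = K w" if "\<delta> \<in> \<Delta>" "w \<in> \<HH>" for \<delta> w
    proof -
      have "K (act \<delta> w) = (\<integral>\<^sup>+\<epsilon>. k (act (\<epsilon> \<otimes>\<^bsub>PSL2R\<^esub> \<delta>) w) \<partial>count_space \<Delta>)"
        unfolding K_def by (rule nn_integral_cong) (simp add: act_mult target.mem_carrier that)
      also have "\<dots> = K w" unfolding K_def by (rule target.sum_over_translates[OF that(1)])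
      finally show ?thesis .
    qed
    have "source.invariant f" unfolding source.invariant_def f_def
      using source.invariantD[OF jacobian_invariant] equivariant Kinv \<rho>_mem p_in act_closed[OF source.mem_carrier] by simp
    from source.integral_fundamental_domain_unique[OF F fd0 fm this]
    have "(\<integral>\<^sup>+z. indicator F0 z * f z \<partial>hyp_area) = (\<integral>\<^sup>+z. indicator F z * f z \<partial>hyp_area)" .
    moreover have "(\<integral>\<^sup>+z. indicator A z * f z \<partial>hyp_area) = (\<integral>\<^sup>+z. indicator A z * (ennreal (hyp_jacobian p z) * K (p z)) \<partial>hyp_area)" for A
      by (rule nn_integral_hyp_cong) (simp add: f_def)
    ultimately show ?thesis by simp
  qed
  finally show ?thesis by (simp add: K_def)
qed

end

section \<open>Powers of the point-pair invariant\<close>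

definition power_mass :: "nat \<Rightarrow> ennreal" where
  "power_mass s = kernel_mass (\<lambda>x. ennreal (x ^ s))"

lemma measurable_Complex: "(\<lambda>(x, y). Complex x y) \<in> borel_measurable (lborel \<Otimes>\<^sub>M lborel)"
proof -
  have "continuous_on UNIV (\<lambda>p::real\<times>real. complex_of_real (fst p) + \<i> * complex_of_real (snd p))"
    by (intro continuous_intros)
  then have "(\<lambda>p::real\<times>real. complex_of_real (fst p) + \<i> * complex_of_real (snd p)) \<in> borel_measurable borel"
    by (rule borel_measurable_continuous_onI)
  moreover have "(\<lambda>(x, y). Complex x y) = (\<lambda>p. complex_of_real (fst p) + \<i> * complex_of_real (snd p))"
    by (rule ext) (simp add: case_prod_beta' complex_eq_iff)
  ultimately show ?thesis by (simp add: lborel_prod)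
qed

text \<open>Lebesgue measure on the complex plane as a product, for integrals in Cartesian
  coordinates.\<close>

lemma lborel_complex_prod: "(lborel :: complex measure) = distr (lborel \<Otimes>\<^sub>M lborel) borel (\<lambda>(x, y). Complex x y)"
proof (rule lborel_eqI)
  have m: "(\<lambda>(x, y). Complex x y) \<in> borel_measurable (lborel \<Otimes>\<^sub>M lborel)"
    by (rule measurable_Complex)
  fix l u :: complex
  assume le: "\<And>b. b \<in> Basis \<Longrightarrow> l \<bullet> b \<le> u \<bullet> b"
  have le': "Re l \<le> Re u" "Im l \<le> Im u" using le[of 1] le[of \<i>] by (auto simp: Basis_complex_def inner_complex_def)
  have "(\<lambda>(x, y). Complex x y) -` box l u = box (Re l) (Re u) \<times> box (Im l) (Im u)"
    by (auto simp: box_def Basis_complex_def inner_complex_def)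
  then have "emeasure (distr (lborel \<Otimes>\<^sub>M lborel) borel (\<lambda>(x, y). Complex x y)) (box l u)
     = emeasure (lborel \<Otimes>\<^sub>M lborel) (box (Re l) (Re u) \<times> box (Im l) (Im u))"
    using m by (simp add: emeasure_distr space_pair_measure)
  also have "\<dots> = ennreal (Re u - Re l) * ennreal (Im u - Im l)"
    using le' by (subst lborel.emeasure_pair_measure_Times) auto
  also have "\<dots> = ennreal (\<Prod>b\<in>Basis. (u - l) \<bullet> b)"
    using le' by (simp add: Basis_complex_def inner_complex_def ennreal_mult)
  finally show "emeasure (distr (lborel \<Otimes>\<^sub>M lborel) borel (\<lambda>(x, y). Complex x y)) (box l u) = ennreal (\<Prod>b\<in>Basis. (u - l) \<bullet> b)" .
qed simp

text \<open>With \<open>w = u + i v\<close> the integrand is \<open>16 / (u\<^sup>2 + (1 +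
  v)\<^sup>2)\<^sup>2\<close>, which is at most \<open>16 / ((1 + u\<^sup>2) (1 +
  v\<^sup>2))\<close>, an integrable product.\<close>

lemma power_mass_2_finite: "power_mass 2 < \<infinity>"
proof -
  define f where "f x = ennreal (inverse (1 + x\<^sup>2))" for x :: real
  have fm [measurable]: "f \<in> borel_measurable borel" unfolding f_def by measurable
  have fin: "(\<integral>\<^sup>+x. f x \<partial>lborel) < \<infinity>"
  proof -
    have "set_integrable lborel UNIV (\<lambda>x::real. inverse (1 + x\<^sup>2))" using integrable_inverse_1_plus_square by simp
    then have "integrable lborel (\<lambda>x::real. inverse (1 + x\<^sup>2))" by (simp add: set_integrable_def)
    then have "(\<integral>\<^sup>+x. ennreal (norm (inverse (1 + x\<^sup>2 :: real))) \<partial>lborel) < \<infinity>" by (simp only: integrable_iff_bounded)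
    moreover have "norm (inverse (1 + x\<^sup>2)) = inverse (1 + x\<^sup>2)" for x :: real by (simp add: add_nonneg_pos)
    ultimately show ?thesis unfolding f_def by simp
  qed
  have [measurable]: "Re \<in> borel_measurable borel" "Im \<in> borel_measurable borel"
    by (intro borel_measurable_continuous_onI continuous_intros)+
  have "power_mass 2 = (\<integral>\<^sup>+w. indicator \<HH> w * (ennreal (1 / (Im w)\<^sup>2) * ennreal ((sech2 \<i> w)\<^sup>2)) \<partial>lborel)"
    unfolding power_mass_def kernel_mass_def by (rule nn_integral_hyp_area) measurable
  also have "\<dots> \<le> (\<integral>\<^sup>+w. 16 * (f (Re w) * f (Im w)) \<partial>lborel)"
  proof (rule nn_integral_mono)
    fix w
    show "indicator \<HH> w * (ennreal (1 / (Im w)\<^sup>2) * ennreal ((sech2 \<i> w)\<^sup>2)) \<le> 16 * (f (Re w) * f (Im w))"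
    proof (cases "w \<in> \<HH>")
      case True
      define u v where "u = Re w" and "v = Im w"
      have v: "v > 0" using True by (simp add: v_def upper_half_plane_iff)
      define D where "D = u\<^sup>2 + (1 + v)\<^sup>2"
      have "(cmod (\<i> - cnj w))\<^sup>2 = D" by (simp add: cmod_power2 D_def u_def v_def)
      then have s: "sech2 \<i> w = 4 * v / D" by (simp add: sech2_def v_def)
      have D: "1 + u\<^sup>2 \<le> D" "1 + v\<^sup>2 \<le> D" using v by (auto simp: D_def power2_sum)
      have pos: "0 < 1 + u\<^sup>2" "0 < 1 + v\<^sup>2" by (auto intro: add_pos_nonneg)
      have D0: "D > 0" using D pos by linarith
      have "(1 + u\<^sup>2) * (1 + v\<^sup>2) \<le> D * D" using D pos D0 by (intro mult_mono) auto
      then have "16 / (D * D) \<le> 16 / ((1 + u\<^sup>2) * (1 + v\<^sup>2))" using pos D0 by (intro divide_left_mono) auto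
      moreover have "1 / v\<^sup>2 * (sech2 \<i> w)\<^sup>2 = 16 / (D * D)" using v D0 unfolding s by (simp add: power2_eq_square)
      ultimately have "1 / v\<^sup>2 * (sech2 \<i> w)\<^sup>2 \<le> 16 * (inverse (1 + u\<^sup>2) * inverse (1 + v\<^sup>2))"
        by (simp add: divide_inverse)
      then have "ennreal (1 / v\<^sup>2 * (sech2 \<i> w)\<^sup>2) \<le> ennreal (16 * (inverse (1 + u\<^sup>2) * inverse (1 + v\<^sup>2)))"
        by (rule ennreal_leI)
      moreover have "ennreal (16 * (inverse (1 + u\<^sup>2) * inverse (1 + v\<^sup>2))) = 16 * (f u * f v)"
        using pos by (simp add: f_def ennreal_mult)
      moreover have "ennreal (1 / v\<^sup>2 * (sech2 \<i> w)\<^sup>2) = ennreal (1 / v\<^sup>2) * ennreal ((sech2 \<i> w)\<^sup>2)"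
        by (rule ennreal_mult) auto
      ultimately have "ennreal (1 / v\<^sup>2) * ennreal ((sech2 \<i> w)\<^sup>2) \<le> 16 * (f u * f v)" by (simp only:)
      then show ?thesis using True by (simp add: u_def v_def)
    qed simp
  qed
  also have "\<dots> = 16 * (\<integral>\<^sup>+w. f (Re w) * f (Im w) \<partial>lborel)" by (rule nn_integral_cmult) measurable
  also have "(\<integral>\<^sup>+w. f (Re w) * f (Im w) \<partial>lborel) = (\<integral>\<^sup>+p. f (fst p) * f (snd p) \<partial>(lborel \<Otimes>\<^sub>M lborel))"
  proof -
    have m: "(\<lambda>(x, y). Complex x y) \<in> borel_measurable (lborel \<Otimes>\<^sub>M lborel)"
      by (rule measurable_Complex)
    show ?thesis by (subst lborel_complex_prod, subst nn_integral_distr[OF m]) (auto simp: case_prod_beta')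
  qed
  also have "\<dots> = (\<integral>\<^sup>+x. (\<integral>\<^sup>+y. f x * f y \<partial>lborel) \<partial>lborel)"
    by (subst lborel.nn_integral_fst[symmetric]) auto
  also have "\<dots> = (\<integral>\<^sup>+x. f x \<partial>lborel) * (\<integral>\<^sup>+y. f y \<partial>lborel)"
    by (simp add: nn_integral_cmult nn_integral_multc)
  finally show ?thesis using fin by (simp add: ennreal_mult_less_top le_less_trans)
qed

lemma kernel_power:
  assumes "z \<in> \<HH>" shows "(\<integral>\<^sup>+w. ennreal (sech2 z w ^ s) \<partial>hyp_area) = power_mass s"
  unfolding power_mass_def by (rule kernel_mass[OF assms]) measurable

lemma trivial_discontinuous_group: "discontinuous_group {\<one>\<^bsub>PSL2R\<^esub>}"
proof (rule discontinuous_group.intro)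
  show "subgroup {\<one>\<^bsub>PSL2R\<^esub>} PSL2R" by (rule group.triv_subgroup[OF group_PSL2R])
  show "acts_discretely {\<one>\<^bsub>PSL2R\<^esub>}" unfolding acts_discretely_def
    by (auto intro: finite_subset[of _ "{\<one>\<^bsub>PSL2R\<^esub>}"])
qed

text \<open>This is \<open>moment_recursion\<close> for the identity map and the trivial group,
  with the whole half-plane as fundamental domain: it normalises the kernels.\<close>

lemma power_mass_recursion:
  assumes "2 \<le> s"
  shows "ennreal (real (s - 1)) * power_mass s = ennreal (real s) * power_mass (s + 1)"
proof -
  interpret T: discontinuous_group "{\<one>\<^bsub>PSL2R\<^esub>}" by (rule trivial_discontinuous_group)
  interpret I: equivariant_map "{\<one>\<^bsub>PSL2R\<^esub>}" "{\<one>\<^bsub>PSL2R\<^esub>}" "\<lambda>z. z" "\<lambda>g. g"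
    by unfold_locales auto
  have "act \<one>\<^bsub>PSL2R\<^esub> ` \<HH> = \<HH>" by (rule act_image[OF monoid.one_closed[OF group.is_monoid[OF group_PSL2R]]])
  then have fd: "fundamental_domain {\<one>\<^bsub>PSL2R\<^esub>} \<HH>" by (simp add: fundamental_domain_def)
  have ps: "I.poincare_series \<i> r z = ennreal (sech2 \<i> z ^ r)" if "z \<in> \<HH>" for r z
    using that unfolding I.poincare_series_def by (simp add: nn_integral_count_space_finite act_one sech2_commute)
  have mom: "I.moment \<HH> \<i> r = power_mass r" for r
  proof -
    have "I.moment \<HH> \<i> r = (\<integral>\<^sup>+z. ennreal (sech2 \<i> z ^ r) \<partial>hyp_area)"
      unfolding I.moment_def by (rule nn_integral_hyp_cong) (simp add: ps hyp_jacobian_id)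
    then show ?thesis by (simp add: kernel_power)
  qed
  have "(\<integral>\<^sup>+z. indicator \<HH> z * I.poincare_series \<i> 2 z \<partial>hyp_area) = (\<integral>\<^sup>+z. ennreal (sech2 \<i> z ^ 2) \<partial>hyp_area)"
    by (rule nn_integral_hyp_cong) (simp add: ps)
  then have "(\<integral>\<^sup>+z. indicator \<HH> z * I.poincare_series \<i> 2 z \<partial>hyp_area) < \<infinity>"
    using power_mass_2_finite by (simp add: kernel_power)
  from I.moment_recursion(1)[OF fd i_in assms this] show ?thesis by (simp add: mom)
qed

lemma recursion_telescopes:
  fixes A :: "nat \<Rightarrow> ennreal"
  assumes "\<And>s. 2 \<le> s \<Longrightarrow> ennreal (real (s - 1)) * A s = ennreal (real s) * A (s + 1)" and "2 \<le> s"
  shows "ennreal (real (s - 1)) * A s = A 2"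
  using assms(2)
proof (induction s rule: dec_induct)
  case base
  then show ?case by simp
next
  case (step n)
  then show ?case using assms(1)[of n] by simp
qed

lemma power_mass_pos: "power_mass 2 > 0"
proof -
  have "emeasure hyp_area (hdisc (1/2) \<i>) > 0"
    by (rule emeasure_open_pos) (use open_hdisc[OF i_in] centre_in_hdisc[OF i_in, of "1/2"] hdisc_subset in auto)
  then have "0 < ennreal (1/4) * emeasure hyp_area (hdisc (1/2) \<i>)" by (simp add: ennreal_zero_less_mult_iff)
  also have "\<dots> = (\<integral>\<^sup>+w. ennreal (1/4) * indicator (hdisc (1/2) \<i>) w \<partial>hyp_area)" by (simp add: nn_integral_cmult)
  also have "\<dots> \<le> (\<integral>\<^sup>+w. ennreal (sech2 \<i> w ^ 2) \<partial>hyp_area)"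
  proof (rule nn_integral_mono)
    fix w
    show "ennreal (1/4) * indicator (hdisc (1/2) \<i>) w \<le> ennreal (sech2 \<i> w ^ 2)"
    proof (cases "w \<in> hdisc (1/2) \<i>")
      case True
      then have "(1/2)\<^sup>2 \<le> sech2 \<i> w ^ 2" by (intro power_mono) (auto simp: hdisc_def)
      then show ?thesis using True by (simp add: power2_eq_square ennreal_leI)
    qed simp
  qed
  finally show ?thesis by (simp add: kernel_power)
qed

section \<open>Constancy of the degree\<close>

context nonconstant_equivariant_map
begin

definition weighted_count :: "complex \<Rightarrow> nat \<Rightarrow> ennreal" where
  "weighted_count b s = (\<integral>\<^sup>+w. ennreal (sech2 b w ^ s) * N w \<partial>hyp_area)"

text \<open>The area formula for the function \<open>sech2 b _ ^ s\<close>.\<close>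

lemma moment_eq_weighted_count:
  assumes F: "fundamental_domain \<Gamma> F" and b: "b \<in> \<HH>"
  shows "moment F b s = weighted_count b s"
proof -
  have "weighted_count b s = (\<integral>\<^sup>+w. N w * ennreal (sech2 b w ^ s) \<partial>hyp_area)"
    unfolding weighted_count_def by (simp add: mult.commute)
  also have "\<dots> = (\<integral>\<^sup>+z. indicator F z * (ennreal (hyp_jacobian p z) * (\<integral>\<^sup>+\<delta>. ennreal (sech2 b (act \<delta> (p z)) ^ s) \<partial>count_space \<Delta>)) \<partial>hyp_area)"
    by (rule area_formula[OF F]) measurable
  also have "\<dots> = moment F b s"
    unfolding moment_def
  proof (rule nn_integral_hyp_cong)
    fix z assume z: "z \<in> \<HH>"
    have "(\<integral>\<^sup>+\<delta>. ennreal (sech2 b (act \<delta> (p z)) ^ s) \<partial>count_space \<Delta>)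
        = (\<integral>\<^sup>+\<delta>. ennreal (sech2 (p z) (act (inv\<^bsub>PSL2R\<^esub> \<delta>) b) ^ s) \<partial>count_space \<Delta>)"
    proof (rule nn_integral_cong)
      fix \<delta> assume "\<delta> \<in> space (count_space \<Delta>)"
      then have "sech2 (act \<delta> (p z)) b = sech2 (p z) (act (inv\<^bsub>PSL2R\<^esub> \<delta>) b)"
        using sech2_act_left[OF target.mem_carrier p_in[OF z] b] by simp
      then show "ennreal (sech2 b (act \<delta> (p z)) ^ s) = ennreal (sech2 (p z) (act (inv\<^bsub>PSL2R\<^esub> \<delta>) b) ^ s)"
        by (simp add: sech2_commute[of b])
    qed
    also have "\<dots> = (\<integral>\<^sup>+\<delta>. ennreal (sech2 (p z) (act \<delta> b) ^ s) \<partial>count_space \<Delta>)" by (rule target.sum_over_inverses)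
    also have "\<dots> = poincare_series b s z" using z by (simp add: poincare_series_def)
    finally show "indicator F z * (ennreal (hyp_jacobian p z) * (\<integral>\<^sup>+\<delta>. ennreal (sech2 b (act \<delta> (p z)) ^ s) \<partial>count_space \<Delta>))
       = indicator F z * (ennreal (hyp_jacobian p z) * poincare_series b s z)" by simp
  qed
  finally show ?thesis by simp
qed

text \<open>By Tonelli and unfolding, the integral over \<open>b\<close> in \<open>G\<close> of
  these integrals is the area of \<open>F\<close> times \<open>power_mass 2\<close>, so it is
  finite.\<close>

lemma poincare_series_AE_integrable:
  assumes F: "fundamental_domain \<Gamma> F" and finF: "emeasure hyp_area F < \<infinity>"
    and G: "fundamental_domain \<Delta> G"
  shows "AE b in hyp_area. b \<in> G \<longrightarrow> (\<integral>\<^sup>+z. indicator F z * poincare_series b 2 z \<partial>hyp_area) < \<infinity>"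
proof -
  interpret pair_sigma_finite hyp_area hyp_area by (rule pair_sigma_finite_hyp_area)
  have [measurable]: "F \<in> sets borel" "G \<in> sets borel"
    using source.fundamental_domain_borel[OF F] target.fundamental_domain_borel[OF G] by auto
  have GH: "G \<subseteq> \<HH>" using G by (simp add: fundamental_domain_def)
  note [measurable] = measurable_act[OF target.mem_carrier]
  define q where "q z = indicator \<HH> z *\<^sub>R p z" for z
  have [measurable]: "q \<in> borel_measurable borel" unfolding q_def by (rule borel_measurable_on_upper_half_plane[OF p_continuous])
  define S where "S b z = (\<integral>\<^sup>+\<delta>. ennreal (sech2 (q z) (act \<delta> b) ^ 2) \<partial>count_space \<Delta>)" for b z
  have Sm [measurable]: "(\<lambda>x. S (fst x) (snd x)) \<in> borel_measurable (borel \<Otimes>\<^sub>M borel)"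
    unfolding S_def by (rule target.measurable_count_integral) measurable
  have Sm' [measurable]: "(\<lambda>x. S (snd x) (fst x)) \<in> borel_measurable (borel \<Otimes>\<^sub>M borel)"
    unfolding S_def by (rule target.measurable_count_integral) measurable
  have PS: "poincare_series b 2 z = S b z" if "z \<in> \<HH>" for b z
    using that by (simp add: poincare_series_def S_def q_def)
  have eqI: "(\<integral>\<^sup>+z. indicator F z * poincare_series b 2 z \<partial>hyp_area) = (\<integral>\<^sup>+z. indicator F z * S b z \<partial>hyp_area)" for b
    by (rule nn_integral_hyp_cong) (simp add: PS)
  have m1: "(\<lambda>b. \<integral>\<^sup>+z. indicator F z * S b z \<partial>hyp_area) \<in> borel_measurable borel"
  proof -
    have "(\<lambda>x. indicator F (snd x) * S (fst x) (snd x)) \<in> borel_measurable (borel \<Otimes>\<^sub>M hyp_area)" by measurable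
    from sigma_finite_measure.borel_measurable_nn_integral_fst[OF sigma_finite_hyp_area this] show ?thesis by simp
  qed
  have "(\<integral>\<^sup>+b. indicator G b * (\<integral>\<^sup>+z. indicator F z * S b z \<partial>hyp_area) \<partial>hyp_area)
     = (\<integral>\<^sup>+b. (\<integral>\<^sup>+z. indicator F z * (indicator G b * S b z) \<partial>hyp_area) \<partial>hyp_area)"
  proof (rule nn_integral_cong)
    fix b
    have "(\<lambda>z. indicator F z * S b z) \<in> borel_measurable hyp_area"
      using measurable_compose[OF measurable_Pair1'[of b borel borel] Sm] by simp
    then show "indicator G b * (\<integral>\<^sup>+z. indicator F z * S b z \<partial>hyp_area) = (\<integral>\<^sup>+z. indicator F z * (indicator G b * S b z) \<partial>hyp_area)"
      by (subst nn_integral_cmult[symmetric]) (auto simp: mult_ac)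
  qed
  also have "\<dots> = (\<integral>\<^sup>+z. (\<integral>\<^sup>+b. indicator F z * (indicator G b * S b z) \<partial>hyp_area) \<partial>hyp_area)"
    by (rule Fubini') measurable
  also have "\<dots> = (\<integral>\<^sup>+z. indicator F z * power_mass 2 \<partial>hyp_area)"
  proof (rule nn_integral_hyp_cong)
    fix z assume z: "z \<in> \<HH>"
    have m2: "(\<lambda>b. S b z) \<in> borel_measurable borel"
      using measurable_compose[OF measurable_Pair2'[of z borel borel] Sm] by simp
    have "(\<integral>\<^sup>+b. indicator F z * (indicator G b * S b z) \<partial>hyp_area) = indicator F z * (\<integral>\<^sup>+b. indicator G b * S b z \<partial>hyp_area)"
      using m2 by (intro nn_integral_cmult) measurable
    also have "(\<integral>\<^sup>+b. indicator G b * S b z \<partial>hyp_area) = (\<integral>\<^sup>+b. ennreal (sech2 (q z) b ^ 2) \<partial>hyp_area)"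
      unfolding S_def by (rule target.unfolding_integral[OF G, symmetric]) measurable
    also have "\<dots> = power_mass 2" by (rule kernel_power) (use z p_in in \<open>simp add: q_def\<close>)
    finally show "(\<integral>\<^sup>+b. indicator F z * (indicator G b * S b z) \<partial>hyp_area) = indicator F z * power_mass 2" .
  qed
  also have "\<dots> = emeasure hyp_area F * power_mass 2" by (simp add: nn_integral_multc)
  also have "\<dots> < \<infinity>" using finF power_mass_2_finite by (simp add: ennreal_mult_less_top)
  finally have "AE b in hyp_area. indicator G b * (\<integral>\<^sup>+z. indicator F z * S b z \<partial>hyp_area) \<noteq> \<infinity>"
    using m1 by (intro nn_integral_PInf_AE) auto
  then show ?thesis unfolding eqI by eventually_elim (auto simp: less_top)
qed

text \<open>By the recursions the normalised moments do not depend on \<open>s\<close>: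
  \<open>(s + 1)\<close> times the moment of order \<open>s + 2\<close> is the moment of order
  \<open>2\<close>, with \<open>N\<close> or without. There is a disc about \<open>b\<close> on
  which \<open>N \<ge> m\<close>. Outside it \<open>sech2 b\<close> is at most some \<open>t <
  1\<close>, and the contribution \<open>(s + 1) t ^ s\<close> of that part vanishes as
  \<open>s\<close> grows.\<close>

lemma weighted_count_ge:
  assumes b: "b \<in> \<HH>"
    and rec: "\<And>s. 2 \<le> s \<Longrightarrow> ennreal (real (s - 1)) * weighted_count b s = ennreal (real s) * weighted_count b (s + 1)"
    and m: "of_nat m \<le> N b"
  shows "power_mass 2 * of_nat m \<le> weighted_count b 2"
proof (cases "m = 0")
  case False
  have "b \<in> {w \<in> \<HH>. of_nat m \<le> fibre_count w}" using m b by (simp add: N_def)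
  then obtain t0 where t0: "t0 < 1" "\<And>t. t0 < t \<Longrightarrow> t < 1 \<Longrightarrow> hdisc t b \<subseteq> {w \<in> \<HH>. of_nat m \<le> fibre_count w}"
    using hdisc_shrinks[OF b open_fibre_count_ge[of m]] by blast
  define t where "t = (max 0 t0 + 1) / 2"
  have t: "t0 < t" "0 < t" "t < 1" using t0(1) by (auto simp: t_def)
  have ge: "of_nat m \<le> N w" if "w \<in> hdisc t b" for w
    using t0(2)[OF t(1,3)] that by (auto simp: N_def)
  obtain c where c: "power_mass 2 = ennreal c" "0 \<le> c" using power_mass_2_finite by (cases "power_mass 2") auto
  have bound: "power_mass 2 * of_nat m \<le> weighted_count b 2 + ennreal (real (s + 1) * t ^ s) * power_mass 2 * of_nat m" for s :: nat
  proof -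
    have nn: "0 \<le> sech2 b w" if "w \<in> \<HH>" for w using sech2_pos[OF b that] by simp
    have "power_mass (s + 2) * of_nat m = (\<integral>\<^sup>+w. ennreal (sech2 b w ^ (s + 2)) * of_nat m \<partial>hyp_area)"
      using kernel_power[OF b, of "s + 2"] by (subst nn_integral_multc) auto
    also have "\<dots> \<le> (\<integral>\<^sup>+w. ennreal (sech2 b w ^ (s + 2)) * N w + ennreal (t ^ s) * ennreal (sech2 b w ^ 2) * of_nat m \<partial>hyp_area)"
    proof (rule nn_integral_mono_AE, use AE_upper_half_plane in eventually_elim)
      case (elim w)
      show ?case
      proof (cases "w \<in> hdisc t b")
        case True
        then have "ennreal (sech2 b w ^ (s + 2)) * of_nat m \<le> ennreal (sech2 b w ^ (s + 2)) * N w"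
          using ge by (intro mult_left_mono) auto
        then show ?thesis by (rule order_trans) simp
      next
        case False
        then have "sech2 b w \<le> t" using elim by (simp add: hdisc_def)
        then have "sech2 b w ^ s \<le> t ^ s" using nn[OF elim] by (rule power_mono)
        then have "sech2 b w ^ (s + 2) \<le> t ^ s * sech2 b w ^ 2"
          unfolding power_add by (intro mult_right_mono) auto
        then have "ennreal (sech2 b w ^ (s + 2)) \<le> ennreal (t ^ s * sech2 b w ^ 2)" by (rule ennreal_leI)
        also have "\<dots> = ennreal (t ^ s) * ennreal (sech2 b w ^ 2)" using t by (intro ennreal_mult) auto
        finally have "ennreal (sech2 b w ^ (s + 2)) * of_nat m \<le> ennreal (t ^ s) * ennreal (sech2 b w ^ 2) * of_nat m"
          by (rule mult_right_mono) simp
        then show ?thesis by (rule order_trans) simp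
      qed
    qed
    also have "\<dots> = weighted_count b (s + 2) + ennreal (t ^ s) * power_mass 2 * of_nat m"
      unfolding weighted_count_def kernel_power[OF b, symmetric]
      by (subst nn_integral_add) (auto simp: nn_integral_cmult nn_integral_multc)
    finally have "ennreal (real (s + 1)) * (power_mass (s + 2) * of_nat m)
       \<le> ennreal (real (s + 1)) * (weighted_count b (s + 2) + ennreal (t ^ s) * power_mass 2 * of_nat m)"
      by (rule mult_left_mono) simp
    moreover have "ennreal (real (s + 1)) * power_mass (s + 2) = power_mass 2"
      using recursion_telescopes[of power_mass "s + 2", OF power_mass_recursion] by simp
    moreover have "ennreal (real (s + 1)) * weighted_count b (s + 2) = weighted_count b 2"
      using recursion_telescopes[of "weighted_count b" "s + 2", OF rec] by simp
    moreover have "ennreal (real (s + 1)) * ennreal (t ^ s) = ennreal (real (s + 1) * t ^ s)"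
      using t by (intro ennreal_mult[symmetric]) auto
    ultimately show ?thesis by (simp add: distrib_left mult.assoc[symmetric])
  qed
  have "(\<lambda>s. real (s + 1) * t ^ s) \<longlonglongrightarrow> 0"
  proof -
    have "(\<lambda>s. real s * t ^ s + t ^ s) \<longlonglongrightarrow> 0 + 0"
      by (intro tendsto_add powser_times_n_limit_0 LIMSEQ_power_zero) (use t in auto)
    then show ?thesis by (simp add: algebra_simps)
  qed
  then have "(\<lambda>s. ennreal (real (s + 1) * t ^ s)) \<longlonglongrightarrow> ennreal 0" by (rule tendsto_ennrealI)
  then have "(\<lambda>s. ennreal (real (s + 1) * t ^ s) * (power_mass 2 * of_nat m)) \<longlonglongrightarrow> ennreal 0 * (power_mass 2 * of_nat m)"
    using c by (intro tendsto_mult_ennreal tendsto_const) (auto simp: ennreal_mult_eq_top_iff)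
  then have "(\<lambda>s. weighted_count b 2 + ennreal (real (s + 1) * t ^ s) * power_mass 2 * of_nat m) \<longlonglongrightarrow> weighted_count b 2 + 0"
    by (intro tendsto_add tendsto_const) (simp add: mult.assoc)
  then show ?thesis using bound by (intro LIMSEQ_le_const[of _ "weighted_count b 2"]) auto
qed simp

lemma weighted_count_ge_N:
  assumes F: "fundamental_domain \<Gamma> F" and b: "b \<in> \<HH>"
    and fin: "(\<integral>\<^sup>+z. indicator F z * poincare_series b 2 z \<partial>hyp_area) < \<infinity>"
  shows "power_mass 2 * N b \<le> weighted_count b 2"
proof -
  have rec: "ennreal (real (s - 1)) * weighted_count b s = ennreal (real s) * weighted_count b (s + 1)" if "2 \<le> s" for s
    using moment_recursion(1)[OF F b that fin] by (simp add: moment_eq_weighted_count[OF F b])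
  have fin2: "weighted_count b 2 < \<infinity>"
    using moment_recursion(2)[OF F b _ fin, of 2] by (simp add: moment_eq_weighted_count[OF F b])
  show ?thesis
  proof (rule N_cases[of b])
    fix n :: nat assume "N b = of_nat n"
    then show ?thesis using weighted_count_ge[OF b rec, of n] by simp
  next
    assume inf: "N b = \<infinity>"
    have "power_mass 2 * of_nat m \<le> weighted_count b 2" for m using weighted_count_ge[OF b rec, of m] inf by simp
    moreover obtain c where c: "power_mass 2 = ennreal c" "0 < c"
      using power_mass_2_finite power_mass_pos by (cases "power_mass 2") auto
    moreover obtain W where W: "weighted_count b 2 = ennreal W" "0 \<le> W" using fin2 by (cases "weighted_count b 2") auto
    ultimately have "ennreal (c * real m) \<le> ennreal W" for m by (simp add: ennreal_of_nat_eq_real_of_nat ennreal_mult)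
    then have le: "c * real m \<le> W" for m using W(2) by (simp add: ennreal_le_iff)
    obtain m :: nat where "W / c < real m" using reals_Archimedean2 by blast
    then have "W < c * real m" using c(2) by (simp add: pos_divide_less_eq mult.commute)
    then show ?thesis using le[of m] by linarith
  qed
qed

text \<open>Apply the area formula to the indicator function of a strict fundamental set of
  \<open>\<Delta>\<close>: the orbit of \<open>p z\<close> meets it once unless \<open>p
  z\<close> is a fixed point, which happens for countably many \<open>z\<close> only.\<close>

lemma integral_N:
  assumes F: "fundamental_domain \<Gamma> F" and G: "fundamental_domain \<Delta> G"
  shows "(\<integral>\<^sup>+w. indicator G w * N w \<partial>hyp_area) = (\<integral>\<^sup>+z. indicator F z * ennreal (hyp_jacobian p z) \<partial>hyp_area)"
proof -
  have [measurable]: "G \<in> sets borel" by (rule target.fundamental_domain_borel[OF G])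
  obtain G0 where G0: "G0 \<in> sets borel" "G0 \<subseteq> \<HH>" "target.fixed_points \<subseteq> G0"
    and ex1: "\<And>z. z \<in> \<HH> - target.fixed_points \<Longrightarrow> \<exists>!\<gamma>. \<gamma> \<in> \<Delta> \<and> act \<gamma> z \<in> G0"
    by (rule target.strict_fundamental_set) blast
  have fd0: "fundamental_domain \<Delta> G0" by (rule target.strict_fundamental_domain[OF G0 ex1])
  have [measurable]: "G0 \<in> sets borel" by (rule G0)
  define bad where "bad = {z \<in> \<HH>. p z \<in> target.fixed_points}"
  have "countable bad"
  proof -
    have eq: "bad = (\<Union>c\<in>target.fixed_points. {z \<in> \<HH>. p z - c = 0})" by (auto simp: bad_def)
    have "countable {z \<in> \<HH>. p z - c = 0}" for c
    proof (rule holomorphic_countable_zeros)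
      show "(\<lambda>z. p z - c) holomorphic_on \<HH>" by (intro holomorphic_intros hol)
      show "\<not> (\<lambda>z. p z - c) constant_on \<HH>"
      proof
        assume "(\<lambda>z. p z - c) constant_on \<HH>"
        then obtain d where "\<And>z. z \<in> \<HH> \<Longrightarrow> p z - c = d" by (auto simp: constant_on_def)
        then have "\<And>z. z \<in> \<HH> \<Longrightarrow> p z = d + c" by (metis diff_add_cancel)
        then have "p constant_on \<HH>" unfolding constant_on_def by blast
        then show False using nonconst by simp
      qed
    qed (simp_all add: open_upper_half_plane fsigma_upper_half_plane convex_connected[OF convex_upper_half_plane])
    then show ?thesis unfolding eq by (intro countable_UN target.countable_fixed_points)
  qed
  have "(\<integral>\<^sup>+w. indicator G w * N w \<partial>hyp_area) = (\<integral>\<^sup>+w. indicator G0 w * N w \<partial>hyp_area)"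
    by (rule target.integral_fundamental_domain_unique[OF fd0 G N_measurable N_invariant])
  also have "\<dots> = (\<integral>\<^sup>+w. N w * indicator G0 w \<partial>hyp_area)" by (simp add: mult.commute)
  also have "\<dots> = (\<integral>\<^sup>+z. indicator F z * (ennreal (hyp_jacobian p z) * (\<integral>\<^sup>+\<delta>. indicator G0 (act \<delta> (p z)) \<partial>count_space \<Delta>)) \<partial>hyp_area)"
    by (rule area_formula[OF F]) measurable
  also have "\<dots> = (\<integral>\<^sup>+z. indicator F z * ennreal (hyp_jacobian p z) \<partial>hyp_area)"
  proof (rule nn_integral_cong_AE, use AE_not_in[OF hyp_area_countable_null[OF \<open>countable bad\<close>]] AE_upper_half_plane in eventually_elim)
    case (elim z)
    then have "p z \<in> \<HH> - target.fixed_points" using p_in by (auto simp: bad_def)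
    from ex1[OF this] have "(\<integral>\<^sup>+\<delta>. indicator G0 (act \<delta> (p z)) \<partial>count_space \<Delta>) = 1"
      by (rule sum_indicator_unique)
    then show ?case by simp
  qed
  finally show ?thesis .
qed

end

lemma AE_eq_if_le_and_integral_eq:
  fixes u v :: "'a \<Rightarrow> ennreal"
  assumes [measurable]: "u \<in> borel_measurable M" "v \<in> borel_measurable M"
    and le: "AE x in M. u x \<le> v x" and eq: "(\<integral>\<^sup>+x. u x \<partial>M) = (\<integral>\<^sup>+x. v x \<partial>M)" and fin: "(\<integral>\<^sup>+x. u x \<partial>M) < \<infinity>"
  shows "AE x in M. u x = v x"
proof -
  have "(\<integral>\<^sup>+x. v x - u x \<partial>M) = (\<integral>\<^sup>+x. v x \<partial>M) - (\<integral>\<^sup>+x. u x \<partial>M)"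
    by (rule nn_integral_diff) (use le fin in auto)
  also have "\<dots> = 0" using eq fin by simp
  finally have "AE x in M. v x - u x = 0" by (subst (asm) nn_integral_0_iff_AE) auto
  then show ?thesis using le
    by eventually_elim (meson antisym ennreal_minus_eq_0)
qed

lemma not_AE_hyp_area_False: "\<not> (AE z in hyp_area. False)"
proof
  assume "AE z in hyp_area. False"
  then have "emeasure hyp_area UNIV = 0" by (subst (asm) AE_iff_measurable[OF _ refl]) auto
  then show False using emeasure_hyp_area_UNIV by simp
qed

context nonconstant_equivariant_map
begin

text \<open>Let \<open>K\<close> be the averaging operator with kernel
  \<open>sech2\<^sup>2\<close> and \<open>c\<close> its mass. Since \<open>K N \<ge> c N\<close>
  and both sides have the same finite integral over \<open>G\<close>, they agree almost
  everywhere. For the truncations \<open>M m\<close> of \<open>N\<close> at height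
  \<open>m\<close> the inequality \<open>K (M m) \<le> c (M m)\<close> is immediate from this,
  and again the integrals agree. The difference \<open>e m\<close> of two consecutive
  truncations is the indicator function of \<open>{N \<ge> m + 1}\<close>. If this set does not
  have full area, \<open>K (e m)\<close> vanishes at some point outside it, and as the kernel is
  positive the set is null.\<close>

lemma N_AE_constant:
  assumes F: "fundamental_domain \<Gamma> F" and finF: "emeasure hyp_area F < \<infinity>"
    and G: "fundamental_domain \<Delta> G"
  obtains d :: nat where "AE w in hyp_area. N w = of_nat d"
proof -
  have [measurable]: "F \<in> sets borel" "G \<in> sets borel"
    using source.fundamental_domain_borel[OF F] target.fundamental_domain_borel[OF G] by auto
  have GH: "G \<subseteq> \<HH>" using G by (simp add: fundamental_domain_def)
  define c where "c = power_mass 2"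
  have c: "0 < c" "c < \<infinity>" using power_mass_pos power_mass_2_finite by (auto simp: c_def)
  define K where "K f b = (\<integral>\<^sup>+w. ennreal (sech2 b w ^ 2) * f w \<partial>hyp_area)" for f b
  have Km: "K f \<in> borel_measurable borel" if f [measurable]: "f \<in> borel_measurable borel" for f
  proof -
    have "(\<lambda>x. ennreal (sech2 (fst x) (snd x) ^ 2) * f (snd x)) \<in> borel_measurable (borel \<Otimes>\<^sub>M hyp_area)" by measurable
    from sigma_finite_measure.borel_measurable_nn_integral_fst[OF sigma_finite_hyp_area this]
    show ?thesis unfolding K_def by simp
  qed
  have intK: "(\<integral>\<^sup>+b. indicator G b * K f b \<partial>hyp_area) = (\<integral>\<^sup>+b. indicator G b * (c * f b) \<partial>hyp_area)"
    if f [measurable]: "f \<in> borel_measurable borel" and inv: "target.invariant f" for f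
  proof -
    have "(\<integral>\<^sup>+b. indicator G b * K f b \<partial>hyp_area) = c * (\<integral>\<^sup>+w. indicator G w * f w \<partial>hyp_area)"
      unfolding K_def c_def power_mass_def
      by (rule target.integral_kernel[OF G _ f inv, of "\<lambda>x. ennreal (x ^ 2)"]) measurable
    also have "\<dots> = (\<integral>\<^sup>+b. c * (indicator G b * f b) \<partial>hyp_area)" by (rule nn_integral_cmult[symmetric]) measurable
    finally show ?thesis by (simp add: mult_ac)
  qed
  define I where "I = (\<integral>\<^sup>+w. indicator G w * N w \<partial>hyp_area)"
  have "I \<le> (\<integral>\<^sup>+z. indicator F z \<partial>hyp_area)"
    unfolding I_def integral_N[OF F G]
    by (rule nn_integral_mono_AE, use AE_upper_half_plane in eventually_elim)
      (use hyp_jacobian_le_1[OF hol maps] in \<open>auto simp: indicator_def\<close>)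
  also have "\<dots> < \<infinity>" using finF by simp
  finally have I: "I < \<infinity>" .
  have fin_le: "(\<integral>\<^sup>+b. indicator G b * (c * f b) \<partial>hyp_area) < \<infinity>" if "\<And>w. f w \<le> N w" for f
  proof -
    have "(\<integral>\<^sup>+b. indicator G b * (c * f b) \<partial>hyp_area) \<le> (\<integral>\<^sup>+b. c * (indicator G b * N b) \<partial>hyp_area)"
      using that by (intro nn_integral_mono) (auto simp: indicator_def intro!: mult_left_mono)
    also have "\<dots> = c * I" unfolding I_def by (rule nn_integral_cmult) measurable
    finally show ?thesis using c I by (simp add: ennreal_mult_less_top le_less_trans)
  qed
  have KN: "AE b in hyp_area. b \<in> G \<longrightarrow> K N b = c * N b"
  proof -
    have "AE b in hyp_area. indicator G b * (c * N b) = indicator G b * K N b"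
    proof (rule AE_eq_if_le_and_integral_eq)
      show "AE b in hyp_area. indicator G b * (c * N b) \<le> indicator G b * K N b"
        using poincare_series_AE_integrable[OF F finF G]
      proof eventually_elim
        case (elim b)
        show ?case
        proof (cases "b \<in> G")
          case True
          then show ?thesis using weighted_count_ge_N[OF F _ elim[rule_format]] GH
            by (auto simp: c_def K_def weighted_count_def)
        qed simp
      qed
      show "(\<lambda>b. indicator G b * K N b) \<in> borel_measurable hyp_area" using Km[OF N_measurable] by measurable
      show "(\<integral>\<^sup>+b. indicator G b * (c * N b) \<partial>hyp_area) = (\<integral>\<^sup>+b. indicator G b * K N b \<partial>hyp_area)"
        by (rule intK[OF N_measurable N_invariant, symmetric])
      show "(\<integral>\<^sup>+b. indicator G b * (c * N b) \<partial>hyp_area) < \<infinity>" by (rule fin_le) simp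
    qed measurable
    then show ?thesis by eventually_elim auto
  qed
  define M where "M m w = min (N w) (of_nat m)" for m :: nat and w
  have Mm [measurable]: "M m \<in> borel_measurable borel" for m unfolding M_def by measurable
  have Minv: "target.invariant (M m)" for m using N_invariant by (simp add: target.invariant_def M_def)
  have KM: "AE b in hyp_area. b \<in> G \<longrightarrow> K (M m) b = c * M m b" for m
  proof -
    have "AE b in hyp_area. indicator G b * K (M m) b = indicator G b * (c * M m b)"
    proof (rule AE_eq_if_le_and_integral_eq)
      show "AE b in hyp_area. indicator G b * K (M m) b \<le> indicator G b * (c * M m b)"
        using KN
      proof eventually_elim
        case (elim b)
        show ?case
        proof (cases "b \<in> G")
          case True
          then have bH: "b \<in> \<HH>" using GH by blast
          have "K (M m) b \<le> K N b" unfolding K_def M_def by (intro nn_integral_mono mult_left_mono) auto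
          moreover have "K (M m) b \<le> c * of_nat m"
          proof -
            have "K (M m) b \<le> (\<integral>\<^sup>+w. ennreal (sech2 b w ^ 2) * of_nat m \<partial>hyp_area)"
              unfolding K_def M_def by (intro nn_integral_mono mult_left_mono) auto
            also have "\<dots> = c * of_nat m" unfolding c_def kernel_power[OF bH, symmetric] by (rule nn_integral_multc) measurable
            finally show ?thesis .
          qed
          ultimately show ?thesis using elim True by (auto simp: M_def min_def)
        qed simp
      qed
      show "(\<lambda>b. indicator G b * K (M m) b) \<in> borel_measurable hyp_area" using Km[OF Mm] by measurable
      show eq: "(\<integral>\<^sup>+b. indicator G b * K (M m) b \<partial>hyp_area) = (\<integral>\<^sup>+b. indicator G b * (c * M m b) \<partial>hyp_area)"
        by (rule intK[OF Mm Minv])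
      show "(\<integral>\<^sup>+b. indicator G b * K (M m) b \<partial>hyp_area) < \<infinity>" unfolding eq by (rule fin_le) (simp add: M_def)
    qed measurable
    then show ?thesis by eventually_elim auto
  qed
  define e where "e m w = (indicator {w. of_nat (Suc m) \<le> N w} w :: ennreal)" for m :: nat and w
  have em [measurable]: "e m \<in> borel_measurable borel" for m
    unfolding e_def by (intro borel_measurable_indicator N_ge_measurable)
  have M_Suc: "M (Suc m) w = M m w + e m w" for m w
  proof (rule N_cases[of w])
    fix n :: nat assume n: "N w = of_nat n"
    show ?thesis
    proof (cases "Suc m \<le> n")
      case True
      then have "M (Suc m) w = of_nat (Suc m)" "M m w = of_nat m" "e m w = 1"
        unfolding M_def e_def by (auto simp: n indicator_def min_def simp del: of_nat_Suc)
      then show ?thesis by simp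
    next
      case False
      then have "M (Suc m) w = of_nat n" "M m w = of_nat n" "e m w = 0"
        unfolding M_def e_def by (auto simp: n indicator_def min_def simp del: of_nat_Suc)
      then show ?thesis by simp
    qed
  next
    assume "N w = \<infinity>"
    then show ?thesis by (simp add: M_def e_def)
  qed
  have Ke: "AE b in hyp_area. b \<in> G \<longrightarrow> K (e m) b = c * e m b" for m
    using KM[of m] KM[of "Suc m"]
  proof eventually_elim
    case (elim b)
    show ?case
    proof
      assume b: "b \<in> G"
      have "K (M (Suc m)) b = (\<integral>\<^sup>+w. ennreal (sech2 b w ^ 2) * M m w + ennreal (sech2 b w ^ 2) * e m w \<partial>hyp_area)"
        unfolding K_def M_Suc by (simp add: distrib_left)
      also have "\<dots> = K (M m) b + K (e m) b" unfolding K_def by (rule nn_integral_add) measurable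
      finally have "c * M m b + K (e m) b = c * M m b + c * e m b"
        using elim b by (auto simp: M_Suc distrib_left)
      moreover have "c * M m b < \<infinity>"
      proof -
        have "M m b \<le> of_nat m" by (simp add: M_def)
        also have "\<dots> < \<infinity>" by (simp add: of_nat_less_top)
        finally show ?thesis using c by (simp add: ennreal_mult_less_top)
      qed
      ultimately show "K (e m) b = c * e m b" by auto
    qed
  qed
  have dich: "(AE w in hyp_area. of_nat (Suc m) \<le> N w) \<or> (AE w in hyp_area. \<not> of_nat (Suc m) \<le> N w)" for m
  proof (cases "AE b in hyp_area. b \<in> G \<longrightarrow> of_nat (Suc m) \<le> N b")
    case True
    have "AE w in hyp_area. of_nat (Suc m) \<le> N w"
    proof (rule target.AE_invariant[OF G _ _ True])
      show "Measurable.pred borel (\<lambda>w. of_nat (Suc m) \<le> N w)" using N_ge_measurable[of "Suc m"] by (simp add: pred_def)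
      show "target.invariant (\<lambda>w. of_nat (Suc m) \<le> N w)" using N_invariant by (simp add: target.invariant_def)
    qed
    then show ?thesis ..
  next
    case False
    have "\<exists>b. b \<in> G \<and> \<not> of_nat (Suc m) \<le> N b \<and> K (e m) b = c * e m b"
    proof (rule ccontr)
      assume "\<not> ?thesis"
      then have "AE b in hyp_area. b \<in> G \<longrightarrow> of_nat (Suc m) \<le> N b"
        using Ke[of m] by (auto elim!: eventually_mono simp del: of_nat_Suc)
      then show False using False by simp
    qed
    then obtain b where b: "b \<in> G" "\<not> of_nat (Suc m) \<le> N b" "K (e m) b = c * e m b" by blast
    have bH: "b \<in> \<HH>" using b GH by blast
    have "e m b = 0" using b(2) by (simp add: e_def del: of_nat_Suc)
    then have "K (e m) b = 0" using b(3) by simp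
    then have "AE w in hyp_area. ennreal (sech2 b w ^ 2) * e m w = 0"
      unfolding K_def by (subst (asm) nn_integral_0_iff_AE) measurable
    then have "AE w in hyp_area. \<not> of_nat (Suc m) \<le> N w" using AE_upper_half_plane
    proof eventually_elim
      case (elim w)
      have "sech2 b w ^ 2 > 0" using sech2_pos[OF bH elim(2)] by simp
      then have "e m w = 0" using elim(1) by (simp add: ennreal_eq_0_iff not_le)
      then show ?case by (auto simp: e_def simp del: of_nat_Suc)
    qed
    then show ?thesis ..
  qed
  have finN: "AE w in hyp_area. N w \<noteq> \<infinity>"
  proof (rule target.AE_invariant[OF G])
    show "Measurable.pred borel (\<lambda>w. N w \<noteq> \<infinity>)" by measurable
    show "target.invariant (\<lambda>w. N w \<noteq> \<infinity>)" using N_invariant by (simp add: target.invariant_def)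
    have "AE w in hyp_area. indicator G w * N w \<noteq> \<infinity>"
      by (rule nn_integral_PInf_AE) (use I in \<open>auto simp: I_def\<close>)
    then show "AE w in hyp_area. w \<in> G \<longrightarrow> N w \<noteq> \<infinity>" by eventually_elim auto
  qed
  have ex: "\<exists>m. \<not> (AE w in hyp_area. of_nat (Suc m) \<le> N w)"
  proof (rule ccontr)
    assume "\<not> ?thesis"
    then have "AE w in hyp_area. \<forall>m. of_nat (Suc m) \<le> N w" by (subst AE_all_countable) blast
    then have "AE w in hyp_area. False" using finN
    proof eventually_elim
      case (elim w)
      show False
      proof (rule N_cases[of w])
        fix n :: nat assume "N w = of_nat n"
        then have "of_nat (Suc n) \<le> (of_nat n :: ennreal)" using elim(1) by metis
        then show False by (simp del: of_nat_Suc)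
      qed (use elim in simp)
    qed
    then show False using not_AE_hyp_area_False by simp
  qed
  define d where "d = (LEAST m. \<not> (AE w in hyp_area. of_nat (Suc m) \<le> N w))"
  have "\<not> (AE w in hyp_area. of_nat (Suc d) \<le> N w)" unfolding d_def by (rule LeastI_ex[OF ex])
  then have d1: "AE w in hyp_area. \<not> of_nat (Suc d) \<le> N w" using dich[of d] by blast
  have d2: "AE w in hyp_area. of_nat d \<le> N w"
  proof (cases d)
    case (Suc k)
    then have "AE w in hyp_area. of_nat (Suc k) \<le> N w" using not_less_Least[of k] unfolding d_def by (metis lessI)
    then show ?thesis by (simp only: Suc)
  qed simp
  have "AE w in hyp_area. N w = of_nat d" using d1 d2
  proof eventually_elim
    case (elim w)
    show ?case
    proof (rule N_cases[of w])
      fix n :: nat assume n: "N w = of_nat n"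
      have "d \<le> n" "\<not> Suc d \<le> n" using elim unfolding n by (simp_all del: of_nat_Suc)
      then show ?thesis using n by simp
    qed (use elim in simp)
  qed
  then show ?thesis by (rule that)
qed

text \<open>The almost everywhere constant value of \<open>N\<close> is the degree; integrate it
  over \<open>G\<close>.\<close>

lemma quotient_degree_times_area:
  assumes F: "fundamental_domain \<Gamma> F" and finF: "emeasure hyp_area F < \<infinity>"
    and G: "fundamental_domain \<Delta> G"
  shows "of_nat (quotient_degree \<Gamma> \<Delta> (descended_map \<Delta> p)) * emeasure hyp_area G
    = (\<integral>\<^sup>+z. indicator F z * ennreal (hyp_jacobian p z) \<partial>hyp_area)"
proof -
  obtain d :: nat where d: "AE w in hyp_area. N w = of_nat d" by (rule N_AE_constant[OF F finF G])
  have cnt: "AE w in hyp_area. finite (preimages w) \<and> card (preimages w) = d"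
    using d AE_upper_half_plane
  proof eventually_elim
    case (elim w)
    then have fc: "fibre_count w = of_nat d" by (simp add: N_def)
    have "finite (preimages w)"
    proof (rule ccontr)
      assume "infinite (preimages w)"
      then show False using fc by (simp add: fibre_count_def)
    qed
    then show ?case using fc by (simp add: fibre_count_def)
  qed
  have "quotient_degree \<Gamma> \<Delta> (descended_map \<Delta> p) = d"
    unfolding quotient_degree_def
  proof (rule the_equality)
    show "AE w in hyp_area. finite {X \<in> quotient_space \<Gamma>. descended_map \<Delta> p X = orbit_of \<Delta> w} \<and>
        card {X \<in> quotient_space \<Gamma>. descended_map \<Delta> p X = orbit_of \<Delta> w} = d"
      using cnt by (simp add: preimages_def)
  next
    fix d' assume "AE w in hyp_area. finite {X \<in> quotient_space \<Gamma>. descended_map \<Delta> p X = orbit_of \<Delta> w} \<and>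
        card {X \<in> quotient_space \<Gamma>. descended_map \<Delta> p X = orbit_of \<Delta> w} = d'"
    then have ae: "AE w in hyp_area. card (preimages w) = d'" by eventually_elim (simp add: preimages_def)
    show "d' = d"
    proof (rule ccontr)
      assume ne: "d' \<noteq> d"
      have "AE w in hyp_area. False" using cnt ae by eventually_elim (use ne in auto)
      then show False using not_AE_hyp_area_False by simp
    qed
  qed
  moreover have "of_nat d * emeasure hyp_area G = (\<integral>\<^sup>+w. indicator G w * N w \<partial>hyp_area)"
  proof -
    have [measurable]: "G \<in> sets borel" by (rule target.fundamental_domain_borel[OF G])
    have "(\<integral>\<^sup>+w. indicator G w * N w \<partial>hyp_area) = (\<integral>\<^sup>+w. of_nat d * indicator G w \<partial>hyp_area)"
      by (rule nn_integral_cong_AE, use d in eventually_elim) (simp add: mult.commute)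
    then show ?thesis by (simp add: nn_integral_cmult)
  qed
  ultimately show ?thesis by (simp add: integral_N[OF F G])
qed

end

section \<open>The Lyapunov exponent as a mean Jacobian\<close>

text \<open>Were \<open>p\<close> constant, its value would be fixed by \<open>\<rho> `
  \<Gamma>\<close>. A group that acts discretely and fixes a point is finite, and a finite group
  has infinite covolume.\<close>

lemma cofinite_modular_embedding_locale:
  assumes "cofinite_modular_embedding \<Gamma> p \<rho>"
  shows "nonconstant_equivariant_map \<Gamma> (\<rho> ` \<Gamma>) p \<rho>"
    "covolume \<Gamma> < \<infinity>" "covolume (\<rho> ` \<Gamma>) < \<infinity>"
proof -
  have m: "modular_embedding \<Gamma> p \<rho>" and disc: "acts_discretely (\<rho> ` \<Gamma>)" and cov: "covolume (\<rho> ` \<Gamma>) < \<infinity>"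
    using assms by (auto simp: cofinite_modular_embedding_def)
  have lat: "lattice_PSL2R \<Gamma>" and hom: "\<rho> \<in> hom (PSL2R\<lparr>carrier := \<Gamma>\<rparr>) PSL2R"
    and maps: "p ` \<HH> \<subseteq> \<HH>" and hol: "p holomorphic_on \<HH>"
    and eqv: "\<And>\<gamma> z. \<gamma> \<in> \<Gamma> \<Longrightarrow> z \<in> \<HH> \<Longrightarrow> p (act \<gamma> z) = act (\<rho> \<gamma>) (p z)"
    using m by (auto simp: modular_embedding_def)
  show "covolume \<Gamma> < \<infinity>" "covolume (\<rho> ` \<Gamma>) < \<infinity>" using lat cov by (auto simp: lattice_PSL2R_def)
  interpret S: discontinuous_group \<Gamma> by (rule lattice_discontinuous[OF lat])
  have "group_hom (PSL2R\<lparr>carrier := \<Gamma>\<rparr>) PSL2R \<rho>"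
    using hom group_PSL2R group.subgroup_imp_group[OF group_PSL2R S.subgroup]
    by (simp add: group_hom_def group_hom_axioms_def)
  then have "subgroup (\<rho> ` \<Gamma>) PSL2R" using group_hom.img_is_subgroup by fastforce
  then interpret T: discontinuous_group "\<rho> ` \<Gamma>" using disc by (rule discontinuous_group.intro)
  interpret E: equivariant_map \<Gamma> "\<rho> ` \<Gamma>" p \<rho> by unfold_locales (use hol maps eqv in auto)
  obtain G0 where G0: "G0 \<in> sets borel" "G0 \<subseteq> \<HH>" "T.fixed_points \<subseteq> G0"
    and ex1: "\<And>z. z \<in> \<HH> - T.fixed_points \<Longrightarrow> \<exists>!\<gamma>. \<gamma> \<in> \<rho> ` \<Gamma> \<and> act \<gamma> z \<in> G0"
    by (rule T.strict_fundamental_set) blast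
  have fd: "fundamental_domain (\<rho> ` \<Gamma>) G0" by (rule T.strict_fundamental_domain[OF G0 ex1])
  show "nonconstant_equivariant_map \<Gamma> (\<rho> ` \<Gamma>) p \<rho>"
  proof
    show "\<not> p constant_on \<HH>"
    proof
      assume "p constant_on \<HH>"
      then obtain c where c: "\<And>z. z \<in> \<HH> \<Longrightarrow> p z = c" by (auto simp: constant_on_def)
      have cH: "c \<in> \<HH>" using c[OF i_in] E.p_in[OF i_in] by simp
      have "act \<delta> c = c" if "\<delta> \<in> \<rho> ` \<Gamma>" for \<delta>
      proof -
        obtain \<gamma> where \<gamma>: "\<gamma> \<in> \<Gamma>" "\<delta> = \<rho> \<gamma>" using \<open>\<delta> \<in> \<rho> ` \<Gamma>\<close> by auto
        then show ?thesis using eqv[OF \<gamma>(1) i_in] c[OF i_in] c[OF act_closed[OF S.mem_carrier[OF \<gamma>(1)] i_in]] by simp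
      qed
      then have "\<rho> ` \<Gamma> \<subseteq> {\<gamma> \<in> \<rho> ` \<Gamma>. act \<gamma> ` {c} \<inter> {c} \<noteq> {}}" by auto
      moreover have "finite {\<gamma> \<in> \<rho> ` \<Gamma>. act \<gamma> ` {c} \<inter> {c} \<noteq> {}}"
        using disc[unfolded acts_discretely_def, rule_format, of "{c}"] cH compact_sing[of c] by (simp only: empty_subsetI insert_subset simp_thms)
      ultimately have "finite (\<rho> ` \<Gamma>)" by (rule finite_subset)
      moreover have "infinite (\<rho> ` \<Gamma>)"
        by (rule T.finite_covolume_imp_infinite[OF fd]) (use cov T.covolume_eq[OF fd] in simp)
      ultimately show False by simp
    qed
  qed
qed

lemma (in discontinuous_group) fundamental_domain_exists:
  obtains F where "fundamental_domain \<Gamma> F"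
proof -
  obtain F where F: "F \<in> sets borel" "F \<subseteq> \<HH>" "fixed_points \<subseteq> F"
    and ex1: "\<And>z. z \<in> \<HH> - fixed_points \<Longrightarrow> \<exists>!\<gamma>. \<gamma> \<in> \<Gamma> \<and> act \<gamma> z \<in> F"
    by (rule strict_fundamental_set) blast
  show thesis by (rule that[OF strict_fundamental_domain[OF F ex1]])
qed

text \<open>As a mean of the Jacobian the exponent can be compared across subgroups of finite
  index and conjugates.\<close>

lemma lyapunov_exponent_eq:
  assumes c: "cofinite_modular_embedding \<Gamma> p \<rho>" and F: "fundamental_domain \<Gamma> F"
  shows "lyapunov_exponent \<Gamma> p \<rho> =
    enn2real (\<integral>\<^sup>+z. indicator F z * ennreal (hyp_jacobian p z) \<partial>hyp_area) / enn2real (emeasure hyp_area F)"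
proof -
  interpret nonconstant_equivariant_map \<Gamma> "\<rho> ` \<Gamma>" p \<rho> by (rule cofinite_modular_embedding_locale(1)[OF c])
  obtain G where G: "fundamental_domain (\<rho> ` \<Gamma>) G" by (rule target.fundamental_domain_exists)
  have fin: "emeasure hyp_area F < \<infinity>"
    using cofinite_modular_embedding_locale(2)[OF c] source.covolume_eq[OF F] by simp
  show ?thesis
    unfolding lyapunov_exponent_def source.covolume_eq[OF F] target.covolume_eq[OF G]
      quotient_degree_times_area[OF F fin G, symmetric]
    by (simp add: enn2real_mult ennreal_of_nat_eq_real_of_nat)
qed

section \<open>Invariance under weak commensurability\<close>

theorem proposition5p12:
  fixes \<Gamma>\<^sub>1 \<Gamma>\<^sub>2 :: "psl2r set"
    and p\<^sub>1 p\<^sub>2 :: "complex \<Rightarrow> complex"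
    and \<rho>\<^sub>1 \<rho>\<^sub>2 :: "psl2r \<Rightarrow> psl2r"
  assumes "cofinite_modular_embedding \<Gamma>\<^sub>1 p\<^sub>1 \<rho>\<^sub>1"
    and "cofinite_modular_embedding \<Gamma>\<^sub>2 p\<^sub>2 \<rho>\<^sub>2"
    and "weakly_commensurable \<Gamma>\<^sub>1 \<rho>\<^sub>1 \<Gamma>\<^sub>2 \<rho>\<^sub>2"
  shows "lyapunov_exponent \<Gamma>\<^sub>1 p\<^sub>1 \<rho>\<^sub>1 = lyapunov_exponent \<Gamma>\<^sub>2 p\<^sub>2 \<rho>\<^sub>2"
proof -
  interpret G: group PSL2R by (rule group_PSL2R)
  interpret A: nonconstant_equivariant_map \<Gamma>\<^sub>1 "\<rho>\<^sub>1 ` \<Gamma>\<^sub>1" p\<^sub>1 \<rho>\<^sub>1 by (rule cofinite_modular_embedding_locale(1)[OF assms(1)])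
  interpret B: nonconstant_equivariant_map \<Gamma>\<^sub>2 "\<rho>\<^sub>2 ` \<Gamma>\<^sub>2" p\<^sub>2 \<rho>\<^sub>2 by (rule cofinite_modular_embedding_locale(1)[OF assms(2)])
  obtain g h \<Gamma>' where g: "g \<in> carrier PSL2R" and h: "h \<in> carrier PSL2R"
    and i1: "finite_index_subgroup \<Gamma>' \<Gamma>\<^sub>1" and i2: "finite_index_subgroup \<Gamma>' (conj_PSL2R h ` \<Gamma>\<^sub>2)"
    and \<rho>eq: "\<And>\<gamma>. \<gamma> \<in> \<Gamma>' \<Longrightarrow> \<rho>\<^sub>1 \<gamma> = conj_PSL2R g (\<rho>\<^sub>2 (conj_PSL2R (inv\<^bsub>PSL2R\<^esub> h) \<gamma>))"
    using assms(3) unfolding weakly_commensurable_def by blast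
  define \<Gamma> where "\<Gamma> = conj_PSL2R h ` \<Gamma>\<^sub>2"
  have D: "discontinuous_group \<Gamma>" unfolding \<Gamma>_def by (rule conj_discontinuous_group[OF h B.source.discontinuous_group_axioms])
  interpret C: discontinuous_group \<Gamma> by (rule D)
  interpret P: discontinuous_group \<Gamma>' by (rule finite_index_integral(1)[OF A.source.discontinuous_group_axioms i1])
  obtain F\<^sub>1 F\<^sub>2 F' where F: "fundamental_domain \<Gamma>\<^sub>1 F\<^sub>1" "fundamental_domain \<Gamma>\<^sub>2 F\<^sub>2" "fundamental_domain \<Gamma>' F'"
    using A.source.fundamental_domain_exists B.source.fundamental_domain_exists P.fundamental_domain_exists by metis
  have Fb: "F\<^sub>1 \<in> sets borel" "F\<^sub>2 \<in> sets borel" "F' \<in> sets borel" "F\<^sub>2 \<subseteq> \<HH>" using F by (auto simp: fundamental_domain_def)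
  have FC: "fundamental_domain \<Gamma> (act h ` F\<^sub>2)"
    unfolding \<Gamma>_def by (rule conj_fundamental_domain[OF h _ F(2)]) (use B.source.mem_carrier in blast)
  have sub: "\<Gamma>' \<subseteq> \<Gamma>\<^sub>1" "\<Gamma>' \<subseteq> \<Gamma>"
    using i1 i2 subgroup.subset by (fastforce simp: finite_index_subgroup_def \<Gamma>_def)+
  have fin: "emeasure hyp_area F\<^sub>1 < \<infinity>" "emeasure hyp_area F\<^sub>2 < \<infinity>"
    using cofinite_modular_embedding_locale(2)[OF assms(1)] A.source.covolume_eq[OF F(1)]
      cofinite_modular_embedding_locale(2)[OF assms(2)] B.source.covolume_eq[OF F(2)] by auto
  \<comment> \<open>The second embedding, moved to the first one by the commensurating
    pair.\<close>
  define q where "q z = act g (p\<^sub>2 (act (inv\<^bsub>PSL2R\<^esub> h) z))" for z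
  have hi: "inv\<^bsub>PSL2R\<^esub> h \<in> carrier PSL2R" using h by simp
  have q: "q holomorphic_on \<HH>" "q ` \<HH> \<subseteq> \<HH>"
  proof -
    have "(p\<^sub>2 \<circ> act (inv\<^bsub>PSL2R\<^esub> h)) holomorphic_on \<HH>"
      by (rule holomorphic_on_compose_gen[OF act_holomorphic[OF hi] B.hol]) (use act_closed[OF hi] in auto)
    then have "(act g \<circ> (p\<^sub>2 \<circ> act (inv\<^bsub>PSL2R\<^esub> h))) holomorphic_on \<HH>"
      by (rule holomorphic_on_compose_gen[OF _ act_holomorphic[OF g]]) (use act_closed[OF hi] B.p_in in auto)
    then show "q holomorphic_on \<HH>" by (simp add: q_def[abs_def] comp_def)
    show "q ` \<HH> \<subseteq> \<HH>" using act_closed[OF hi] B.p_in act_closed[OF g] by (auto simp: q_def)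
  qed
  have q_eq: "q (act (conj_PSL2R h \<gamma>) z) = act (conj_PSL2R g (\<rho>\<^sub>2 \<gamma>)) (q z)" if \<gamma>: "\<gamma> \<in> \<Gamma>\<^sub>2" and z: "z \<in> \<HH>" for \<gamma> z
  proof -
    define y where "y = act (inv\<^bsub>PSL2R\<^esub> h) z"
    have y: "y \<in> \<HH>" "z = act h y" using act_closed[OF hi z] act_act_inv[OF h z] by (auto simp: y_def)
    note gc = B.source.mem_carrier[OF \<gamma>]
    note rc = B.target.mem_carrier[OF B.\<rho>_mem[OF \<gamma>]]
    have "q (act (conj_PSL2R h \<gamma>) z) = act g (p\<^sub>2 (act (inv\<^bsub>PSL2R\<^esub> h) (act h (act \<gamma> y))))"
      unfolding q_def y(2) act_conj[OF h gc y(1)] ..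
    also have "\<dots> = act g (act (\<rho>\<^sub>2 \<gamma>) (p\<^sub>2 y))"
      unfolding act_inv_act[OF h act_closed[OF gc y(1)]] B.equivariant[OF \<gamma> y(1)] ..
    also have "\<dots> = act (conj_PSL2R g (\<rho>\<^sub>2 \<gamma>)) (act g (p\<^sub>2 y))" by (rule act_conj[OF g rc B.p_in[OF y(1)], symmetric])
    finally show ?thesis by (simp add: q_def y_def)
  qed
  have conj_inv: "conj_PSL2R (inv\<^bsub>PSL2R\<^esub> h) (conj_PSL2R h \<gamma>) = \<gamma>" if \<gamma>: "\<gamma> \<in> carrier PSL2R" for \<gamma>
  proof -
    have "h \<otimes>\<^bsub>PSL2R\<^esub> \<gamma> \<otimes>\<^bsub>PSL2R\<^esub> inv\<^bsub>PSL2R\<^esub> h \<otimes>\<^bsub>PSL2R\<^esub> h = h \<otimes>\<^bsub>PSL2R\<^esub> \<gamma>"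
      using \<gamma> h by (simp add: G.m_assoc)
    moreover have "inv\<^bsub>PSL2R\<^esub> h \<otimes>\<^bsub>PSL2R\<^esub> (h \<otimes>\<^bsub>PSL2R\<^esub> \<gamma>) = \<gamma>"
      using \<gamma> h by (simp flip: G.m_assoc)
    ultimately show ?thesis using \<gamma> h hi by (simp add: G.m_assoc)
  qed
  obtain n1 :: nat where n1: "n1 > 0" "\<And>f. f \<in> borel_measurable borel \<Longrightarrow> A.source.invariant f \<Longrightarrow>
      (\<integral>\<^sup>+z. indicator F' z * f z \<partial>hyp_area) = of_nat n1 * (\<integral>\<^sup>+z. indicator F\<^sub>1 z * f z \<partial>hyp_area)"
    using finite_index_integral(2)[OF A.source.discontinuous_group_axioms i1] F by blast
  obtain n2 :: nat where n2: "n2 > 0" "\<And>f. f \<in> borel_measurable borel \<Longrightarrow> C.invariant f \<Longrightarrow>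
      (\<integral>\<^sup>+z. indicator F' z * f z \<partial>hyp_area) = of_nat n2 * (\<integral>\<^sup>+z. indicator (act h ` F\<^sub>2) z * f z \<partial>hyp_area)"
    using finite_index_integral(2)[OF D i2[folded \<Gamma>_def]] F FC by blast
  have V1: "emeasure hyp_area F' = of_nat n1 * emeasure hyp_area F\<^sub>1"
    using n1(2)[of "\<lambda>_. 1"] Fb by (simp add: A.source.invariant_def)
  have V2: "emeasure hyp_area F' = of_nat n2 * emeasure hyp_area F\<^sub>2"
    using n2(2)[of "\<lambda>_. 1"] Fb emeasure_act_image[OF h Fb(2,4)] by (simp add: C.invariant_def)
  have finF': "emeasure hyp_area F' < \<infinity>" unfolding V1 using fin by (simp add: ennreal_mult_less_top of_nat_less_top)
  have pq: "p\<^sub>1 z = q z" if z: "z \<in> \<HH>" for z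
  proof (rule P.equivariant_map_unique[OF F(3) finF' A.hol A.maps q, of \<rho>\<^sub>1])
    fix \<gamma> z assume \<gamma>: "\<gamma> \<in> \<Gamma>'" and z: "z \<in> \<HH>"
    show "p\<^sub>1 (act \<gamma> z) = act (\<rho>\<^sub>1 \<gamma>) (p\<^sub>1 z)" using A.equivariant sub(1) \<gamma> z by blast
    obtain \<gamma>2 where \<gamma>2: "\<gamma>2 \<in> \<Gamma>\<^sub>2" "\<gamma> = conj_PSL2R h \<gamma>2" using sub(2) \<gamma> by (auto simp: \<Gamma>_def)
    have "\<rho>\<^sub>1 \<gamma> = conj_PSL2R g (\<rho>\<^sub>2 \<gamma>2)"
      using \<rho>eq[OF \<gamma>] conj_inv[OF B.source.mem_carrier[OF \<gamma>2(1)]] by (simp only: \<gamma>2(2))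
    then show "q (act \<gamma> z) = act (\<rho>\<^sub>1 \<gamma>) (q z)" using q_eq[OF \<gamma>2(1) z] by (simp only: \<gamma>2(2))
  next
    show "\<rho>\<^sub>1 \<gamma> \<in> carrier PSL2R" if "\<gamma> \<in> \<Gamma>'" for \<gamma> using A.target.mem_carrier A.\<rho>_mem sub(1) that by blast
  qed (use A.nonconst z in auto)
  \<comment> \<open>As \<open>p\<^sub>1 = q\<close>, this Jacobian is invariant under both
    groups that contain \<open>\<Gamma>'\<close>. Its integral over \<open>F'\<close> is
    computed from either of them.\<close>
  define f where "f z = ennreal (indicator \<HH> z *\<^sub>R hyp_jacobian p\<^sub>1 z)" for z
  have fm: "f \<in> borel_measurable borel" unfolding f_def
    using borel_measurable_on_upper_half_plane[OF A.jacobian_continuous] by measurable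
  have one: "\<one>\<^bsub>PSL2R\<^esub> \<in> carrier PSL2R" by simp
  have Jq: "hyp_jacobian p\<^sub>1 z = hyp_jacobian q z" if z: "z \<in> \<HH>" for z
  proof -
    have "hyp_jacobian p\<^sub>1 (act \<one>\<^bsub>PSL2R\<^esub> z) = hyp_jacobian q z"
      by (rule hyp_jacobian_covariant[OF A.hol q one one _ z]) (use q pq act_one in auto)
    then show ?thesis using act_one[OF z] by simp
  qed
  have Jh: "hyp_jacobian q (act h y) = hyp_jacobian p\<^sub>2 y" if y: "y \<in> \<HH>" for y
    by (rule hyp_jacobian_covariant[OF q(1) B.hol B.maps g h _ y]) (simp add: q_def act_inv_act[OF h])
  have finv1: "A.source.invariant f"
    using A.source.invariantD[OF A.jacobian_invariant] act_closed[OF A.source.mem_carrier]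
    by (simp add: A.source.invariant_def f_def)
  have finv2: "C.invariant f" unfolding C.invariant_def
  proof (intro ballI)
    fix \<gamma> z assume \<gamma>: "\<gamma> \<in> \<Gamma>" and z: "z \<in> \<HH>"
    obtain \<gamma>2 where \<gamma>2: "\<gamma>2 \<in> \<Gamma>\<^sub>2" "\<gamma> = conj_PSL2R h \<gamma>2" using \<gamma> by (auto simp: \<Gamma>_def)
    have cg: "conj_PSL2R g (\<rho>\<^sub>2 \<gamma>2) \<in> carrier PSL2R" using g B.target.mem_carrier[OF B.\<rho>_mem[OF \<gamma>2(1)]] by simp
    have "hyp_jacobian q (act \<gamma> z) = hyp_jacobian q z"
      by (rule hyp_jacobian_covariant[OF q(1) q cg C.mem_carrier[OF \<gamma>] _ z]) (use q_eq[OF \<gamma>2(1)] \<gamma>2(2) in blast)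
    then show "f (act \<gamma> z) = f z" using Jq z act_closed[OF C.mem_carrier[OF \<gamma>] z] by (simp add: f_def)
  qed
  define E\<^sub>1 E\<^sub>2 where "E\<^sub>1 = (\<integral>\<^sup>+z. indicator F\<^sub>1 z * ennreal (hyp_jacobian p\<^sub>1 z) \<partial>hyp_area)"
    and "E\<^sub>2 = (\<integral>\<^sup>+z. indicator F\<^sub>2 z * ennreal (hyp_jacobian p\<^sub>2 z) \<partial>hyp_area)"
  have E1: "(\<integral>\<^sup>+z. indicator F' z * f z \<partial>hyp_area) = of_nat n1 * E\<^sub>1"
  proof -
    have "(\<integral>\<^sup>+z. indicator F\<^sub>1 z * f z \<partial>hyp_area) = E\<^sub>1" unfolding E\<^sub>1_def by (rule nn_integral_hyp_cong) (simp add: f_def)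
    then show ?thesis using n1(2)[OF fm finv1] by simp
  qed
  have E2: "(\<integral>\<^sup>+z. indicator F' z * f z \<partial>hyp_area) = of_nat n2 * E\<^sub>2"
  proof -
    have m: "(\<lambda>z. indicator (act h ` F\<^sub>2) z * f z) \<in> borel_measurable borel"
      using fm emeasure_act_image(1)[OF h Fb(2,4)] by measurable
    have "(\<integral>\<^sup>+z. indicator (act h ` F\<^sub>2) z * f z \<partial>hyp_area)
        = (\<integral>\<^sup>+y. indicator (act h ` F\<^sub>2) (act h y) * f (act h y) \<partial>hyp_area)"
      by (rule nn_integral_act[OF h m, symmetric])
    also have "\<dots> = E\<^sub>2" unfolding E\<^sub>2_def
    proof (rule nn_integral_hyp_cong)
      fix y assume y: "y \<in> \<HH>"
      have "act h y \<in> act h ` F\<^sub>2 \<longleftrightarrow> y \<in> F\<^sub>2" using inj_on_image_mem_iff[OF inj_on_act[OF h] y Fb(4)] .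
      moreover have "f (act h y) = ennreal (hyp_jacobian p\<^sub>2 y)"
        using Jq[OF act_closed[OF h y]] Jh[OF y] act_closed[OF h y] by (simp add: f_def)
      ultimately show "indicator (act h ` F\<^sub>2) (act h y) * f (act h y) = indicator F\<^sub>2 y * ennreal (hyp_jacobian p\<^sub>2 y)"
        by (simp add: indicator_def)
    qed
    finally show ?thesis using n2(2)[OF fm finv2] by simp
  qed
  have rE: "real n1 * enn2real E\<^sub>1 = real n2 * enn2real E\<^sub>2"
    using arg_cong[OF trans[OF E1[symmetric] E2], of enn2real] by (simp add: enn2real_mult ennreal_of_nat_eq_real_of_nat)
  have rV: "real n1 * enn2real (emeasure hyp_area F\<^sub>1) = real n2 * enn2real (emeasure hyp_area F\<^sub>2)"
    using arg_cong[OF trans[OF V1[symmetric] V2], of enn2real] by (simp add: enn2real_mult ennreal_of_nat_eq_real_of_nat)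
  have "enn2real E\<^sub>1 / enn2real (emeasure hyp_area F\<^sub>1) = (real n1 * enn2real E\<^sub>1) / (real n1 * enn2real (emeasure hyp_area F\<^sub>1))"
    using n1(1) by simp
  also have "\<dots> = enn2real E\<^sub>2 / enn2real (emeasure hyp_area F\<^sub>2)" unfolding rE rV using n2(1) by simp
  finally show ?thesis
    unfolding lyapunov_exponent_eq[OF assms(1) F(1)] lyapunov_exponent_eq[OF assms(2) F(2)] E\<^sub>1_def E\<^sub>2_def .
qed

end
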